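(* There exist constants $C,c>0$ such that the following holds. Let $n\ge 2$, let $0\le\Delta\le(\log n)^{1/4}$ be an integer and let $(\log n)^{-1/4}\le p\le 1-(\log n)^{-1/4}$. Run majority dynamics on $G\sim\mathbb{G}(2n+\Delta,p)$ starting from a fixed partition $R_0\sqcup B_0$ of the vertex set with $|R_0|=n+\Delta$, $|B_0|=n$. For integers $x,y$ define $x',y'$ by \begin{align*} \sqrt{\tfrac{n}{4\pi}}\,x' &= x - \bigg(\frac{1}{2}+\frac{p(\Delta-1)+1/2}{2\sqrt{\pi p(1-p)n}}\bigg)n,\\ \sqrt{\tfrac{n}{4\pi}}\,y' &= y - \bigg(\frac{1}{2}+\frac{p(-\Delta-1)+1/2}{2\sqrt{\pi p(1-p)n}}\bigg)n. \end{align*} Then for all integers $x,y$, \[\mathbb{P}[|R_0\cap R_1| = x\wedge|B_0 \cap B_1|=y]= \frac{2}{n\sqrt{\pi(2+\pi)}}\exp\bigg(-\frac{(1+\pi)(x')^2-2x'y'+(1+\pi)(y')^2}{2\pi(2+\pi)}\bigg) + O(n^{-1-c}).\] Furthermore, if $|x'|\ge C\sqrt{\log n}$ or $|y'|\ge C\sqrt{\log n}$, then \[\mathbb{P}[|R_0\cap R_1| = x\wedge|B_0 \cap B_1|=y]\le n^{-5}.\]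
   Context: Majority dynamics: given a graph $G$ with a bipartition $B_0\sqcup R_0$ of its vertex set, for each $i\ge0$ the partition $B_{i+1}\sqcup R_{i+1}$ is obtained from $B_i\sqcup R_i$ by moving to the other side precisely those vertices which have strictly more neighbors on the other side of the partition than on their own side (ties stay). $\mathbb{G}(N,p)$ is the Erdős–Rényi random graph on $N$ vertices with edge probability $p$. Implied constants in $O(\cdot)$ are absolute. *)

theory Defs
  imports "HOL-Probability.Probability" "HOL-Probability.Product_PMF"
begin

text \<open>A simple graph on a vertex set \<open>V\<close> is given by its set of edges, a set of two-element
  subsets of \<open>V\<close>.\<close>

definition possible_edges :: "'a set \<Rightarrow> 'a set set" where
  "possible_edges V = {e. e \<subseteq> V \<and> card e = 2}"

definition erdos_renyi :: "'a set \<Rightarrow> real \<Rightarrow> 'a set set pmf" where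
  "erdos_renyi V p =
     map_pmf (\<lambda>present. {e \<in> possible_edges V. present e})
       (Pi_pmf (possible_edges V) False (\<lambda>_. bernoulli_pmf p))"

definition neighbors :: "'a set set \<Rightarrow> 'a \<Rightarrow> 'a set" where
  "neighbors E v = {u. {u, v} \<in> E}"

definition wants_to_move :: "'a set set \<Rightarrow> 'a set \<Rightarrow> 'a set \<Rightarrow> 'a \<Rightarrow> bool" where
  "wants_to_move E own other v \<longleftrightarrow>
     card (neighbors E v \<inter> other) > card (neighbors E v \<inter> own)"

fun majority_step :: "'a set set \<Rightarrow> 'a set \<times> 'a set \<Rightarrow> 'a set \<times> 'a set" where
  "majority_step E (R, B) =
     ({v \<in> R. \<not> wants_to_move E R B v} \<union> {v \<in> B. wants_to_move E B R v},
      {v \<in> B. \<not> wants_to_move E B R v} \<union> {v \<in> R. wants_to_move E R B v})"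

definition majority_dynamics ::
    "'a set set \<Rightarrow> 'a set \<Rightarrow> 'a set \<Rightarrow> nat \<Rightarrow> 'a set \<times> 'a set" where
  "majority_dynamics E R0 B0 i = (majority_step E ^^ i) (R0, B0)"

definition red_at :: "'a set set \<Rightarrow> 'a set \<Rightarrow> 'a set \<Rightarrow> nat \<Rightarrow> 'a set" where
  "red_at E R0 B0 i = fst (majority_dynamics E R0 B0 i)"

definition blue_at :: "'a set set \<Rightarrow> 'a set \<Rightarrow> 'a set \<Rightarrow> nat \<Rightarrow> 'a set" where
  "blue_at E R0 B0 i = snd (majority_dynamics E R0 B0 i)"

end

theory Submission imports Defs "HOL-Real_Asymp.Real_Asymp" begin

text \<open>
  Let \<open>Z\<close> be a linear combination of the indicators \<open>I v\<close> that \<open>v\<close> stays, with coefficient \<open>s\<close> on the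
  red and \<open>t\<close> on the blue side. The joint law of the two counts is recovered from the characteristic
  function \<open>E (cis Z)\<close> on \<open>[-pi, pi]\<close> squared by Fourier inversion.

  For frequencies below \<open>n powr (-1/2 + 3/100)\<close> one differentiates \<open>\<phi> r = E (cis (r * (Z - E Z)))\<close>: after
  removing a vertex \<open>v\<close>, its star changes \<open>Z\<close> only through \<open>I v\<close> and through those \<open>w\<close> which are critical
  (decided by the single edge \<open>vw\<close>), so a first-order expansion over the star yields \<open>\<phi>' r = - Q r \<phi> r\<close>
  up to a small error, where \<open>Q\<close> is the variance. Its off-diagonal part comes from the
  probability that both endpoints of an edge are critical and gives the term with \<open>pi\<close> in the
  limiting covariance.

  For the other frequencies fix a small balanced set \<open>S\<close> of vertices. Almost all vertices outside \<open>S\<close> have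
  so large a discrepancy that the edges to \<open>S\<close> do not matter; conditionally on everything except the
  edges between \<open>S\<close> and these vertices, the indicators of \<open>S\<close> are independent and still random, so the
  characteristic function is tiny.

  The tail bound is a bounded-difference estimate: given the edges inside one side, the indicators
  of that side are independent.
\<close>

section \<open>Expectations over independent bits\<close>

text \<open>The stay indicators depend on each other through every edge, yet the error has to beat
  the density scale 1/n by a power of n. This fixes the exponents. Put u = n^(1/100) and take
  frequencies up to z = u^3 / sqrt n. When a vertex is removed, about sqrt (n / pq) others are
  critical for it, so its star moves the phase by about z n^(1/4). Hence the equation for \<phi> has
  an error of order z^2 n^(1/4) per vertex, and n z^3 n^(1/4) = u^(-16) in all. Integrated over a
  square of area of order z^2 = u^6 / n this gives u^(-10) / n, whence c = 1/10. Beyond z the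
  expansion is useless, but there smallness is enough. The set S takes about u^95 vertices from each
  side. It shifts a discrepancy by more than u^48 only with probability exp (- const u); u^48 is far
  below the spread sqrt (pq n) of a discrepancy, so few vertices feel S; and u^95 z^2 = u makes the
  product over S at most exp (- const u). Since pq may tend to 0 like (log n)^(-1/4), every estimate
  keeps track of it, and one factor u pays for 1 / pq.\<close>

lemma exp_le_quadratic:
  fixes x :: real assumes "\<bar>x\<bar> \<le> 1" shows "exp x \<le> 1 + x + x\<^sup>2"
proof (cases "0 \<le> x")
  case False
  let ?g = "\<lambda>x::real. 1 + x + x\<^sup>2/2 - exp x"
  have "?g x \<ge> ?g 0"
  proof (rule DERIV_nonpos_imp_nonincreasing[of x 0])
    fix y :: real assume "y \<le> 0"
    have "(?g has_real_derivative (1 + y - exp y)) (at y)"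
      by (auto intro!: derivative_eq_intros)
    then show "\<exists>z. (?g has_real_derivative z) (at y) \<and> z \<le> 0"
      using exp_ge_add_one_self[of y] by (intro exI[of _ "1 + y - exp y"]) auto
  qed (use False in auto)
  then have "exp x \<le> 1 + x + x\<^sup>2/2" by simp
  then show ?thesis using zero_le_power2[of x] by linarith
qed (use assms exp_bound[of x] in auto)

text \<open>Expectations are finite weighted sums over subsets, so that conditioning on a part of
  the edges is a rearrangement of sums. \<open>prob_Pi_bernoulli\<close> connects them with the pmf
  of the statement.\<close>

locale bernoulli_bits =
  fixes p :: real
  assumes p_pos: "0 < p" and p_less_1: "p < 1"
begin

text \<open>The expectation of \<open>f A\<close> when each element of \<open>I\<close> belongs to \<open>A\<close> independently with probability \<open>p\<close>.\<close>

definition mean :: "'e set \<Rightarrow> ('e set \<Rightarrow> 'b::real_normed_vector) \<Rightarrow> 'b" where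
  "mean I f = (\<Sum>A\<in>Pow I. (p ^ card A * (1 - p) ^ card (I - A)) *\<^sub>R f A)"

definition pq :: real where "pq = p * (1 - p)"

lemma pq_pos: "0 < pq"
  using p_pos p_less_1 by (simp add: pq_def)

lemma pq_le: "pq \<le> 1/4"
  using zero_le_power2[of "p - 1/2"] by (simp add: pq_def power2_eq_square algebra_simps)

lemma mean_empty [simp]: "mean {} f = f {}"
  by (simp add: mean_def)

lemma mean_cong: "(\<And>A. A \<subseteq> I \<Longrightarrow> f A = g A) \<Longrightarrow> mean I f = mean I g"
  unfolding mean_def by (rule sum.cong) auto

lemma mean_add: "mean I (\<lambda>A. f A + g A) = mean I f + mean I g"
  by (simp add: mean_def scaleR_add_right sum.distrib)

lemma mean_diff: "mean I (\<lambda>A. f A - g A) = mean I f - mean I g"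
  by (simp add: mean_def scaleR_diff_right sum_subtractf)

lemma mean_scaleR: "mean I (\<lambda>A. c *\<^sub>R f A) = c *\<^sub>R mean I f"
  by (simp add: mean_def scaleR_sum_right mult.commute)

lemma mean_bounded_linear:
  assumes "bounded_linear h" shows "mean I (\<lambda>A. h (f A)) = h (mean I f)"
proof -
  interpret bounded_linear h by fact
  show ?thesis by (simp add: mean_def sum scaleR)
qed

lemma mean_mult_left: "mean I (\<lambda>A. c * f A) = c * (mean I f :: 'b::real_normed_algebra)"
  by (rule mean_bounded_linear[OF bounded_linear_mult_right])

lemma mean_mult_right: "mean I (\<lambda>A. f A * c) = mean I f * (c :: 'b::real_normed_algebra)"
  by (rule mean_bounded_linear[OF bounded_linear_mult_left])

lemma mean_divide: "mean I (\<lambda>A. f A / c) = mean I f / (c :: 'b::real_normed_field)"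
  by (rule mean_bounded_linear[OF bounded_linear_divide])

lemma mean_of_real: "mean I (\<lambda>A. of_real (f A)) = (of_real (mean I f) :: 'b::{real_normed_algebra_1})"
  by (rule mean_bounded_linear[OF bounded_linear_of_real])

lemma mean_sum: "mean I (\<lambda>A. \<Sum>j\<in>J. f j A) = (\<Sum>j\<in>J. mean I (f j))"
  by (simp add: mean_def scaleR_sum_right) (rule sum.swap)

lemma mean_swap: "mean I (\<lambda>A. mean J (\<lambda>B. f A B)) = mean J (\<lambda>B. mean I (\<lambda>A. f A B))"
  by (simp add: mean_def scaleR_sum_right mult.commute) (rule sum.swap)

lemma mean_insert:
  assumes "finite I" "e \<notin> I"
  shows "mean (insert e I) f = (1 - p) *\<^sub>R mean I f + p *\<^sub>R mean I (\<lambda>A. f (insert e A))"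
proof -
  have inj: "inj_on (insert e) (Pow I)"
    using assms(2) by (auto simp: inj_on_def)
  have disj: "Pow I \<inter> insert e ` Pow I = {}"
    using assms(2) by auto
  have 1: "(\<Sum>A\<in>Pow I. (p ^ card A * (1 - p) ^ card (insert e I - A)) *\<^sub>R f A) = (1 - p) *\<^sub>R mean I f"
    unfolding mean_def scaleR_sum_right
  proof (rule sum.cong[OF refl])
    fix A assume "A \<in> Pow I"
    then have "insert e I - A = insert e (I - A)" "e \<notin> I - A" "finite (I - A)"
      using assms by auto
    then show "(p ^ card A * (1 - p) ^ card (insert e I - A)) *\<^sub>R f A =
       (1 - p) *\<^sub>R (p ^ card A * (1 - p) ^ card (I - A)) *\<^sub>R f A"
      by (simp add: mult_ac)
  qed
  have 2: "(\<Sum>A\<in>Pow I. (p ^ card (insert e A) * (1 - p) ^ card (insert e I - insert e A)) *\<^sub>R f (insert e A))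
     = p *\<^sub>R mean I (\<lambda>A. f (insert e A))"
    unfolding mean_def scaleR_sum_right
  proof (rule sum.cong[OF refl])
    fix A assume "A \<in> Pow I"
    then have "insert e I - insert e A = I - A" "e \<notin> A" "finite A"
      using assms by (auto dest: finite_subset)
    then show "(p ^ card (insert e A) * (1 - p) ^ card (insert e I - insert e A)) *\<^sub>R f (insert e A) =
       p *\<^sub>R (p ^ card A * (1 - p) ^ card (I - A)) *\<^sub>R f (insert e A)"
      by (simp add: mult_ac)
  qed
  have "mean (insert e I) f = (\<Sum>A\<in>Pow I. (p ^ card A * (1 - p) ^ card (insert e I - A)) *\<^sub>R f A)
     + (\<Sum>A\<in>insert e ` Pow I. (p ^ card A * (1 - p) ^ card (insert e I - A)) *\<^sub>R f A)"
    unfolding mean_def Pow_insert by (rule sum.union_disjoint[OF _ _ disj]) (use assms in auto)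
  then show ?thesis
    unfolding sum.reindex[OF inj] o_def 1 2 .
qed

lemma mean_const [simp]: "finite I \<Longrightarrow> mean I (\<lambda>_. c) = c"
  by (induction I rule: finite_induct) (simp_all add: mean_insert flip: scaleR_add_left)

lemma mean_mono:
  fixes f g :: "'e set \<Rightarrow> real"
  assumes "\<And>A. A \<subseteq> I \<Longrightarrow> f A \<le> g A" shows "mean I f \<le> mean I g"
  unfolding mean_def using assms p_pos p_less_1
  by (intro sum_mono) (auto intro!: mult_left_mono)

lemma mean_nonneg: "(\<And>A. A \<subseteq> I \<Longrightarrow> 0 \<le> f A) \<Longrightarrow> 0 \<le> mean I (f :: _ \<Rightarrow> real)"
  unfolding mean_def using p_pos p_less_1 by (intro sum_nonneg) auto

lemma mean_le_const:
  fixes f :: "'e set \<Rightarrow> real"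
  assumes "finite I" "\<And>A. A \<subseteq> I \<Longrightarrow> f A \<le> c" shows "mean I f \<le> c"
  using mean_mono[of I f "\<lambda>_. c"] assms by simp

lemma norm_mean_le: "norm (mean I f) \<le> mean I (\<lambda>A. norm (f A))"
  unfolding mean_def using p_pos p_less_1 by (intro norm_sum[THEN order_trans]) simp

lemma norm_mean_diff_le: "norm (mean I f - mean I g) \<le> mean I (\<lambda>A. norm (f A - g A))"
  using norm_mean_le[of I "\<lambda>A. f A - g A"] by (simp add: mean_diff)

lemma mean_Un:
  assumes "finite I" "finite J" "I \<inter> J = {}"
  shows "mean (I \<union> J) f = mean I (\<lambda>A. mean J (\<lambda>B. f (A \<union> B)))"
  using assms(2,3)
proof (induction J arbitrary: f rule: finite_induct)
  case (insert e J)
  have "mean (I \<union> insert e J) f = mean (insert e (I \<union> J)) f" by simp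
  also have "\<dots> = (1 - p) *\<^sub>R mean (I \<union> J) f + p *\<^sub>R mean (I \<union> J) (\<lambda>A. f (insert e A))"
    using insert assms(1) by (subst mean_insert) auto
  also have "\<dots> = mean I (\<lambda>A. mean (insert e J) (\<lambda>B. f (A \<union> B)))"
    using insert assms(1) by (simp add: mean_insert mean_add mean_scaleR)
  finally show ?case .
qed simp

lemma mean_image:
  assumes "finite I" "inj_on h I"
  shows "mean (h ` I) f = mean I (\<lambda>A. f (h ` A))"
  using assms by (induction I arbitrary: f rule: finite_induct) (simp_all add: mean_insert)

lemma mean_remove:
  assumes "finite I" "e \<in> I"
  shows "mean I f = (1 - p) *\<^sub>R mean (I - {e}) f + p *\<^sub>R mean (I - {e}) (\<lambda>A. f (insert e A))"
  using mean_insert[of "I - {e}" e f] assms by (simp add: insert_absorb)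

text \<open>The variance of \<open>\<bar>f A\<bar>\<close> is nonnegative.\<close>

lemma mean_abs_le_sqrt:
  fixes f :: "'e set \<Rightarrow> real"
  assumes "finite I"
  shows "mean I (\<lambda>A. \<bar>f A\<bar>) \<le> sqrt (mean I (\<lambda>A. (f A)\<^sup>2))"
proof -
  define m where "m = mean I (\<lambda>A. \<bar>f A\<bar>)"
  have "0 \<le> mean I (\<lambda>A. (\<bar>f A\<bar> - m)\<^sup>2)" by (intro mean_nonneg) simp
  also have "\<dots> = mean I (\<lambda>A. (f A)\<^sup>2 - 2 * m * \<bar>f A\<bar> + m\<^sup>2)"
    by (intro mean_cong) (simp add: power2_diff algebra_simps)
  also have "\<dots> = mean I (\<lambda>A. (f A)\<^sup>2) - 2 * m * m + m\<^sup>2"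
    using assms by (simp add: mean_add mean_diff mean_mult_left m_def)
  finally have "m\<^sup>2 \<le> mean I (\<lambda>A. (f A)\<^sup>2)" by (simp add: power2_eq_square)
  then show ?thesis unfolding m_def by (rule real_le_rsqrt)
qed

text \<open>Reveal one bit at a time: the two conditional means differ by at most \<open>c\<close>,
  so the bit contributes a centred two-point variable of variance at most
  \<open>pq * c\<^sup>2\<close>. The factor \<open>pq\<close> is kept because it cancels a factor
  \<open>1 / pq\<close> in \<open>mgf_stays\<close>.\<close>

lemma mean_exp_bounded_differences:
  fixes f :: "'e set \<Rightarrow> real"
  assumes "finite I" "\<bar>l\<bar> * c \<le> 1"
    "\<And>e A. e \<in> I \<Longrightarrow> A \<subseteq> I - {e} \<Longrightarrow> \<bar>f (insert e A) - f A\<bar> \<le> c"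
  shows "mean I (\<lambda>A. exp (l * f A)) \<le> exp (l * mean I f + l\<^sup>2 * c\<^sup>2 * pq * card I)"
  using assms(1,3)
proof (induction I arbitrary: f rule: finite_induct)
  case (insert e I)
  define a where "a = mean I f"
  define b where "b = mean I (\<lambda>A. f (insert e A))"
  define w where "w = l\<^sup>2 * c\<^sup>2 * pq * card I"
  have 1: "mean I (\<lambda>A. exp (l * f A)) \<le> exp (l * a + w)"
    unfolding a_def w_def
  proof (rule insert.IH)
    fix e' A assume "e' \<in> I" "A \<subseteq> I - {e'}"
    then show "\<bar>f (insert e' A) - f A\<bar> \<le> c"
      using insert.prems[of e' A] by auto
  qed
  have 2: "mean I (\<lambda>A. exp (l * f (insert e A))) \<le> exp (l * b + w)"
    unfolding b_def w_def
  proof (rule insert.IH)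
    fix e' A assume h: "e' \<in> I" "A \<subseteq> I - {e'}"
    then show "\<bar>f (insert e (insert e' A)) - f (insert e A)\<bar> \<le> c"
      using insert.prems[of e' "insert e A"] insert.hyps by (auto simp: insert_commute)
  qed
  have ab: "\<bar>b - a\<bar> \<le> c"
  proof -
    have "\<bar>b - a\<bar> \<le> mean I (\<lambda>A. \<bar>f (insert e A) - f A\<bar>)"
      using norm_mean_diff_le[of I "\<lambda>A. f (insert e A)" f] by (simp add: a_def b_def)
    also have "\<dots> \<le> c" using insert.prems[of e] insert.hyps by (intro mean_le_const) auto
    finally show ?thesis .
  qed
  define d where "d = l * (b - a)"
  have d1: "\<bar>d\<bar> \<le> 1"
  proof -
    have "\<bar>d\<bar> = \<bar>l\<bar> * \<bar>b - a\<bar>" by (simp add: d_def abs_mult)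
    also have "\<dots> \<le> \<bar>l\<bar> * c" by (rule mult_left_mono[OF ab]) simp
    finally show ?thesis using assms(2) by linarith
  qed
  have d2: "d\<^sup>2 \<le> l\<^sup>2 * c\<^sup>2"
  proof -
    have "(b - a)\<^sup>2 \<le> c\<^sup>2" using ab by (simp add: abs_le_square_iff[symmetric])
    then show ?thesis by (simp add: d_def power_mult_distrib mult_left_mono)
  qed
  have pqe: "p * (1 - p) = pq" by (simp add: pq_def)
  have q1: "\<bar>- p * d\<bar> \<le> 1" "\<bar>(1 - p) * d\<bar> \<le> 1"
    using d1 p_pos p_less_1 by (simp_all add: abs_mult mult_le_one)
  \<comment> \<open>The linear terms of the two quadratic bounds cancel, because the two-point
    variable is centred.\<close>
  have "(1 - p) * exp (- p * d) + p * exp ((1 - p) * d)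
        \<le> (1 - p) * (1 + - p * d + (- p * d)\<^sup>2) + p * (1 + (1 - p) * d + ((1 - p) * d)\<^sup>2)"
    using p_pos p_less_1 by (intro add_mono mult_left_mono exp_le_quadratic q1) auto
  also have "\<dots> = 1 + p * (1 - p) * d\<^sup>2" by (simp add: power2_eq_square algebra_simps)
  also have "\<dots> = 1 + pq * d\<^sup>2" by (simp only: pqe)
  also have "\<dots> \<le> exp (pq * d\<^sup>2)" by (rule exp_ge_add_one_self)
  also have "\<dots> \<le> exp (l\<^sup>2 * c\<^sup>2 * pq)" using d2 pq_pos by (simp add: mult.commute)
  finally have key: "(1 - p) * exp (- p * d) + p * exp ((1 - p) * d) \<le> exp (l\<^sup>2 * c\<^sup>2 * pq)" .
  define m where "m = (1 - p) * a + p * b"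
  have m: "mean (insert e I) f = m" using insert by (simp add: mean_insert m_def a_def b_def)
  have "mean (insert e I) (\<lambda>A. exp (l * f A)) \<le> (1 - p) * exp (l * a + w) + p * exp (l * b + w)"
    using insert.hyps 1 2 p_pos p_less_1 by (simp add: mean_insert add_mono mult_left_mono)
  also have "l * a = l * m - p * d" by (simp add: m_def d_def algebra_simps)
  also have "l * b = l * m + (1 - p) * d" by (simp add: m_def d_def algebra_simps)
  also have "(1 - p) * exp (l * m - p * d + w) + p * exp (l * m + (1 - p) * d + w)
     = exp (l * m + w) * ((1 - p) * exp (- p * d) + p * exp ((1 - p) * d))"
    by (simp add: distrib_left flip: exp_add) (simp add: algebra_simps flip: exp_add)
  also have "\<dots> \<le> exp (l * m + w) * exp (l\<^sup>2 * c\<^sup>2 * pq)" using key by simp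
  also have "\<dots> = exp (l * mean (insert e I) f + l\<^sup>2 * c\<^sup>2 * pq * card (insert e I))"
    using insert.hyps unfolding m by (simp add: w_def algebra_simps flip: exp_add)
  finally show ?case .
qed simp

text \<open>Induction over the bits by the law of total covariance: a bit contributes the average of
  two conditional covariances, plus \<open>pq\<close> times the product of the jumps of the two
  conditional means. For \<open>h\<close> the worst jump is used, for \<open>g\<close> the mean
  jump.\<close>

lemma norm_covariance_le:
  fixes h :: "'e set \<Rightarrow> real" and g :: "'e set \<Rightarrow> complex"
  assumes "finite I"
    "\<And>e A. e \<in> I \<Longrightarrow> A \<subseteq> I - {e} \<Longrightarrow> \<bar>h (insert e A) - h A\<bar> \<le> k"
  shows "norm (mean I (\<lambda>A. h A *\<^sub>R g A) - mean I h *\<^sub>R mean I g)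
     \<le> pq * k * (\<Sum>e\<in>I. mean (I - {e}) (\<lambda>A. norm (g (insert e A) - g A)))"
  using assms
proof (induction I arbitrary: h g rule: finite_induct)
  case (insert e I)
  let ?h = "\<lambda>A. h (insert e A)" and ?g = "\<lambda>A. g (insert e A)"
  define D where "D g = (\<Sum>e\<in>I. mean (I - {e}) (\<lambda>A. norm (g (insert e A) - g A)))" for g :: "'e set \<Rightarrow> complex"
  define a where "a = mean I h"
  define b where "b = mean I ?h"
  define a' where "a' = mean I g"
  define b' where "b' = mean I ?g"
  have 1: "norm (mean I (\<lambda>A. h A *\<^sub>R g A) - a *\<^sub>R a') \<le> pq * k * D g"
    unfolding D_def a_def a'_def
  proof (rule insert.IH)
    fix e' A assume "e' \<in> I" "A \<subseteq> I - {e'}"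
    then show "\<bar>h (insert e' A) - h A\<bar> \<le> k"
      using insert.prems[of e' A] by auto
  qed
  have 2: "norm (mean I (\<lambda>A. ?h A *\<^sub>R ?g A) - b *\<^sub>R b') \<le> pq * k * D ?g"
    unfolding D_def b_def b'_def
  proof (rule insert.IH)
    fix e' A assume h: "e' \<in> I" "A \<subseteq> I - {e'}"
    then show "\<bar>h (insert e (insert e' A)) - h (insert e A)\<bar> \<le> k"
      using insert.prems[of e' "insert e A"] insert.hyps by (auto simp: insert_commute)
  qed
  have ab: "\<bar>b - a\<bar> \<le> k"
  proof -
    have "\<bar>b - a\<bar> \<le> mean I (\<lambda>A. \<bar>?h A - h A\<bar>)"
      using norm_mean_diff_le[of I ?h h] by (simp add: a_def b_def)
    also have "\<dots> \<le> k" using insert.prems[of e] insert.hyps by (intro mean_le_const) auto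
    finally show ?thesis .
  qed
  define d where "d = mean I (\<lambda>A. norm (?g A - g A))"
  have ab': "norm (b' - a') \<le> d"
    unfolding d_def a'_def b'_def by (rule norm_mean_diff_le)
  have k0: "0 \<le> k" using ab by linarith
  have D: "(\<Sum>e'\<in>insert e I. mean (insert e I - {e'}) (\<lambda>A. norm (g (insert e' A) - g A)))
     = d + ((1 - p) * D g + p * D ?g)"
  proof -
    have "mean (insert e I - {e'}) (\<lambda>A. norm (g (insert e' A) - g A)) =
       (1 - p) * mean (I - {e'}) (\<lambda>A. norm (g (insert e' A) - g A)) +
       p * mean (I - {e'}) (\<lambda>A. norm (?g (insert e' A) - ?g A))" if "e' \<in> I" for e'
    proof -
      have "insert e I - {e'} = insert e (I - {e'})" "e \<notin> I - {e'}" "finite (I - {e'})"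
        using that insert.hyps by auto
      then show ?thesis by (simp add: mean_insert insert_commute)
    qed
    then show ?thesis using insert.hyps
      by (simp add: D_def d_def sum.distrib sum_distrib_left)
  qed
  have eq: "(1 - p) *\<^sub>R x + p *\<^sub>R y - ((1 - p) * a + p * b) *\<^sub>R ((1 - p) *\<^sub>R a' + p *\<^sub>R b')
    = (1 - p) *\<^sub>R (x - a *\<^sub>R a') + p *\<^sub>R (y - b *\<^sub>R b') + (pq * (b - a)) *\<^sub>R (b' - a')" for x y
    by (simp add: pq_def scaleR_conv_of_real algebra_simps)
  have "norm (mean (insert e I) (\<lambda>A. h A *\<^sub>R g A) - mean (insert e I) h *\<^sub>R mean (insert e I) g)
    = norm ((1 - p) *\<^sub>R (mean I (\<lambda>A. h A *\<^sub>R g A) - a *\<^sub>R a') + p *\<^sub>R (mean I (\<lambda>A. ?h A *\<^sub>R ?g A) - b *\<^sub>R b')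
       + (pq * (b - a)) *\<^sub>R (b' - a'))"
    using insert.hyps unfolding eq[symmetric] by (simp add: mean_insert a_def b_def a'_def b'_def)
  also have "\<dots> \<le> (1 - p) * (pq * k * D g) + p * (pq * k * D ?g) + pq * k * d"
    using p_pos p_less_1 pq_pos ab ab' k0 1 2
    by (intro norm_triangle_mono) (auto simp: abs_mult intro!: mult_mono mult_left_mono)
  also have "\<dots> = pq * k * (d + ((1 - p) * D g + p * D ?g))" by (simp add: algebra_simps)
  finally show ?case unfolding D .
qed simp

lemma mean_linear:
  fixes l :: "'e \<Rightarrow> real"
  assumes "finite I" shows "mean I (\<lambda>A. \<Sum>e\<in>A. l e) = p * (\<Sum>e\<in>I. l e)"
  using assms
proof (induction I rule: finite_induct)
  case (insert e I)
  have "mean I (\<lambda>A. sum l (insert e A)) = mean I (\<lambda>A. l e + sum l A)"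
    using insert by (intro mean_cong sum.insert) (auto dest: finite_subset)
  then show ?case using insert by (simp add: mean_insert mean_add algebra_simps)
qed simp

lemma mean_linear_square:
  fixes l :: "'e \<Rightarrow> real"
  assumes "finite I"
  shows "mean I (\<lambda>A. ((\<Sum>e\<in>A. l e) - p * (\<Sum>e\<in>I. l e))\<^sup>2) = pq * (\<Sum>e\<in>I. (l e)\<^sup>2)"
  using assms
proof (induction I rule: finite_induct)
  case (insert e I)
  let ?L = "\<lambda>A. sum l A - p * sum l I"
  have z: "mean I ?L = 0" using insert by (simp add: mean_diff mean_linear)
  have sh: "mean I (\<lambda>A. (?L A + c)\<^sup>2) = mean I (\<lambda>A. (?L A)\<^sup>2) + c\<^sup>2" for c
  proof -
    have "mean I (\<lambda>A. (?L A + c)\<^sup>2) = mean I (\<lambda>A. (?L A)\<^sup>2 + 2 * c * ?L A + c\<^sup>2)"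
      by (intro mean_cong) (simp add: power2_eq_square algebra_simps)
    also have "\<dots> = mean I (\<lambda>A. (?L A)\<^sup>2) + 2 * c * mean I ?L + c\<^sup>2"
      using insert.hyps by (simp only: mean_add mean_mult_left mean_const)
    finally show ?thesis by (simp only: z)
  qed
  have "mean I (\<lambda>A. (sum l A - p * sum l (insert e I))\<^sup>2) = mean I (\<lambda>A. (?L A + (- p * l e))\<^sup>2)"
    using insert by (intro mean_cong) (simp add: algebra_simps)
  moreover have "mean I (\<lambda>A. (sum l (insert e A) - p * sum l (insert e I))\<^sup>2) = mean I (\<lambda>A. (?L A + (1 - p) * l e)\<^sup>2)"
  proof (intro mean_cong)
    fix A assume "A \<subseteq> I"
    then have "finite A" "e \<notin> A" using insert by (auto dest: finite_subset)
    then show "(sum l (insert e A) - p * sum l (insert e I))\<^sup>2 = (?L A + (1 - p) * l e)\<^sup>2"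
      using insert by (simp add: algebra_simps)
  qed
  ultimately have "mean (insert e I) (\<lambda>A. (sum l A - p * sum l (insert e I))\<^sup>2)
     = (1 - p) * (pq * (\<Sum>e\<in>I. (l e)\<^sup>2) + (- p * l e)\<^sup>2) + p * (pq * (\<Sum>e\<in>I. (l e)\<^sup>2) + ((1 - p) * l e)\<^sup>2)"
    unfolding mean_insert[OF insert.hyps] by (simp only: sh insert.IH real_scaleR_def)
  also have "\<dots> = pq * (\<Sum>e\<in>insert e I. (l e)\<^sup>2)"
    using insert.hyps by (simp add: pq_def power2_eq_square algebra_simps)
  finally show ?case .
qed simp

lemma mean_abs_linear_le:
  fixes l :: "'e \<Rightarrow> real"
  assumes "finite I"
  shows "mean I (\<lambda>A. \<bar>(\<Sum>e\<in>A. l e) - p * (\<Sum>e\<in>I. l e)\<bar>) \<le> sqrt (pq * (\<Sum>e\<in>I. (l e)\<^sup>2))"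
  using mean_abs_le_sqrt[OF assms, of "\<lambda>A. (\<Sum>e\<in>A. l e) - p * (\<Sum>e\<in>I. l e)"]
  by (simp add: mean_linear_square[OF assms])

lemma prob_Pi_bernoulli:
  assumes "finite I"
  shows "measure_pmf.prob (map_pmf (\<lambda>x. {e \<in> I. x e}) (Pi_pmf I False (\<lambda>_. bernoulli_pmf p))) {E. Q E}
    = mean I (\<lambda>A. of_bool (Q A))"
  using assms
proof (induction I arbitrary: Q rule: finite_induct)
  case empty
  then show ?case by (simp add: indicator_def)
next
  case (insert e I)
  let ?P = "\<lambda>I. Pi_pmf I False (\<lambda>_. bernoulli_pmf p)"
  have *: "map_pmf (\<lambda>x. {e' \<in> insert e I. x e'}) (?P (insert e I))
    = bind_pmf (bernoulli_pmf p) (\<lambda>b. map_pmf (\<lambda>A. if b then insert e A else A) (map_pmf (\<lambda>x. {e \<in> I. x e}) (?P I)))"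
    using insert.hyps
    by (subst Pi_pmf_insert') 
       (auto simp: map_bind_pmf bind_return_pmf map_pmf_def bind_assoc_pmf split: if_splits intro!: bind_pmf_cong arg_cong[where f = return_pmf])
  let ?M = "map_pmf (\<lambda>x. {e \<in> I. x e}) (?P I)"
  have "ennreal (measure_pmf.prob (map_pmf (\<lambda>x. {e' \<in> insert e I. x e'}) (?P (insert e I))) {E. Q E})
    = ennreal (measure_pmf.prob ?M {E. Q (insert e E)}) * ennreal p + ennreal (measure_pmf.prob ?M {E. Q E}) * ennreal (1 - p)"
    unfolding * using p_pos p_less_1
    by (simp add: measure_pmf.emeasure_eq_measure[symmetric] vimage_def)
  also have "\<dots> = ennreal (mean (insert e I) (\<lambda>A. of_bool (Q A)))"
    unfolding insert.IH mean_insert[OF insert.hyps] using p_pos p_less_1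
    by (subst ennreal_mult[symmetric] ennreal_plus[symmetric], auto intro!: mean_nonneg mult_nonneg_nonneg simp: mult.commute add.commute)+
  finally show ?case
    by (subst (asm) ennreal_inj) (auto intro!: mean_nonneg)
qed

end

section \<open>Point probabilities of signed sums\<close>

text \<open>Moments of the normal density of variance 1 / (2 a), rescaled.\<close>

lemma has_bochner_integral_gauss_even:
  assumes "(a::real) > 0"
  shows "has_bochner_integral lborel (\<lambda>x. x ^ (2 * k) * exp (- a * x\<^sup>2))
     (sqrt (pi / a) * (fact (2 * k) / ((4 * a) ^ k * fact k)))"
proof -
  define s where "s = sqrt (1 / (2 * a))"
  have s: "s > 0" "s\<^sup>2 = 1 / (2 * a)" using assms by (simp_all add: s_def)
  have e: "normal_density 0 s x = exp (- a * x\<^sup>2) / sqrt (pi / a)" for x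
    using assms by (simp add: normal_density_def s mult.commute)
  have "has_bochner_integral lborel (\<lambda>x. sqrt (pi / a) * (normal_density 0 s x * (x - 0) ^ (2 * k)))
     (sqrt (pi / a) * (fact (2 * k) / ((2 / s\<^sup>2) ^ k * fact k)))"
    by (intro has_bochner_integral_mult_right normal_moment_even s)
  then show ?thesis using assms by (simp add: e s mult.commute)
qed

lemma has_bochner_integral_gauss_abs:
  assumes "(a::real) > 0"
  shows "has_bochner_integral lborel (\<lambda>x. \<bar>x\<bar> * exp (- a * x\<^sup>2)) (1 / a)"
proof -
  define s where "s = sqrt (1 / (2 * a))"
  have s: "s > 0" "s\<^sup>2 = 1 / (2 * a)" using assms by (simp_all add: s_def)
  have e: "normal_density 0 s x = exp (- a * x\<^sup>2) / sqrt (pi / a)" for x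
    using assms by (simp add: normal_density_def s mult.commute)
  have "has_bochner_integral lborel (\<lambda>x. sqrt (pi / a) * (normal_density 0 s x * \<bar>x - 0\<bar> ^ (2 * 0 + 1)))
     (sqrt (pi / a) * (2 ^ 0 * s ^ (2 * 0 + 1) * fact 0 * sqrt (2 / pi)))"
    by (intro has_bochner_integral_mult_right normal_moment_abs_odd s)
  moreover have "sqrt (pi / a) * (2 ^ 0 * s ^ (2 * 0 + 1) * fact 0 * sqrt (2 / pi)) = 1 / a"
  proof -
    have "sqrt (pi / a) * s * sqrt (2 / pi) = sqrt ((1 / a)\<^sup>2)"
      unfolding s_def real_sqrt_mult[symmetric] using assms by (simp add: power2_eq_square)
    then show ?thesis using assms by simp
  qed
  ultimately show ?thesis using assms by (simp add: e mult.commute)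
qed

text \<open>Sine is concave on the interval and so lies above its chord.\<close>

lemma jordan_sin:
  fixes x :: real assumes "0 \<le> x" "x \<le> pi / 2" shows "2 * x / pi \<le> sin x"
proof -
  have "convex_on {0..pi/2} (\<lambda>x. - sin x :: real)"
  proof (rule f''_ge0_imp_convex)
    fix x :: real assume x: "x \<in> {0..pi/2}"
    show "((\<lambda>x. - sin x) has_real_derivative - cos x) (at x)" by (auto intro!: derivative_eq_intros)
    show "((\<lambda>x. - cos x) has_real_derivative sin x) (at x)" by (auto intro!: derivative_eq_intros)
    show "0 \<le> sin x" using x by (intro sin_ge_zero) auto
  qed auto
  then have "- sin ((1 - t) * 0 + t * (pi/2)) \<le> (1 - t) * - sin 0 + t * - sin (pi/2)" if "0 \<le> t" "t \<le> 1" for t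
    using that convex_onD[of "{0..pi/2}" "\<lambda>x. - sin x" t 0 "pi/2"] by simp
  from this[of "2 * x / pi"] show ?thesis using assms by (simp add: field_simps)
qed

lemma one_minus_cos_ge:
  fixes x :: real assumes "\<bar>x\<bar> \<le> pi" shows "2 * x\<^sup>2 / pi\<^sup>2 \<le> 1 - cos x"
proof -
  have "(2 * (\<bar>x\<bar>/2) / pi)\<^sup>2 \<le> (sin (\<bar>x\<bar>/2))\<^sup>2"
    using jordan_sin[of "\<bar>x\<bar>/2"] assms by (intro power_mono) auto
  moreover have "1 - cos x = 2 * (sin (\<bar>x\<bar>/2))\<^sup>2"
    using cos_double_sin[of "\<bar>x\<bar>/2"] by simp
  ultimately show ?thesis by (simp add: power_divide)
qed

lemma cos_upper_quartic:
  fixes x :: real shows "cos x \<le> 1 - x\<^sup>2/2 + x^4/6"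
proof -
  have "norm (cos (complex_of_real x) - (\<Sum>k\<le>3. complex_of_real (cos_coeff k) * complex_of_real x ^ k))
     \<le> exp\<bar>Im (complex_of_real x)\<bar> * (norm (complex_of_real x)) ^ Suc 3 / (fact 3)"
    by (rule Taylor_cos)
  moreover have "(\<Sum>k\<le>3. complex_of_real (cos_coeff k) * complex_of_real x ^ k) = complex_of_real (1 - x\<^sup>2/2)"
    by (simp add: cos_coeff_def numeral_3_eq_3 fact_numeral power2_eq_square)
  ultimately have "norm (complex_of_real (cos x - (1 - x\<^sup>2/2))) \<le> x^4/6"
    by (simp add: cos_of_real fact_numeral)
  then have "\<bar>cos x - (1 - x\<^sup>2/2)\<bar> \<le> x^4/6" by (simp only: norm_of_real)
  then show ?thesis by linarith
qed

lemma norm_cis_minus_1_le: "norm (cis x - 1) \<le> \<bar>x\<bar>"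
  using iexp_approx1[of x 0] by (simp add: cis_conv_exp mult.commute)

lemma norm_cis_minus_linear_le: "norm (cis x - 1 - \<i> * of_real x) \<le> x\<^sup>2 / 2"
  using iexp_approx1[of x 1] by (simp add: cis_conv_exp mult.commute power2_eq_square algebra_simps)

lemma set_integral_cis:
  "(LINT x:{-pi..pi}|lborel. cis (x * of_int m)) = (if m = 0 then of_real (2 * pi) else 0)"
proof (cases "m = 0")
  case True
  then show ?thesis by (simp add: set_lebesgue_integral_def scaleR_conv_of_real)
next
  case False
  let ?F = "\<lambda>x. cis (x * of_int m) / (\<i> * of_int m)"
  have "(\<integral>x. indicator {-pi..pi} x *\<^sub>R cis (x * of_int m) \<partial>lborel) = ?F pi - ?F (- pi)"
  proof (rule integral_FTC_Icc)
    fix x :: real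
    show "(?F has_vector_derivative cis (x * of_int m)) (at x within {-pi..pi})"
      using False unfolding cis_conv_exp
      by (auto intro!: derivative_eq_intros has_vector_derivative_real_field simp: field_simps)
  qed (auto intro!: continuous_intros)
  also have "\<dots> = 0"
    using sin_int_times_real by (simp add: cis.ctr complex_eq_iff mult.commute)
  finally show ?thesis using False by (simp add: set_lebesgue_integral_def)
qed

context bernoulli_bits
begin

definition pp :: "'e set \<Rightarrow> ('e \<Rightarrow> int) \<Rightarrow> int \<Rightarrow> real" where
  "pp J s j = mean J (\<lambda>A. of_bool (sum s A = j))"

definition bit_char :: "real \<Rightarrow> complex" where
  "bit_char t = of_real (1 - p) + of_real p * cis t"

lemma norm_bit_char_square: "(norm (bit_char t))\<^sup>2 = 1 - 2 * pq * (1 - cos t)"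
proof -
  have "(norm (bit_char t))\<^sup>2 = (1 - p + p * cos t)\<^sup>2 + (p * sin t)\<^sup>2"
    by (simp add: bit_char_def cmod_power2)
  also have "\<dots> = (1 - p)\<^sup>2 + 2 * (1 - p) * p * cos t + p\<^sup>2 * ((cos t)\<^sup>2 + (sin t)\<^sup>2)"
    by (simp only: power2_eq_square) algebra
  finally show ?thesis by (simp add: pq_def power2_eq_square algebra_simps)
qed

lemma norm_bit_char_le:
  assumes "\<bar>t\<bar> \<le> pi" shows "norm (bit_char t) \<le> exp (- (2 * pq / pi\<^sup>2) * t\<^sup>2)"
proof -
  have "(norm (bit_char t))\<^sup>2 \<le> exp (- (2 * pq * (1 - cos t)))"
    unfolding norm_bit_char_square using exp_ge_add_one_self[of "- (2 * pq * (1 - cos t))"] by simp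
  also have "\<dots> \<le> exp (- (2 * pq * (2 * t\<^sup>2 / pi\<^sup>2)))"
    using mult_left_mono[OF one_minus_cos_ge[OF assms], of "2 * pq"] pq_pos by (simp del: times_divide_eq_right)
  also have "\<dots> = (exp (- (2 * pq / pi\<^sup>2) * t\<^sup>2))\<^sup>2"
    by (simp add: exp_double[symmetric] algebra_simps flip: exp_of_nat_mult)
  finally show ?thesis by (rule power2_le_imp_le) simp
qed

lemma norm_bit_char_le_1: "norm (bit_char t) \<le> 1"
proof -
  have "(norm (bit_char t))\<^sup>2 \<le> 1\<^sup>2"
    unfolding norm_bit_char_square using pq_pos by simp
  then show ?thesis by (rule power2_le_imp_le) simp
qed

lemma norm_bit_char_minus_1: "norm (bit_char t - 1) \<le> \<bar>t\<bar>"
proof -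
  have "bit_char t - 1 = of_real p * (cis t - 1)" by (simp add: bit_char_def algebra_simps)
  then have "norm (bit_char t - 1) = p * norm (cis t - 1)" using p_pos by (simp add: norm_mult)
  also have "\<dots> \<le> 1 * \<bar>t\<bar>" using p_pos p_less_1 by (intro mult_mono norm_cis_minus_1_le) auto
  finally show ?thesis by simp
qed

lemma continuous_on_bit_char [continuous_intros]:
  "continuous_on X f \<Longrightarrow> continuous_on X (\<lambda>x. bit_char (f x))"
  unfolding bit_char_def by (intro continuous_intros)

lemma mean_cis_sum:
  assumes "finite J"
  shows "mean J (\<lambda>A. cis (t * of_int (sum s A))) = (\<Prod>e\<in>J. bit_char (t * of_int (s e)))"
  using assms
proof (induction J rule: finite_induct)
  case (insert e J)
  have "mean J (\<lambda>A. cis (t * of_int (sum s (insert e A))))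
     = mean J (\<lambda>A. cis (t * of_int (s e)) * cis (t * of_int (sum s A)))"
  proof (intro mean_cong)
    fix A assume "A \<subseteq> J"
    then have "finite A" "e \<notin> A" using insert by (auto dest: finite_subset)
    then show "cis (t * of_int (sum s (insert e A))) = cis (t * of_int (s e)) * cis (t * of_int (sum s A))"
      by (simp add: cis_mult distrib_left)
  qed
  then show ?case using insert
    by (simp add: mean_insert mean_mult_left bit_char_def scaleR_conv_of_real algebra_simps)
qed simp

lemma pp_fourier:
  assumes "finite J"
  shows "of_real (2 * pi * pp J s j) =
    (LINT t:{-pi..pi}|lborel. (\<Prod>e\<in>J. bit_char (t * of_int (s e))) * cis (- t * of_int j))"
proof -
  have "(LINT t:{-pi..pi}|lborel. (\<Prod>e\<in>J. bit_char (t * of_int (s e))) * cis (- t * of_int j))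
    = (LINT t:{-pi..pi}|lborel. mean J (\<lambda>A. cis (t * of_int (sum s A - j))))"
    by (simp add: mean_cis_sum[OF assms, symmetric] mean_mult_right[symmetric] cis_mult right_diff_distrib del: of_int_sum)
  also have "\<dots> = mean J (\<lambda>A. LINT t:{-pi..pi}|lborel. cis (t * of_int (sum s A - j)))"
    unfolding mean_def set_lebesgue_integral_def scaleR_sum_right
    by (subst Bochner_Integration.integral_sum)
       (auto simp: scaleR_left_commute[of "indicat_real _ _"] simp del: scaleR_scaleR of_int_diff
         intro!: integrable_scaleR_right borel_integrable_compact continuous_intros)
  also have "\<dots> = mean J (\<lambda>A. of_real (2 * pi * of_bool (sum s A = j)))"
    unfolding set_integral_cis by (intro mean_cong) auto
  also have "\<dots> = of_real (2 * pi * pp J s j)"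
    unfolding mean_of_real pp_def by (simp only: mean_mult_left)
  finally show ?thesis ..
qed

lemma norm_prod_bit_char_le:
  assumes "finite J" "\<And>e. e \<in> J \<Longrightarrow> s e = 1 \<or> s e = - 1" "\<bar>t\<bar> \<le> pi"
  shows "norm (\<Prod>e\<in>J. bit_char (t * of_int (s e))) \<le> exp (- (2 * pq * card J / pi\<^sup>2) * t\<^sup>2)"
proof -
  have "norm (\<Prod>e\<in>J. bit_char (t * of_int (s e))) \<le> (\<Prod>e\<in>J. exp (- (2 * pq / pi\<^sup>2) * t\<^sup>2))"
    unfolding prod_norm[symmetric]
  proof (intro prod_mono conjI norm_ge_zero)
    fix e assume "e \<in> J"
    then show "norm (bit_char (t * of_int (s e))) \<le> exp (- (2 * pq / pi\<^sup>2) * t\<^sup>2)"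
      using assms(2)[of e] assms(3) norm_bit_char_le[of t] norm_bit_char_le[of "-t"] by auto
  qed
  then show ?thesis by (simp add: exp_of_nat_mult[symmetric] algebra_simps)
qed

text \<open>Majorants are integrated over the whole line, where their integrals are
  explicit.\<close>

lemma norm_set_integral_le_gauss:
  fixes f :: "real \<Rightarrow> complex"
  assumes "set_integrable lborel {-pi..pi} f" "has_bochner_integral lborel g c"
    "\<And>t. \<bar>t\<bar> \<le> pi \<Longrightarrow> norm (f t) \<le> g t" "\<And>t. 0 \<le> g t"
  shows "norm (LINT t:{-pi..pi}|lborel. f t) \<le> c"
proof -
  have "norm (LINT t:{-pi..pi}|lborel. f t) \<le> (LINT t|lborel. g t)"
    unfolding set_lebesgue_integral_def
    using assms by (intro Bochner_Integration.integral_norm_bound_integral)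
      (auto simp: set_integrable_def has_bochner_integral_iff indicator_def)
  then show ?thesis using assms(2) by (simp add: has_bochner_integral_iff)
qed

text \<open>By inversion a point probability is at most the L1 norm of the characteristic function
  divided by 2 pi, and each factor of the latter has Gaussian decay. The constant sqrt (pi / 8) that
  comes out is rounded up to 1.\<close>

lemma pp_le:
  assumes "finite J" "\<And>e. e \<in> J \<Longrightarrow> s e = 1 \<or> s e = - 1" "J \<noteq> {}"
  shows "pp J s j \<le> 1 / sqrt (pq * card J)"
proof -
  define a where "a = 2 * pq * card J / pi\<^sup>2"
  have c: "0 < pq * card J" using assms pq_pos by (simp add: card_gt_0_iff)
  then have a: "a > 0" by (simp add: a_def)
  have "norm (complex_of_real (2 * pi * pp J s j)) \<le> sqrt (pi / a)"
    unfolding pp_fourier[OF assms(1)]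
  proof (rule norm_set_integral_le_gauss)
    show "has_bochner_integral lborel (\<lambda>x. exp (- a * x\<^sup>2)) (sqrt (pi / a))"
      using has_bochner_integral_gauss_even[OF a, of 0] by simp
    show "set_integrable lborel {-pi..pi} (\<lambda>t. (\<Prod>e\<in>J. bit_char (t * of_int (s e))) * cis (- t * of_int j))"
      by (intro borel_integrable_atLeastAtMost' continuous_intros)
    show "norm ((\<Prod>e\<in>J. bit_char (t * of_int (s e))) * cis (- t * of_int j)) \<le> exp (- a * t\<^sup>2)" if "\<bar>t\<bar> \<le> pi" for t
      using norm_prod_bit_char_le[OF assms(1,2) that] by (simp add: norm_mult a_def)
  qed auto
  then have "\<bar>2 * pi * pp J s j\<bar> \<le> sqrt (pi / a)" by (simp only: norm_of_real)
  then have "2 * pi * pp J s j \<le> sqrt (pi / a)" by linarith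
  also have "\<dots> = sqrt ((pi / 8) * (2 * pi)\<^sup>2 / (pq * card J))"
    using c by (simp add: a_def power2_eq_square)
  also have "\<dots> \<le> sqrt (1 * (2 * pi)\<^sup>2 / (pq * card J))"
    using pi_less_4 c by (intro real_sqrt_le_mono divide_right_mono mult_right_mono) auto
  also have "\<dots> = 2 * pi * (1 / sqrt (pq * card J))" 
    by (simp only: mult_1 real_sqrt_divide real_sqrt_abs) simp
  finally show ?thesis by (rule mult_left_le_imp_le) simp
qed

text \<open>The difference of two adjacent inversion integrals carries a factor of modulus at most
  \<bar>t\<bar>, which gains another \<open>sqrt (pq * card J)\<close>. This gain is what makes two
  critical vertices almost uncorrelated.\<close>

lemma pp_diff_le:
  assumes "finite J" "\<And>e. e \<in> J \<Longrightarrow> s e = 1 \<or> s e = - 1" "J \<noteq> {}" "\<bar>j - i\<bar> \<le> 1"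
  shows "\<bar>pp J s j - pp J s i\<bar> \<le> 1 / (pq * card J)"
proof -
  define a where "a = 2 * pq * card J / pi\<^sup>2"
  have c: "0 < pq * card J" using assms pq_pos by (simp add: card_gt_0_iff)
  then have a: "a > 0" by (simp add: a_def)
  let ?f = "\<lambda>j t. (\<Prod>e\<in>J. bit_char (t * of_int (s e))) * cis (- t * of_int j)"
  have int: "set_integrable lborel {-pi..pi} (?f j)" for j
    by (intro borel_integrable_atLeastAtMost' continuous_intros)
  have "norm (complex_of_real (2 * pi * pp J s j) - complex_of_real (2 * pi * pp J s i)) \<le> 1 / a"
    unfolding pp_fourier[OF assms(1)] set_integral_diff(2)[OF int int, symmetric]
  proof (rule norm_set_integral_le_gauss)
    show "has_bochner_integral lborel (\<lambda>x. \<bar>x\<bar> * exp (- a * x\<^sup>2)) (1 / a)"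
      by (rule has_bochner_integral_gauss_abs[OF a])
    show "set_integrable lborel {-pi..pi} (\<lambda>t. ?f j t - ?f i t)" by (intro set_integral_diff int)
    fix t :: real assume t: "\<bar>t\<bar> \<le> pi"
    have "?f j t - ?f i t = (\<Prod>e\<in>J. bit_char (t * of_int (s e))) * cis (- t * of_int i) * (cis (- t * of_int (j - i)) - 1)"
      by (simp add: algebra_simps cis_mult)
    then have "norm (?f j t - ?f i t) = norm (\<Prod>e\<in>J. bit_char (t * of_int (s e))) * norm (cis (- t * of_int (j - i)) - 1)"
      by (simp add: norm_mult)
    also have "\<dots> \<le> exp (- a * t\<^sup>2) * \<bar>t\<bar>"
    proof (intro mult_mono)
      have "norm (cis (- t * of_int (j - i)) - 1) \<le> \<bar>- t * of_int (j - i)\<bar>" by (rule norm_cis_minus_1_le)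
      also have "\<dots> = \<bar>t\<bar> * of_int \<bar>j - i\<bar>" by (simp add: abs_mult)
      also have "\<dots> \<le> \<bar>t\<bar> * 1" using assms(4) by (intro mult_left_mono) auto
      finally show "norm (cis (- t * of_int (j - i)) - 1) \<le> \<bar>t\<bar>" by simp
    qed (use norm_prod_bit_char_le[OF assms(1,2) t] in \<open>auto simp: a_def\<close>)
    finally show "norm (?f j t - ?f i t) \<le> \<bar>t\<bar> * exp (- a * t\<^sup>2)" by (simp add: mult.commute)
  qed auto
  then have "2 * pi * \<bar>pp J s j - pp J s i\<bar> \<le> 1 / a"
    by (simp only: norm_of_real of_real_diff[symmetric] right_diff_distrib[symmetric] abs_mult) simp
  also have "\<dots> = 2 * pi * (pi / 4 / (pq * card J))"
    using c by (simp add: a_def power2_eq_square field_simps)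
  finally have "\<bar>pp J s j - pp J s i\<bar> \<le> pi / 4 / (pq * card J)"
    by (rule mult_left_le_imp_le) simp
  also have "\<dots> \<le> 1 / (pq * card J)"
    using pi_less_4 c by (intro divide_right_mono) auto
  finally show ?thesis .
qed

text \<open>The factor \<open>c ^ (m - 1)\<close> preserves an exponential decay that both bases
  share.\<close>

lemma abs_power_diff_le:
  fixes a b c :: real
  assumes "0 \<le> a" "a \<le> c" "0 \<le> b" "b \<le> c"
  shows "\<bar>a ^ m - b ^ m\<bar> \<le> m * \<bar>a - b\<bar> * c ^ (m - 1)"
proof (cases m)
  case (Suc k)
  have "\<bar>a ^ Suc k - b ^ Suc k\<bar> = \<bar>a - b\<bar> * \<bar>\<Sum>i<Suc k. b ^ (k - i) * a ^ i\<bar>"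
    by (subst power_diff_sumr2) (simp add: abs_mult mult.commute lessThan_Suc_atMost)
  also have "\<bar>\<Sum>i<Suc k. b ^ (k - i) * a ^ i\<bar> \<le> (\<Sum>i<Suc k. c ^ k)"
  proof (rule order_trans[OF sum_abs sum_mono])
    fix i assume "i \<in> {..<Suc k}"
    then have "c ^ k = c ^ (k - i) * c ^ i" by (simp flip: power_add)
    then show "\<bar>b ^ (k - i) * a ^ i\<bar> \<le> c ^ k"
      using assms by (simp add: abs_mult mult_mono power_mono)
  qed
  finally have "\<bar>a ^ Suc k - b ^ Suc k\<bar> \<le> \<bar>a - b\<bar> * (\<Sum>i<Suc k. c ^ k)"
    by (simp add: mult_left_mono)
  then show ?thesis using Suc by (simp add: algebra_simps)
qed simp

text \<open>Telescoping, with only the factors of modulus at most 1 left in front of the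
  differences.\<close>

lemma norm_mult_power_minus_1:
  fixes a b c :: complex
  assumes "norm a \<le> 1" "norm b \<le> 1" "norm (a - 1) \<le> x" "norm (b - 1) \<le> x" "norm (c - 1) \<le> y"
  shows "norm (a ^ k * b ^ l * c - 1) \<le> (k + l) * x + y"
proof -
  have pw: "norm (a ^ k - 1) \<le> k * x" if "norm a \<le> 1" "norm (a - 1) \<le> x" for a :: complex and k
  proof (induction k)
    case (Suc k)
    have "a ^ Suc k - 1 = a * (a ^ k - 1) + (a - 1)" by (simp add: algebra_simps)
    then have "norm (a ^ Suc k - 1) \<le> norm a * norm (a ^ k - 1) + norm (a - 1)"
      by (metis norm_mult norm_triangle_ineq)
    also have "\<dots> \<le> 1 * (k * x) + x" using Suc that by (intro add_mono mult_mono) auto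
    finally show ?case by (simp add: algebra_simps)
  qed simp
  have "a ^ k * b ^ l * c - 1 = a ^ k * b ^ l * (c - 1) + a ^ k * (b ^ l - 1) + (a ^ k - 1)"
    by (simp add: algebra_simps)
  then have "norm (a ^ k * b ^ l * c - 1) \<le> norm (a ^ k * b ^ l * (c - 1)) + norm (a ^ k * (b ^ l - 1)) + norm (a ^ k - 1)"
    by (simp only:) (intro norm_triangle_mono order_refl)
  also have "\<dots> \<le> 1 * y + 1 * (l * x) + k * x"
    unfolding norm_mult using assms pw[of a k] pw[of b l]
    by (intro add_mono mult_mono) (auto simp: norm_power power_le_one mult_le_one)
  finally show ?thesis by (simp add: algebra_simps)
qed

text \<open>Pair off \<open>M\<close> positive bits with \<open>M\<close> negative ones. A pair
  contributes the real factor \<open>y t\<close>, the squared modulus of \<open>bit_char t\<close>,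
  and \<open>y t ^ M\<close> is close to exp (- pq M t^2), whose integral is the main term. The
  \<open>k + l\<close> unpaired bits and the shift by \<open>j\<close> disturb the integrand by a
  relative error linear in t.\<close>

lemma pp_local_limit:
  assumes J: "finite J" "\<And>e. e \<in> J \<Longrightarrow> s e = 1 \<or> s e = - 1"
    and k: "card {e \<in> J. s e = 1} = M + k" and l: "card {e \<in> J. s e = - 1} = M + l"
    and M: "M \<ge> 2" "pq * M \<ge> 1"
  shows "\<bar>pp J s j - 1 / (2 * sqrt (pi * pq * M))\<bar> \<le> (k + l + \<bar>j\<bar> + 12) / (pq * M)"
proof -
  define y where "y t = 1 - 2 * pq * (1 - cos t)" for t
  define w where "w = pq * M"
  have w: "w \<ge> 1" using M by (simp add: w_def)
  let ?f = "\<lambda>t. (\<Prod>e\<in>J. bit_char (t * of_int (s e))) * cis (- t * of_int j)"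
  let ?u = "\<lambda>t. bit_char t ^ k * bit_char (- t) ^ l * cis (- t * of_int j)"
  have conj: "bit_char t * bit_char (- t) = of_real (y t)" for t
  proof -
    have "bit_char (- t) = cnj (bit_char t)" by (simp add: bit_char_def cis_cnj)
    then show ?thesis by (simp add: complex_norm_square[symmetric] norm_bit_char_square y_def
          del: of_real_diff of_real_mult flip: of_real_power)
  qed
  have f: "?f t = of_real (y t ^ M) * ?u t" for t
  proof -
    have "(\<Prod>e\<in>J. bit_char (t * of_int (s e))) =
      (\<Prod>e\<in>{e\<in>J. s e = 1}. bit_char (t * of_int (s e))) * (\<Prod>e\<in>{e\<in>J. s e = - 1}. bit_char (t * of_int (s e)))"
      using J by (subst prod.union_disjoint[symmetric]) (auto intro!: prod.cong)
    also have "\<dots> = bit_char t ^ (M + k) * bit_char (- t) ^ (M + l)"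
      by (simp add: k l)
    also have "\<dots> = (bit_char t * bit_char (- t)) ^ M * (bit_char t ^ k * bit_char (- t) ^ l)"
      by (simp add: power_add power_mult_distrib)
    finally show ?thesis by (simp add: conj)
  qed
  have y0: "0 \<le> y t" for t unfolding y_def norm_bit_char_square[symmetric] by simp
  have y1: "y t \<le> exp (- (4 * pq / pi\<^sup>2) * t\<^sup>2)" if "\<bar>t\<bar> \<le> pi" for t
  proof -
    have "y t \<le> (exp (- (2 * pq / pi\<^sup>2) * t\<^sup>2))\<^sup>2"
      unfolding y_def norm_bit_char_square[symmetric] by (intro power_mono norm_bit_char_le that) auto
    then show ?thesis by (simp add: exp_double[symmetric] algebra_simps flip: exp_of_nat_mult)
  qed
  have int: "set_integrable lborel {-pi..pi} ?f" by (intro borel_integrable_atLeastAtMost' continuous_intros)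
  have inty: "set_integrable lborel {-pi..pi} (\<lambda>t. complex_of_real (y t ^ M))"
    unfolding y_def by (intro borel_integrable_atLeastAtMost' continuous_intros)
  define a where "a = 4 * w / pi\<^sup>2"
  have a: "a > 0" using w by (simp add: a_def)
  have 1: "norm ((LINT t:{-pi..pi}|lborel. ?f t) - (LINT t:{-pi..pi}|lborel. complex_of_real (y t ^ M)))
     \<le> (k + l + \<bar>j\<bar>) * (1 / a)"
    unfolding set_integral_diff(2)[OF int inty, symmetric]
  proof (rule norm_set_integral_le_gauss)
    show "has_bochner_integral lborel (\<lambda>x. (k + l + \<bar>j\<bar>) * (\<bar>x\<bar> * exp (- a * x\<^sup>2))) ((k + l + \<bar>j\<bar>) * (1 / a))"
      by (intro has_bochner_integral_mult_right has_bochner_integral_gauss_abs a)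
    show "set_integrable lborel {-pi..pi} (\<lambda>t. ?f t - complex_of_real (y t ^ M))"
      by (intro set_integral_diff int inty)
    fix t :: real assume t: "\<bar>t\<bar> \<le> pi"
    have "?f t - complex_of_real (y t ^ M) = of_real (y t ^ M) * (?u t - 1)"
      unfolding f by (simp add: algebra_simps)
    then have "norm (?f t - complex_of_real (y t ^ M)) = y t ^ M * norm (?u t - 1)"
      using y0 by (simp add: norm_mult norm_power)
    also have "\<dots> \<le> exp (- (4 * pq / pi\<^sup>2) * t\<^sup>2) ^ M * ((k + l) * \<bar>t\<bar> + \<bar>- t * of_int j\<bar>)"
    proof (intro mult_mono power_mono y0 y1[OF t])
      show "norm (?u t - 1) \<le> (k + l) * \<bar>t\<bar> + \<bar>- t * of_int j\<bar>"
        using norm_bit_char_le_1 norm_bit_char_minus_1[of t] norm_bit_char_minus_1[of "- t"]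
          norm_mult_power_minus_1[OF _ _ _ _ norm_cis_minus_1_le[of "- t * of_int j"], of "bit_char t" "bit_char (- t)" "\<bar>t\<bar>" k l]
        by simp
    qed auto
    also have "exp (- (4 * pq / pi\<^sup>2) * t\<^sup>2) ^ M = exp (- a * t\<^sup>2)"
      by (simp add: a_def w_def field_simps flip: exp_of_nat_mult)
    finally show "norm (?f t - complex_of_real (y t ^ M)) \<le> (k + l + \<bar>j\<bar>) * (\<bar>t\<bar> * exp (- a * t\<^sup>2))"
      by (simp add: abs_mult algebra_simps)
  qed auto
  \<comment> \<open>Half the rate \<open>a\<close>: \<open>abs_power_diff_le\<close> leaves only
    \<open>M - 1\<close> of the \<open>M\<close> factors, and
    \<open>M \<le> 2 * (M - 1)\<close>.\<close>
  define b where "b = 2 * w / pi\<^sup>2"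
  have b: "b > 0" using w by (simp add: b_def)
  define G where "G t = exp (- w * t\<^sup>2)" for t :: real
  have G: "has_bochner_integral lborel G (sqrt (pi / w))"
    using has_bochner_integral_gauss_even[of w 0] w by (simp add: G_def[abs_def])
  have pi9: "9 < pi\<^sup>2"
    using power_strict_mono[OF pi_gt3, of 2] by simp
  have Gb: "G t \<le> exp (- b * t\<^sup>2)" for t
  proof -
    have "b \<le> w" using pi9 w by (simp add: b_def field_simps)
    then show ?thesis by (simp add: G_def mult_right_mono)
  qed
  have 2: "norm ((LINT t:{-pi..pi}|lborel. complex_of_real (y t ^ M)) - complex_of_real (sqrt (pi / w)))
     \<le> w * (sqrt (pi / b) * (fact (2 * 2) / ((4 * b) ^ 2 * fact 2)))"
  proof -
    have e: "complex_of_real (sqrt (pi / w)) = (LINT t|lborel. complex_of_real (G t))"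
      using has_bochner_integral_of_real[OF G, where 'a = complex] by (simp add: has_bochner_integral_iff)
    have iG: "integrable lborel (\<lambda>t. complex_of_real (G t))"
      using has_bochner_integral_of_real[OF G, where 'a = complex] by (simp add: has_bochner_integral_iff)
    have H: "has_bochner_integral lborel (\<lambda>x. w * (x ^ (2 * 2) * exp (- b * x\<^sup>2)))
        (w * (sqrt (pi / b) * (fact (2 * 2) / ((4 * b) ^ 2 * fact 2))))"
      by (intro has_bochner_integral_mult_right has_bochner_integral_gauss_even b)
    have "norm ((LINT t:{-pi..pi}|lborel. complex_of_real (y t ^ M)) - (LINT t|lborel. complex_of_real (G t)))
       \<le> (LINT t|lborel. w * (t ^ (2 * 2) * exp (- b * t\<^sup>2)))"
      unfolding set_lebesgue_integral_def
      using inty[unfolded set_integrable_def] iG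
    proof (subst Bochner_Integration.integral_diff[symmetric], simp, simp,
        intro Bochner_Integration.integral_norm_bound_integral)
      show "integrable lborel (\<lambda>t. w * (t ^ (2 * 2) * exp (- b * t\<^sup>2)))"
        using H by (simp add: has_bochner_integral_iff)
      fix t :: real
      show "norm (indicat_real {- pi..pi} t *\<^sub>R complex_of_real (y t ^ M) - complex_of_real (G t))
         \<le> w * (t ^ (2 * 2) * exp (- b * t\<^sup>2))"
      proof (cases "\<bar>t\<bar> \<le> pi")
        case False
        \<comment> \<open>Outside the interval only the Gaussian is left; as w t^4 is at least 1
          there, it obeys the same bound.\<close>
        then have "1 ^ 4 \<le> \<bar>t\<bar> ^ 4" using pi_gt3 by (intro power_mono) auto
        then have "1 * 1 * G t \<le> w * t ^ (2 * 2) * exp (- b * t\<^sup>2)"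
          using Gb[of t] w by (intro mult_mono) (auto simp: G_def)
        with False show ?thesis by (auto simp: G_def indicator_def)
      next
        case True
        define g where "g = exp (- pq * t\<^sup>2)"
        have Gg: "G t = g ^ M" by (simp add: G_def g_def w_def algebra_simps flip: exp_of_nat_mult)
        have t4: "0 \<le> pq * t^4" "0 \<le> pq * t\<^sup>2" using pq_pos by auto
        have c1: "1 - t\<^sup>2/2 \<le> cos t"
          using cos_double_sin[of "t/2"] power_mono[OF abs_sin_x_le_abs_x[of "t/2"], of 2]
          by (simp add: power_divide)
        have yl: "1 - pq * t\<^sup>2 \<le> y t"
          using mult_left_mono[OF c1, of "2 * pq"] pq_pos by (simp add: y_def algebra_simps)
        have yu: "y t \<le> 1 - pq * t\<^sup>2 + pq * t^4 / 3"
          using mult_left_mono[OF cos_upper_quartic[of t], of "2 * pq"] pq_pos by (simp add: y_def algebra_simps)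
        have gl: "1 - pq * t\<^sup>2 \<le> g"
          using exp_ge_add_one_self[of "- pq * t\<^sup>2"] by (simp add: g_def)
        have gu: "g \<le> 1 - pq * t\<^sup>2 + pq * t^4"
        proof -
          have "g \<le> 1 - pq * t\<^sup>2 + (pq * t\<^sup>2)\<^sup>2"
          proof (cases "pq * t\<^sup>2 \<le> 1")
            case True
            have "1 + pq * t\<^sup>2 \<le> exp (pq * t\<^sup>2)" by (rule exp_ge_add_one_self)
            then have "g \<le> 1 / (1 + pq * t\<^sup>2)"
              using t4 by (simp add: g_def exp_minus inverse_eq_divide divide_left_mono add_pos_nonneg)
            also have "\<dots> \<le> 1 - pq * t\<^sup>2 + (pq * t\<^sup>2)\<^sup>2"
            proof -
              define z where "z = pq * t\<^sup>2"
              have "0 \<le> z" using t4 by (simp add: z_def)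
              moreover have "(1 - z + z\<^sup>2) * (1 + z) = 1 + z ^ 3" by (simp add: power2_eq_square power3_eq_cube algebra_simps)
              ultimately show ?thesis unfolding z_def[symmetric] by (simp add: pos_divide_le_eq)
            qed
            finally show ?thesis .
          next
            case False
            define z where "z = pq * t\<^sup>2"
            have "z > 1" using False by (simp add: z_def)
            then have "1 * z \<le> z * z" by (intro mult_right_mono) auto
            moreover have "g \<le> 1" using t4 by (simp add: g_def)
            ultimately show ?thesis unfolding z_def[symmetric] by (simp add: power2_eq_square)
          qed
          also have "(pq * t\<^sup>2)\<^sup>2 \<le> pq * t^4"
          proof -
            have "(pq * t\<^sup>2)\<^sup>2 = pq * (pq * t^4)" by (simp add: power2_eq_square power4_eq_xxxx)
            also have "\<dots> \<le> 1 * (pq * t^4)" using pq_le t4 by (intro mult_right_mono) auto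
            finally show ?thesis by simp
          qed
          finally show ?thesis by simp
        qed
        \<comment> \<open>Both quantities agree with 1 - pq t^2 up to pq t^4.\<close>
        have d: "\<bar>y t - g\<bar> \<le> pq * t^4" using yl yu gl gu t4 by linarith
        let ?e = "exp (- (4 * pq / pi\<^sup>2) * t\<^sup>2)"
        have ge: "g \<le> ?e"
        proof -
          have "4 * pq / pi\<^sup>2 \<le> pq" using pi9 pq_pos by (simp add: field_simps)
          from mult_right_mono[OF this, of "t\<^sup>2"] show ?thesis by (simp add: g_def)
        qed
        have "\<bar>y t ^ M - g ^ M\<bar> \<le> M * \<bar>y t - g\<bar> * ?e ^ (M - 1)"
          using y0 y1[OF True] ge by (intro abs_power_diff_le) (auto simp: g_def)
        also have "\<dots> \<le> M * (pq * t^4) * exp (- b * t\<^sup>2)"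
        proof (intro mult_mono d mult_left_mono)
          have "?e ^ (M - 1) = exp (real (M - 1) * (- (4 * pq / pi\<^sup>2) * t\<^sup>2))" by (rule exp_of_nat_mult[symmetric])
          also have "\<dots> \<le> exp (- b * t\<^sup>2)"
          proof -
            have "M \<le> 2 * real (M - 1)" using M by simp
            from mult_right_mono[OF this, of "2 * pq * t\<^sup>2 / pi\<^sup>2"] show ?thesis
              using pq_pos by (simp add: b_def w_def mult_ac)
          qed
          finally show "?e ^ (M - 1) \<le> exp (- b * t\<^sup>2)" .
        qed (use t4 in auto)
        finally have "\<bar>y t ^ M - G t\<bar> \<le> w * (t ^ (2 * 2) * exp (- b * t\<^sup>2))"
          by (simp add: Gg w_def mult_ac)
        moreover have "indicat_real {- pi..pi} t *\<^sub>R complex_of_real (y t ^ M) - complex_of_real (G t) = of_real (y t ^ M - G t)"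
          using True by (auto simp: indicator_def)
        ultimately show ?thesis by (simp only: norm_of_real)
      qed
    qed (intro Bochner_Integration.integrable_diff; assumption)
    then show ?thesis unfolding e using H by (simp add: has_bochner_integral_iff)
  qed
  have "norm (complex_of_real (2 * pi * pp J s j) - complex_of_real (sqrt (pi / w)))
     \<le> (k + l + \<bar>j\<bar>) * (1 / a) + w * (sqrt (pi / b) * (fact (2 * 2) / ((4 * b) ^ 2 * fact 2)))"
    unfolding pp_fourier[OF J(1)] using norm_triangle_mono[OF 1 2] by simp
  \<comment> \<open>Divided by \<open>2 * pi\<close>, this term becomes the 12 in the
    statement.\<close>
  also have "w * (sqrt (pi / b) * (fact (2 * 2) / ((4 * b) ^ 2 * fact 2))) \<le> 24 * pi / w"
  proof -
    have "w * (sqrt (pi / b) * (fact (2 * 2) / ((4 * b) ^ 2 * fact 2))) = (3/16) * pi ^ 4 * sqrt (pi ^ 3 / 2 / w) / w"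
      using w by (simp add: b_def fact_numeral power2_eq_square power4_eq_xxxx power3_eq_cube field_simps)
    also have "\<dots> \<le> (3/16) * pi ^ 4 * sqrt (pi ^ 3 / 2 / 1) / w"
      using w by (intro divide_right_mono mult_left_mono real_sqrt_le_mono divide_left_mono) auto
    also have "\<dots> \<le> 24 * pi / w"
    proof -
      have p: "pi \<le> 3.15" using pi_approx by simp
      have "pi ^ 3 \<le> 3.15 ^ 3" by (rule power_mono[OF p]) simp
      also have "\<dots> \<le> (31.3::real)" by (simp add: power3_eq_cube)
      finally have p3: "pi ^ 3 \<le> 31.3" .
      then have "sqrt (pi ^ 3 / 2 / 1) \<le> sqrt (4\<^sup>2)" by (intro real_sqrt_le_mono) simp
      then have sq: "sqrt (pi ^ 3 / 2 / 1) \<le> 4" by simp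
      have "(3/16) * pi ^ 4 * sqrt (pi ^ 3 / 2 / 1) = (3/16) * pi * (pi ^ 3 * sqrt (pi ^ 3 / 2 / 1))"
        by (simp add: power4_eq_xxxx power3_eq_cube)
      also have "\<dots> \<le> (3/16) * pi * (31.3 * 4)" by (intro mult_left_mono mult_mono p3 sq) auto
      also have "\<dots> \<le> 24 * pi" by simp
      finally show ?thesis using w by (intro divide_right_mono) auto
    qed
    finally show ?thesis .
  qed
  also have "(k + l + \<bar>j\<bar>) * (1 / a) \<le> 2 * pi * ((k + l + \<bar>j\<bar>) / w)"
  proof -
    have "(k + l + \<bar>j\<bar>) * (1 / a) = (pi / 4) * pi * ((k + l + \<bar>j\<bar>) / w)" using w by (simp add: a_def power2_eq_square)
    also have "\<dots> \<le> 2 * pi * ((k + l + \<bar>j\<bar>) / w)"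
      using pi_less_4 w by (intro mult_right_mono divide_nonneg_nonneg) auto
    finally show ?thesis .
  qed
  finally have *: "norm (complex_of_real (2 * pi * pp J s j) - complex_of_real (sqrt (pi / w)))
     \<le> 2 * pi * ((k + l + \<bar>j\<bar>) / w) + 24 * pi / w" by simp
  have "sqrt (pi / w) = 2 * pi * (1 / (2 * sqrt (pi * w)))"
    using w by (simp add: real_sqrt_divide real_sqrt_mult field_simps)
  then have "norm (complex_of_real (2 * pi * pp J s j) - complex_of_real (sqrt (pi / w)))
     = 2 * pi * \<bar>pp J s j - 1 / (2 * sqrt (pi * w))\<bar>"
    by (simp only: norm_of_real of_real_diff[symmetric] right_diff_distrib[symmetric] abs_mult) simp
  moreover have "2 * pi * ((k + l + \<bar>j\<bar>) / w) + 24 * pi / w = 2 * pi * ((k + l + \<bar>j\<bar> + 12) / w)"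
    by (simp add: add_divide_distrib distrib_left)
  ultimately have "2 * pi * \<bar>pp J s j - 1 / (2 * sqrt (pi * w))\<bar> \<le> 2 * pi * ((k + l + \<bar>j\<bar> + 12) / w)"
    using * by linarith
  then have "\<bar>pp J s j - 1 / (2 * sqrt (pi * w))\<bar> \<le> (k + l + \<bar>j\<bar> + 12) / w"
    by (rule mult_left_le_imp_le) simp
  then show ?thesis by (simp add: w_def mult.assoc)
qed

end

section \<open>Covariance of a threshold indicator with functions of the same bits\<close>

context bernoulli_bits
begin

text \<open>The value of a sum at which adding \<open>a = \<plusminus>1\<close> changes whether the sum is nonnegative.\<close>

definition crit :: "int \<Rightarrow> int" where "crit a = (if a = 1 then - 1 else 0)"

lemma of_bool_nonneg_shift:
  assumes "a = 1 \<or> a = - 1"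
  shows "(of_bool (0 \<le> d + a) :: real) = of_bool (0 \<le> d) + of_int a * of_bool (d = crit a)"
  using assms by (auto simp: crit_def)

lemma mean_nonneg_sum_diff:
  assumes "finite J" "w \<notin> J" "s w = 1 \<or> s w = - 1"
  shows "mean J (\<lambda>B. of_bool (0 \<le> c + sum s (insert w B)) :: real) - mean J (\<lambda>B. of_bool (0 \<le> c + sum s B))
     = of_int (s w) * pp J s (crit (s w) - c)"
proof -
  have "mean J (\<lambda>B. of_bool (0 \<le> c + sum s (insert w B)) :: real)
     = mean J (\<lambda>B. of_bool (0 \<le> c + sum s B) + of_int (s w) * of_bool (sum s B = crit (s w) - c))"
  proof (intro mean_cong)
    fix B assume "B \<subseteq> J"
    then have "finite B" "w \<notin> B" using assms by (auto dest: finite_subset)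
    then have "c + sum s (insert w B) = (c + sum s B) + s w" by simp
    moreover have "(sum s B = crit (s w) - c) = (c + sum s B = crit (s w))" by auto
    ultimately show "(of_bool (0 \<le> c + sum s (insert w B)) :: real)
      = of_bool (0 \<le> c + sum s B) + of_int (s w) * of_bool (sum s B = crit (s w) - c)"
      by (simp only: of_bool_nonneg_shift[OF assms(3)])
  qed
  then show ?thesis by (simp add: mean_add mean_mult_left pp_def)
qed

lemma sum_subset_eq:
  fixes l :: "'e \<Rightarrow> real"
  assumes "finite U" "T \<subseteq> U"
  shows "sum l T - p * sum l U = (\<Sum>w\<in>U. l w * (of_bool (w \<in> T) - p))"
proof -
  have "(\<Sum>w\<in>U. l w * (of_bool (w \<in> T) - p)) = (\<Sum>w\<in>U. l w * of_bool (w \<in> T)) - (\<Sum>w\<in>U. p * l w)"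
    by (simp add: algebra_simps sum_subtractf)
  also have "(\<Sum>w\<in>U. l w * of_bool (w \<in> T)) = sum l T"
    using assms by (subst sum.mono_neutral_cong_right[of U T]) auto
  finally show ?thesis by (simp add: sum_distrib_left)
qed

text \<open>The bits are independent, so a bit \<open>w\<close> is correlated with the indicator
  only through the expected change of the indicator when \<open>w\<close> is switched on. This
  change is weighted by the variance \<open>pq\<close> of the bit.\<close>

lemma mean_nonneg_times_linear:
  fixes l :: "'e \<Rightarrow> real"
  assumes U: "finite U" "\<And>w. w \<in> U \<Longrightarrow> s w = 1 \<or> s w = - 1"
  shows "mean U (\<lambda>T. of_bool (0 \<le> c + sum s T) * (sum l T - p * sum l U))
     = pq * (\<Sum>w\<in>U. l w * (of_int (s w) * pp (U - {w}) s (crit (s w) - c)))"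
proof -
  have one: "mean U (\<lambda>T. of_bool (0 \<le> c + sum s T) * (of_bool (w \<in> T) - p)) = pq * (of_int (s w) * pp (U - {w}) s (crit (s w) - c))"
    if w: "w \<in> U" for w
  proof -
    have "mean U (\<lambda>T. of_bool (0 \<le> c + sum s T) * (of_bool (w \<in> T) - p)) =
      (1 - p) * mean (U - {w}) (\<lambda>T. of_bool (0 \<le> c + sum s T) * (of_bool (w \<in> T) - p)) +
      p * mean (U - {w}) (\<lambda>T. of_bool (0 \<le> c + sum s (insert w T)) * (of_bool (w \<in> insert w T) - p))"
      using mean_remove[OF U(1) w, of "\<lambda>T. of_bool (0 \<le> c + sum s T) * (of_bool (w \<in> T) - p)"] by simp
    also have "mean (U - {w}) (\<lambda>T. of_bool (0 \<le> c + sum s T) * (of_bool (w \<in> T) - p))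
      = mean (U - {w}) (\<lambda>T. of_bool (0 \<le> c + sum s T) * (- p))" by (intro mean_cong) auto
    also have "mean (U - {w}) (\<lambda>T. of_bool (0 \<le> c + sum s (insert w T)) * (of_bool (w \<in> insert w T) - p))
      = mean (U - {w}) (\<lambda>T. of_bool (0 \<le> c + sum s (insert w T)) * (1 - p))" by (intro mean_cong) auto
    finally have "mean U (\<lambda>T. of_bool (0 \<le> c + sum s T) * (of_bool (w \<in> T) - p)) =
       pq * (mean (U - {w}) (\<lambda>T. of_bool (0 \<le> c + sum s (insert w T))) - mean (U - {w}) (\<lambda>T. of_bool (0 \<le> c + sum s T)))"
      unfolding mean_mult_right by (simp add: pq_def algebra_simps)
    also have "\<dots> = pq * (of_int (s w) * pp (U - {w}) s (crit (s w) - c))"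
      using U w by (subst mean_nonneg_sum_diff) auto
    finally show ?thesis .
  qed
  have "mean U (\<lambda>T. of_bool (0 \<le> c + sum s T) * (sum l T - p * sum l U))
     = mean U (\<lambda>T. \<Sum>w\<in>U. l w * (of_bool (0 \<le> c + sum s T) * (of_bool (w \<in> T) - p)))"
  proof (intro mean_cong)
    fix T assume T: "T \<subseteq> U"
    show "of_bool (0 \<le> c + sum s T) * (sum l T - p * sum l U) = (\<Sum>w\<in>U. l w * (of_bool (0 \<le> c + sum s T) * (of_bool (w \<in> T) - p)))"
      unfolding sum_subset_eq[OF U(1) T] by (subst sum_distrib_left) (intro sum.cong refl, simp)
  qed
  also have "\<dots> = (\<Sum>w\<in>U. l w * (pq * (of_int (s w) * pp (U - {w}) s (crit (s w) - c))))"
    unfolding mean_sum mean_mult_left by (intro sum.cong refl) (simp add: one)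
  finally show ?thesis by (simp add: sum_distrib_left mult_ac)
qed

text \<open>\<open>K\<close> will be the set of critical vertices. The effect of a star is governed
  by \<open>card K\<close>, which is typically much smaller than \<open>card U\<close>.\<close>

lemma mean_abs_star_linear_le:
  fixes l :: "'e \<Rightarrow> real"
  assumes "finite U" "K \<subseteq> U" "\<And>w. w \<in> U - K \<Longrightarrow> l w = 0" "\<And>w. w \<in> K \<Longrightarrow> \<bar>l w\<bar> \<le> z" "0 \<le> z"
  shows "mean U (\<lambda>T. \<bar>sum l T - p * sum l U\<bar>) \<le> z * sqrt (pq * card K)"
    and "mean U (\<lambda>T. (sum l T - p * sum l U)\<^sup>2) \<le> pq * z\<^sup>2 * card K"
proof -
  have "(\<Sum>e\<in>U. (l e)\<^sup>2) = (\<Sum>e\<in>K. (l e)\<^sup>2)"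
    using assms by (intro sum.mono_neutral_right) auto
  also have "\<dots> \<le> (\<Sum>e\<in>K. z\<^sup>2)"
    using assms by (intro sum_mono) (simp add: abs_le_square_iff[symmetric])
  finally have *: "(\<Sum>e\<in>U. (l e)\<^sup>2) \<le> card K * z\<^sup>2" by simp
  then have "pq * (\<Sum>e\<in>U. (l e)\<^sup>2) \<le> pq * (card K * z\<^sup>2)" using pq_pos by (intro mult_left_mono) auto
  then have **: "pq * (\<Sum>e\<in>U. (l e)\<^sup>2) \<le> z\<^sup>2 * (pq * card K)" by (simp add: mult_ac)
  show "mean U (\<lambda>T. (sum l T - p * sum l U)\<^sup>2) \<le> pq * z\<^sup>2 * card K"
    using ** by (simp add: mean_linear_square[OF assms(1)] mult_ac)
  have "mean U (\<lambda>T. \<bar>sum l T - p * sum l U\<bar>) \<le> sqrt (pq * (\<Sum>e\<in>U. (l e)\<^sup>2))"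
    by (rule mean_abs_linear_le[OF assms(1)])
  also have "\<dots> \<le> sqrt (z\<^sup>2 * (pq * card K))" using ** by (rule real_sqrt_le_mono)
  also have "\<dots> = z * sqrt (pq * card K)" using assms(5) by (simp add: real_sqrt_mult)
  finally show "mean U (\<lambda>T. \<bar>sum l T - p * sum l U\<bar>) \<le> z * sqrt (pq * card K)" .
qed

text \<open>As \<open>g\<close> is the second-order remainder of \<open>cis (L T)\<close>, its
  covariance with \<open>h\<close> is trivially at most half the variance of \<open>L\<close>. To
  gain on this when at least half of the bits lie outside \<open>K\<close>, average over those bits
  first. The averaged indicator changes by at most a point probability \<open>k\<close> when a bit
  of \<open>K\<close> flips, and \<open>norm_covariance_le\<close> collects this factor. Otherwise
  \<open>card K\<close> is comparable to \<open>card U\<close>, and the trivial bound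
  suffices.\<close>

lemma covariance_remainder_le:
  fixes l :: "'e \<Rightarrow> real"
  assumes U: "finite U" "\<And>w. w \<in> U \<Longrightarrow> s w = 1 \<or> s w = - 1"
    and K: "K \<subseteq> U" "\<And>w. w \<in> U - K \<Longrightarrow> l w = 0" "\<And>w. w \<in> K \<Longrightarrow> \<bar>l w\<bar> \<le> z" and z: "0 \<le> z"
    and k: "\<And>J j. J \<subseteq> U \<Longrightarrow> card U \<le> 2 * card J \<Longrightarrow> pp J s j \<le> k" "0 \<le> k" and U0: "U \<noteq> {}"
  defines "L \<equiv> \<lambda>T. sum l T - p * sum l U"
  defines "g \<equiv> \<lambda>T. cis (L T) - 1 - \<i> * of_real (L T)"
  defines "h \<equiv> \<lambda>T. of_bool (0 \<le> sum s T) :: real"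
  shows "norm (mean U (\<lambda>T. h T *\<^sub>R g T) - mean U h *\<^sub>R mean U g)
    \<le> pq * k * z * card K * (z * sqrt (pq * card K) + 2 * z) + pq * z\<^sup>2 * (card K)\<^sup>2 / card U"
proof (cases "card U \<le> 2 * card (U - K)")
  case False
  have fK: "finite K" using K(1) U(1) by (rule finite_subset)
  have cK: "card U < 2 * card K"
    using False K(1) fK by (simp add: card_Diff_subset)
  have cU: "card U > 0" using U U0 by (simp add: card_gt_0_iff)
  have "mean U (\<lambda>T. h T *\<^sub>R g T) - mean U h *\<^sub>R mean U g = mean U (\<lambda>T. (h T - mean U h) *\<^sub>R g T)"
    by (simp add: scaleR_diff_left mean_diff mean_scaleR)
  also have "norm \<dots> \<le> mean U (\<lambda>T. norm ((h T - mean U h) *\<^sub>R g T))" by (rule norm_mean_le)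
  also have "\<dots> \<le> mean U (\<lambda>T. (L T)\<^sup>2 / 2)"
  proof (intro mean_mono)
    fix T assume "T \<subseteq> U"
    have "0 \<le> mean U h" "mean U h \<le> 1" "0 \<le> h T" "h T \<le> 1"
      using U(1) by (auto simp: h_def intro!: mean_nonneg mean_le_const)
    then have "\<bar>h T - mean U h\<bar> \<le> 1" by linarith
    then have "\<bar>h T - mean U h\<bar> * norm (g T) \<le> 1 * ((L T)\<^sup>2 / 2)"
      unfolding g_def by (intro mult_mono norm_cis_minus_linear_le) auto
    then show "norm ((h T - mean U h) *\<^sub>R g T) \<le> (L T)\<^sup>2 / 2" by simp
  qed
  also have "\<dots> \<le> pq * z\<^sup>2 * card K / 2"
    using mean_abs_star_linear_le(2)[OF U(1) K z] by (simp add: mean_divide L_def)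
  also have "\<dots> \<le> pq * z\<^sup>2 * (card K)\<^sup>2 / card U"
  proof -
    have "pq * z\<^sup>2 * card K * card U \<le> pq * z\<^sup>2 * card K * (2 * card K)"
      using cK pq_pos by (intro mult_left_mono) auto
    then show ?thesis using cU by (simp add: field_simps power2_eq_square)
  qed
  finally show ?thesis using z k pq_pos by (simp add: add_increasing)
next
  case True
  have fK: "finite K" using K(1) U(1) by (rule finite_subset)
  define hb where "hb A = mean (U - K) (\<lambda>B. h (A \<union> B))" for A
  have UK: "U = K \<union> (U - K)" using K(1) by auto
  have split: "mean U f = mean K (\<lambda>A. mean (U - K) (\<lambda>B. f (A \<union> B)))" for f :: "'e set \<Rightarrow> 'c::real_normed_vector"
    using U(1) fK mean_Un[of K "U - K" f] UK by auto
  have LU: "sum l U = sum l K" using K U by (intro sum.mono_neutral_right) auto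
  have LAB: "L (A \<union> B) = L A" if "A \<subseteq> K" "B \<subseteq> U - K" for A B
  proof -
    have "finite A" "finite B" "A \<inter> B = {}" using that fK U(1) by (auto dest: finite_subset)
    then have "sum l (A \<union> B) = sum l A + sum l B" by (rule sum.union_disjoint)
    moreover have "sum l B = 0" using that K(2) by (intro sum.neutral) auto
    ultimately show ?thesis by (simp add: L_def)
  qed
  have e1: "mean U (\<lambda>T. h T *\<^sub>R g T) = mean K (\<lambda>A. hb A *\<^sub>R g A)"
    unfolding split
  proof (intro mean_cong)
    fix A assume A: "A \<subseteq> K"
    have "mean (U - K) (\<lambda>B. h (A \<union> B) *\<^sub>R g (A \<union> B)) = mean (U - K) (\<lambda>B. h (A \<union> B) *\<^sub>R g A)"
      by (intro mean_cong) (simp add: g_def LAB A)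
    also have "\<dots> = hb A *\<^sub>R g A"
      unfolding hb_def by (rule mean_bounded_linear[OF bounded_linear_scaleR_left])
    finally show "mean (U - K) (\<lambda>B. h (A \<union> B) *\<^sub>R g (A \<union> B)) = hb A *\<^sub>R g A" .
  qed
  have e2: "mean U h = mean K hb" unfolding split hb_def ..
  have e3: "mean U g = mean K g"
    unfolding split
  proof (intro mean_cong)
    fix A assume A: "A \<subseteq> K"
    have "mean (U - K) (\<lambda>B. g (A \<union> B)) = mean (U - K) (\<lambda>B. g A)"
      by (intro mean_cong) (simp add: g_def LAB A)
    then show "mean (U - K) (\<lambda>B. g (A \<union> B)) = g A" using U(1) by simp
  qed
  \<comment> \<open>Flipping \<open>w\<close> matters only if the bits outside \<open>K\<close> make
    the sum land on one critical value.\<close>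
  have dh: "\<bar>hb (insert w A) - hb A\<bar> \<le> k" if w: "w \<in> K" and A: "A \<subseteq> K - {w}" for w A
  proof -
    have finA: "finite A" using A fK by (meson Diff_subset finite_subset)
    have sAB: "sum s (A \<union> B) = sum s A + sum s B" if "B \<subseteq> U - K" for B
      using that A finA U(1) by (intro sum.union_disjoint) (auto dest: finite_subset)
    have swAB: "sum s (insert w A \<union> B) = sum s A + sum s (insert w B)" if "B \<subseteq> U - K" for B
    proof -
      have "finite B" "w \<notin> B" "w \<notin> A \<union> B" using that w A U(1) by (auto dest: finite_subset)
      then show ?thesis using sAB[OF that] finA by simp
    qed
    have "hb (insert w A) - hb A = mean (U - K) (\<lambda>B. of_bool (0 \<le> sum s A + sum s (insert w B)) :: real)
         - mean (U - K) (\<lambda>B. of_bool (0 \<le> sum s A + sum s B))"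
      unfolding hb_def h_def by (intro arg_cong2[where f = "(-)"] mean_cong) (simp_all only: sAB swAB)
    also have "\<dots> = of_int (s w) * pp (U - K) s (crit (s w) - sum s A)"
      using U w K(1) by (intro mean_nonneg_sum_diff) auto
    also have "\<bar>\<dots>\<bar> = \<bar>pp (U - K) s (crit (s w) - sum s A)\<bar>"
    proof -
      have "s w = 1 \<or> s w = - 1" using U(2)[of w] w K(1) by auto
      then have "\<bar>real_of_int (s w)\<bar> = 1" by auto
      then show ?thesis by (simp add: abs_mult)
    qed
    also have "\<dots> = pp (U - K) s (crit (s w) - sum s A)"
      unfolding pp_def by (simp add: mean_nonneg)
    also have "\<dots> \<le> k" using True by (intro k(1)) auto
    finally show ?thesis .
  qed
  have dg: "mean (K - {w}) (\<lambda>A. norm (g (insert w A) - g A)) \<le> z * (z * sqrt (pq * card K) + 2 * z)"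
    if w: "w \<in> K" for w
  proof -
    let ?L' = "\<lambda>A. sum l A - p * sum l (K - {w})"
    have pt: "norm (g (insert w A) - g A) \<le> z * \<bar>?L' A\<bar> + 2 * z\<^sup>2" if A: "A \<subseteq> K - {w}" for A
    proof -
      have fA: "finite A" "w \<notin> A" using A fK by (auto dest: finite_subset)
      have L1: "L (insert w A) = L A + l w" using fA by (simp add: L_def)
      have L2: "L A = ?L' A - p * l w" using w fK by (simp add: L_def LU sum_diff1 algebra_simps)
      have lw: "\<bar>l w\<bar> \<le> z" using K(3) w by auto
      \<comment> \<open>Since \<open>g\<close> has no linear part, its increment is of second order
        in \<open>z\<close>.\<close>
      have "g (insert w A) - g A = cis (L A) * (cis (l w) - 1 - \<i> * of_real (l w)) + (\<i> * of_real (l w)) * (cis (L A) - 1)"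
        unfolding g_def L1 by (simp add: cis_mult[symmetric] algebra_simps)
      also have "norm \<dots> \<le> norm (cis (L A) * (cis (l w) - 1 - \<i> * of_real (l w))) + norm ((\<i> * of_real (l w)) * (cis (L A) - 1))"
        by (rule norm_triangle_ineq)
      also have "\<dots> \<le> (l w)\<^sup>2 / 2 + \<bar>l w\<bar> * \<bar>L A\<bar>"
        unfolding norm_mult using norm_cis_minus_linear_le[of "l w"] norm_cis_minus_1_le[of "L A"]
        by (intro add_mono) (auto intro: mult_left_mono)
      also have "\<dots> \<le> z\<^sup>2 / 2 + z * (\<bar>?L' A\<bar> + z)"
      proof (intro add_mono mult_mono divide_right_mono)
        show "(l w)\<^sup>2 \<le> z\<^sup>2" using lw by (simp add: abs_le_square_iff[symmetric])
        have "\<bar>p * l w\<bar> \<le> 1 * z" unfolding abs_mult using p_pos p_less_1 lw by (intro mult_mono) auto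
        then show "\<bar>L A\<bar> \<le> \<bar>?L' A\<bar> + z" unfolding L2 by linarith
      qed (use lw z in auto)
      also have "\<dots> \<le> z * \<bar>?L' A\<bar> + 2 * z\<^sup>2" by (simp add: algebra_simps power2_eq_square)
      finally show ?thesis .
    qed
    have "mean (K - {w}) (\<lambda>A. norm (g (insert w A) - g A)) \<le> mean (K - {w}) (\<lambda>A. z * \<bar>?L' A\<bar> + 2 * z\<^sup>2)"
      by (intro mean_mono pt)
    also have "\<dots> = z * mean (K - {w}) (\<lambda>A. \<bar>?L' A\<bar>) + 2 * z\<^sup>2"
      using fK by (simp add: mean_add mean_mult_left)
    also have "\<dots> \<le> z * (z * sqrt (pq * card (K - {w}))) + 2 * z\<^sup>2"
      using fK K z by (intro add_mono mult_left_mono mean_abs_star_linear_le) auto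
    also have "\<dots> \<le> z * (z * sqrt (pq * card K)) + 2 * z\<^sup>2"
      using fK z pq_pos by (intro add_mono mult_left_mono real_sqrt_le_mono) (auto simp: card_Diff1_le)
    finally show ?thesis by (simp add: algebra_simps power2_eq_square)
  qed
  have "norm (mean U (\<lambda>T. h T *\<^sub>R g T) - mean U h *\<^sub>R mean U g)
     \<le> pq * k * (\<Sum>w\<in>K. mean (K - {w}) (\<lambda>A. norm (g (insert w A) - g A)))"
    unfolding e1 e2 e3 by (rule norm_covariance_le[OF fK dh])
  also have "\<dots> \<le> pq * k * (\<Sum>w\<in>K. z * (z * sqrt (pq * card K) + 2 * z))"
    using pq_pos k(2) by (intro mult_left_mono sum_mono dg) auto
  also have "\<dots> = pq * k * z * card K * (z * sqrt (pq * card K) + 2 * z)" by simp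
  also have "\<dots> \<le> \<dots> + pq * z\<^sup>2 * (card K)\<^sup>2 / card U" using pq_pos by simp
  finally show ?thesis .
qed

text \<open>\<open>h\<close> is the indicator of the centre of a star, \<open>x\<close> its
  frequency, and \<open>L\<close> the centred effect of the star on the critical vertices, with
  their frequencies multiplied in. To first order the mean is imaginary: \<open>m * (1 - m)\<close>
  is the variance of \<open>h\<close>, and the sum is the covariance of \<open>h\<close> with
  \<open>L\<close>. The second estimate says that the mean phase is nearly 1, so that it can be put
  back as a factor of this first-order term.\<close>

lemma star_expansion:
  fixes l :: "'e \<Rightarrow> real"
  assumes U: "finite U" "\<And>w. w \<in> U \<Longrightarrow> s w = 1 \<or> s w = - 1"
    and K: "K \<subseteq> U" "\<And>w. w \<in> U - K \<Longrightarrow> l w = 0" "\<And>w. w \<in> K \<Longrightarrow> \<bar>l w\<bar> \<le> z" and z: "\<bar>x\<bar> \<le> z"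
    and k: "\<And>J j. J \<subseteq> U \<Longrightarrow> card U \<le> 2 * card J \<Longrightarrow> pp J s j \<le> k" "0 \<le> k" and U0: "U \<noteq> {}"
  defines "L \<equiv> \<lambda>T. sum l T - p * sum l U"
  defines "h \<equiv> \<lambda>T. of_bool (0 \<le> sum s T) :: real"
  defines "m \<equiv> mean U h"
  defines "a \<equiv> z * sqrt (pq * card K)"
  shows "norm (mean U (\<lambda>T. (h T - m) *\<^sub>R cis (x * (h T - m) + L T))
      - \<i> * of_real (x * m * (1 - m) + pq * (\<Sum>w\<in>U. l w * (of_int (s w) * pp (U - {w}) s (crit (s w))))))
    \<le> z\<^sup>2 / 2 + z * a + pq * k * z * card K * (a + 2 * z) + pq * z\<^sup>2 * (card K)\<^sup>2 / card U"
    and "norm (mean U (\<lambda>T. cis (x * (h T - m) + L T)) - 1) \<le> z + a"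
proof -
  have z0: "0 \<le> z" using z by linarith
  have h01: "h T = 0 \<or> h T = 1" for T by (simp add: h_def)
  have m01: "0 \<le> m" "m \<le> 1"
    unfolding m_def using U(1) by (auto simp: h_def intro!: mean_nonneg mean_le_const)
  have hm: "\<bar>h T - m\<bar> \<le> 1" for T using h01[of T] m01 by auto
  have mL: "mean U (\<lambda>T. \<bar>L T\<bar>) \<le> a"
    unfolding L_def a_def using mean_abs_star_linear_le[OF U(1) K z0] by auto
  have mhm: "mean U (\<lambda>T. h T - m) = 0" using U(1) by (simp add: mean_diff m_def)
  define g where "g T = cis (L T) - 1 - \<i> * of_real (L T)" for T
  define lin where "lin = pq * (\<Sum>w\<in>U. l w * (of_int (s w) * pp (U - {w}) s (crit (s w))))"
  have linear: "mean U (\<lambda>T. (h T - m) * L T) = lin"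
  proof -
    have "mean U L = 0" using U(1) by (simp add: L_def mean_diff mean_linear)
    moreover have "mean U (\<lambda>T. (h T - m) * L T) = mean U (\<lambda>T. h T * L T) - m * mean U L"
      by (simp add: left_diff_distrib mean_diff mean_mult_left)
    ultimately show ?thesis using mean_nonneg_times_linear[OF U, where c = 0] by (simp add: lin_def h_def L_def)
  qed
  \<comment> \<open>First without the own frequency \<open>x\<close>; its effect is added in
    \<open>B\<close>.\<close>
  have A: "norm (mean U (\<lambda>T. (h T - m) *\<^sub>R cis (L T)) - \<i> * of_real lin)
     \<le> pq * k * z * card K * (a + 2 * z) + pq * z\<^sup>2 * (card K)\<^sup>2 / card U"
  proof -
    have "mean U (\<lambda>T. (h T - m) *\<^sub>R cis (L T)) =
       mean U (\<lambda>T. ((h T *\<^sub>R g T - m *\<^sub>R g T) + of_real (h T - m)) + \<i> * of_real ((h T - m) * L T))"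
      by (intro mean_cong) (simp add: g_def scaleR_conv_of_real algebra_simps)
    also have "\<dots> = (mean U (\<lambda>T. h T *\<^sub>R g T) - mean U h *\<^sub>R mean U g) + of_real (mean U (\<lambda>T. h T - m))
        + \<i> * of_real (mean U (\<lambda>T. (h T - m) * L T))"
      by (simp only: mean_add mean_diff mean_scaleR mean_of_real mean_mult_left m_def)
    also have "\<dots> = (mean U (\<lambda>T. h T *\<^sub>R g T) - mean U h *\<^sub>R mean U g) + \<i> * of_real lin"
      by (simp only: linear mhm) simp
    finally show ?thesis
      using covariance_remainder_le[OF U K z0 k U0]
      by (simp add: a_def h_def g_def[abs_def] L_def)
  qed
  have B: "norm (mean U (\<lambda>T. (h T - m) *\<^sub>R cis (x * (h T - m) + L T)) - mean U (\<lambda>T. (h T - m) *\<^sub>R cis (L T))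
       - \<i> * of_real (x * m * (1 - m))) \<le> z\<^sup>2 / 2 + z * a"
  proof -
    have m2: "mean U (\<lambda>T. (h T - m)\<^sup>2) = m * (1 - m)"
    proof -
      have "mean U (\<lambda>T. (h T - m)\<^sup>2) = mean U (\<lambda>T. (1 - 2 * m) * h T + m\<^sup>2)"
      proof (intro mean_cong)
        fix T show "(h T - m)\<^sup>2 = (1 - 2 * m) * h T + m\<^sup>2"
          using h01[of T] by (auto simp: power2_eq_square algebra_simps)
      qed
      also have "\<dots> = (1 - 2 * m) * m + m\<^sup>2"
        using U(1) by (simp add: mean_add mean_mult_left m_def)
      finally show ?thesis by (simp add: power2_eq_square algebra_simps)
    qed
    have eq: "mean U (\<lambda>T. (h T - m) *\<^sub>R cis (x * (h T - m) + L T)) - mean U (\<lambda>T. (h T - m) *\<^sub>R cis (L T))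
       - \<i> * of_real (x * m * (1 - m))
      = mean U (\<lambda>T. (h T - m) *\<^sub>R cis (x * (h T - m) + L T) - (h T - m) *\<^sub>R cis (L T) - \<i> * of_real (x * (h T - m)\<^sup>2))"
      by (simp only: mean_diff mean_mult_left mean_of_real m2) (simp add: mult.assoc)
    have "norm (mean U (\<lambda>T. (h T - m) *\<^sub>R cis (x * (h T - m) + L T)) - mean U (\<lambda>T. (h T - m) *\<^sub>R cis (L T))
       - \<i> * of_real (x * m * (1 - m))) \<le> mean U (\<lambda>T. norm ((h T - m) *\<^sub>R cis (x * (h T - m) + L T) - (h T - m) *\<^sub>R cis (L T) - \<i> * of_real (x * (h T - m)\<^sup>2)))"
      unfolding eq by (rule norm_mean_le)
    also have "\<dots> \<le> mean U (\<lambda>T. z\<^sup>2 / 2 + z * \<bar>L T\<bar>)"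
    proof (intro mean_mono)
      fix T assume "T \<subseteq> U"
      let ?d = "h T - m"
      have e: "?d *\<^sub>R cis (x * ?d + L T) - ?d *\<^sub>R cis (L T) - \<i> * of_real (x * ?d\<^sup>2)
        = of_real ?d * cis (L T) * (cis (x * ?d) - 1 - \<i> * of_real (x * ?d)) + \<i> * of_real (x * ?d\<^sup>2) * (cis (L T) - 1)"
      proof -
        define d where "d = ?d"
        show ?thesis unfolding d_def[symmetric] cis_mult[symmetric, of "x * d" "L T"]
          by (simp add: scaleR_conv_of_real power2_eq_square algebra_simps)
      qed
      have xd: "\<bar>x * ?d\<bar> \<le> z * 1" unfolding abs_mult using z hm[of T] z0 by (intro mult_mono) auto
      have d2: "?d\<^sup>2 \<le> 1" using hm[of T] by (simp add: abs_square_le_1)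
      have xd2: "\<bar>x * ?d\<^sup>2\<bar> \<le> z * 1" unfolding abs_mult using z d2 z0 by (intro mult_mono) auto
      have "norm (of_real ?d * cis (L T) * (cis (x * ?d) - 1 - \<i> * of_real (x * ?d))) \<le> 1 * (z\<^sup>2 / 2)"
        unfolding norm_mult
      proof (intro mult_mono)
        have "norm (cis (x * ?d) - 1 - \<i> * of_real (x * ?d)) \<le> (x * ?d)\<^sup>2 / 2" by (rule norm_cis_minus_linear_le)
        also have "(x * ?d)\<^sup>2 \<le> z\<^sup>2" using xd by (simp add: abs_le_square_iff[symmetric])
        finally show "norm (cis (x * ?d) - 1 - \<i> * of_real (x * ?d)) \<le> z\<^sup>2 / 2" by simp
      qed (use hm[of T] in \<open>auto simp del: of_real_diff\<close>)
      moreover have "norm (\<i> * of_real (x * ?d\<^sup>2) * (cis (L T) - 1)) \<le> z * \<bar>L T\<bar>"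
      proof -
        have "norm (\<i> * of_real (x * ?d\<^sup>2) * (cis (L T) - 1)) = \<bar>x * ?d\<^sup>2\<bar> * norm (cis (L T) - 1)"
          by (simp only: norm_mult norm_of_real norm_ii mult_1)
        also have "\<dots> \<le> z * \<bar>L T\<bar>" using xd2 z0 by (intro mult_mono norm_cis_minus_1_le) auto
        finally show ?thesis .
      qed
      ultimately show "norm (?d *\<^sub>R cis (x * ?d + L T) - ?d *\<^sub>R cis (L T) - \<i> * of_real (x * ?d\<^sup>2)) \<le> z\<^sup>2 / 2 + z * \<bar>L T\<bar>"
        unfolding e by (intro norm_triangle_mono) simp_all
    qed
    also have "\<dots> = z\<^sup>2 / 2 + z * mean U (\<lambda>T. \<bar>L T\<bar>)" using U(1) by (simp add: mean_add mean_mult_left)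
    also have "\<dots> \<le> z\<^sup>2 / 2 + z * a" using mL z0 by (simp add: mult_left_mono)
    finally show ?thesis .
  qed
  show "norm (mean U (\<lambda>T. (h T - m) *\<^sub>R cis (x * (h T - m) + L T))
      - \<i> * of_real (x * m * (1 - m) + pq * (\<Sum>w\<in>U. l w * (of_int (s w) * pp (U - {w}) s (crit (s w))))))
    \<le> z\<^sup>2 / 2 + z * a + pq * k * z * card K * (a + 2 * z) + pq * z\<^sup>2 * (card K)\<^sup>2 / card U"
  proof -
    have eq: "mean U (\<lambda>T. (h T - m) *\<^sub>R cis (x * (h T - m) + L T)) - \<i> * of_real (x * m * (1 - m) + lin)
     = (mean U (\<lambda>T. (h T - m) *\<^sub>R cis (x * (h T - m) + L T)) - mean U (\<lambda>T. (h T - m) *\<^sub>R cis (L T))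
       - \<i> * of_real (x * m * (1 - m))) + (mean U (\<lambda>T. (h T - m) *\<^sub>R cis (L T)) - \<i> * of_real lin)"
      by (simp only: of_real_add distrib_left) simp
    show ?thesis unfolding lin_def[symmetric] eq
      using norm_triangle_mono[OF B A] by (simp only: add.assoc)
  qed
  show "norm (mean U (\<lambda>T. cis (x * (h T - m) + L T)) - 1) \<le> z + a"
  proof -
    have "norm (mean U (\<lambda>T. cis (x * (h T - m) + L T)) - 1) = norm (mean U (\<lambda>T. cis (x * (h T - m) + L T) - 1))"
      using U(1) by (simp add: mean_diff)
    also have "\<dots> \<le> mean U (\<lambda>T. norm (cis (x * (h T - m) + L T) - 1))" by (rule norm_mean_le)
    also have "\<dots> \<le> mean U (\<lambda>T. z + \<bar>L T\<bar>)"
    proof (intro mean_mono)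
      fix T assume "T \<subseteq> U"
      have "\<bar>x * (h T - m)\<bar> \<le> z * 1" unfolding abs_mult using z hm[of T] z0 by (intro mult_mono) auto
      then show "norm (cis (x * (h T - m) + L T) - 1) \<le> z + \<bar>L T\<bar>"
        using norm_cis_minus_1_le[of "x * (h T - m) + L T"] by linarith
    qed
    also have "\<dots> = z + mean U (\<lambda>T. \<bar>L T\<bar>)" using U(1) by (simp add: mean_add)
    finally show ?thesis using mL by simp
  qed
qed

end

section \<open>Stars and discrepancies\<close>

lemma finite_possible_edges: "finite U \<Longrightarrow> finite (possible_edges U)"
  unfolding possible_edges_def by (rule finite_subset[of _ "Pow U"]) auto

definition star :: "'a \<Rightarrow> 'a set \<Rightarrow> 'a set set" where "star v T = (\<lambda>w. {v, w}) ` T"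

lemma inj_on_star: "inj_on (\<lambda>w. {v, w}) U"
  by (auto simp: inj_on_def doubleton_eq_iff)

lemma pair_in_star_iff: "{v, w} \<in> star v T \<longleftrightarrow> w \<in> T"
  by (auto simp: star_def doubleton_eq_iff)

lemma possible_edges_insert:
  assumes "v \<notin> U" shows "possible_edges (insert v U) = star v U \<union> possible_edges U"
proof (intro subset_antisym subsetI)
  fix e assume e: "e \<in> possible_edges (insert v U)"
  then obtain a b where ab: "e = {a, b}" "a \<noteq> b" by (auto simp: possible_edges_def card_2_iff)
  then show "e \<in> star v U \<union> possible_edges U"
    using e assms by (auto simp: possible_edges_def star_def)
next
  fix e assume "e \<in> star v U \<union> possible_edges U"
  then show "e \<in> possible_edges (insert v U)"
    using assms by (auto simp: possible_edges_def star_def card_2_iff)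
qed

lemma star_inter_possible_edges: "v \<notin> U \<Longrightarrow> star v U \<inter> possible_edges U = {}"
  by (auto simp: possible_edges_def star_def)

locale signed_vertices = bernoulli_bits p for p :: real +
  fixes \<sigma> :: "'a \<Rightarrow> int"
  assumes sigma: "\<sigma> v = 1 \<or> \<sigma> v = - 1"
begin

text \<open>1 if the two vertices lie on the same side, and - 1 otherwise.\<close>

definition sg :: "'a \<Rightarrow> 'a \<Rightarrow> int" where "sg v w = \<sigma> v * \<sigma> w"

lemma sg: "sg v w = 1 \<or> sg v w = - 1"
  using sigma[of v] sigma[of w] by (auto simp: sg_def)

lemma sg_commute: "sg v w = sg w v"
  by (simp add: sg_def)

text \<open>The number of neighbours of \<open>v\<close> on its own side minus the number on the
  other side. The vertex set is an argument because vertices will be removed.\<close>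

definition disc :: "'a set \<Rightarrow> 'a set set \<Rightarrow> 'a \<Rightarrow> int" where
  "disc U A v = (\<Sum>w\<in>U. of_bool ({v, w} \<in> A) * sg v w)"

text \<open>The inequality is weak because ties stay.\<close>

definition stays :: "'a set \<Rightarrow> 'a set set \<Rightarrow> 'a \<Rightarrow> real" where
  "stays U A v = of_bool (0 \<le> disc U A v)"

text \<open>Whether \<open>v\<close> stays depends on its star alone, so a random neighbourhood is
  enough here; \<open>mean_stays\<close> identifies this number with the expectation over all
  edges.\<close>

definition stay_prob :: "'a set \<Rightarrow> 'a \<Rightarrow> real" where
  "stay_prob V v = mean (V - {v}) (\<lambda>T. of_bool (0 \<le> sum (sg v) T))"

text \<open>The probability that the edge \<open>vw\<close> decides whether \<open>v\<close> stays.\<close>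

definition influence :: "'a set \<Rightarrow> 'a \<Rightarrow> 'a \<Rightarrow> real" where
  "influence V v w = pp (V - {v, w}) (sg v) (crit (sg v w))"

text \<open>The star of \<open>v\<close> is drawn last, given the graph \<open>B\<close> without
  \<open>v\<close>.\<close>

lemma mean_edges_insert:
  assumes "finite U" "v \<notin> U"
  shows "mean (possible_edges (insert v U)) f = mean (possible_edges U) (\<lambda>B. mean U (\<lambda>T. f (star v T \<union> B)))"
proof -
  have "mean (possible_edges (insert v U)) f = mean (star v U) (\<lambda>S. mean (possible_edges U) (\<lambda>B. f (S \<union> B)))"
    unfolding possible_edges_insert[OF assms(2)]
    using assms by (intro mean_Un) (auto simp: finite_possible_edges star_inter_possible_edges, simp add: star_def)
  also have "\<dots> = mean U (\<lambda>T. mean (possible_edges U) (\<lambda>B. f (star v T \<union> B)))"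
    unfolding star_def by (rule mean_image[OF assms(1) inj_on_star])
  also have "\<dots> = mean (possible_edges U) (\<lambda>B. mean U (\<lambda>T. f (star v T \<union> B)))" by (rule mean_swap)
  finally show ?thesis .
qed

lemma disc_star_self:
  assumes "finite U" "v \<notin> U" "T \<subseteq> U" "B \<subseteq> possible_edges U"
  shows "disc (insert v U) (star v T \<union> B) v = sum (sg v) T"
proof -
  have B: "{v, w} \<notin> B" for w using assms by (auto simp: possible_edges_def)
  have "disc (insert v U) (star v T \<union> B) v = (\<Sum>w\<in>insert v U. of_bool (w \<in> T) * sg v w)"
    using B by (simp add: disc_def pair_in_star_iff)
  also have "\<dots> = (\<Sum>w\<in>T. sg v w)"
    using assms by (intro sum.mono_neutral_cong_right) auto
  finally show ?thesis .
qed

lemma disc_star_other: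
  assumes "finite U" "v \<notin> U" "T \<subseteq> U" "B \<subseteq> possible_edges U" "w \<in> U"
  shows "disc (insert v U) (star v T \<union> B) w = disc U B w + of_bool (w \<in> T) * sg v w"
proof -
  have B: "{w, v} \<notin> B" using assms by (auto simp: possible_edges_def)
  have 1: "{w, v} \<in> star v T \<longleftrightarrow> w \<in> T" using pair_in_star_iff[of v w T] by (simp add: insert_commute)
  have 2: "{w, u} \<notin> star v T" if "u \<in> U" for u using that assms by (auto simp: star_def doubleton_eq_iff)
  show ?thesis using assms B 1 2 by (simp add: disc_def sg_commute[of w v])
qed

lemma disc_insert_edges_self:
  assumes "finite V" "v \<in> V"
  shows "mean (possible_edges V) (\<lambda>A. F (disc V A v)) = mean (V - {v}) (\<lambda>T. F (sum (sg v) T))"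
proof -
  define U where "U = V - {v}"
  have V: "V = insert v U" "v \<notin> U" "finite U" using assms by (auto simp: U_def)
  have "mean (possible_edges V) (\<lambda>A. F (disc V A v)) = mean (possible_edges U) (\<lambda>B. mean U (\<lambda>T. F (sum (sg v) T)))"
    unfolding V(1) mean_edges_insert[OF V(3,2)] by (intro mean_cong) (simp add: disc_star_self V)
  also have "\<dots> = mean U (\<lambda>T. F (sum (sg v) T))" using V by (simp add: finite_possible_edges)
  finally show ?thesis by (simp add: U_def)
qed

lemma mean_disc_eq:
  assumes "finite U" "w \<in> U"
  shows "mean (possible_edges U) (\<lambda>B. of_bool (disc U B w = j)) = pp (U - {w}) (sg w) j"
  unfolding pp_def by (rule disc_insert_edges_self[OF assms])

lemma pp_remove:
  assumes "finite J" "u \<in> J"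
  shows "pp J s j = (1 - p) * pp (J - {u}) s j + p * pp (J - {u}) s (j - s u)"
proof -
  have "mean (J - {u}) (\<lambda>A. of_bool (sum s (insert u A) = j) :: real) = mean (J - {u}) (\<lambda>A. of_bool (sum s A = j - s u))"
  proof (intro mean_cong)
    fix A assume "A \<subseteq> J - {u}"
    then have "finite A" "u \<notin> A" using assms by (auto dest: finite_subset)
    then have "sum s (insert u A) = s u + sum s A" by simp
    then show "(of_bool (sum s (insert u A) = j) :: real) = of_bool (sum s A = j - s u)" by auto
  qed
  then show ?thesis unfolding pp_def by (subst mean_remove[OF assms]) simp
qed

text \<open>Given the edge between \<open>w\<close> and \<open>u\<close>, the two discrepancies are
  independent. The covariance is therefore that of two functions of a single bit, namely
  \<open>pq\<close> times the product of their increments.\<close>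

lemma covariance_disc_eq:
  assumes U: "finite U" "w \<in> U" "u \<in> U" "w \<noteq> u"
  shows "mean (possible_edges U) (\<lambda>B. of_bool (disc U B w = a) * of_bool (disc U B u = b))
      - pp (U - {w}) (sg w) a * pp (U - {u}) (sg u) b
    = pq * (pp (U - {w, u}) (sg w) (a - sg w u) - pp (U - {w, u}) (sg w) a)
         * (pp (U - {w, u}) (sg u) (b - sg w u) - pp (U - {w, u}) (sg u) b)"
proof -
  define U' where "U' = U - {w}"
  have V: "U = insert w U'" "w \<notin> U'" "finite U'" "u \<in> U'" using U by (auto simp: U'_def)
  define f where "f c = pp (U' - {u}) (sg u) (b - of_bool c * sg w u)" for c
  define J where "J = U - {w, u}"
  have J: "U' - {u} = J" by (auto simp: J_def U'_def)
  have "mean (possible_edges U) (\<lambda>B. of_bool (disc U B w = a) * of_bool (disc U B u = b) :: real)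
    = mean (possible_edges U') (\<lambda>B. mean U' (\<lambda>T. of_bool (sum (sg w) T = a) * of_bool (disc U' B u = b - of_bool (u \<in> T) * sg w u)))"
    unfolding V(1) mean_edges_insert[OF V(3,2)] by (intro mean_cong) (auto simp: disc_star_self disc_star_other V)
  also have "\<dots> = mean U' (\<lambda>T. of_bool (sum (sg w) T = a) * f (u \<in> T))"
    by (subst mean_swap) (simp only: mean_mult_left mean_disc_eq[OF V(3,4)] f_def)
  also have "\<dots> = (1 - p) * mean J (\<lambda>T. of_bool (sum (sg w) T = a) * f (u \<in> T))
      + p * mean J (\<lambda>T. of_bool (sum (sg w) (insert u T) = a) * f (u \<in> insert u T))"
    using mean_remove[OF V(3,4), of "\<lambda>T. of_bool (sum (sg w) T = a) * f (u \<in> T)"] by (simp add: J)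
  also have "mean J (\<lambda>T. of_bool (sum (sg w) T = a) * f (u \<in> T)) = mean J (\<lambda>T. of_bool (sum (sg w) T = a) * f False)"
    by (intro mean_cong arg_cong2[where f = "(*)"] refl arg_cong[where f = f]) (auto simp: J_def)
  also have "\<dots> = pp J (sg w) a * f False" unfolding mean_mult_right pp_def ..
  also have "mean J (\<lambda>T. of_bool (sum (sg w) (insert u T) = a) * f (u \<in> insert u T))
     = mean J (\<lambda>T. of_bool (sum (sg w) T = a - sg w u) * f True)"
  proof (intro mean_cong)
    fix T assume "T \<subseteq> J"
    then have "finite T" "u \<notin> T" using V U by (auto simp: J_def dest: finite_subset)
    then have "sum (sg w) (insert u T) = sg w u + sum (sg w) T" by simp
    then show "of_bool (sum (sg w) (insert u T) = a) * f (u \<in> insert u T) = of_bool (sum (sg w) T = a - sg w u) * f True"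
      by auto
  qed
  also have "\<dots> = pp J (sg w) (a - sg w u) * f True" unfolding mean_mult_right pp_def ..
  finally have *: "mean (possible_edges U) (\<lambda>B. of_bool (disc U B w = a) * of_bool (disc U B u = b))
     = (1 - p) * (pp J (sg w) a * f False) + p * (pp J (sg w) (a - sg w u) * f True)" .
  have f: "f False = pp J (sg u) b" "f True = pp J (sg u) (b - sg w u)" by (simp_all add: f_def J)
  have w: "pp (U - {w}) (sg w) a = (1 - p) * pp J (sg w) a + p * pp J (sg w) (a - sg w u)"
    using pp_remove[OF V(3,4), of "sg w" a] by (simp only: J U'_def[symmetric])
  have "U - {u} - {w} = J" by (auto simp: J_def)
  then have u: "pp (U - {u}) (sg u) b = (1 - p) * pp J (sg u) b + p * pp J (sg u) (b - sg w u)"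
    using pp_remove[of "U - {u}" w "sg u" b] U by (simp add: sg_commute)
  show ?thesis unfolding * f w u J_def[symmetric] by (simp add: pq_def algebra_simps)
qed

end

section \<open>Critical vertices and their near-independence\<close>

locale majority_graph = signed_vertices p \<sigma> for p :: real and \<sigma> :: "'a \<Rightarrow> int" +
  fixes V :: "'a set"
  assumes finite_V: "finite V" and card_V: "16 \<le> card V" and pq_card: "4 \<le> pq * card V"
begin

text \<open>Bounds the point probabilities of signed sums over any quarter of the vertices. This
  leaves room for removing single vertices as well as up to half of a star.\<close>

definition ppb :: real where "ppb = 2 / sqrt (pq * card V)"

lemma ppb_pos: "0 < ppb" and ppb_le_1: "ppb \<le> 1"
  using pq_card real_sqrt_le_mono[OF pq_card] by (auto simp: ppb_def)

lemma ppb_square: "pq * card V * ppb\<^sup>2 = 4"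
  using pq_card pq_pos card_V by (simp add: ppb_def power_divide)

lemma pp_le_ppb:
  assumes "J \<subseteq> V" "card V \<le> 4 * card J"
  shows "pp J (sg v) j \<le> ppb"
proof -
  have fJ: "finite J" using assms finite_V by (auto dest: finite_subset)
  have J: "J \<noteq> {}" using assms card_V by auto
  have "pp J (sg v) j \<le> 1 / sqrt (pq * card J)" by (rule pp_le[OF fJ sg J])
  also have "\<dots> \<le> 1 / sqrt (pq * card V / 4)"
    using assms pq_pos card_V by (intro divide_left_mono real_sqrt_le_mono mult_pos_pos real_sqrt_gt_zero) auto
  also have "\<dots> = ppb" by (simp add: ppb_def real_sqrt_divide)
  finally show ?thesis .
qed

lemma pp_diff_le_ppb:
  assumes "J \<subseteq> V" "card V \<le> 4 * card J"
  shows "\<bar>pp J (sg v) (j - sg u w) - pp J (sg v) j\<bar> \<le> ppb\<^sup>2"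
proof -
  have fJ: "finite J" using assms finite_V by (auto dest: finite_subset)
  have J: "J \<noteq> {}" using assms card_V by auto
  have "\<bar>pp J (sg v) (j - sg u w) - pp J (sg v) j\<bar> \<le> 1 / (pq * card J)"
    by (rule pp_diff_le[OF fJ sg J]) (use sg[of u w] in auto)
  also have "\<dots> \<le> 1 / (pq * card V / 4)"
    using assms pq_pos card_V by (intro divide_left_mono mult_pos_pos) auto
  also have "\<dots> = ppb\<^sup>2" using pq_pos by (simp add: ppb_def power_divide)
  finally show ?thesis .
qed

lemma card_Diff_V_ge: "finite X \<Longrightarrow> card X \<le> 3 \<Longrightarrow> card V \<le> 4 * card (V - X)"
  using diff_card_le_card_Diff[of X V] card_V by linarith

lemma pp_nonneg: "0 \<le> pp J s j"
  unfolding pp_def by (intro mean_nonneg) simp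

lemma influence_le: "influence V v w \<le> ppb"
  unfolding influence_def by (intro pp_le_ppb card_Diff_V_ge) (auto simp: card_insert_if)

lemma influence_nonneg: "0 \<le> influence V v w"
  unfolding influence_def by (rule pp_nonneg)

text \<open>In the graph without \<open>v\<close>, the vertex \<open>w\<close> is balanced so that
  the edge between them decides whether \<open>w\<close> stays. It is \<open>w\<close> that is
  decided here, hence \<open>influence V w v\<close> in \<open>mean_critical\<close>.\<close>

definition critical :: "'a \<Rightarrow> 'a set set \<Rightarrow> 'a \<Rightarrow> real" where
  "critical v B w = of_bool (disc (V - {v}) B w = crit (sg v w))"

lemma mean_critical:
  assumes "v \<in> V" "w \<in> V - {v}"
  shows "mean (possible_edges (V - {v})) (\<lambda>B. critical v B w) = influence V w v"
proof -
  have "V - {v} - {w} = V - {w, v}" by auto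
  then show ?thesis
    unfolding critical_def influence_def
    using mean_disc_eq[of "V - {v}" w "crit (sg v w)"] finite_V assms by (simp add: sg_commute)
qed

text \<open>Two vertices share only the edge between them, and each responds to it by a difference
  of adjacent point probabilities, which is at most \<open>ppb\<^sup>2\<close>.\<close>

lemma covariance_critical:
  assumes "v \<in> V" "w \<in> V - {v}" "u \<in> V - {v}" "w \<noteq> u"
  shows "\<bar>mean (possible_edges (V - {v})) (\<lambda>B. critical v B w * critical v B u) - influence V w v * influence V u v\<bar>
     \<le> pq * ppb ^ 4"
proof -
  let ?J = "V - {v} - {w, u}"
  have J: "?J \<subseteq> V" "card V \<le> 4 * card ?J"
  proof -
    have "?J = V - {v, w, u}" by auto
    then show "card V \<le> 4 * card ?J" using card_Diff_V_ge[of "{v, w, u}"] by (simp add: card_insert_if)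
  qed auto
  have e: "V - {v} - {w} = V - {w, v}" "V - {v} - {u} = V - {u, v}" by auto
  have "mean (possible_edges (V - {v})) (\<lambda>B. critical v B w * critical v B u) - influence V w v * influence V u v
    = pq * (pp ?J (sg w) (crit (sg v w) - sg w u) - pp ?J (sg w) (crit (sg v w)))
         * (pp ?J (sg u) (crit (sg v u) - sg w u) - pp ?J (sg u) (crit (sg v u)))"
    unfolding critical_def influence_def
    using covariance_disc_eq[of "V - {v}" w u "crit (sg v w)" "crit (sg v u)"] finite_V assms
    by (simp add: e sg_commute[of w v] sg_commute[of u v])
  also have "\<bar>\<dots>\<bar> \<le> pq * ppb\<^sup>2 * ppb\<^sup>2"
    unfolding abs_mult using pq_pos J by (intro mult_mono pp_diff_le_ppb) auto
  finally show ?thesis by (simp add: power4_eq_xxxx power2_eq_square mult.assoc)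
qed

text \<open>The size that independent indicators would give: the diagonal contributes
  \<open>card V * ppb\<close>, and the off-diagonal terms add up to (card V)^2 pq ppb^4 = 4 card V
  ppb^2, at most four times as much.\<close>

lemma mean_square_critical_sum:
  assumes v: "v \<in> V" and a: "\<And>w. w \<in> V - {v} \<Longrightarrow> \<bar>a w\<bar> \<le> c"
  shows "mean (possible_edges (V - {v})) (\<lambda>B. (\<Sum>w\<in>V-{v}. a w * (critical v B w - influence V w v))\<^sup>2)
    \<le> c\<^sup>2 * (5 * (card V * ppb))"
proof -
  let ?U = "V - {v}" and ?E = "possible_edges (V - {v})"
  have fU: "finite ?U" using finite_V by simp
  have c0: "0 \<le> c"
  proof -
    have "\<not> V \<subseteq> {v}" using card_V card_mono[of "{v}" V] by auto
    then obtain w where "w \<in> ?U" by auto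
    then show ?thesis using a[of w] by linarith
  qed
  let ?d = "\<lambda>w B. critical v B w - influence V w v"
  have cov: "mean ?E (\<lambda>B. ?d w B * ?d u B) = mean ?E (\<lambda>B. critical v B w * critical v B u) - influence V w v * influence V u v"
    if "w \<in> ?U" "u \<in> ?U" for w u
  proof -
    have "mean ?E (\<lambda>B. ?d w B * ?d u B) = mean ?E (\<lambda>B. critical v B w * critical v B u - influence V w v * critical v B u
      - influence V u v * critical v B w + influence V w v * influence V u v)"
      by (intro mean_cong) (simp add: algebra_simps)
    then show ?thesis using that v fU
      by (simp add: mean_add mean_diff mean_mult_left mean_critical finite_possible_edges)
  qed
  have ub: "\<bar>mean ?E (\<lambda>B. ?d w B * ?d u B)\<bar> \<le> pq * ppb ^ 4 + (if w = u then ppb else 0)" if w: "w \<in> ?U" and u: "u \<in> ?U" for w u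
  proof (cases "w = u")
    case False
    then show ?thesis unfolding cov[OF w u] using covariance_critical[OF v w u False] by simp
  next
    case True
    have cc: "(\<lambda>B. critical v B u * critical v B u) = (\<lambda>B. critical v B u)"
      by (simp add: critical_def fun_eq_iff)
    have "mean ?E (\<lambda>B. ?d w B * ?d u B) = influence V u v - influence V u v * influence V u v"
      unfolding True cov[OF u u] cc using u v by (simp add: mean_critical)
    moreover have "0 \<le> influence V u v * influence V u v" "influence V u v * influence V u v \<le> 1 * influence V u v"
      using influence_le[of u v] influence_nonneg[of u v] ppb_le_1
      by (simp, intro mult_right_mono) auto
    ultimately have "\<bar>mean ?E (\<lambda>B. ?d w B * ?d u B)\<bar> \<le> ppb"
      using influence_le[of u v] influence_nonneg[of u v] by linarith
    then show ?thesis using True pq_pos ppb_pos by (simp add: add_increasing)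
  qed
  have "mean ?E (\<lambda>B. (\<Sum>w\<in>?U. a w * ?d w B)\<^sup>2) = (\<Sum>w\<in>?U. \<Sum>u\<in>?U. a w * a u * mean ?E (\<lambda>B. ?d w B * ?d u B))"
    unfolding power2_eq_square sum_product mean_sum mean_mult_left[symmetric] by (simp add: mult_ac)
  also have "\<dots> \<le> (\<Sum>w\<in>?U. \<Sum>u\<in>?U. c * c * (pq * ppb ^ 4 + (if w = u then ppb else 0)))"
  proof (intro sum_mono)
    fix w u assume h: "w \<in> ?U" "u \<in> ?U"
    have "a w * a u * mean ?E (\<lambda>B. ?d w B * ?d u B) \<le> \<bar>a w\<bar> * \<bar>a u\<bar> * \<bar>mean ?E (\<lambda>B. ?d w B * ?d u B)\<bar>"
      unfolding abs_mult[symmetric] by (rule abs_ge_self)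
    also have "\<dots> \<le> c * c * (pq * ppb ^ 4 + (if w = u then ppb else 0))"
      using h c0 by (intro mult_mono a ub) auto
    finally show "a w * a u * mean ?E (\<lambda>B. ?d w B * ?d u B) \<le> c * c * (pq * ppb ^ 4 + (if w = u then ppb else 0))" .
  qed
  also have "\<dots> = c * c * (card ?U * (card ?U * (pq * ppb ^ 4)) + card ?U * ppb)"
    using fU by (simp add: sum.distrib distrib_left sum_distrib_left[symmetric] sum_distrib_right[symmetric] algebra_simps)
  also have "\<dots> \<le> c * c * (card V * (card V * (pq * ppb ^ 4)) + card V * ppb)"
    using finite_V pq_pos ppb_pos c0
    by (intro mult_left_mono add_mono mult_mono) (auto intro: card_mono)
  also have "card V * (card V * (pq * ppb ^ 4)) = (pq * card V * ppb\<^sup>2) * (card V * ppb\<^sup>2)"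
    by (simp add: power4_eq_xxxx power2_eq_square)
  also have "\<dots> = 4 * (card V * ppb\<^sup>2)" by (simp add: ppb_square)
  also have "\<dots> \<le> 4 * (card V * (ppb * 1))"
    unfolding power2_eq_square using ppb_pos ppb_le_1 by (intro mult_left_mono) auto
  finally have "mean ?E (\<lambda>B. (\<Sum>w\<in>?U. a w * ?d w B)\<^sup>2) \<le> c * c * (4 * (card V * (ppb * 1)) + card V * ppb)"
    using c0 by (simp add: mult_left_mono)
  also have "\<dots> = c\<^sup>2 * (5 * (card V * ppb))" by (simp add: power2_eq_square)
  finally show ?thesis .
qed

end

section \<open>The differential equation for the characteristic function\<close>

context majority_graph
begin

definition fluct :: "('a \<Rightarrow> real) \<Rightarrow> 'a set set \<Rightarrow> real" where
  "fluct \<zeta> A = (\<Sum>v\<in>V. \<zeta> v * (stays V A v - stay_prob V v))"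

text \<open>The weighted sum of \<open>drift \<zeta>\<close> with weights \<open>\<zeta>\<close> is the approximate variance of \<open>fluct \<zeta>\<close>.\<close>

definition drift :: "('a \<Rightarrow> real) \<Rightarrow> 'a \<Rightarrow> real" where
  "drift \<zeta> v = \<zeta> v * stay_prob V v * (1 - stay_prob V v)
     + pq * (\<Sum>w\<in>V-{v}. \<zeta> w * (influence V v w * influence V w v))"

text \<open>The square root of \<open>pq\<close> times the number of critical vertices is at most of
  this order, so \<open>z * root4\<close> measures the effect of a star on the phase.\<close>

definition root4 :: real where "root4 = sqrt (sqrt (card V))"

lemma root4: "1 \<le> root4" "root4\<^sup>2 = sqrt (card V)"
  using card_V by (auto simp: root4_def)

text \<open>An upper bound for the expected number of critical vertices.\<close>

abbreviation "gcrit \<equiv> real (card V) * ppb"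

lemma gcrit_ge: "4 * root4\<^sup>2 \<le> gcrit" and gcrit_ge_1: "1 \<le> gcrit"
  and pq_gcrit: "sqrt (pq * gcrit) \<le> root4" and pq_ppb_gcrit: "pq * ppb * gcrit = 4"
proof -
  let ?N = "real (card V)"
  have N: "?N > 0" using card_V by simp
  have "sqrt (pq * ?N) \<le> sqrt (1/4 * ?N)" using pq_le by (intro real_sqrt_le_mono mult_right_mono) auto
  then have s: "sqrt (pq * ?N) \<le> sqrt ?N / 2" by (simp add: real_sqrt_divide)
  have sp: "0 < sqrt (pq * ?N)" using N pq_pos by simp
  have "4 * root4\<^sup>2 = 2 * ?N / (sqrt ?N / 2)" using N by (simp add: root4 field_simps)
  also have "\<dots> \<le> 2 * ?N / sqrt (pq * ?N)"
    using s sp N by (intro divide_left_mono mult_pos_pos) auto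
  finally show g4: "4 * root4\<^sup>2 \<le> gcrit" by (simp add: ppb_def mult.commute)
  have "1 \<le> root4\<^sup>2" using root4(1) by (simp add: one_le_power)
  with g4 show "1 \<le> gcrit" by linarith
  have "pq * gcrit = 2 * (pq * ?N / sqrt (pq * ?N))" by (simp add: ppb_def)
  also have "\<dots> = 2 * sqrt (pq * ?N)" using sp by (subst real_div_sqrt) auto
  also have "\<dots> \<le> root4\<^sup>2" using s by (simp add: root4)
  finally show "sqrt (pq * gcrit) \<le> root4" using root4(1) by (intro real_le_lsqrt) auto
  show "pq * ppb * gcrit = 4" using ppb_square by (simp add: power2_eq_square mult_ac)
qed

text \<open>The first two moments come from linearity and \<open>mean_square_critical_sum\<close>,
  the moment of order 1/2 from Jensen's inequality, and the one of order 3/2 from interpolation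
  between the first and the second. These are the powers of the count that occur in
  \<open>star_expansion\<close>.\<close>

lemma critical_count:
  assumes v: "v \<in> V"
  defines "E \<equiv> possible_edges (V - {v})"
  defines "K \<equiv> \<lambda>B. (\<Sum>w\<in>V-{v}. critical v B w)"
  shows "mean E K \<le> gcrit" "mean E (\<lambda>B. (K B)\<^sup>2) \<le> 12 * gcrit\<^sup>2"
    "mean E (\<lambda>B. sqrt (pq * K B)) \<le> root4"
    "mean E (\<lambda>B. K B * sqrt (pq * K B)) \<le> 13 / 2 * root4 * gcrit"
proof -
  let ?U = "V - {v}"
  have fE: "finite E" using finite_V by (simp add: E_def finite_possible_edges)
  have K0: "0 \<le> K B" for B unfolding K_def by (intro sum_nonneg) (simp add: critical_def)
  have infl: "0 \<le> (\<Sum>w\<in>?U. influence V w v)" "(\<Sum>w\<in>?U. influence V w v) \<le> gcrit"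
  proof -
    show "0 \<le> (\<Sum>w\<in>?U. influence V w v)" by (intro sum_nonneg influence_nonneg)
    have "(\<Sum>w\<in>?U. influence V w v) \<le> (\<Sum>w\<in>?U. ppb)" by (intro sum_mono influence_le)
    also have "\<dots> = card ?U * ppb" by simp
    also have "\<dots> \<le> gcrit" using finite_V ppb_pos by (intro mult_right_mono) (auto intro: card_mono)
    finally show "(\<Sum>w\<in>?U. influence V w v) \<le> gcrit" .
  qed
  show m1: "mean E K \<le> gcrit"
    using infl v by (simp add: K_def mean_sum E_def mean_critical)
  \<comment> \<open>Fluctuation and mean are separated; the constant is 12 = 2 * 5 + 2.\<close>
  have "mean E (\<lambda>B. (K B)\<^sup>2) \<le> mean E (\<lambda>B. 2 * (\<Sum>w\<in>?U. 1 * (critical v B w - influence V w v))\<^sup>2 + 2 * gcrit\<^sup>2)"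
  proof (intro mean_mono)
    fix B
    define x where "x = (\<Sum>w\<in>?U. 1 * (critical v B w - influence V w v))"
    define y where "y = (\<Sum>w\<in>?U. influence V w v)"
    have "K B = x + y" by (simp add: K_def x_def y_def sum_subtractf)
    moreover have "(x + y)\<^sup>2 \<le> 2 * x\<^sup>2 + 2 * y\<^sup>2"
      using zero_le_power2[of "x - y"] by (simp add: power2_eq_square algebra_simps)
    moreover have "y\<^sup>2 \<le> gcrit\<^sup>2" using infl unfolding y_def by (intro power_mono) auto
    ultimately show "(K B)\<^sup>2 \<le> 2 * x\<^sup>2 + 2 * gcrit\<^sup>2" by auto
  qed
  also have "\<dots> \<le> 2 * (1\<^sup>2 * (5 * gcrit)) + 2 * gcrit\<^sup>2"
    unfolding mean_add mean_mult_left E_def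
    using mean_square_critical_sum[OF v, of "\<lambda>_. 1" 1] finite_V by (simp add: finite_possible_edges mult.commute)
  also have "\<dots> \<le> 12 * gcrit\<^sup>2"
  proof -
    have "1 * gcrit \<le> gcrit * gcrit" using gcrit_ge_1 by (intro mult_right_mono) auto
    then show ?thesis unfolding power2_eq_square by linarith
  qed
  finally show m2: "mean E (\<lambda>B. (K B)\<^sup>2) \<le> 12 * gcrit\<^sup>2" .
  have "mean E (\<lambda>B. sqrt (pq * K B)) \<le> sqrt (mean E (\<lambda>B. (sqrt (pq * K B))\<^sup>2))"
    using mean_abs_le_sqrt[OF fE, of "\<lambda>B. sqrt (pq * K B)"] K0 pq_pos by simp
  also have "mean E (\<lambda>B. (sqrt (pq * K B))\<^sup>2) = pq * mean E K"
    using K0 pq_pos by (simp add: mean_mult_left)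
  also have "sqrt (pq * mean E K) \<le> sqrt (pq * gcrit)" using m1 pq_pos by simp
  also have "\<dots> \<le> root4" by (rule pq_gcrit)
  finally show "mean E (\<lambda>B. sqrt (pq * K B)) \<le> root4" .
  have "mean E (\<lambda>B. K B * sqrt (pq * K B)) \<le> mean E (\<lambda>B. root4 / 2 * (K B + (K B)\<^sup>2 / gcrit))"
  proof (intro mean_mono)
    fix B
    define y where "y = K B / gcrit"
    have y0: "0 \<le> y" using K0[of B] gcrit_ge_1 by (simp add: y_def)
    \<comment> \<open>The interpolation \<open>sqrt y \<le> (1 + y) / 2\<close>, with the count
      measured in units of \<open>gcrit\<close>; the final constant is (1 + 12) / 2.\<close>
    have "(1 + y)\<^sup>2 \<ge> 4 * y" using zero_le_power2[of "1 - y"] by (simp add: power2_eq_square algebra_simps)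
    then have "y \<le> ((1 + y) / 2)\<^sup>2" by (simp add: power_divide)
    then have sy: "sqrt y \<le> (1 + y) / 2" using y0 by (intro real_le_lsqrt) auto
    have "pq * K B = (pq * gcrit) * y" 
    proof -
      have "gcrit \<noteq> 0" using gcrit_ge_1 by linarith
      then have "gcrit * (K B / gcrit) = K B" by (rule nonzero_mult_div_cancel_left[of gcrit "K B", unfolded times_divide_eq_right[symmetric]])
      then show ?thesis by (simp only: y_def mult.assoc)
    qed
    then have "sqrt (pq * K B) = sqrt (pq * gcrit) * sqrt y" by (simp only: real_sqrt_mult)
    also have "\<dots> \<le> root4 * ((1 + y) / 2)" using pq_gcrit sy root4 y0 by (intro mult_mono) auto
    finally have "K B * sqrt (pq * K B) \<le> K B * (root4 * ((1 + y) / 2))" by (intro mult_left_mono K0)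
    also have "\<dots> = root4 / 2 * (K B + (K B)\<^sup>2 / gcrit)" by (simp add: y_def power2_eq_square algebra_simps)
    finally show "K B * sqrt (pq * K B) \<le> root4 / 2 * (K B + (K B)\<^sup>2 / gcrit)" .
  qed
  also have "\<dots> = root4 / 2 * (mean E K + mean E (\<lambda>B. (K B)\<^sup>2) / gcrit)"
    by (simp only: mean_mult_left mean_add mean_divide)
  also have "\<dots> \<le> root4 / 2 * (gcrit + 12 * gcrit\<^sup>2 / gcrit)"
    using m1 m2 gcrit_ge_1 root4 by (intro mult_left_mono add_mono divide_right_mono) auto
  also have "\<dots> = 13 / 2 * root4 * gcrit" using gcrit_ge_1 by (simp add: power2_eq_square)
  finally show "mean E (\<lambda>B. K B * sqrt (pq * K B)) \<le> 13 / 2 * root4 * gcrit" .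
qed

text \<open>The own variance contributes 1, and the other vertices contribute
  \<open>pq * card V * ppb\<^sup>2 = 4\<close>.\<close>

lemma drift_le:
  fixes z :: real
  assumes "\<And>v. v \<in> V \<Longrightarrow> \<bar>\<zeta> v\<bar> \<le> z" "v \<in> V"
  shows "\<bar>drift \<zeta> v\<bar> \<le> 5 * z"
proof -
  have z0: "0 \<le> z" using assms(1)[OF assms(2)] by linarith
  have m: "0 \<le> stay_prob V v" "stay_prob V v \<le> 1"
    unfolding stay_prob_def using finite_V by (auto intro!: mean_nonneg mean_le_const)
  have "\<bar>\<Sum>w\<in>V-{v}. \<zeta> w * (influence V v w * influence V w v)\<bar> \<le> (\<Sum>w\<in>V-{v}. z * (ppb * ppb))"
  proof (rule order_trans[OF sum_abs sum_mono])
    fix w assume "w \<in> V - {v}"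
    then show "\<bar>\<zeta> w * (influence V v w * influence V w v)\<bar> \<le> z * (ppb * ppb)"
      unfolding abs_mult using assms(1)[of w] z0 ppb_pos influence_le influence_nonneg
      by (intro mult_mono) (auto simp: abs_of_nonneg)
  qed
  also have "\<dots> = card (V - {v}) * (z * ppb\<^sup>2)" by (simp add: power2_eq_square)
  also have "\<dots> \<le> card V * (z * ppb\<^sup>2)" using finite_V z0 by (intro mult_right_mono) (auto intro: card_mono)
  finally have "pq * \<bar>\<Sum>w\<in>V-{v}. \<zeta> w * (influence V v w * influence V w v)\<bar> \<le> pq * (card V * (z * ppb\<^sup>2))"
    using pq_pos by (intro mult_left_mono) auto
  also have "\<dots> = (pq * card V * ppb\<^sup>2) * z" by (simp add: mult_ac)
  also have "\<dots> = 4 * z" by (simp add: ppb_square)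
  finally have 1: "\<bar>pq * (\<Sum>w\<in>V-{v}. \<zeta> w * (influence V v w * influence V w v))\<bar> \<le> 4 * z"
    using pq_pos by (simp add: abs_mult)
  have "\<bar>\<zeta> v * stay_prob V v * (1 - stay_prob V v)\<bar> \<le> z * 1 * 1"
    unfolding abs_mult using assms m z0 by (intro mult_mono) auto
  with 1 show ?thesis unfolding drift_def by linarith
qed

text \<open>Given the graph \<open>B\<close> without \<open>v\<close>, the phase is a constant plus
  the phase of \<open>star_expansion\<close>. The first-order coefficient found there still depends
  on \<open>B\<close> through the critical vertices: it is \<open>r * drift \<zeta> v\<close> plus
  \<open>r * pq * X B\<close>. The term \<open>X B\<close> has mean zero and is small because
  critical vertices are almost uncorrelated. Multiplying by the mean phase \<open>S B\<close>, which
  is nearly 1, restores the full characteristic function.\<close>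

lemma vertex_step:
  fixes z :: real
  assumes \<zeta>: "\<And>v. v \<in> V \<Longrightarrow> \<bar>\<zeta> v\<bar> \<le> z" and v: "v \<in> V" and r: "0 \<le> r" "r \<le> 1"
    and z: "1 / sqrt (card V) \<le> z"
  shows "norm (mean (possible_edges V) (\<lambda>A. (stays V A v - stay_prob V v) *\<^sub>R cis (r * fluct \<zeta> A))
      - \<i> * of_real (r * drift \<zeta> v) * mean (possible_edges V) (\<lambda>A. cis (r * fluct \<zeta> A)))
    \<le> 150 * z\<^sup>2 * root4"
proof -
  define U where "U = V - {v}"
  define E where "E = possible_edges U"
  have V: "V = insert v U" "v \<notin> U" "finite U" using v finite_V by (auto simp: U_def)
  have fE: "finite E" using V by (simp add: E_def finite_possible_edges)
  have z0: "0 \<le> z" using \<zeta>[OF v] by linarith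
  define s where "s = sg v"
  define h where "h T = (of_bool (0 \<le> sum s T) :: real)" for T
  define m where "m = mean U h"
  have m: "stay_prob V v = m" by (simp add: stay_prob_def m_def h_def[abs_def] U_def s_def)
  define l where "l B w = r * \<zeta> w * of_int (s w) * critical v B w" for B w
  define L where "L B T = sum (l B) T - p * sum (l B) U" for B T
  \<comment> \<open>The part of the phase fixed by \<open>B\<close>. As \<open>L\<close> is centred,
    the mean effect of the star belongs here.\<close>
  define M where "M B = r * (\<Sum>w\<in>U. \<zeta> w * (of_bool (0 \<le> disc U B w) - stay_prob V w)) + p * sum (l B) U" for B
  define x where "x = r * \<zeta> v"
  define K where "K B = {w \<in> U. disc U B w = crit (s w)}" for B
  define \<kappa> where "\<kappa> B = (\<Sum>w\<in>U. critical v B w)" for B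
  have cK: "real (card (K B)) = \<kappa> B" for B
  proof -
    have "\<kappa> B = (\<Sum>w\<in>U. of_bool (disc U B w = crit (s w)))" by (simp add: \<kappa>_def critical_def U_def s_def)
    also have "\<dots> = real (card (U \<inter> {w. disc U B w = crit (s w)}))" using V(3) by (simp add: sum.If_cases of_bool_def)
    also have "U \<inter> {w. disc U B w = crit (s w)} = K B" by (auto simp: K_def)
    finally show ?thesis ..
  qed
  have xz: "\<bar>x\<bar> \<le> z"
    using mult_mono[OF r(2) \<zeta>[OF v]] r by (simp add: x_def abs_mult)
  have lK: "\<bar>l B w\<bar> \<le> z" if "w \<in> U" for B w
  proof -
    have "\<bar>l B w\<bar> = r * \<bar>\<zeta> w\<bar> * critical v B w"
      using sg[of v w] r by (auto simp: l_def s_def abs_mult critical_def)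
    also have "\<dots> \<le> 1 * z * 1" using r \<zeta>[of w] that z0 by (intro mult_mono) (auto simp: critical_def U_def)
    finally show ?thesis by simp
  qed
  have l0: "l B w = 0" if "w \<in> U - K B" for B w
    using that by (auto simp: l_def critical_def K_def U_def s_def)
  have cU: "card V = Suc (card U)" using V by simp
  have kk: "pp J s j \<le> ppb" if "J \<subseteq> U" "card U \<le> 2 * card J" for J j
    unfolding s_def using that cU card_V by (intro pp_le_ppb) (auto simp: U_def)
  have Une: "U \<noteq> {}" using cU card_V by auto
  have s: "s w = 1 \<or> s w = - 1" for w by (simp add: s_def sg)
  define a where "a B = z * sqrt (pq * \<kappa> B)" for B
  define TT where "TT B = mean U (\<lambda>T. (h T - m) *\<^sub>R cis (x * (h T - m) + L B T))" for B
  define S where "S B = mean U (\<lambda>T. cis (x * (h T - m) + L B T))" for B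
  define lin where "lin B = x * m * (1 - m) + pq * (\<Sum>w\<in>U. l B w * (of_int (s w) * pp (U - {w}) s (crit (s w))))" for B
  have exp1: "norm (TT B - \<i> * of_real (lin B))
      \<le> z\<^sup>2 / 2 + z * a B + pq * ppb * z * \<kappa> B * (a B + 2 * z) + pq * z\<^sup>2 * (\<kappa> B)\<^sup>2 / card U"
    and exp2: "norm (S B - 1) \<le> z + a B" for B
    unfolding TT_def S_def L_def h_def m_def lin_def a_def cK[symmetric]
    using star_expansion[of U s "K B" "l B" z x ppb] V(3) s lK l0 xz kk ppb_pos Une
    by (auto simp: K_def)
  have Z: "r * fluct \<zeta> (star v T \<union> B) = M B + (x * (h T - m) + L B T)"
    and stv: "stays V (star v T \<union> B) v = h T" if T: "T \<subseteq> U" and B: "B \<subseteq> E" for T B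
  proof -
    show sv: "stays V (star v T \<union> B) v = h T"
      using disc_star_self[OF V(3,2) T] B unfolding stays_def h_def s_def E_def V(1) by simp
    \<comment> \<open>An edge to \<open>w\<close> changes the indicator of \<open>w\<close> only if
      \<open>w\<close> is critical, and then by the sign of the edge.\<close>
    have sw: "stays V (star v T \<union> B) w = of_bool (0 \<le> disc U B w) + of_bool (w \<in> T) * (of_int (s w) * critical v B w)"
      if w: "w \<in> U" for w
    proof -
      have "disc V (star v T \<union> B) w = disc U B w + of_bool (w \<in> T) * s w"
        using disc_star_other[OF V(3,2) T _ w] B unfolding s_def E_def V(1) by simp
      then show ?thesis using of_bool_nonneg_shift[OF s[of w], of "disc U B w"]
        by (cases "w \<in> T") (simp_all add: stays_def critical_def U_def s_def)
    qed
    have "fluct \<zeta> (star v T \<union> B) = \<zeta> v * (stays V (star v T \<union> B) v - stay_prob V v)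
       + (\<Sum>w\<in>U. \<zeta> w * (stays V (star v T \<union> B) w - stay_prob V w))"
      unfolding fluct_def using v finite_V by (simp add: sum.remove[of V v] U_def)
    also have "(\<Sum>w\<in>U. \<zeta> w * (stays V (star v T \<union> B) w - stay_prob V w))
      = (\<Sum>w\<in>U. \<zeta> w * (of_bool (0 \<le> disc U B w) - stay_prob V w)) + (\<Sum>w\<in>U. of_bool (w \<in> T) * (\<zeta> w * of_int (s w) * critical v B w))"
      unfolding sum.distrib[symmetric] by (intro sum.cong refl) (simp add: sw algebra_simps)
    also have "(\<Sum>w\<in>U. of_bool (w \<in> T) * (\<zeta> w * of_int (s w) * critical v B w)) = (\<Sum>w\<in>T. \<zeta> w * of_int (s w) * critical v B w)"
      using T V(3) by (intro sum.mono_neutral_cong_right) auto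
    finally have "r * fluct \<zeta> (star v T \<union> B) = x * (h T - m)
       + r * (\<Sum>w\<in>U. \<zeta> w * (of_bool (0 \<le> disc U B w) - stay_prob V w)) + sum (l B) T"
      unfolding sv m x_def l_def by (simp add: distrib_left sum_distrib_left mult_ac)
    then show "r * fluct \<zeta> (star v T \<union> B) = M B + (x * (h T - m) + L B T)"
      by (simp add: M_def L_def)
  qed
  have e1: "mean (possible_edges V) (\<lambda>A. (stays V A v - stay_prob V v) *\<^sub>R cis (r * fluct \<zeta> A)) = mean E (\<lambda>B. cis (M B) * TT B)"
  proof -
    have "mean (possible_edges V) (\<lambda>A. (stays V A v - stay_prob V v) *\<^sub>R cis (r * fluct \<zeta> A))
      = mean E (\<lambda>B. mean U (\<lambda>T. (stays V (star v T \<union> B) v - stay_prob V v) *\<^sub>R cis (r * fluct \<zeta> (star v T \<union> B))))"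
      using mean_edges_insert[OF V(3,2)] unfolding E_def V(1)[symmetric] .
    also have "\<dots> = mean E (\<lambda>B. mean U (\<lambda>T. cis (M B) * ((h T - m) *\<^sub>R cis (x * (h T - m) + L B T))))"
      by (intro mean_cong) (simp only: Z stv m cis_mult[symmetric, of "M _"] mult_scaleR_right)
    finally show ?thesis unfolding TT_def mean_mult_left .
  qed
  have e2: "mean (possible_edges V) (\<lambda>A. cis (r * fluct \<zeta> A)) = mean E (\<lambda>B. cis (M B) * S B)"
  proof -
    have "mean (possible_edges V) (\<lambda>A. cis (r * fluct \<zeta> A)) = mean E (\<lambda>B. mean U (\<lambda>T. cis (r * fluct \<zeta> (star v T \<union> B))))"
      using mean_edges_insert[OF V(3,2)] unfolding E_def V(1)[symmetric] .
    also have "\<dots> = mean E (\<lambda>B. mean U (\<lambda>T. cis (M B) * cis (x * (h T - m) + L B T)))"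
      by (intro mean_cong) (simp only: Z cis_mult[symmetric, of "M _"])
    finally show ?thesis unfolding S_def mean_mult_left .
  qed
  \<comment> \<open>The fluctuation of the number of critical vertices, weighted by their effect on
    the covariance with \<open>v\<close>.\<close>
  define X where "X B = (\<Sum>w\<in>U. (\<zeta> w * influence V v w) * (critical v B w - influence V w v))" for B
  have lin: "lin B = r * drift \<zeta> v + r * pq * X B" for B
  proof -
    have "l B w * (of_int (s w) * pp (U - {w}) s (crit (s w))) = r * (\<zeta> w * influence V v w * critical v B w)" if "w \<in> U" for w
    proof -
      have "U - {w} = V - {v, w}" by (auto simp: U_def)
      then have "pp (U - {w}) s (crit (s w)) = influence V v w" by (simp add: influence_def s_def)
      then show ?thesis using s[of w] by (auto simp: l_def)
    qed
    then have "(\<Sum>w\<in>U. l B w * (of_int (s w) * pp (U - {w}) s (crit (s w)))) = (\<Sum>w\<in>U. r * (\<zeta> w * influence V v w * critical v B w))"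
      by (intro sum.cong) auto
    then show ?thesis
      by (simp add: lin_def drift_def X_def x_def m U_def[symmetric] sum_distrib_left sum_subtractf algebra_simps)
  qed
  have dz: "\<bar>drift \<zeta> v\<bar> \<le> 5 * z" by (rule drift_le[OF \<zeta> v])
  have pt: "norm (TT B - \<i> * of_real (r * drift \<zeta> v) * S B) \<le>
     (z\<^sup>2 / 2 + z * a B + pq * ppb * z * \<kappa> B * (a B + 2 * z) + pq * z\<^sup>2 * (\<kappa> B)\<^sup>2 / card U) + pq * \<bar>X B\<bar> + 5 * z * (z + a B)" for B
  proof -
    have eq: "TT B - \<i> * of_real (r * drift \<zeta> v) * S B = (TT B - \<i> * of_real (lin B)) + \<i> * of_real (r * pq * X B)
        - \<i> * of_real (r * drift \<zeta> v) * (S B - 1)"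
      by (simp only: lin of_real_add) (simp add: algebra_simps)
    have n2: "norm (\<i> * of_real (r * pq * X B)) \<le> pq * \<bar>X B\<bar>"
    proof -
      have "norm (\<i> * of_real (r * pq * X B)) = r * (pq * \<bar>X B\<bar>)"
        using r pq_pos by (simp add: norm_mult abs_mult)
      also have "\<dots> \<le> 1 * (pq * \<bar>X B\<bar>)" using r pq_pos by (intro mult_right_mono) auto
      finally show ?thesis by simp
    qed
    have n3: "norm (\<i> * of_real (r * drift \<zeta> v) * (S B - 1)) \<le> 5 * z * (z + a B)"
    proof -
      have "norm (\<i> * of_real (r * drift \<zeta> v) * (S B - 1)) = (r * \<bar>drift \<zeta> v\<bar>) * norm (S B - 1)"
        using r by (simp add: norm_mult abs_mult)
      also have "\<dots> \<le> (1 * (5 * z)) * (z + a B)"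
        using r dz exp2[of B] z0 by (intro mult_mono) auto
      finally show ?thesis by simp
    qed
    show ?thesis unfolding eq
      using norm_triangle_ineq4[of "(TT B - \<i> * of_real (lin B)) + \<i> * of_real (r * pq * X B)" "\<i> * of_real (r * drift \<zeta> v) * (S B - 1)"]
        norm_triangle_ineq[of "TT B - \<i> * of_real (lin B)" "\<i> * of_real (r * pq * X B)"] exp1[of B] n2 n3 by linarith
  qed
  note cc = critical_count[OF v, folded U_def, folded E_def, folded \<kappa>_def]
  have mX: "pq * mean E (\<lambda>B. \<bar>X B\<bar>) \<le> 5 * z\<^sup>2 * root4"
  proof -
    have "mean E (\<lambda>B. (X B)\<^sup>2) \<le> (z * ppb)\<^sup>2 * (5 * gcrit)"
      unfolding X_def E_def U_def
    proof (rule mean_square_critical_sum[OF v])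
      fix w assume "w \<in> V - {v}"
      then show "\<bar>\<zeta> w * influence V v w\<bar> \<le> z * ppb"
        unfolding abs_mult using \<zeta>[of w] influence_le influence_nonneg z0 by (intro mult_mono) (auto simp: abs_of_nonneg)
    qed
    then have "sqrt (mean E (\<lambda>B. (X B)\<^sup>2)) \<le> sqrt ((z * ppb)\<^sup>2 * (5 * gcrit))" by (rule real_sqrt_le_mono)
    also have "\<dots> = z * ppb * (sqrt 5 * sqrt gcrit)" using z0 ppb_pos by (simp add: real_sqrt_mult)
    finally have "mean E (\<lambda>B. \<bar>X B\<bar>) \<le> z * ppb * (sqrt 5 * sqrt gcrit)"
      using mean_abs_le_sqrt[OF fE, of X] by linarith
    then have "pq * mean E (\<lambda>B. \<bar>X B\<bar>) \<le> pq * (z * ppb * (sqrt 5 * sqrt gcrit))" using pq_pos by (intro mult_left_mono) auto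
    also have "\<dots> = z * sqrt 5 * (pq * ppb * sqrt gcrit)" by (simp add: mult_ac)
    also have "pq * ppb * sqrt gcrit = 4 / sqrt gcrit"
    proof -
      have "pq * ppb * sqrt gcrit * sqrt gcrit = 4" using pq_ppb_gcrit gcrit_ge_1 by (simp add: mult.assoc)
      moreover have nz: "sqrt gcrit \<noteq> 0" using gcrit_ge_1 ppb_pos card_V by auto
      ultimately show ?thesis by (simp only: nonzero_eq_divide_eq[OF nz])
    qed
    also have "z * sqrt 5 * (4 / sqrt gcrit) \<le> z * (5 / 2) * (4 / (2 * root4))"
    proof (intro mult_mono divide_left_mono)
      show "sqrt 5 \<le> 5 / 2" by (intro real_le_lsqrt) (auto simp: power_divide)
      show "2 * root4 \<le> sqrt gcrit" using gcrit_ge root4 by (intro real_le_rsqrt) (simp add: power_mult_distrib)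
      show "0 < sqrt gcrit * (2 * root4)" using root4 gcrit_ge_1 ppb_pos card_V by simp
    qed (use z0 ppb_pos in auto)
    also have "\<dots> = 5 * z * (1 / root4)" by simp
    \<comment> \<open>The lower bound on \<open>z\<close> reads 1 / root4^2 \<le> z, which turns z /
      root4 into an error of the common form.\<close>
    also have "\<dots> \<le> 5 * z * (z * root4)"
    proof (intro mult_left_mono)
      have "1 / root4\<^sup>2 \<le> z" using z by (simp add: root4)
      then show "1 / root4 \<le> z * root4" using root4 by (simp add: field_simps power2_eq_square)
    qed (use z0 in auto)
    finally show ?thesis by (simp add: power2_eq_square mult_ac)
  qed
  have mean_a: "mean E a \<le> z * root4"
    unfolding a_def mean_mult_left using cc(3) z0 by (intro mult_left_mono) auto
  have mean_Ka: "mean E (\<lambda>B. \<kappa> B * a B) \<le> z * (13 / 2 * root4 * gcrit)"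
  proof -
    have "mean E (\<lambda>B. \<kappa> B * a B) = z * mean E (\<lambda>B. \<kappa> B * sqrt (pq * \<kappa> B))"
      unfolding a_def mean_mult_left[symmetric] by (simp add: mult_ac)
    then show ?thesis using mult_left_mono[OF cc(4) z0] by (simp only:)
  qed
  have split: "mean E (\<lambda>B. (z\<^sup>2 / 2 + z * a B + pq * ppb * z * \<kappa> B * (a B + 2 * z) + pq * z\<^sup>2 * (\<kappa> B)\<^sup>2 / card U) + pq * \<bar>X B\<bar> + 5 * z * (z + a B))
    = z\<^sup>2 / 2 + z * mean E a + pq * ppb * z * mean E (\<lambda>B. \<kappa> B * a B) + pq * ppb * z * (2 * z) * mean E \<kappa>
      + pq * z\<^sup>2 / card U * mean E (\<lambda>B. (\<kappa> B)\<^sup>2) + pq * mean E (\<lambda>B. \<bar>X B\<bar>) + 5 * z * z + 5 * z * mean E a"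
  proof -
    have "mean E (\<lambda>B. (z\<^sup>2 / 2 + z * a B + pq * ppb * z * \<kappa> B * (a B + 2 * z) + pq * z\<^sup>2 * (\<kappa> B)\<^sup>2 / card U) + pq * \<bar>X B\<bar> + 5 * z * (z + a B))
     = mean E (\<lambda>B. z\<^sup>2 / 2 + z * a B + pq * ppb * z * (\<kappa> B * a B) + pq * ppb * z * (2 * z) * \<kappa> B
      + pq * z\<^sup>2 / card U * (\<kappa> B)\<^sup>2 + pq * \<bar>X B\<bar> + 5 * z * z + 5 * z * a B)"
      by (intro mean_cong) (simp add: algebra_simps)
    then show ?thesis by (simp only: mean_add mean_mult_left mean_const[OF fE])
  qed
  have t3: "pq * ppb * z * mean E (\<lambda>B. \<kappa> B * a B) \<le> 26 * z\<^sup>2 * root4"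
  proof -
    have "pq * ppb * z * mean E (\<lambda>B. \<kappa> B * a B) \<le> pq * ppb * z * (z * (13 / 2 * root4 * gcrit))"
      using mean_Ka pq_pos ppb_pos z0 by (intro mult_left_mono) auto
    also have "\<dots> = (pq * ppb * gcrit) * (13 / 2 * root4 * z\<^sup>2)" by (simp add: power2_eq_square mult_ac)
    finally show ?thesis unfolding pq_ppb_gcrit by (simp add: mult_ac)
  qed
  have t4: "pq * ppb * z * (2 * z) * mean E \<kappa> \<le> 8 * z\<^sup>2"
  proof -
    have "pq * ppb * z * (2 * z) * mean E \<kappa> \<le> pq * ppb * z * (2 * z) * gcrit"
      using cc(1) pq_pos ppb_pos z0 by (intro mult_left_mono) auto
    also have "\<dots> = (pq * ppb * gcrit) * (2 * z\<^sup>2)" by (simp add: power2_eq_square mult_ac)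
    finally show ?thesis unfolding pq_ppb_gcrit by simp
  qed
  have t5: "pq * z\<^sup>2 / card U * mean E (\<lambda>B. (\<kappa> B)\<^sup>2) \<le> 96 * z\<^sup>2"
  proof -
    have cU2: "real (card V) / 2 \<le> card U" "0 < real (card V) / 2" using cU card_V by auto
    have "pq * z\<^sup>2 / card U * mean E (\<lambda>B. (\<kappa> B)\<^sup>2) \<le> pq * z\<^sup>2 / (card V / 2) * (12 * gcrit\<^sup>2)"
      using cc(2) cU2 pq_pos by (intro mult_mono divide_left_mono mult_pos_pos) (auto intro!: mean_nonneg)
    also have "\<dots> = 24 * z\<^sup>2 * (pq * card V * ppb\<^sup>2)" using card_V by (simp add: power2_eq_square field_simps)
    finally show ?thesis unfolding ppb_square by simp
  qed
  have z2: "z\<^sup>2 \<le> z\<^sup>2 * root4" using root4 by (simp add: mult_le_cancel_left1)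
  have za: "z * mean E a \<le> z\<^sup>2 * root4" using mult_left_mono[OF mean_a z0] by (simp add: power2_eq_square mult_ac)
  have "norm (mean (possible_edges V) (\<lambda>A. (stays V A v - stay_prob V v) *\<^sub>R cis (r * fluct \<zeta> A))
      - \<i> * of_real (r * drift \<zeta> v) * mean (possible_edges V) (\<lambda>A. cis (r * fluct \<zeta> A)))
    = norm (mean E (\<lambda>B. cis (M B) * (TT B - \<i> * of_real (r * drift \<zeta> v) * S B)))"
  proof -
    have "mean E (\<lambda>B. cis (M B) * TT B) - \<i> * of_real (r * drift \<zeta> v) * mean E (\<lambda>B. cis (M B) * S B)
      = mean E (\<lambda>B. cis (M B) * (TT B - \<i> * of_real (r * drift \<zeta> v) * S B))"
      unfolding mean_mult_left[symmetric] mean_diff[symmetric] by (intro mean_cong) (simp add: algebra_simps)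
    then show ?thesis unfolding e1 e2 by simp
  qed
  also have "\<dots> \<le> mean E (\<lambda>B. norm (cis (M B) * (TT B - \<i> * of_real (r * drift \<zeta> v) * S B)))" by (rule norm_mean_le)
  also have "\<dots> \<le> mean E (\<lambda>B. (z\<^sup>2 / 2 + z * a B + pq * ppb * z * \<kappa> B * (a B + 2 * z) + pq * z\<^sup>2 * (\<kappa> B)\<^sup>2 / card U) + pq * \<bar>X B\<bar> + 5 * z * (z + a B))"
  proof (intro mean_mono)
    fix B
    have "norm (cis (M B) * (TT B - \<i> * of_real (r * drift \<zeta> v) * S B)) = norm (TT B - \<i> * of_real (r * drift \<zeta> v) * S B)"
      by (simp only: norm_mult norm_cis mult_1)
    then show "norm (cis (M B) * (TT B - \<i> * of_real (r * drift \<zeta> v) * S B)) \<le>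
     (z\<^sup>2 / 2 + z * a B + pq * ppb * z * \<kappa> B * (a B + 2 * z) + pq * z\<^sup>2 * (\<kappa> B)\<^sup>2 / card U) + pq * \<bar>X B\<bar> + 5 * z * (z + a B)"
      using pt[of B] by (simp only:)
  qed
  also have "\<dots> \<le> 150 * z\<^sup>2 * root4"
  proof -
    \<comment> \<open>The constants add up to 146.5.\<close>
    have aux: "y / 2 + f + a + b + c + d + 5 * y + 5 * f \<le> 150 * R"
      if "a \<le> 26 * R" "b \<le> 8 * y" "c \<le> 96 * y" "d \<le> 5 * R" "f \<le> R" "y \<le> R" "0 \<le> y" for a b c d f y R :: real
      using that by linarith
    have e: "5 * z * z = 5 * z\<^sup>2" "5 * z * mean E a = 5 * (z * mean E a)" "150 * z\<^sup>2 * root4 = 150 * (z\<^sup>2 * root4)"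
      by (simp_all add: power2_eq_square)
    show ?thesis unfolding split e
      using t3 t4 t5 mX za z2 by (intro aux) (simp_all only: mult.assoc zero_le_power2)
  qed
  finally show ?thesis .
qed

text \<open>The derivative of \<open>\<phi>\<close> is a weighted sum of the means in
  \<open>vertex_step\<close>, so \<open>\<phi>\<close> satisfies the equation of exp (- Q r^2 / 2)
  up to \<open>err\<close>. After multiplication by exp (Q r^2 / 2) the derivative is at most
  \<open>exp (Q / 2) * err\<close>, and dividing by \<open>exp (Q / 2)\<close> at r = 1 leaves
  exactly \<open>err\<close>. Nothing is lost however large \<open>Q\<close> is.\<close>

lemma fourier_clt:
  fixes z :: real
  assumes \<zeta>: "\<And>v. v \<in> V \<Longrightarrow> \<bar>\<zeta> v\<bar> \<le> z" and z: "1 / sqrt (card V) \<le> z" and Q: "0 \<le> Q"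
  shows "norm (mean (possible_edges V) (\<lambda>A. cis (fluct \<zeta> A)) - of_real (exp (- Q / 2)))
    \<le> 150 * card V * z ^ 3 * root4 + \<bar>(\<Sum>v\<in>V. \<zeta> v * drift \<zeta> v) - Q\<bar>"
proof -
  let ?E = "possible_edges V"
  have fE: "finite ?E" using finite_V by (simp add: finite_possible_edges)
  have z0: "0 \<le> z" using z order_trans[of 0 "1 / sqrt (card V)" z] by simp
  define \<phi> where "\<phi> r = mean ?E (\<lambda>A. cis (r * fluct \<zeta> A))" for r
  define W where "W = (\<Sum>v\<in>V. \<zeta> v * drift \<zeta> v)"
  define err where "err = 150 * card V * z ^ 3 * root4 + \<bar>W - Q\<bar>"
  define d\<phi> where "d\<phi> r = mean ?E (\<lambda>A. \<i> * of_real (fluct \<zeta> A) * cis (r * fluct \<zeta> A))" for r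
  have der: "(\<phi> has_vector_derivative d\<phi> r) (at r within X)" for r X
    unfolding \<phi>_def[abs_def] d\<phi>_def mean_def
    by (auto simp: cis_conv_exp mult_ac intro!: derivative_eq_intros has_vector_derivative_sum has_vector_derivative_real_field)
  have \<phi>1: "norm (\<phi> r) \<le> 1" for r
    unfolding \<phi>_def using fE by (intro order_trans[OF norm_mean_le] mean_le_const) auto
  have d\<phi>: "norm (d\<phi> r + of_real (r * Q) * \<phi> r) \<le> err" if r: "0 \<le> r" "r \<le> 1" for r
  proof -
    define Y where "Y v = mean ?E (\<lambda>A. (stays V A v - stay_prob V v) *\<^sub>R cis (r * fluct \<zeta> A))" for v
    have "d\<phi> r = mean ?E (\<lambda>A. \<Sum>v\<in>V. (\<i> * of_real (\<zeta> v)) * ((stays V A v - stay_prob V v) *\<^sub>R cis (r * fluct \<zeta> A)))"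
      unfolding d\<phi>_def
    proof (intro mean_cong)
      fix A
      define c where "c = cis (r * fluct \<zeta> A)"
      show "\<i> * of_real (fluct \<zeta> A) * cis (r * fluct \<zeta> A) = (\<Sum>v\<in>V. (\<i> * of_real (\<zeta> v)) * ((stays V A v - stay_prob V v) *\<^sub>R cis (r * fluct \<zeta> A)))"
        unfolding c_def[symmetric] fluct_def
        by (simp add: sum_distrib_left sum_distrib_right scaleR_conv_of_real mult.assoc)
    qed
    also have "\<dots> = (\<Sum>v\<in>V. (\<i> * of_real (\<zeta> v)) * Y v)" unfolding mean_sum mean_mult_left Y_def ..
    finally have 1: "d\<phi> r = (\<Sum>v\<in>V. (\<i> * of_real (\<zeta> v)) * Y v)" .
    have 2: "of_real (r * W) * \<phi> r = - (\<Sum>v\<in>V. (\<i> * of_real (\<zeta> v)) * (\<i> * of_real (r * drift \<zeta> v) * \<phi> r))"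
      by (simp add: W_def sum_distrib_left sum_distrib_right sum_negf[symmetric] mult_ac)
    have "norm (d\<phi> r + of_real (r * W) * \<phi> r) = norm (\<Sum>v\<in>V. (\<i> * of_real (\<zeta> v)) * (Y v - \<i> * of_real (r * drift \<zeta> v) * \<phi> r))"
      unfolding 1 2 by (simp only: right_diff_distrib sum_subtractf) simp
    also have "\<dots> \<le> (\<Sum>v\<in>V. z * (150 * z\<^sup>2 * root4))"
    proof (rule order_trans[OF norm_sum sum_mono])
      fix v assume v: "v \<in> V"
      have "norm ((\<i> * of_real (\<zeta> v)) * (Y v - \<i> * of_real (r * drift \<zeta> v) * \<phi> r)) = \<bar>\<zeta> v\<bar> * norm (Y v - \<i> * of_real (r * drift \<zeta> v) * \<phi> r)"
        by (simp only: norm_mult norm_of_real norm_ii mult_1)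
      also have "\<dots> \<le> z * (150 * z\<^sup>2 * root4)"
        unfolding Y_def \<phi>_def using vertex_step[OF \<zeta> v r z] \<zeta>[OF v] z0 by (intro mult_mono) auto
      finally show "norm ((\<i> * of_real (\<zeta> v)) * (Y v - \<i> * of_real (r * drift \<zeta> v) * \<phi> r)) \<le> z * (150 * z\<^sup>2 * root4)" .
    qed
    also have "\<dots> = 150 * card V * z ^ 3 * root4" by (simp add: power2_eq_square power3_eq_cube)
    finally have 3: "norm (d\<phi> r + of_real (r * W) * \<phi> r) \<le> 150 * card V * z ^ 3 * root4" .
    have "norm (of_real (r * (Q - W)) * \<phi> r) = r * \<bar>W - Q\<bar> * norm (\<phi> r)"
      using r by (simp only: norm_mult norm_of_real abs_mult) (simp add: abs_minus_commute)
    also have "\<dots> \<le> 1 * \<bar>W - Q\<bar> * 1" using r \<phi>1 by (intro mult_mono) auto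
    finally have 4: "norm (of_real (r * (Q - W)) * \<phi> r) \<le> \<bar>W - Q\<bar>" by simp
    have "d\<phi> r + of_real (r * Q) * \<phi> r = (d\<phi> r + of_real (r * W) * \<phi> r) + of_real (r * (Q - W)) * \<phi> r"
      by (simp add: algebra_simps)
    then show ?thesis unfolding err_def using norm_triangle_mono[OF 3 4] by (simp only:)
  qed
  define \<psi> where "\<psi> r = of_real (exp (r\<^sup>2 * Q / 2)) * \<phi> r" for r
  have "norm (\<psi> 1 - \<psi> 0) \<le> (exp (Q / 2) * err) * norm (1 - 0 :: real)"
  proof (rule differentiable_bound[where S = "{0..1}"])
    fix r :: real assume r: "r \<in> {0..1}"
    let ?D = "complex_of_real (exp (r\<^sup>2 * Q / 2)) * (d\<phi> r + of_real (r * Q) * \<phi> r)"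
    have "((\<lambda>r. complex_of_real (exp (r\<^sup>2 * Q / 2))) has_vector_derivative of_real (r * Q * exp (r\<^sup>2 * Q / 2))) (at r within {0..1})"
      by (auto intro!: derivative_eq_intros has_vector_derivative_of_real simp: has_real_derivative_iff_has_vector_derivative[symmetric])
    from has_vector_derivative_mult[OF this der]
    have "(\<psi> has_vector_derivative ?D) (at r within {0..1})"
      unfolding \<psi>_def[abs_def] by (simp add: algebra_simps)
    then show "(\<psi> has_derivative (\<lambda>h. h *\<^sub>R ?D)) (at r within {0..1})"
      by (simp add: has_vector_derivative_def)
    have "norm ?D \<le> exp (Q / 2) * err"
      unfolding norm_mult
    proof (intro mult_mono)
      have "r\<^sup>2 * Q \<le> 1 * Q" using r Q by (intro mult_right_mono) (auto simp: power_le_one)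
      then show "norm (complex_of_real (exp (r\<^sup>2 * Q / 2))) \<le> exp (Q / 2)" by simp
      show "norm (d\<phi> r + of_real (r * Q) * \<phi> r) \<le> err" using d\<phi> r by simp
    qed auto
    then show "onorm (\<lambda>h. h *\<^sub>R ?D) \<le> exp (Q / 2) * err"
      by (intro onorm_le) (simp add: mult.commute mult_left_mono)
  qed auto
  moreover have "\<psi> 1 - \<psi> 0 = of_real (exp (Q / 2)) * (\<phi> 1 - of_real (exp (- Q / 2)))"
    using fE by (simp add: \<psi>_def \<phi>_def algebra_simps flip: of_real_mult exp_add)
  ultimately have "exp (Q / 2) * norm (\<phi> 1 - of_real (exp (- Q / 2))) \<le> exp (Q / 2) * err"
    by (simp only: norm_mult norm_of_real) simp
  then have "norm (\<phi> 1 - of_real (exp (- Q / 2))) \<le> err" by simp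
  then show ?thesis by (simp add: \<phi>_def err_def W_def)
qed

end

section \<open>High frequencies and the moment generating function\<close>

definition cross :: "'a set \<Rightarrow> 'a set \<Rightarrow> 'a set set" where "cross S W = (\<Union>v\<in>S. star v W)"

definition nbrs :: "'a set \<Rightarrow> 'a set set \<Rightarrow> 'a \<Rightarrow> 'a set" where "nbrs W C v = {w \<in> W. {v, w} \<in> C}"

lemma finite_cross: "finite S \<Longrightarrow> finite W \<Longrightarrow> finite (cross S W)"
  by (simp add: cross_def star_def)

lemma possible_edges_Un:
  assumes "S \<inter> W = {}"
  shows "possible_edges (S \<union> W) = possible_edges S \<union> (possible_edges W \<union> cross S W)"
proof (intro subset_antisym subsetI)
  fix e assume e: "e \<in> possible_edges (S \<union> W)"
  then obtain a b where ab: "e = {a, b}" "a \<noteq> b" by (auto simp: possible_edges_def card_2_iff)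
  have ba: "{a, b} = {b, a}" by auto
  show "e \<in> possible_edges S \<union> (possible_edges W \<union> cross S W)"
    using e ab ba unfolding possible_edges_def cross_def star_def by auto
next
  fix e assume "e \<in> possible_edges S \<union> (possible_edges W \<union> cross S W)"
  then show "e \<in> possible_edges (S \<union> W)"
    using assms by (auto simp: possible_edges_def cross_def star_def card_insert_if)
qed

lemma pair_in_edges: "A \<subseteq> possible_edges S \<Longrightarrow> {v, w} \<in> A \<Longrightarrow> v \<in> S \<and> w \<in> S"
  by (auto simp: possible_edges_def)

lemma pair_in_cross:
  assumes "S \<inter> W = {}" "{u, w} \<in> cross S W"
  shows "(u \<in> S \<and> w \<in> W) \<or> (u \<in> W \<and> w \<in> S)"
  using assms by (auto simp: cross_def star_def doubleton_eq_iff)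

lemma possible_edges_cross_disjoint:
  assumes "S \<inter> W = {}"
  shows "possible_edges S \<inter> (possible_edges W \<union> cross S W) = {}" "possible_edges W \<inter> cross S W = {}"
proof -
  have 1: "e \<notin> possible_edges W" if "e \<in> possible_edges S" for e
    using that assms by (auto simp: possible_edges_def card_2_iff)
  have 2: "e \<notin> cross S W" if "e \<in> possible_edges S" for e
    using that assms by (auto simp: possible_edges_def cross_def star_def)
  have 3: "e \<notin> cross S W" if "e \<in> possible_edges W" for e
    using that assms by (auto simp: possible_edges_def cross_def star_def)
  show "possible_edges S \<inter> (possible_edges W \<union> cross S W) = {}" "possible_edges W \<inter> cross S W = {}"
    using 1 2 3 by auto
qed

context bernoulli_bits
begin

text \<open>Used as a lower bound for a second moment, by testing against a suitable
  \<open>g\<close>.\<close>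

lemma mean_cauchy_schwarz:
  fixes f g :: "'e set \<Rightarrow> real"
  assumes "0 < mean I (\<lambda>A. (g A)\<^sup>2)"
  shows "(mean I (\<lambda>A. f A * g A))\<^sup>2 / mean I (\<lambda>A. (g A)\<^sup>2) \<le> mean I (\<lambda>A. (f A)\<^sup>2)"
proof -
  define G where "G = mean I (\<lambda>A. (g A)\<^sup>2)"
  define H where "H = mean I (\<lambda>A. f A * g A)"
  define t where "t = H / G"
  have "0 \<le> mean I (\<lambda>A. (f A - t * g A)\<^sup>2)" by (intro mean_nonneg) simp
  also have "\<dots> = mean I (\<lambda>A. (f A)\<^sup>2 - 2 * t * (f A * g A) + t\<^sup>2 * (g A)\<^sup>2)"
    by (intro mean_cong) (simp add: power2_eq_square algebra_simps)
  also have "\<dots> = mean I (\<lambda>A. (f A)\<^sup>2) - 2 * t * H + t\<^sup>2 * G"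
    by (simp only: mean_add mean_diff mean_mult_left G_def H_def)
  also have "\<dots> = mean I (\<lambda>A. (f A)\<^sup>2) - H\<^sup>2 / G"
    using assms by (simp add: t_def G_def[symmetric] power2_eq_square field_simps)
  finally show ?thesis by (simp add: G_def H_def)
qed

text \<open>Distinct vertices of \<open>S\<close> have disjoint sets of edges to \<open>W\<close>,
  so their neighbourhoods in \<open>W\<close> are independent.\<close>

lemma mean_cross:
  fixes F :: "'a \<Rightarrow> 'a set \<Rightarrow> 'b::{real_normed_field}"
  assumes "finite S" "finite W" "S \<inter> W = {}"
  shows "mean (cross S W) (\<lambda>C. \<Prod>v\<in>S. F v (nbrs W C v)) = (\<Prod>v\<in>S. mean W (F v))"
  using assms
proof (induction S rule: finite_induct)
  case empty
  then show ?case by (simp add: cross_def)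
next
  case (insert v S)
  have dis: "star v W \<inter> cross S W = {}"
    using insert by (auto simp: cross_def star_def doubleton_eq_iff)
  have "mean (cross (insert v S) W) (\<lambda>C. \<Prod>u\<in>insert v S. F u (nbrs W C u))
    = mean (star v W) (\<lambda>A. mean (cross S W) (\<lambda>C. \<Prod>u\<in>insert v S. F u (nbrs W (A \<union> C) u)))"
    using dis insert mean_Un[of "star v W" "cross S W"] by (simp add: cross_def star_def)
  also have "\<dots> = mean W (\<lambda>T. mean (cross S W) (\<lambda>C. \<Prod>u\<in>insert v S. F u (nbrs W (star v T \<union> C) u)))"
    unfolding star_def using insert by (intro mean_image inj_on_star) auto
  also have "\<dots> = mean W (\<lambda>T. mean (cross S W) (\<lambda>C. F v T * (\<Prod>u\<in>S. F u (nbrs W C u))))"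
  proof (intro mean_cong)
    fix T C assume T: "T \<subseteq> W" and C: "C \<subseteq> cross S W"
    have 1: "nbrs W (star v T \<union> C) v = T"
    proof -
      have "{v, w} \<notin> C" if "w \<in> W" for w
        using C insert that by (auto simp: cross_def star_def doubleton_eq_iff)
      then show ?thesis using T by (auto simp: nbrs_def pair_in_star_iff)
    qed
    have 2: "nbrs W (star v T \<union> C) u = nbrs W C u" if "u \<in> S" for u
    proof -
      have "{u, w} \<notin> star v T" for w
        using that T insert by (auto simp: star_def doubleton_eq_iff)
      then show ?thesis by (auto simp: nbrs_def)
    qed
    show "(\<Prod>u\<in>insert v S. F u (nbrs W (star v T \<union> C) u)) = F v T * (\<Prod>u\<in>S. F u (nbrs W C u))"
      using insert by (simp add: 1 2)
  qed
  also have "\<dots> = mean W (F v) * (\<Prod>u\<in>S. mean W (F u))"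
    using insert by (simp add: mean_mult_left mean_mult_right)
  finally show ?case using insert by simp
qed

lemma mean_cross_single:
  fixes f :: "'a set \<Rightarrow> 'b::real_normed_field"
  assumes SW: "finite S" "finite W" "S \<inter> W = {}" and v: "v \<in> S"
  shows "mean (cross S W) (\<lambda>C. f (nbrs W C v)) = mean W f"
proof -
  let ?F = "\<lambda>u T. if u = v then f T else 1"
  have "mean (cross S W) (\<lambda>C. \<Prod>u\<in>S. ?F u (nbrs W C u)) = (\<Prod>u\<in>S. mean W (?F u))"
    by (rule mean_cross[OF SW])
  moreover have "(\<Prod>u\<in>S. ?F u (nbrs W C u)) = f (nbrs W C v)" for C
    using SW v by (simp add: prod.remove[of S v] cong: prod.cong)
  moreover have "(\<Prod>u\<in>S. mean W (?F u)) = mean W f"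
  proof -
    have "(\<Prod>u\<in>S. mean W (?F u)) = mean W (?F v) * (\<Prod>u\<in>S-{v}. mean W (?F u))" using SW v by (simp only: prod.remove)
    also have "(\<Prod>u\<in>S-{v}. mean W (?F u)) = 1" using SW by (intro prod.neutral) auto
    finally show ?thesis by simp
  qed
  ultimately show ?thesis by (simp only:)
qed

lemma mean_edges_Un:
  assumes "finite S" "finite W" "S \<inter> W = {}"
  shows "mean (possible_edges (S \<union> W)) f
    = mean (possible_edges S) (\<lambda>A. mean (possible_edges W) (\<lambda>B. mean (cross S W) (\<lambda>C. f (A \<union> (B \<union> C)))))"
  unfolding possible_edges_Un[OF assms(3)] using assms possible_edges_cross_disjoint[OF assms(3)]
  by (simp add: mean_Un finite_possible_edges finite_cross)

text \<open>A Chernoff bound with parameter \<open>\<theta> / m\<close>, which is at most 1. Since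
  the signs are almost balanced, the mean is at most 1 in modulus. This costs a factor exp 1, and
  the two tails together give \<open>2 * exp 1 \<le> 6\<close>.\<close>

lemma mean_sum_tail:
  fixes \<theta> :: real and m :: nat
  assumes J: "finite J" "\<And>e. e \<in> J \<Longrightarrow> s e = 1 \<or> s e = - 1" and m: "card J \<le> m" "\<theta> \<le> m" "0 \<le> \<theta>" "0 < m"
    and b: "\<bar>sum s J\<bar> \<le> 1"
  shows "mean J (\<lambda>T. of_bool (\<theta> < \<bar>of_int (sum s T)\<bar>)) \<le> 6 * exp (- (3/4) * \<theta>\<^sup>2 / m)"
proof -
  define l where "l = \<theta> / m"
  have l: "0 \<le> l" "l \<le> 1" using m by (simp_all add: l_def)
  have mgf: "mean J (\<lambda>T. exp (c * of_int (sum s T))) \<le> exp (1 + \<theta>\<^sup>2 / (4 * m))" if c: "c = l \<or> c = - l" for c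
  proof -
    have "mean J (\<lambda>T. exp (c * of_int (sum s T))) \<le> exp (c * mean J (\<lambda>T. of_int (sum s T)) + c\<^sup>2 * 1\<^sup>2 * pq * card J)"
    proof (rule mean_exp_bounded_differences[OF J(1)])
      show "\<bar>c\<bar> * 1 \<le> 1" using c l by auto
      fix e T assume e: "e \<in> J" and T: "T \<subseteq> J - {e}"
      then have "finite T" "e \<notin> T" using J(1) by (auto dest: finite_subset)
      then have "sum s (insert e T) = s e + sum s T" by simp
      then show "\<bar>real_of_int (sum s (insert e T)) - of_int (sum s T)\<bar> \<le> 1" using J(2)[OF e] by auto
    qed
    also have "\<dots> \<le> exp (1 + \<theta>\<^sup>2 / (4 * m))"
    proof -
      have e: "mean J (\<lambda>T. of_int (sum s T)) = p * of_int (sum s J)"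
        using mean_linear[OF J(1), of "\<lambda>e. of_int (s e)"] by simp
      have "\<bar>c * (p * of_int (sum s J))\<bar> \<le> 1 * (1 * 1)"
        unfolding abs_mult using c l p_pos p_less_1 b by (intro mult_mono) (auto simp del: of_int_sum)
      moreover have "c\<^sup>2 * 1\<^sup>2 * pq * card J \<le> (\<theta> / m)\<^sup>2 * 1\<^sup>2 * (1/4) * m"
        using c l pq_le pq_pos m by (intro mult_mono) (auto simp: l_def)
      moreover have "(\<theta> / m)\<^sup>2 * 1\<^sup>2 * (1/4) * m = \<theta>\<^sup>2 / (4 * m)" using m by (simp add: power2_eq_square)
      ultimately have "c * (p * of_int (sum s J)) + c\<^sup>2 * 1\<^sup>2 * pq * card J \<le> 1 + \<theta>\<^sup>2 / (4 * m)" by linarith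
      then show ?thesis unfolding e by (simp only: exp_le_cancel_iff)
    qed
    finally show ?thesis .
  qed
  have "mean J (\<lambda>T. of_bool (\<theta> < \<bar>of_int (sum s T)\<bar>)) \<le>
    mean J (\<lambda>T. exp (- (l * \<theta>)) * (exp (l * of_int (sum s T)) + exp (- l * of_int (sum s T))))"
  proof (intro mean_mono)
    fix T
    define x where "x = real_of_int (sum s T)"
    have "1 \<le> exp (- (l * \<theta>)) * (exp (l * x) + exp (- l * x))" if h: "\<theta> < \<bar>x\<bar>"
    proof -
      have "l * \<theta> \<le> l * \<bar>x\<bar>" using h l by (intro mult_left_mono) auto
      then have "1 \<le> exp (- (l * \<theta>)) * exp (l * \<bar>x\<bar>)" by (simp flip: exp_add)
      also have "\<dots> \<le> exp (- (l * \<theta>)) * (exp (l * x) + exp (- l * x))"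
        by (intro mult_left_mono) (cases "0 \<le> x", auto)
      finally show ?thesis .
    qed
    then show "of_bool (\<theta> < \<bar>of_int (sum s T)\<bar>) \<le> exp (- (l * \<theta>)) * (exp (l * of_int (sum s T)) + exp (- l * of_int (sum s T)))"
      unfolding x_def[symmetric] by (auto simp: add_nonneg_nonneg)
  qed
  also have "\<dots> \<le> exp (- (l * \<theta>)) * (exp (1 + \<theta>\<^sup>2 / (4 * m)) + exp (1 + \<theta>\<^sup>2 / (4 * m)))"
    unfolding mean_mult_left mean_add by (intro mult_left_mono add_mono mgf) auto
  also have "\<dots> = 2 * exp 1 * exp (- (3/4) * \<theta>\<^sup>2 / m)"
    using m by (simp add: l_def field_simps power2_eq_square flip: exp_add)
  also have "\<dots> \<le> 6 * exp (- (3/4) * \<theta>\<^sup>2 / m)" using exp_le by (intro mult_right_mono) auto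
  finally show ?thesis .
qed

end

section \<open>Exponential moments, given the edges inside one vertex set\<close>

context signed_vertices
begin

lemma disc_cross_left:
  assumes "finite S" "finite W" "S \<inter> W = {}" "A \<subseteq> possible_edges S" "B \<subseteq> possible_edges W" "C \<subseteq> cross S W" "v \<in> S"
  shows "disc (S \<union> W) (A \<union> (B \<union> C)) v = disc S A v + sum (sg v) (nbrs W C v)"
proof -
  have 1: "{v, w} \<notin> B" for w using pair_in_edges[OF assms(5)] assms(3,7) by blast
  have 2: "{v, w} \<notin> C" if "w \<in> S" for w using assms(3,6,7) that pair_in_cross[OF assms(3), of v w] by auto
  have 3: "{v, w} \<notin> A" if "w \<in> W" for w using pair_in_edges[OF assms(4)] assms(3) that by blast
  have "disc (S \<union> W) (A \<union> (B \<union> C)) v = (\<Sum>w\<in>S. of_bool ({v, w} \<in> A \<union> (B \<union> C)) * sg v w)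
      + (\<Sum>w\<in>W. of_bool ({v, w} \<in> A \<union> (B \<union> C)) * sg v w)"
    unfolding disc_def using assms by (intro sum.union_disjoint) auto
  also have "(\<Sum>w\<in>S. of_bool ({v, w} \<in> A \<union> (B \<union> C)) * sg v w) = disc S A v"
    unfolding disc_def using 1 2 by (intro sum.cong) auto
  also have "(\<Sum>w\<in>W. of_bool ({v, w} \<in> A \<union> (B \<union> C)) * sg v w) = sum (sg v) (nbrs W C v)"
    using assms(2) 1 3 by (intro sum.mono_neutral_cong_right) (auto simp: nbrs_def)
  finally show ?thesis .
qed

lemma disc_cross_right:
  assumes "finite S" "finite W" "S \<inter> W = {}" "A \<subseteq> possible_edges S" "B \<subseteq> possible_edges W" "C \<subseteq> cross S W" "w \<in> W"
  shows "disc (S \<union> W) (A \<union> (B \<union> C)) w = disc W B w + sum (sg w) (nbrs S C w)"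
proof -
  have 1: "{w, v} \<notin> A" for v using pair_in_edges[OF assms(4)] assms(3,7) by blast
  have 2: "{w, v} \<notin> C" if "v \<in> W" for v using assms(3,6,7) that pair_in_cross[OF assms(3), of w v] by auto
  have 3: "{w, v} \<notin> B" if "v \<in> S" for v using pair_in_edges[OF assms(5)] assms(3) that by blast
  have "disc (S \<union> W) (A \<union> (B \<union> C)) w = (\<Sum>v\<in>S. of_bool ({w, v} \<in> A \<union> (B \<union> C)) * sg w v)
      + (\<Sum>v\<in>W. of_bool ({w, v} \<in> A \<union> (B \<union> C)) * sg w v)"
    unfolding disc_def using assms by (intro sum.union_disjoint) auto
  also have "(\<Sum>v\<in>W. of_bool ({w, v} \<in> A \<union> (B \<union> C)) * sg w v) = disc W B w"
    unfolding disc_def using 1 2 by (intro sum.cong) auto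
  also have "(\<Sum>v\<in>S. of_bool ({w, v} \<in> A \<union> (B \<union> C)) * sg w v) = sum (sg w) (nbrs S C w)"
    using assms(1) 1 3 by (intro sum.mono_neutral_cong_right) (auto simp: nbrs_def)
  finally show ?thesis by simp
qed

text \<open>Given the edges inside \<open>S\<close>, the discrepancies of the vertices of
  \<open>S\<close> depend on disjoint sets of edges to \<open>W\<close>.\<close>

lemma mean_prod_disc:
  fixes F :: "'a \<Rightarrow> int \<Rightarrow> 'b::real_normed_field"
  assumes "finite S" "finite W" "S \<inter> W = {}"
  shows "mean (possible_edges (S \<union> W)) (\<lambda>A. \<Prod>v\<in>S. F v (disc (S \<union> W) A v))
    = mean (possible_edges S) (\<lambda>A. \<Prod>v\<in>S. mean W (\<lambda>T. F v (disc S A v + sum (sg v) T)))"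
proof -
  have "mean (possible_edges (S \<union> W)) (\<lambda>A. \<Prod>v\<in>S. F v (disc (S \<union> W) A v))
    = mean (possible_edges S) (\<lambda>A. mean (possible_edges W) (\<lambda>B. mean (cross S W) (\<lambda>C. \<Prod>v\<in>S. F v (disc S A v + sum (sg v) (nbrs W C v)))))"
    unfolding mean_edges_Un[OF assms] by (intro mean_cong prod.cong) (auto simp: disc_cross_left[OF assms])
  also have "\<dots> = mean (possible_edges S) (\<lambda>A. \<Prod>v\<in>S. mean W (\<lambda>T. F v (disc S A v + sum (sg v) T)))"
    using assms by (subst mean_cross[OF assms]) (simp add: finite_possible_edges)
  finally show ?thesis .
qed

lemma mean_stays:
  assumes "finite V" "v \<in> V" shows "mean (possible_edges V) (\<lambda>A. stays V A v) = stay_prob V v"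
  unfolding stays_def stay_prob_def by (rule disc_insert_edges_self[OF assms])

lemma disc_insert_edge:
  assumes "finite S" "e \<in> possible_edges S" "A \<subseteq> possible_edges S - {e}"
  shows "v \<in> e \<Longrightarrow> disc S (insert e A) v = disc S A v + 1 \<or> disc S (insert e A) v = disc S A v - 1"
    and "v \<notin> e \<Longrightarrow> disc S (insert e A) v = disc S A v"
proof -
  show "disc S (insert e A) v = disc S A v" if "v \<notin> e"
    unfolding disc_def using that by (intro sum.cong) auto
  assume v: "v \<in> e"
  then obtain u where u: "e = {v, u}" "u \<noteq> v" "u \<in> S"
    using assms(2) by (auto simp: possible_edges_def card_2_iff)
  have "disc S (insert e A) v = of_bool ({v, u} \<in> insert e A) * sg v u + (\<Sum>w\<in>S-{u}. of_bool ({v, w} \<in> insert e A) * sg v w)"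
    unfolding disc_def using assms(1) u by (simp add: sum.remove)
  also have "(\<Sum>w\<in>S-{u}. of_bool ({v, w} \<in> insert e A) * sg v w) = (\<Sum>w\<in>S-{u}. of_bool ({v, w} \<in> A) * sg v w)"
    using u by (intro sum.cong) (auto simp: doubleton_eq_iff)
  also have "\<dots> = disc S A v"
    unfolding disc_def using assms u by (intro sum.mono_neutral_left) auto
  finally show "disc S (insert e A) v = disc S A v + 1 \<or> disc S (insert e A) v = disc S A v - 1"
    using sg[of v u] u by auto
qed

lemma mean_shift_nonneg_diff:
  assumes "finite W" "W \<noteq> {}"
  shows "\<bar>mean W (\<lambda>T. of_bool (0 \<le> d + 1 + sum (sg v) T)) - mean W (\<lambda>T. of_bool (0 \<le> d + sum (sg v) T) :: real)\<bar> \<le> 1 / sqrt (pq * card W)"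
proof -
  have "mean W (\<lambda>T. of_bool (0 \<le> d + 1 + sum (sg v) T)) - mean W (\<lambda>T. of_bool (0 \<le> d + sum (sg v) T) :: real)
     = pp W (sg v) (- d - 1)"
    unfolding mean_diff[symmetric] pp_def by (intro mean_cong) auto
  moreover have "0 \<le> pp W (sg v) (- d - 1)" unfolding pp_def by (intro mean_nonneg) simp
  moreover have "pp W (sg v) (- d - 1) \<le> 1 / sqrt (pq * card W)" by (rule pp_le[OF assms(1) sg assms(2)])
  ultimately show ?thesis by simp
qed

text \<open>Given the edges \<open>A\<close> inside \<open>S\<close> the indicators are independent
  with means \<open>g v A\<close>; this accounts for the term \<open>card S\<close>. The sum
  \<open>f A\<close> of these means changes by at most two point probabilities when an edge is
  added, one for each end. Bounded differences over at most \<open>(card S)\<^sup>2\<close> edges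
  give the second term, in which \<open>pq\<close> has cancelled.\<close>

lemma mgf_stays:
  assumes SW: "finite S" "finite W" "S \<inter> W = {}" "W \<noteq> {}"
    and l: "\<bar>l\<bar> \<le> 1" "4 \<le> pq * card W"
  shows "mean (possible_edges (S \<union> W)) (\<lambda>A. exp (l * (\<Sum>v\<in>S. stays (S \<union> W) A v - stay_prob (S \<union> W) v)))
    \<le> exp (l\<^sup>2 * (card S + 4 * (card S)\<^sup>2 / card W))"
proof -
  let ?V = "S \<union> W"
  define k where "k = 1 / sqrt (pq * card W)"
  have k: "0 \<le> k" "2 * k \<le> 1"
    using l(2) real_sqrt_le_mono[OF l(2)] pq_pos by (simp_all add: k_def)
  define g where "g v A = mean W (\<lambda>T. of_bool (0 \<le> disc S A v + sum (sg v) T) :: real)" for v A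
  define f where "f A = (\<Sum>v\<in>S. g v A)" for A
  define M where "M = (\<Sum>v\<in>S. stay_prob ?V v)"
  have fS: "finite (possible_edges S)" using SW by (simp add: finite_possible_edges)
  have mf: "mean (possible_edges S) f = M"
  proof -
    have "mean (possible_edges S) (g v) = stay_prob ?V v" if v: "v \<in> S" for v
    proof -
      have "stay_prob ?V v = mean (possible_edges ?V) (\<lambda>A. stays ?V A v)" using SW v by (simp add: mean_stays)
      also have "\<dots> = mean (possible_edges S) (\<lambda>A. mean (possible_edges W) (\<lambda>B. mean (cross S W) (\<lambda>C. of_bool (0 \<le> disc S A v + sum (sg v) (nbrs W C v)))))"
        unfolding mean_edges_Un[OF SW(1-3)] stays_def by (intro mean_cong) (simp add: disc_cross_left[OF SW(1-3)] v)
      also have "\<dots> = mean (possible_edges S) (\<lambda>A. mean (cross S W) (\<lambda>C. of_bool (0 \<le> disc S A v + sum (sg v) (nbrs W C v))))"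
        using SW by (simp add: finite_possible_edges)
      also have "\<dots> = mean (possible_edges S) (g v)"
      proof (intro mean_cong)
        fix A
        show "mean (cross S W) (\<lambda>C. of_bool (0 \<le> disc S A v + sum (sg v) (nbrs W C v))) = g v A"
          unfolding g_def by (rule mean_cross_single[OF SW(1-3) v])
      qed
      finally show ?thesis ..
    qed
    then show ?thesis by (simp add: f_def[abs_def] mean_sum M_def)
  qed
  have e1: "mean (possible_edges ?V) (\<lambda>A. exp (l * (\<Sum>v\<in>S. stays ?V A v - stay_prob ?V v)))
    = exp (- (l * M)) * mean (possible_edges S) (\<lambda>A. \<Prod>v\<in>S. mean W (\<lambda>T. exp (l * of_bool (0 \<le> disc S A v + sum (sg v) T))))"
  proof -
    have "mean (possible_edges ?V) (\<lambda>A. exp (l * (\<Sum>v\<in>S. stays ?V A v - stay_prob ?V v)))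
      = mean (possible_edges ?V) (\<lambda>A. exp (- (l * M)) * (\<Prod>v\<in>S. exp (l * of_bool (0 \<le> disc ?V A v))))"
    proof (intro mean_cong)
      fix A
      have "exp (l * (\<Sum>v\<in>S. stays ?V A v - stay_prob ?V v)) = exp (- (l * M) + (\<Sum>v\<in>S. l * stays ?V A v))"
        by (simp add: sum_subtractf M_def right_diff_distrib sum_distrib_left)
      also have "\<dots> = exp (- (l * M)) * (\<Prod>v\<in>S. exp (l * of_bool (0 \<le> disc ?V A v)))"
        by (simp only: exp_add exp_sum[OF SW(1)] stays_def)
      finally show "exp (l * (\<Sum>v\<in>S. stays ?V A v - stay_prob ?V v)) = exp (- (l * M)) * (\<Prod>v\<in>S. exp (l * of_bool (0 \<le> disc ?V A v)))" .
    qed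
    then show ?thesis unfolding mean_mult_left
      using mean_prod_disc[OF SW(1-3), of "\<lambda>v d. exp (l * of_bool (0 \<le> d))"] by (simp only:)
  qed
  have one: "mean W (\<lambda>T. exp (l * of_bool (0 \<le> disc S A v + sum (sg v) T))) \<le> exp (l * g v A + l\<^sup>2)" for A v
  proof -
    have g01: "0 \<le> g v A" "g v A \<le> 1" unfolding g_def using SW by (auto intro!: mean_nonneg mean_le_const)
    have "mean W (\<lambda>T. exp (l * of_bool (0 \<le> disc S A v + sum (sg v) T)))
      = mean W (\<lambda>T. 1 + of_bool (0 \<le> disc S A v + sum (sg v) T) * (exp l - 1))"
      by (intro mean_cong) auto
    also have "\<dots> = 1 + g v A * (exp l - 1)" unfolding g_def using SW by (simp add: mean_add mean_mult_right)
    also have "\<dots> \<le> 1 + (l * g v A + l\<^sup>2)"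
    proof -
      have "exp l \<le> 1 + l + l\<^sup>2"
        using l(1) by (rule exp_le_quadratic)
      then have "g v A * (exp l - 1) \<le> g v A * (l + l\<^sup>2)" using g01 by (intro mult_left_mono) auto
      moreover have "g v A * l\<^sup>2 \<le> 1 * l\<^sup>2" using g01 by (intro mult_right_mono) auto
      ultimately show ?thesis by (simp add: algebra_simps)
    qed
    also have "\<dots> \<le> exp (l * g v A + l\<^sup>2)" by (rule exp_ge_add_one_self)
    finally show ?thesis .
  qed
  have "mean (possible_edges S) (\<lambda>A. \<Prod>v\<in>S. mean W (\<lambda>T. exp (l * of_bool (0 \<le> disc S A v + sum (sg v) T))))
     \<le> mean (possible_edges S) (\<lambda>A. exp (l\<^sup>2 * card S) * exp (l * f A))"
  proof (intro mean_mono)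
    fix A
    have "(\<Prod>v\<in>S. mean W (\<lambda>T. exp (l * of_bool (0 \<le> disc S A v + sum (sg v) T)))) \<le> (\<Prod>v\<in>S. exp (l * g v A + l\<^sup>2))"
      by (intro prod_mono conjI one mean_nonneg) auto
    also have "\<dots> = exp (\<Sum>v\<in>S. l * g v A + l\<^sup>2)" by (simp add: exp_sum SW)
    also have "\<dots> = exp (l\<^sup>2 * card S) * exp (l * f A)"
      by (simp add: f_def sum.distrib sum_distrib_left mult.commute flip: exp_add)
    finally show "(\<Prod>v\<in>S. mean W (\<lambda>T. exp (l * of_bool (0 \<le> disc S A v + sum (sg v) T)))) \<le> exp (l\<^sup>2 * card S) * exp (l * f A)" .
  qed
  also have "\<dots> = exp (l\<^sup>2 * card S) * mean (possible_edges S) (\<lambda>A. exp (l * f A))" by (rule mean_mult_left)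
  also have "\<dots> \<le> exp (l\<^sup>2 * card S) * exp (l * M + l\<^sup>2 * (2 * k)\<^sup>2 * pq * card (possible_edges S))"
  proof (intro mult_left_mono)
    have "mean (possible_edges S) (\<lambda>A. exp (l * f A)) \<le> exp (l * mean (possible_edges S) f + l\<^sup>2 * (2 * k)\<^sup>2 * pq * card (possible_edges S))"
    proof (rule mean_exp_bounded_differences[OF fS])
      show "\<bar>l\<bar> * (2 * k) \<le> 1" using mult_mono[OF l(1) k(2)] k by simp
      fix e A assume e: "e \<in> possible_edges S" and A: "A \<subseteq> possible_edges S - {e}"
      note D = disc_insert_edge[OF SW(1) e A]
      have eS: "e \<subseteq> S" "finite e" "card e = 2" using e SW(1) by (auto simp: possible_edges_def dest: finite_subset)
      have gd: "\<bar>g v (insert e A) - g v A\<bar> \<le> k" if "v \<in> e" for v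
        using D(1)[OF that] mean_shift_nonneg_diff[OF SW(2,4), of "disc S A v" v] mean_shift_nonneg_diff[OF SW(2,4), of "disc S A v - 1" v]
        unfolding g_def k_def by (auto simp: abs_minus_commute)
      have g0: "g v (insert e A) - g v A = 0" if "v \<notin> e" for v using D(2)[OF that] by (simp add: g_def)
      have "f (insert e A) - f A = (\<Sum>v\<in>S. g v (insert e A) - g v A)" by (simp add: f_def sum_subtractf)
      also have "\<dots> = (\<Sum>v\<in>e. g v (insert e A) - g v A)" using eS SW g0 by (intro sum.mono_neutral_right) auto
      finally have "\<bar>f (insert e A) - f A\<bar> \<le> (\<Sum>v\<in>e. \<bar>g v (insert e A) - g v A\<bar>)" by (simp only: sum_abs)
      also have "\<dots> \<le> (\<Sum>v\<in>e. k)" by (intro sum_mono gd)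
      finally show "\<bar>f (insert e A) - f A\<bar> \<le> 2 * k" using eS by simp
    qed
    then show "mean (possible_edges S) (\<lambda>A. exp (l * f A)) \<le> exp (l * M + l\<^sup>2 * (2 * k)\<^sup>2 * pq * card (possible_edges S))"
      unfolding mf .
  qed auto
  also have "\<dots> \<le> exp (l * M) * exp (l\<^sup>2 * (card S + 4 * (card S)\<^sup>2 / card W))"
  proof -
    have cE: "card (possible_edges S) \<le> (card S)\<^sup>2"
    proof -
      have "possible_edges S \<subseteq> (\<lambda>(a, b). {a, b}) ` (S \<times> S)"
        by (auto simp: possible_edges_def card_2_iff)
      then have "card (possible_edges S) \<le> card ((\<lambda>(a, b). {a, b}) ` (S \<times> S))" using SW by (intro card_mono) auto
      also have "\<dots> \<le> card (S \<times> S)" using SW by (intro card_image_le) auto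
      finally show ?thesis by (simp add: card_cartesian_product power2_eq_square)
    qed
    have cW: "0 < pq * card W" using SW pq_pos by (simp add: card_gt_0_iff)
    have "(2 * k)\<^sup>2 * pq * card (possible_edges S) \<le> (2 * k)\<^sup>2 * pq * (card S)\<^sup>2"
      using cE pq_pos by (intro mult_left_mono) (simp_all flip: of_nat_power)
    also have "\<dots> = 4 * (card S)\<^sup>2 / card W"
      using cW pq_pos by (simp add: k_def power_divide power_mult_distrib)
    finally have "(2 * k)\<^sup>2 * pq * card (possible_edges S) \<le> 4 * (card S)\<^sup>2 / card W" .
    from mult_left_mono[OF this, of "l\<^sup>2"] show ?thesis
      by (simp add: distrib_left mult.assoc flip: exp_add)
  qed
  finally have "mean (possible_edges S) (\<lambda>A. \<Prod>v\<in>S. mean W (\<lambda>T. exp (l * of_bool (0 \<le> disc S A v + sum (sg v) T))))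
    \<le> exp (l * M) * exp (l\<^sup>2 * (card S + 4 * (card S)\<^sup>2 / card W))" .
  then have "exp (- (l * M)) * mean (possible_edges S) (\<lambda>A. \<Prod>v\<in>S. mean W (\<lambda>T. exp (l * of_bool (0 \<le> disc S A v + sum (sg v) T))))
    \<le> exp (- (l * M)) * (exp (l * M) * exp (l\<^sup>2 * (card S + 4 * (card S)\<^sup>2 / card W)))"
    by (intro mult_left_mono) auto
  also have "\<dots> = exp (l\<^sup>2 * (card S + 4 * (card S)\<^sup>2 / card W))" by (simp add: exp_minus)
  finally show ?thesis unfolding e1 .
qed

text \<open>Given the edges inside \<open>S\<close>, each vertex has its discrepancy in the window
  with probability at most \<open>\<eta>\<close>: the number of integers in the window times the
  maximal point probability. Independence and Markov's inequality for the exponential do the rest;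
  the factor 2 in the exponent comes from exp 1 \<le> 1 + 2.\<close>

lemma bad_count_tail:
  fixes \<theta> t :: real
  assumes SW: "finite S" "finite W" "S \<inter> W = {}" "W \<noteq> {}" and \<theta>: "0 \<le> \<theta>"
  shows "mean (possible_edges (S \<union> W)) (\<lambda>A. of_bool (t \<le> (\<Sum>v\<in>S. of_bool (\<bar>of_int (disc (S \<union> W) A v)\<bar> \<le> \<theta>))))
    \<le> exp (2 * card S * ((2 * \<theta> + 1) / sqrt (pq * card W)) - t)"
proof -
  define \<eta> where "\<eta> = (2 * \<theta> + 1) / sqrt (pq * card W)"
  have one: "mean W (\<lambda>T. exp (of_bool (\<bar>real_of_int (d + sum (sg v) T)\<bar> \<le> \<theta>))) \<le> exp (2 * \<eta>)" for d v
  proof -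
    let ?J = "{- d - \<lfloor>\<theta>\<rfloor>..- d + \<lfloor>\<theta>\<rfloor>}"
    have "mean W (\<lambda>T. of_bool (\<bar>real_of_int (d + sum (sg v) T)\<bar> \<le> \<theta>) :: real) \<le> mean W (\<lambda>T. \<Sum>j\<in>?J. of_bool (sum (sg v) T = j))"
    proof (intro mean_mono)
      fix T
      define x where "x = sum (sg v) T"
      have "x \<in> ?J" if "\<bar>real_of_int (d + x)\<bar> \<le> \<theta>"
      proof -
        have "real_of_int (d + x) \<le> \<theta>" "real_of_int (- d - x) \<le> \<theta>" using that by auto
        then have "d + x \<le> \<lfloor>\<theta>\<rfloor>" "- d - x \<le> \<lfloor>\<theta>\<rfloor>" by (simp_all only: le_floor_iff)
        then show ?thesis by simp
      qed
      then show "(of_bool (\<bar>real_of_int (d + sum (sg v) T)\<bar> \<le> \<theta>) :: real) \<le> (\<Sum>j\<in>?J. of_bool (sum (sg v) T = j))"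
        unfolding x_def[symmetric] by (auto simp: of_bool_def sum.delta sum.delta')
    qed
    also have "\<dots> = (\<Sum>j\<in>?J. pp W (sg v) j)" unfolding mean_sum pp_def ..
    also have "\<dots> \<le> (\<Sum>j\<in>?J. 1 / sqrt (pq * card W))" by (intro sum_mono pp_le[OF SW(2) sg SW(4)])
    also have "\<dots> = (2 * of_int \<lfloor>\<theta>\<rfloor> + 1) * (1 / sqrt (pq * card W))" using \<theta> by simp
    also have "\<dots> \<le> (2 * \<theta> + 1) * (1 / sqrt (pq * card W))" using pq_pos by (intro mult_right_mono) auto
    finally have m: "mean W (\<lambda>T. of_bool (\<bar>real_of_int (d + sum (sg v) T)\<bar> \<le> \<theta>) :: real) \<le> \<eta>" by (simp add: \<eta>_def)
    have "mean W (\<lambda>T. exp (of_bool (\<bar>real_of_int (d + sum (sg v) T)\<bar> \<le> \<theta>)))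
      \<le> mean W (\<lambda>T. 1 + 2 * of_bool (\<bar>real_of_int (d + sum (sg v) T)\<bar> \<le> \<theta>) :: real)"
      using exp_le by (intro mean_mono) auto
    also have "\<dots> \<le> 1 + 2 * \<eta>" using m SW by (simp add: mean_add mean_mult_left)
    also have "\<dots> \<le> exp (2 * \<eta>)" by (rule exp_ge_add_one_self)
    finally show ?thesis .
  qed
  let ?N = "\<lambda>A. \<Sum>v\<in>S. of_bool (\<bar>real_of_int (disc (S \<union> W) A v)\<bar> \<le> \<theta>) :: real"
  have "mean (possible_edges (S \<union> W)) (\<lambda>A. of_bool (t \<le> ?N A)) \<le> mean (possible_edges (S \<union> W)) (\<lambda>A. exp (- t) * exp (?N A))"
    by (intro mean_mono) (simp flip: exp_add)
  also have "\<dots> = exp (- t) * mean (possible_edges (S \<union> W)) (\<lambda>A. \<Prod>v\<in>S. exp (of_bool (\<bar>real_of_int (disc (S \<union> W) A v)\<bar> \<le> \<theta>)))"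
    by (simp only: mean_mult_left exp_sum[OF SW(1)])
  also have "\<dots> = exp (- t) * mean (possible_edges S) (\<lambda>A. \<Prod>v\<in>S. mean W (\<lambda>T. exp (of_bool (\<bar>real_of_int (disc S A v + sum (sg v) T)\<bar> \<le> \<theta>))))"
    by (subst mean_prod_disc[OF SW(1-3)]) (rule refl)
  also have "\<dots> \<le> exp (- t) * (exp (2 * \<eta>)) ^ card S"
  proof (intro mult_left_mono mean_le_const)
    fix A
    have "(\<Prod>v\<in>S. mean W (\<lambda>T. exp (of_bool (\<bar>real_of_int (disc S A v + sum (sg v) T)\<bar> \<le> \<theta>)))) \<le> (\<Prod>v\<in>S. exp (2 * \<eta>))"
      by (intro prod_mono conjI one mean_nonneg) auto
    then show "(\<Prod>v\<in>S. mean W (\<lambda>T. exp (of_bool (\<bar>real_of_int (disc S A v + sum (sg v) T)\<bar> \<le> \<theta>)))) \<le> (exp (2 * \<eta>)) ^ card S" by simp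
  qed (use SW in \<open>auto simp: finite_possible_edges\<close>)
  also have "\<dots> = exp (2 * card S * \<eta> - t)"
    by (simp add: exp_of_nat_mult[symmetric] algebra_simps flip: exp_add)
  finally show ?thesis by (simp add: \<eta>_def)
qed

end

section \<open>Decay of the characteristic function at high frequencies\<close>

lemma cross_commute: "cross S W = cross W S"
proof -
  have "e \<in> cross S W \<longleftrightarrow> (\<exists>v\<in>S. \<exists>w\<in>W. e = {v, w})" for e :: "'a set" and S W
    by (simp add: cross_def star_def image_iff)
  then show ?thesis by (intro set_eqI) (metis insert_commute)
qed

lemma cross_Un_right: "cross S (X \<union> Y) = cross S X \<union> cross S Y"
  by (simp add: cross_def star_def image_Un UN_Un_distrib)

text \<open>The squared modulus is 1 - 2 y, which is at most (1 - y)^2, and y is at most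
  1/2.\<close>

lemma norm_bernoulli_cis_le:
  fixes a x :: real
  assumes "0 \<le> a" "a \<le> 1" "\<bar>x\<bar> \<le> pi"
  shows "norm (of_real (1 - a) + of_real a * cis x) \<le> 1 - 2 * x\<^sup>2 / pi\<^sup>2 * (a * (1 - a))"
proof -
  define y where "y = a * (1 - a) * (1 - cos x)"
  have "(norm (of_real (1 - a) + of_real a * cis x))\<^sup>2 = (1 - a + a * cos x)\<^sup>2 + (a * sin x)\<^sup>2"
    by (simp add: cmod_power2)
  also have "\<dots> = (1 - a)\<^sup>2 + 2 * (1 - a) * a * cos x + a\<^sup>2 * ((cos x)\<^sup>2 + (sin x)\<^sup>2)"
    by (simp only: power2_eq_square) algebra
  also have "\<dots> = 1 - 2 * y" by (simp add: y_def power2_eq_square algebra_simps)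
  also have "\<dots> \<le> (1 - y)\<^sup>2" by (simp add: power2_eq_square algebra_simps)
  finally have 1: "(norm (of_real (1 - a) + of_real a * cis x))\<^sup>2 \<le> (1 - y)\<^sup>2" .
  have a4: "0 \<le> a * (1 - a)" "a * (1 - a) \<le> 1/4"
    using assms zero_le_power2[of "a - 1/2"] by (simp, simp add: power2_eq_square algebra_simps)
  have "y \<le> 1/4 * 2" unfolding y_def using a4 cos_ge_minus_one[of x] by (intro mult_mono) auto
  then have "norm (of_real (1 - a) + of_real a * cis x) \<le> 1 - y" by (intro power2_le_imp_le[OF 1]) simp
  moreover have "a * (1 - a) * (2 * x\<^sup>2 / pi\<^sup>2) \<le> y"
    unfolding y_def using a4 one_minus_cos_ge[OF assms(3)] by (intro mult_left_mono)
  ultimately show ?thesis by (simp add: mult.commute)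
qed

context signed_vertices
begin

text \<open>Given the bits in \<open>X\<close>, let \<open>\<pi>\<close> be the conditional
  probability of the event. The conditional mean of the phase falls short of modulus 1 by a multiple
  of the conditional variance. That this variance is not small on average is seen by testing the
  indicator minus \<open>\<pi>\<close> against the centred signed sum \<open>g\<close> over
  \<open>Y\<close>: \<open>\<pi>\<close> is orthogonal to \<open>g\<close>, while the indicator has
  mean product at least \<open>pq * card Y * \<kappa>\<close> with it. Cauchy-Schwarz gives the
  rest.\<close>

lemma mean_norm_cis_nonneg_le:
  fixes x \<kappa> :: real and s :: "'a \<Rightarrow> int"
  assumes fin: "finite X" "finite Y" "X \<inter> Y = {}" "Y \<noteq> {}" and s: "\<And>w. s w = 1 \<or> s w = - 1"
    and x: "\<bar>x\<bar> \<le> pi" and \<kappa>: "0 \<le> \<kappa>" "\<And>w. w \<in> Y \<Longrightarrow> \<kappa> \<le> pp (X \<union> Y - {w}) s (crit (s w) - d)"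
  shows "mean X (\<lambda>T. norm (mean Y (\<lambda>T'. cis (x * of_bool (0 \<le> d + sum s (T \<union> T'))))))
    \<le> exp (- (2 / pi\<^sup>2 * x\<^sup>2 * pq * card Y * \<kappa>\<^sup>2))"
proof -
  let ?W = "X \<union> Y"
  define h where "h T = (of_bool (0 \<le> d + sum s T) :: real)" for T
  define \<pi> where "\<pi> T = mean Y (\<lambda>T'. h (T \<union> T'))" for T
  have \<pi>01: "0 \<le> \<pi> T" "\<pi> T \<le> 1" for T
    unfolding \<pi>_def h_def using fin by (auto intro!: mean_nonneg mean_le_const)
  define l where "l w = (if w \<in> Y then of_int (s w) else 0 :: real)" for w
  define g where "g T = sum l T - p * sum l ?W" for T
  have split: "mean ?W f = mean X (\<lambda>T. mean Y (\<lambda>T'. f (T \<union> T')))" for f :: "'a set \<Rightarrow> real"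
    using fin by (intro mean_Un) auto
  have cY: "0 < card Y" using fin by (simp add: card_gt_0_iff)
  have l2: "(\<Sum>w\<in>?W. (l w)\<^sup>2) = card Y"
  proof -
    have "(\<Sum>w\<in>?W. (l w)\<^sup>2) = (\<Sum>w\<in>Y. (l w)\<^sup>2)" using fin by (intro sum.mono_neutral_right) (auto simp: l_def)
    also have "\<dots> = (\<Sum>w\<in>Y. 1)"
    proof (intro sum.cong refl)
      fix w assume "w \<in> Y" then show "(l w)\<^sup>2 = 1" using s[of w] by (auto simp: l_def)
    qed
    finally show ?thesis by simp
  qed
  have g2: "mean ?W (\<lambda>T. (g T)\<^sup>2) = pq * card Y"
    unfolding g_def using mean_linear_square[of ?W l] fin l2 by simp
  have hg: "pq * card Y * \<kappa> \<le> mean ?W (\<lambda>T. h T * g T)"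
  proof -
    have "mean ?W (\<lambda>T. h T * g T) = pq * (\<Sum>w\<in>?W. l w * (of_int (s w) * pp (?W - {w}) s (crit (s w) - d)))"
      unfolding h_def g_def using fin s by (intro mean_nonneg_times_linear) auto
    also have "(\<Sum>w\<in>?W. l w * (of_int (s w) * pp (?W - {w}) s (crit (s w) - d))) = (\<Sum>w\<in>Y. pp (?W - {w}) s (crit (s w) - d))"
    proof (intro sum.mono_neutral_cong_right)
      fix w assume "w \<in> Y"
      then show "l w * (of_int (s w) * pp (?W - {w}) s (crit (s w) - d)) = pp (?W - {w}) s (crit (s w) - d)"
        using s[of w] by (auto simp: l_def)
    qed (use fin in \<open>auto simp: l_def\<close>)
    also have "pq * (\<Sum>w\<in>Y. pp (?W - {w}) s (crit (s w) - d)) \<ge> pq * (\<Sum>w\<in>Y. \<kappa>)"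
      using pq_pos \<kappa>(2) by (intro mult_left_mono sum_mono) auto
    finally show ?thesis by simp
  qed
  have \<pi>g: "mean ?W (\<lambda>T. \<pi> (T \<inter> X) * g T) = 0"
  proof -
    have "mean ?W (\<lambda>T. \<pi> (T \<inter> X) * g T) = mean X (\<lambda>T. \<pi> T * mean Y g)"
      unfolding split mean_mult_left[symmetric]
    proof (intro mean_cong)
      fix T T' assume T: "T \<subseteq> X" "T' \<subseteq> Y"
      have "finite T" "finite T'" using T fin by (auto dest: finite_subset)
      then have "sum l (T \<union> T') = sum l T + sum l T'" using T fin by (intro sum.union_disjoint) auto
      moreover have "sum l T = 0" using T fin by (intro sum.neutral) (auto simp: l_def)
      moreover have "(T \<union> T') \<inter> X = T" using T fin by auto
      ultimately show "\<pi> ((T \<union> T') \<inter> X) * g (T \<union> T') = \<pi> T * g T'" by (simp add: g_def)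
    qed
    moreover have "mean Y g = 0"
    proof -
      have "sum l ?W = sum l Y" using fin by (intro sum.mono_neutral_right) (auto simp: l_def)
      then show ?thesis using fin by (simp add: g_def[abs_def] mean_diff mean_linear)
    qed
    ultimately show ?thesis by (simp add: mean_def)
  qed
  have var: "mean ?W (\<lambda>T. (h T - \<pi> (T \<inter> X))\<^sup>2) = mean X (\<lambda>T. \<pi> T * (1 - \<pi> T))"
    unfolding split
  proof (intro mean_cong)
    fix T assume T: "T \<subseteq> X"
    have "mean Y (\<lambda>T'. (h (T \<union> T') - \<pi> ((T \<union> T') \<inter> X))\<^sup>2) = mean Y (\<lambda>T'. (1 - 2 * \<pi> T) * h (T \<union> T') + (\<pi> T)\<^sup>2)"
    proof (intro mean_cong)
      fix T' assume T': "T' \<subseteq> Y"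
      have e: "(T \<union> T') \<inter> X = T" using T T' fin by auto
      show "(h (T \<union> T') - \<pi> ((T \<union> T') \<inter> X))\<^sup>2 = (1 - 2 * \<pi> T) * h (T \<union> T') + (\<pi> T)\<^sup>2"
        unfolding e h_def by (auto simp: power2_eq_square algebra_simps)
    qed
    also have "\<dots> = (1 - 2 * \<pi> T) * \<pi> T + (\<pi> T)\<^sup>2"
      using fin by (simp add: mean_add mean_mult_left \<pi>_def)
    finally show "mean Y (\<lambda>T'. (h (T \<union> T') - \<pi> ((T \<union> T') \<inter> X))\<^sup>2) = \<pi> T * (1 - \<pi> T)"
      by (simp add: power2_eq_square algebra_simps)
  qed
  have fg: "mean ?W (\<lambda>T. (h T - \<pi> (T \<inter> X)) * g T) = mean ?W (\<lambda>T. h T * g T)"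
    using \<pi>g by (simp add: left_diff_distrib mean_diff)
  have pos: "0 < pq * card Y" using pq_pos cY by simp
  have "pq * card Y * \<kappa>\<^sup>2 = (pq * card Y * \<kappa>)\<^sup>2 / (pq * card Y)" using pos by (simp add: power2_eq_square)
  also have "\<dots> \<le> (mean ?W (\<lambda>T. h T * g T))\<^sup>2 / (pq * card Y)"
    using hg \<kappa>(1) pos by (intro divide_right_mono power_mono) auto
  also have "\<dots> \<le> mean X (\<lambda>T. \<pi> T * (1 - \<pi> T))"
    using mean_cauchy_schwarz[of ?W g "\<lambda>T. h T - \<pi> (T \<inter> X)"] pos by (simp only: g2 fg var)
  finally have V: "pq * card Y * \<kappa>\<^sup>2 \<le> mean X (\<lambda>T. \<pi> T * (1 - \<pi> T))" .
  have "mean X (\<lambda>T. norm (mean Y (\<lambda>T'. cis (x * of_bool (0 \<le> d + sum s (T \<union> T'))))))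
    \<le> mean X (\<lambda>T. 1 - 2 * x\<^sup>2 / pi\<^sup>2 * (\<pi> T * (1 - \<pi> T)))"
  proof (intro mean_mono)
    fix T
    have "mean Y (\<lambda>T'. cis (x * of_bool (0 \<le> d + sum s (T \<union> T')))) = mean Y (\<lambda>T'. 1 + of_real (h (T \<union> T')) * (cis x - 1))"
      by (intro mean_cong) (auto simp: h_def)
    also have "\<dots> = of_real (1 - \<pi> T) + of_real (\<pi> T) * cis x"
      unfolding mean_add mean_mult_right mean_of_real \<pi>_def using fin by (simp add: algebra_simps)
    finally show "norm (mean Y (\<lambda>T'. cis (x * of_bool (0 \<le> d + sum s (T \<union> T'))))) \<le> 1 - 2 * x\<^sup>2 / pi\<^sup>2 * (\<pi> T * (1 - \<pi> T))"
      using norm_bernoulli_cis_le[OF \<pi>01 x] by simp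
  qed
  also have "\<dots> = 1 - 2 * x\<^sup>2 / pi\<^sup>2 * mean X (\<lambda>T. \<pi> T * (1 - \<pi> T))"
    using fin by (simp only: mean_diff mean_mult_left mean_const)
  also have "\<dots> \<le> 1 - 2 * x\<^sup>2 / pi\<^sup>2 * (pq * card Y * \<kappa>\<^sup>2)"
    using mult_left_mono[OF V, of "2 * x\<^sup>2 / pi\<^sup>2"] by simp
  also have "\<dots> \<le> exp (- (2 / pi\<^sup>2 * x\<^sup>2 * pq * card Y * \<kappa>\<^sup>2))"
    using exp_ge_add_one_self[of "- (2 * x\<^sup>2 / pi\<^sup>2 * (pq * card Y * \<kappa>\<^sup>2))"] by (simp add: mult_ac)
  finally show ?thesis .
qed

text \<open>Let \<open>Y\<close> be the vertices of \<open>W\<close> whose discrepancy inside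
  \<open>W\<close> exceeds \<open>\<theta>\<close>. As long as the edges from \<open>S\<close> shift
  no discrepancy by more than \<open>\<theta>\<close>, the indicators on \<open>Y\<close> are fixed,
  so the edges between \<open>S\<close> and \<open>Y\<close> act on the indicators of
  \<open>S\<close> alone. Given all other edges these are independent, and those in
  \<open>S'\<close> still fluctuate. The other terms pay for a shift that is too large (2 * 6 for
  each vertex of \<open>W\<close>), a discrepancy inside \<open>S\<close> that is too large (6 for
  each vertex of \<open>S\<close>), and a set \<open>Y\<close> that is too small.\<close>

lemma fourier_high_frequency:
  fixes z \<theta> \<kappa> \<eta> G :: real and \<zeta> :: "'a \<Rightarrow> real"
  assumes fin: "finite S" "finite W" "S \<inter> W = {}" and S': "S' \<subseteq> S" "S' \<noteq> {}"
    and z: "0 \<le> z" "\<And>v. v \<in> S' \<Longrightarrow> z \<le> \<bar>\<zeta> v\<bar>" "\<And>v. v \<in> S' \<Longrightarrow> \<bar>\<zeta> v\<bar> \<le> pi"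
    and \<theta>: "0 \<le> \<theta>" "\<theta> \<le> card S" and bal: "sum \<sigma> S = 0"
    and \<kappa>: "0 \<le> \<kappa>" "\<And>v w j. v \<in> S' \<Longrightarrow> w \<in> W \<Longrightarrow> \<bar>of_int j\<bar> \<le> \<theta> + 1 \<Longrightarrow> \<kappa> \<le> pp (W - {w}) (sg v) j"
    and G: "0 < G"
    and \<eta>: "mean (possible_edges W) (\<lambda>B. of_bool (card {w \<in> W. \<theta> < \<bar>of_int (disc W B w)\<bar>} < G)) \<le> \<eta>"
  shows "norm (mean (possible_edges (S \<union> W)) (\<lambda>A. cis (\<Sum>v\<in>S \<union> W. \<zeta> v * stays (S \<union> W) A v)))
    \<le> (12 * card W + 6 * card S) * exp (- (3/4) * \<theta>\<^sup>2 / card S) + \<eta>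
       + exp (- (card S' * (2 / pi\<^sup>2 * z\<^sup>2 * pq * G * \<kappa>\<^sup>2)))"
proof -
  let ?V = "S \<union> W"
  define e where "e = exp (- (3/4) * \<theta>\<^sup>2 / card S)"
  define q where "q = exp (- (card S' * (2 / pi\<^sup>2 * z\<^sup>2 * pq * G * \<kappa>\<^sup>2)))"
  have S0: "0 < card S" using S' fin by (auto simp: card_gt_0_iff)
  define Good where "Good B = {w \<in> W. \<theta> < \<bar>real_of_int (disc W B w)\<bar>}" for B
  define small where "small B \<longleftrightarrow> card (Good B) < G" for B
  define big where "big A v \<longleftrightarrow> \<theta> < \<bar>real_of_int (disc S A v)\<bar>" for A v
  define \<Psi> where "\<Psi> A = (\<Sum>v\<in>?V. \<zeta> v * stays ?V A v)" for A
  have fE: "finite (possible_edges S)" "finite (possible_edges W)" "finite (cross S W)"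
    using fin by (simp_all add: finite_possible_edges finite_cross)
  have sgS: "\<bar>sum (sg w) S\<bar> \<le> 1" for w
    using bal by (simp add: sg_def flip: sum_distrib_left)
  have sgSv: "\<bar>sum (sg v) (S - {v})\<bar> \<le> 1" if "v \<in> S" for v
  proof -
    have "sum (sg v) (S - {v}) = sum (sg v) S - sg v v" using that fin by (simp add: sum_diff1)
    moreover have "sum (sg v) S = 0" using bal by (simp add: sg_def flip: sum_distrib_left)
    ultimately show ?thesis using sg[of v v] by auto
  qed
  have key: "norm (mean (cross S W) (\<lambda>C. cis (\<Psi> (A \<union> (B \<union> C)))))
    \<le> 12 * card W * e + (\<Sum>v\<in>S. of_bool (big A v)) + of_bool (small B) + q"
    if A: "A \<subseteq> possible_edges S" and B: "B \<subseteq> possible_edges W" for A B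
  proof -
    define Y where "Y = Good B"
    define X where "X = W - Y"
    have XY: "finite X" "finite Y" "X \<inter> Y = {}" "X \<union> Y = W" "S \<inter> X = {}" "S \<inter> Y = {}"
      using fin by (auto simp: X_def Y_def Good_def)
    have cXY: "cross S W = cross S X \<union> cross S Y" using cross_Un_right[of S X Y] XY by simp
    have cdis: "cross S X \<inter> cross S Y = {}"
      using XY fin(3) by (auto simp: cross_def star_def doubleton_eq_iff)
    define c0 where "c0 = (\<Sum>w\<in>Y. \<zeta> w * of_bool (0 \<le> disc W B w))"
    define c1 where "c1 C = (\<Sum>w\<in>X. \<zeta> w * of_bool (0 \<le> disc W B w + sum (sg w) (nbrs S C w)))" for C
    define c2 where "c2 C = (\<Sum>v\<in>S. \<zeta> v * of_bool (0 \<le> disc S A v + sum (sg v) (nbrs W C v)))" for C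
    \<comment> \<open>The phase with the indicators on \<open>Y\<close> frozen. It is defined for
      every \<open>C\<close>, so independence of the edges can be used without conditioning on the
      shifts being small.\<close>
    define \<Psi>' where "\<Psi>' C = c0 + c1 C + c2 C" for C
    have diff: "norm (cis (\<Psi> (A \<union> (B \<union> C))) - cis (\<Psi>' C)) \<le> (\<Sum>w\<in>W. 2 * of_bool (\<theta> < \<bar>real_of_int (sum (sg w) (nbrs S C w))\<bar>))"
      if C: "C \<subseteq> cross S W" for C
    proof (cases "\<exists>w\<in>W. \<theta> < \<bar>real_of_int (sum (sg w) (nbrs S C w))\<bar>")
      case True
      then obtain w where w: "w \<in> W" "\<theta> < \<bar>real_of_int (sum (sg w) (nbrs S C w))\<bar>" by auto
      have "norm (cis (\<Psi> (A \<union> (B \<union> C))) - cis (\<Psi>' C)) \<le> 2"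
        using norm_triangle_ineq4[of "cis (\<Psi> (A \<union> (B \<union> C)))" "cis (\<Psi>' C)"] by simp
      also have "\<dots> = (\<Sum>w\<in>{w}. 2 * of_bool (\<theta> < \<bar>real_of_int (sum (sg w) (nbrs S C w))\<bar>))" using w by simp
      also have "\<dots> \<le> (\<Sum>w\<in>W. 2 * of_bool (\<theta> < \<bar>real_of_int (sum (sg w) (nbrs S C w))\<bar>))"
        using w fin by (intro sum_mono2) auto
      finally show ?thesis .
    next
      case False
      have "\<Psi> (A \<union> (B \<union> C)) = (\<Sum>v\<in>S. \<zeta> v * stays ?V (A \<union> (B \<union> C)) v) + (\<Sum>w\<in>W. \<zeta> w * stays ?V (A \<union> (B \<union> C)) w)"
        unfolding \<Psi>_def using fin by (intro sum.union_disjoint) auto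
      also have "(\<Sum>v\<in>S. \<zeta> v * stays ?V (A \<union> (B \<union> C)) v) = c2 C"
        unfolding c2_def stays_def by (intro sum.cong refl) (simp add: disc_cross_left[OF fin A B C])
      also have "(\<Sum>w\<in>W. \<zeta> w * stays ?V (A \<union> (B \<union> C)) w) = (\<Sum>w\<in>X. \<zeta> w * stays ?V (A \<union> (B \<union> C)) w) + (\<Sum>w\<in>Y. \<zeta> w * stays ?V (A \<union> (B \<union> C)) w)"
        using XY by (subst XY(4)[symmetric], intro sum.union_disjoint) auto
      also have "(\<Sum>w\<in>X. \<zeta> w * stays ?V (A \<union> (B \<union> C)) w) = c1 C"
        unfolding c1_def stays_def by (intro sum.cong refl) (simp add: disc_cross_right[OF fin A B C] X_def)
      also have "(\<Sum>w\<in>Y. \<zeta> w * stays ?V (A \<union> (B \<union> C)) w) = c0"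
        unfolding c0_def stays_def
      proof (intro sum.cong refl)
        fix w assume "w \<in> Y"
        then have w: "w \<in> W" "\<theta> < \<bar>real_of_int (disc W B w)\<bar>" by (auto simp: Y_def Good_def)
        moreover have "\<not> \<theta> < \<bar>real_of_int (sum (sg w) (nbrs S C w))\<bar>" using False w(1) by blast
        ultimately have "\<bar>real_of_int (sum (sg w) (nbrs S C w))\<bar> < \<bar>real_of_int (disc W B w)\<bar>" by linarith
        then have "\<bar>sum (sg w) (nbrs S C w)\<bar> < \<bar>disc W B w\<bar>" by linarith
        then have "(0 \<le> disc W B w + sum (sg w) (nbrs S C w)) = (0 \<le> disc W B w)" by linarith
        then show "\<zeta> w * of_bool (0 \<le> disc ?V (A \<union> (B \<union> C)) w) = \<zeta> w * of_bool (0 \<le> disc W B w)"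
          using disc_cross_right[OF fin A B C w(1)] by simp
      qed
      finally have "\<Psi> (A \<union> (B \<union> C)) = \<Psi>' C" by (simp add: \<Psi>'_def)
      then show ?thesis by (simp add: sum_nonneg)
    qed
    have "norm (mean (cross S W) (\<lambda>C. cis (\<Psi> (A \<union> (B \<union> C)))) - mean (cross S W) (\<lambda>C. cis (\<Psi>' C)))
      \<le> mean (cross S W) (\<lambda>C. \<Sum>w\<in>W. 2 * of_bool (\<theta> < \<bar>real_of_int (sum (sg w) (nbrs S C w))\<bar>))"
      by (rule order_trans[OF norm_mean_diff_le mean_mono[OF diff]])
    also have "\<dots> = (\<Sum>w\<in>W. 2 * mean S (\<lambda>T. of_bool (\<theta> < \<bar>real_of_int (sum (sg w) T)\<bar>)))"
      unfolding mean_sum mean_mult_left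
    proof (intro sum.cong refl arg_cong2[where f = "(*)"])
      fix w assume "w \<in> W"
      then show "mean (cross S W) (\<lambda>C. of_bool (\<theta> < \<bar>real_of_int (sum (sg w) (nbrs S C w))\<bar>)) = mean S (\<lambda>T. of_bool (\<theta> < \<bar>real_of_int (sum (sg w) T)\<bar>) :: real)"
        unfolding cross_commute[of S W] using fin
        by (intro mean_cross_single[where f = "\<lambda>T. of_bool (\<theta> < \<bar>real_of_int (sum (sg w) T)\<bar>)"]) auto
    qed
    also have "\<dots> \<le> (\<Sum>w\<in>W. 2 * (6 * e))"
      unfolding e_def using fin sg S0 \<theta> sgS by (intro sum_mono mult_left_mono mean_sum_tail) auto
    finally have D: "norm (mean (cross S W) (\<lambda>C. cis (\<Psi> (A \<union> (B \<union> C)))) - mean (cross S W) (\<lambda>C. cis (\<Psi>' C))) \<le> 12 * card W * e"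
      by simp
    have M: "norm (mean (cross S W) (\<lambda>C. cis (\<Psi>' C))) \<le> (\<Sum>v\<in>S. of_bool (big A v)) + of_bool (small B) + q"
    proof (cases "(\<exists>v\<in>S. big A v) \<or> small B")
      case True
      \<comment> \<open>On an exceptional event the trivial bound 1 is paid for by its
        indicator.\<close>
      have le1: "norm (mean (cross S W) (\<lambda>C. cis (\<Psi>' C))) \<le> 1"
        using fE by (intro order_trans[OF norm_mean_le] mean_le_const) auto
      have q0: "0 \<le> q" by (simp add: q_def)
      show ?thesis
      proof (cases "small B")
        case True
        have "0 \<le> (\<Sum>v\<in>S. of_bool (big A v) :: real)" by (intro sum_nonneg) simp
        then show ?thesis using le1 q0 True by simp
      next
        case False
        then obtain v where v: "v \<in> S" "big A v" using True by auto
        have "1 = (\<Sum>v\<in>{v}. of_bool (big A v) :: real)" using v by simp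
        also have "\<dots> \<le> (\<Sum>v\<in>S. of_bool (big A v))" using v fin by (intro sum_mono2) auto
        finally have "1 \<le> (\<Sum>v\<in>S. of_bool (big A v) :: real)" .
        then show ?thesis using le1 q0 False by (simp only: of_bool_eq)
      qed
    next
      case False
      then have nb: "\<And>v. v \<in> S \<Longrightarrow> \<bar>real_of_int (disc S A v)\<bar> \<le> \<theta>" and ns: "G \<le> card Y"
        by (auto simp: big_def small_def Y_def not_less)
      have Yne: "Y \<noteq> {}" using ns G by auto
      \<comment> \<open>The edges to \<open>X\<close> are revealed first. They determine
        \<open>c1\<close>, and the edges to \<open>Y\<close> then enter only through the
        discrepancies of \<open>S\<close>.\<close>
      have "mean (cross S W) (\<lambda>C. cis (\<Psi>' C)) = mean (cross S X) (\<lambda>C1. mean (cross S Y) (\<lambda>C2. cis (\<Psi>' (C1 \<union> C2))))"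
        unfolding cXY by (rule mean_Un[OF finite_cross[OF fin(1) XY(1)] finite_cross[OF fin(1) XY(2)] cdis])
      also have "\<dots> = mean (cross S X) (\<lambda>C1. cis (c0 + c1 C1) * (\<Prod>v\<in>S. mean Y (\<lambda>T'. cis (\<zeta> v * of_bool (0 \<le> disc S A v + sum (sg v) (nbrs X C1 v \<union> T'))))))"
      proof (intro mean_cong)
        fix C1 assume C1: "C1 \<subseteq> cross S X"
        have "mean (cross S Y) (\<lambda>C2. cis (\<Psi>' (C1 \<union> C2))) =
          mean (cross S Y) (\<lambda>C2. cis (c0 + c1 C1) * (\<Prod>v\<in>S. cis (\<zeta> v * of_bool (0 \<le> disc S A v + sum (sg v) (nbrs X C1 v \<union> nbrs Y C2 v)))))"
        proof (intro mean_cong)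
          fix C2 assume C2: "C2 \<subseteq> cross S Y"
          have 1: "nbrs S (C1 \<union> C2) w = nbrs S C1 w" if w: "w \<in> X" for w
          proof -
            have "{w, v} \<notin> C2" if "v \<in> S" for v
              using pair_in_cross[OF XY(6), of w v] C2 w that XY(3,5) fin(3) by auto
            then show ?thesis by (auto simp: nbrs_def)
          qed
          have 2: "nbrs W (C1 \<union> C2) v = nbrs X C1 v \<union> nbrs Y C2 v" if v: "v \<in> S" for v
          proof -
            have "{v, w} \<notin> C2" if "w \<in> X" for w
              using pair_in_cross[OF XY(6), of v w] C2 v that XY(3,5,6) by auto
            moreover have "{v, w} \<notin> C1" if "w \<in> Y" for w
              using pair_in_cross[OF XY(5), of v w] C1 v that XY(3,5,6) by auto
            ultimately show ?thesis using XY(4) by (auto simp: nbrs_def)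
          qed
          have "c1 (C1 \<union> C2) = c1 C1" unfolding c1_def by (intro sum.cong refl) (simp add: 1)
          moreover have "c2 (C1 \<union> C2) = (\<Sum>v\<in>S. \<zeta> v * of_bool (0 \<le> disc S A v + sum (sg v) (nbrs X C1 v \<union> nbrs Y C2 v)))"
            unfolding c2_def by (intro sum.cong refl) (simp add: 2)
          ultimately have "\<Psi>' (C1 \<union> C2) = (c0 + c1 C1) + (\<Sum>v\<in>S. \<zeta> v * of_bool (0 \<le> disc S A v + sum (sg v) (nbrs X C1 v \<union> nbrs Y C2 v)))"
            unfolding \<Psi>'_def by (simp only:)
          moreover have "cis (a + (\<Sum>v\<in>S. f v)) = cis a * (\<Prod>v\<in>S. cis (f v))" for a f
            using fin(1) by (induction S arbitrary: a rule: finite_induct) (simp_all add: cis_mult[symmetric] mult.assoc[symmetric] add.assoc[symmetric])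
          ultimately show "cis (\<Psi>' (C1 \<union> C2)) = cis (c0 + c1 C1) * (\<Prod>v\<in>S. cis (\<zeta> v * of_bool (0 \<le> disc S A v + sum (sg v) (nbrs X C1 v \<union> nbrs Y C2 v))))"
            by (simp only:)
        qed
        also have "\<dots> = cis (c0 + c1 C1) * (\<Prod>v\<in>S. mean Y (\<lambda>T'. cis (\<zeta> v * of_bool (0 \<le> disc S A v + sum (sg v) (nbrs X C1 v \<union> T')))))"
          unfolding mean_mult_left using mean_cross[OF fin(1) XY(2,6), of "\<lambda>v T'. cis (\<zeta> v * of_bool (0 \<le> disc S A v + sum (sg v) (nbrs X C1 v \<union> T')))"]
          by (simp only:)
        finally show "mean (cross S Y) (\<lambda>C2. cis (\<Psi>' (C1 \<union> C2))) = cis (c0 + c1 C1) * (\<Prod>v\<in>S. mean Y (\<lambda>T'. cis (\<zeta> v * of_bool (0 \<le> disc S A v + sum (sg v) (nbrs X C1 v \<union> T')))))" .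
      qed
      finally have eq: "mean (cross S W) (\<lambda>C. cis (\<Psi>' C)) = mean (cross S X) (\<lambda>C1. cis (c0 + c1 C1) * (\<Prod>v\<in>S. mean Y (\<lambda>T'. cis (\<zeta> v * of_bool (0 \<le> disc S A v + sum (sg v) (nbrs X C1 v \<union> T'))))))" .
      have "norm (mean (cross S W) (\<lambda>C. cis (\<Psi>' C))) \<le> mean (cross S X) (\<lambda>C1. norm (cis (c0 + c1 C1) * (\<Prod>v\<in>S. mean Y (\<lambda>T'. cis (\<zeta> v * of_bool (0 \<le> disc S A v + sum (sg v) (nbrs X C1 v \<union> T')))))))"
        unfolding eq by (rule norm_mean_le)
      also have "\<dots> = mean (cross S X) (\<lambda>C1. \<Prod>v\<in>S. norm (mean Y (\<lambda>T'. cis (\<zeta> v * of_bool (0 \<le> disc S A v + sum (sg v) (nbrs X C1 v \<union> T'))))))"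
        by (simp only: norm_mult norm_cis mult_1 prod_norm)
      also have "\<dots> = (\<Prod>v\<in>S. mean X (\<lambda>T. norm (mean Y (\<lambda>T'. cis (\<zeta> v * of_bool (0 \<le> disc S A v + sum (sg v) (T \<union> T')))))))"
        using mean_cross[OF fin(1) XY(1,5), of "\<lambda>v T. norm (mean Y (\<lambda>T'. cis (\<zeta> v * of_bool (0 \<le> disc S A v + sum (sg v) (T \<union> T')))))"]
        by (simp only:)
      also have "\<dots> \<le> (\<Prod>v\<in>S. if v \<in> S' then exp (- (2 / pi\<^sup>2 * z\<^sup>2 * pq * G * \<kappa>\<^sup>2)) else 1)"
      proof (intro prod_mono conjI)
        fix v assume v: "v \<in> S"
        show "mean X (\<lambda>T. norm (mean Y (\<lambda>T'. cis (\<zeta> v * of_bool (0 \<le> disc S A v + sum (sg v) (T \<union> T'))))))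
          \<le> (if v \<in> S' then exp (- (2 / pi\<^sup>2 * z\<^sup>2 * pq * G * \<kappa>\<^sup>2)) else 1)"
        proof (cases "v \<in> S'")
          case True
          have "mean X (\<lambda>T. norm (mean Y (\<lambda>T'. cis (\<zeta> v * of_bool (0 \<le> disc S A v + sum (sg v) (T \<union> T'))))))
            \<le> exp (- (2 / pi\<^sup>2 * (\<zeta> v)\<^sup>2 * pq * card Y * \<kappa>\<^sup>2))"
          proof (rule mean_norm_cis_nonneg_le[OF XY(1-3) Yne sg z(3)[OF True] \<kappa>(1)])
            fix w assume w: "w \<in> Y"
            \<comment> \<open>The discrepancy inside \<open>S\<close> shifts the critical value,
              which is why the window has radius \<open>\<theta> + 1\<close>.\<close>
            have "\<bar>real_of_int (crit (sg v w) - disc S A v)\<bar> \<le> \<theta> + 1"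
              using nb[OF v] by (auto simp: crit_def)
            then show "\<kappa> \<le> pp (X \<union> Y - {w}) (sg v) (crit (sg v w) - disc S A v)"
              unfolding XY(4) using True w XY by (intro \<kappa>(2)) auto
          qed
          also have "\<dots> \<le> exp (- (2 / pi\<^sup>2 * z\<^sup>2 * pq * G * \<kappa>\<^sup>2))"
          proof -
            have "z\<^sup>2 \<le> (\<zeta> v)\<^sup>2" using z(1) z(2)[OF True] by (simp add: abs_le_square_iff[symmetric])
            then have "2 / pi\<^sup>2 * z\<^sup>2 * pq * G * \<kappa>\<^sup>2 \<le> 2 / pi\<^sup>2 * (\<zeta> v)\<^sup>2 * pq * card Y * \<kappa>\<^sup>2"
              using ns G pq_pos by (intro mult_mono) auto
            then show ?thesis by simp
          qed
          finally show ?thesis using True by simp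
        next
          case False
          have "norm (mean Y (\<lambda>T'. cis (\<zeta> v * of_bool (0 \<le> disc S A v + sum (sg v) (T \<union> T'))))) \<le> 1" for T
            using XY by (intro order_trans[OF norm_mean_le] mean_le_const) auto
          then show ?thesis using False XY by (auto intro!: mean_le_const)
        qed
      qed (auto intro!: mean_nonneg)
      also have "\<dots> = (\<Prod>v\<in>S'. exp (- (2 / pi\<^sup>2 * z\<^sup>2 * pq * G * \<kappa>\<^sup>2)))"
        using fin S' by (intro prod.mono_neutral_cong_right) auto
      also have "\<dots> = q" by (simp add: q_def flip: exp_of_nat_mult)
      finally show ?thesis by (simp add: sum_nonneg add_increasing)
    qed
    show ?thesis using norm_triangle_sub[of "mean (cross S W) (\<lambda>C. cis (\<Psi> (A \<union> (B \<union> C))))" "mean (cross S W) (\<lambda>C. cis (\<Psi>' C))"] D M by linarith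
  qed
  have big: "mean (possible_edges S) (\<lambda>A. of_bool (big A v)) \<le> 6 * e" if v: "v \<in> S" for v
  proof -
    have "mean (possible_edges S) (\<lambda>A. of_bool (big A v) :: real) = mean (S - {v}) (\<lambda>T. of_bool (\<theta> < \<bar>real_of_int (sum (sg v) T)\<bar>))"
      unfolding big_def by (rule disc_insert_edges_self[OF fin(1) v])
    also have "\<dots> \<le> 6 * e"
      unfolding e_def using fin sg S0 \<theta> sgSv[OF v] by (intro mean_sum_tail) (auto intro: card_Diff1_le)
    finally show ?thesis .
  qed
  have "norm (mean (possible_edges ?V) (\<lambda>A. cis (\<Psi> A)))
    \<le> mean (possible_edges S) (\<lambda>A. mean (possible_edges W) (\<lambda>B. norm (mean (cross S W) (\<lambda>C. cis (\<Psi> (A \<union> (B \<union> C)))))))"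
    unfolding mean_edges_Un[OF fin]
    by (rule order_trans[OF norm_mean_le], intro mean_mono, rule norm_mean_le)
  also have "\<dots> \<le> mean (possible_edges S) (\<lambda>A. mean (possible_edges W) (\<lambda>B. 12 * card W * e + (\<Sum>v\<in>S. of_bool (big A v)) + of_bool (small B) + q))"
    by (intro mean_mono key)
  also have "\<dots> = 12 * card W * e + (\<Sum>v\<in>S. mean (possible_edges S) (\<lambda>A. of_bool (big A v))) + mean (possible_edges W) (\<lambda>B. of_bool (small B)) + q"
    by (simp only: mean_add mean_sum mean_const[OF fE(1)] mean_const[OF fE(2)])
  also have "\<dots> \<le> 12 * card W * e + (\<Sum>v\<in>S. 6 * e) + \<eta> + q"
    using \<eta> unfolding small_def Good_def by (intro add_mono order_refl sum_mono big) auto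
  also have "\<dots> = (12 * card W + 6 * card S) * e + \<eta> + q" by (simp add: algebra_simps)
  finally show ?thesis by (simp add: \<Psi>_def e_def q_def)
qed

end

section \<open>Asymptotics for two sides of almost equal size\<close>

context bernoulli_bits
begin

text \<open>A bijection between the positive and the negative bits reverses the sign of the sum. So
  being nonnegative and being nonpositive are equally likely, and these two events overlap exactly
  in the ties.\<close>

lemma mean_nonneg_balanced:
  assumes J: "finite J" "\<And>e. e \<in> J \<Longrightarrow> s e = 1 \<or> s e = - 1"
    and bal: "card {e \<in> J. s e = 1} = card {e \<in> J. s e = - 1}"
  shows "mean J (\<lambda>T. of_bool (0 \<le> sum s T)) = 1/2 + pp J s 0 / 2"
proof -
  let ?A = "{e \<in> J. s e = 1}" and ?B = "{e \<in> J. s e = - 1}"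
  obtain f where f: "bij_betw f ?A ?B" using bal J(1) finite_same_card_bij[of ?A ?B] by auto
  define h where "h e = (if s e = 1 then f e else the_inv_into ?A f e)" for e
  have fi: "f e \<in> ?B" if "e \<in> ?A" for e using f that by (auto simp: bij_betw_def)
  have gi: "the_inv_into ?A f e \<in> ?A" "f (the_inv_into ?A f e) = e" if "e \<in> ?B" for e
    using that f the_inv_into_into[of f ?A e ?A] f_the_inv_into_f_bij_betw[OF f] by (auto simp: bij_betw_def)
  have hJ: "h e \<in> J" "s (h e) = - s e" if "e \<in> J" for e
    using J(2)[OF that] fi[of e] gi[of e] that by (auto simp: h_def)
  have inj: "inj_on h J"
  proof (rule inj_onI)
    fix x y assume xy: "x \<in> J" "y \<in> J" "h x = h y"
    then have sxy: "s x = s y" using hJ(2)[of x] hJ(2)[of y] by simp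
    show "x = y"
    proof (cases "s x = 1")
      case True
      then show ?thesis using xy sxy f by (auto simp: h_def bij_betw_def inj_on_def)
    next
      case False
      then have xB: "x \<in> ?B" and yB: "y \<in> ?B" using J(2) xy sxy by auto
      have "the_inv_into ?A f x = the_inv_into ?A f y" using xy(3) sxy False by (simp add: h_def)
      then have "f (the_inv_into ?A f x) = f (the_inv_into ?A f y)" by (rule arg_cong)
      then show ?thesis unfolding gi(2)[OF xB] gi(2)[OF yB] .
    qed
  qed
  have img: "h ` J = J" using inj hJ(1) J(1) by (intro endo_inj_surj) auto
  have "mean J (\<lambda>T. of_bool (0 \<le> sum s T) :: real) = mean (h ` J) (\<lambda>T. of_bool (0 \<le> sum s T))" by (simp only: img)
  also have "\<dots> = mean J (\<lambda>T. of_bool (0 \<le> sum s (h ` T)))" by (rule mean_image[OF J(1) inj])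
  also have "\<dots> = mean J (\<lambda>T. of_bool (sum s T \<le> 0))"
  proof (intro mean_cong)
    fix T assume T: "T \<subseteq> J"
    have "sum s (h ` T) = (\<Sum>e\<in>T. s (h e))" using inj T by (subst sum.reindex) (auto intro: inj_on_subset)
    also have "\<dots> = - sum s T" unfolding sum_negf[symmetric] using T hJ(2) by (intro sum.cong) auto
    finally show "(of_bool (0 \<le> sum s (h ` T)) :: real) = of_bool (sum s T \<le> 0)" by simp
  qed
  finally have sym: "mean J (\<lambda>T. of_bool (0 \<le> sum s T) :: real) = mean J (\<lambda>T. of_bool (sum s T \<le> 0))" .
  have "mean J (\<lambda>T. of_bool (0 \<le> sum s T) :: real) + mean J (\<lambda>T. of_bool (sum s T \<le> 0)) = mean J (\<lambda>T. 1 + of_bool (sum s T = 0))"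
    unfolding mean_add[symmetric] by (intro mean_cong) auto
  also have "\<dots> = 1 + pp J s 0" using J by (simp add: mean_add pp_def)
  finally show ?thesis using sym by simp
qed

text \<open>Each further bit of sign \<open>c\<close> moves the probability by \<open>p * c\<close>
  times a point probability near \<open>k\<close>.\<close>

lemma mean_nonneg_add_bits:
  fixes k \<epsilon> :: real
  assumes "finite F" "finite J" "F \<inter> J = {}" "\<And>e. e \<in> F \<Longrightarrow> s e = c" "c = 1 \<or> c = - 1"
    "\<And>J'. J \<subseteq> J' \<Longrightarrow> J' \<subseteq> J \<union> F \<Longrightarrow> \<bar>pp J' s (crit c) - k\<bar> \<le> \<epsilon>"
  shows "\<bar>mean (J \<union> F) (\<lambda>T. of_bool (0 \<le> sum s T)) - mean J (\<lambda>T. of_bool (0 \<le> sum s T)) - p * of_int c * card F * k\<bar> \<le> card F * \<epsilon>"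
  using assms(1,3,4,6)
proof (induction F rule: finite_induct)
  case (insert w F)
  let ?h = "\<lambda>T. of_bool (0 \<le> sum s T) :: real"
  let ?J = "J \<union> F"
  have fJ: "finite ?J" "w \<notin> ?J" using insert assms(2) by auto
  have sw: "s w = c" using insert by auto
  have IH: "\<bar>mean ?J ?h - mean J ?h - p * of_int c * card F * k\<bar> \<le> card F * \<epsilon>"
  proof (rule insert.IH)
    show "F \<inter> J = {}" using insert.prems(1) by auto
    show "s e = c" if "e \<in> F" for e using insert.prems(2) that by auto
    show "\<bar>pp J' s (crit c) - k\<bar> \<le> \<epsilon>" if "J \<subseteq> J'" "J' \<subseteq> J \<union> F" for J'
      using insert.prems(3)[of J'] that by auto
  qed
  have d: "mean ?J (\<lambda>T. ?h (insert w T)) - mean ?J ?h = of_int c * pp ?J s (crit c)"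
    using mean_nonneg_sum_diff[OF fJ, of s 0] sw assms(5) by simp
  have "mean (J \<union> insert w F) ?h = (1 - p) * mean ?J ?h + p * mean ?J (\<lambda>T. ?h (insert w T))"
    using mean_insert[OF fJ, of ?h] by simp
  also have "\<dots> = mean ?J ?h + p * (mean ?J (\<lambda>T. ?h (insert w T)) - mean ?J ?h)" by (simp add: algebra_simps)
  finally have e: "mean (J \<union> insert w F) ?h = mean ?J ?h + p * of_int c * pp ?J s (crit c)" by (simp only: d mult.assoc)
  have pe: "\<bar>pp ?J s (crit c) - k\<bar> \<le> \<epsilon>" by (rule insert.prems(3)) auto
  have "\<bar>p * of_int c * (pp ?J s (crit c) - k)\<bar> \<le> 1 * 1 * \<epsilon>"
    unfolding abs_mult using p_pos p_less_1 assms(5) pe by (intro mult_mono) auto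
  moreover have "mean (J \<union> insert w F) ?h - mean J ?h - p * of_int c * card (insert w F) * k
     = (mean ?J ?h - mean J ?h - p * of_int c * card F * k) + p * of_int c * (pp ?J s (crit c) - k)"
    using insert.hyps unfolding e by (simp add: algebra_simps)
  ultimately show ?case using IH insert.hyps by (simp add: algebra_simps)
qed simp

end

text \<open>All error terms are expressed in powers of \<open>u\<close>, the hundredth root of \<open>n\<close>.\<close>

locale two_sides = bernoulli_bits p for p :: real +
  fixes R B :: "'a set" and n \<Delta> :: nat and u :: real
  assumes finite_R: "finite R" and finite_B: "finite B" and disjoint: "R \<inter> B = {}"
    and card_R: "card R = n + \<Delta>" and card_B: "card B = n"
    and u_ge: "1000 \<le> u" and n_eq: "real n = u ^ 100" and u_pq: "1 \<le> u * pq" and u_Delta: "\<Delta> + 20 \<le> u"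
begin

definition side :: "'a \<Rightarrow> int" where "side v = (if v \<in> R then 1 else - 1)"

definition VV :: "'a set" where "VV = R \<union> B"

lemma card_VV: "card VV = 2 * n + \<Delta>"
  using card_Un_disjoint[OF finite_R finite_B disjoint] by (simp add: VV_def card_R card_B)

lemma n_ge: "u ^ 2 \<le> n" "1000000 \<le> real n"
proof -
  have "u ^ 2 \<le> u ^ 100" using u_ge by (intro power_increasing) auto
  then show "u ^ 2 \<le> n" by (simp only: n_eq)
  have "1000 ^ 2 \<le> u ^ 2" using u_ge by (intro power_mono) auto
  with \<open>u ^ 2 \<le> n\<close> show "1000000 \<le> real n" by simp
qed

lemma sqrt_n: "sqrt n = u ^ 50"
proof -
  have "(u ^ 50)\<^sup>2 = u ^ 100" by (simp flip: power_mult)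
  then show ?thesis using u_ge n_eq by (intro real_sqrt_unique) auto
qed

lemma pq_n: "u \<le> pq * n"
proof -
  have "u * 1 \<le> u * (u * pq)" using u_pq u_ge by (intro mult_left_mono) auto
  also have "\<dots> = u ^ 2 * pq" by (simp add: power2_eq_square)
  also have "\<dots> \<le> n * pq" using n_ge pq_pos by (intro mult_right_mono) auto
  finally show ?thesis by (simp add: mult.commute)
qed

lemma Delta_le: "real \<Delta> \<le> u" "real \<Delta> \<le> n"
proof -
  show 1: "real \<Delta> \<le> u" using u_Delta by linarith
  have "u * 1 \<le> u * u" using u_ge by (intro mult_left_mono) auto
  then show "real \<Delta> \<le> n" using 1 n_ge(1) by (simp add: power2_eq_square)
qed

lemma one_le_u_pi_pq: "1 \<le> u * sqrt (pi * pq)"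
proof -
  have "1 * 1 \<le> u * pi" using u_ge pi_gt3 by (intro mult_mono) auto
  then have "1 * 1 \<le> (u * pi) * (u * pq)" using u_pq by (intro mult_mono) auto
  then have "1 \<le> sqrt (u\<^sup>2 * (pi * pq))" by (simp add: power2_eq_square mult_ac)
  then show ?thesis using u_ge by (simp add: real_sqrt_mult)
qed

sublocale majority_graph p side VV
proof
  show "side v = 1 \<or> side v = - 1" for v by (simp add: side_def)
  show "finite VV" using finite_R finite_B by (simp add: VV_def)
  show "16 \<le> card VV" using n_ge by (simp add: card_VV)
  have "4 \<le> pq * n" using pq_n u_ge by linarith
  also have "\<dots> \<le> pq * card VV" using pq_pos by (intro mult_left_mono) (auto simp: card_VV)
  finally show "4 \<le> pq * card VV" .
qed

text \<open>The density at 0 of the normal law of variance \<open>2 * pq * n\<close>, which is the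
  limiting point probability of a discrepancy.\<close>

definition kap :: real where "kap = 1 / (2 * sqrt (pi * pq * n))"

lemma kap_pos: "0 < kap" and kap_le: "kap \<le> u / sqrt n"
proof -
  have n0: "0 < real n" using n_ge by linarith
  then show "0 < kap" using pq_pos by (simp add: kap_def)
  have "1 \<le> u * sqrt (pi * pq)" by (rule one_le_u_pi_pq)
  moreover have "0 < sqrt (pi * pq)" using pq_pos by simp
  ultimately have "1 / sqrt (pi * pq) \<le> u" by (simp add: field_simps)
  then have "1 / (2 * sqrt (pi * pq)) \<le> u" using \<open>0 < sqrt (pi * pq)\<close> u_ge by (simp add: field_simps)
  then have "1 / (2 * sqrt (pi * pq)) / sqrt n \<le> u / sqrt n" by (intro divide_right_mono) auto
  then show "kap \<le> u / sqrt n" by (simp add: kap_def real_sqrt_mult mult.assoc)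
qed

lemma sg_plus: "v \<in> R \<Longrightarrow> J \<subseteq> VV \<Longrightarrow> {w \<in> J. sg v w = 1} = J \<inter> R" "v \<in> R \<Longrightarrow> J \<subseteq> VV \<Longrightarrow> {w \<in> J. sg v w = - 1} = J \<inter> B"
  "v \<in> B \<Longrightarrow> J \<subseteq> VV \<Longrightarrow> {w \<in> J. sg v w = 1} = J \<inter> B" "v \<in> B \<Longrightarrow> J \<subseteq> VV \<Longrightarrow> {w \<in> J. sg v w = - 1} = J \<inter> R"
  using disjoint unfolding sg_def side_def VV_def by (auto split: if_splits)

text \<open>The hypotheses are symmetric in the two sides, since red counts positively for a red
  vertex and blue for a blue one. \<open>K\<close> bounds the number of unpaired vertices.\<close>

lemma pp_near_general:
  fixes M K :: nat
  assumes "v \<in> VV" "J \<subseteq> VV" "M \<le> card (J \<inter> R)" "M \<le> card (J \<inter> B)" "n \<le> 2 * M"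
    and K: "card (J \<inter> R) + card (J \<inter> B) \<le> 2 * M + K"
  shows "\<bar>pp J (sg v) j - 1 / (2 * sqrt (pi * pq * M))\<bar> \<le> (real K + \<bar>real_of_int j\<bar> + 12) / (pq * M)"
proof -
  have fJ: "finite J" using assms(2) finite_V by (rule finite_subset)
  have pM: "1 \<le> pq * M"
  proof -
    have "pq * n \<le> pq * (2 * M)" using assms(5) pq_pos by (intro mult_left_mono) auto
    then show ?thesis using pq_n u_ge by simp
  qed
  have M2: "2 \<le> M" using assms(5) n_ge by linarith
  obtain k l where kl: "card {w \<in> J. sg v w = 1} = M + k" "card {w \<in> J. sg v w = - 1} = M + l"
    and s: "real k + real l = card (J \<inter> R) + card (J \<inter> B) - 2 * real M"
  proof (cases "v \<in> R")
    case True
    show ?thesis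
      by (rule that[of "card (J \<inter> R) - M" "card (J \<inter> B) - M"])
         (use assms True sg_plus(1,2)[OF True assms(2)] in \<open>auto simp: of_nat_diff\<close>)
  next
    case False
    then have "v \<in> B" using assms by (auto simp: VV_def)
    show ?thesis
      by (rule that[of "card (J \<inter> B) - M" "card (J \<inter> R) - M"])
         (use assms sg_plus(3,4)[OF \<open>v \<in> B\<close> assms(2)] in \<open>auto simp: of_nat_diff\<close>)
  qed
  have "\<bar>pp J (sg v) j - 1 / (2 * sqrt (pi * pq * M))\<bar> \<le> (real k + real l + \<bar>of_int j\<bar> + 12) / (pq * M)"
    using pp_local_limit[OF fJ sg kl M2 pM, of j] by simp
  also have "\<dots> \<le> (real K + \<bar>real_of_int j\<bar> + 12) / (pq * M)"
    using s K pM by (intro divide_right_mono) auto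
  finally show ?thesis .
qed

lemma pp_near:
  assumes "v \<in> VV" "J \<subseteq> VV" "n - 2 \<le> card (J \<inter> R)" "n - 2 \<le> card (J \<inter> B)" "\<bar>j\<bar> \<le> 1"
  shows "\<bar>pp J (sg v) j - kap\<bar> \<le> 6 * u\<^sup>2 / n"
proof -
  \<comment> \<open>The hypotheses allow two vertices of the smaller side to be missing.\<close>
  define M where "M = n - 2"
  have n2: "2 \<le> n" using n_ge by linarith
  have M: "real M = real n - 2" using n2 by (simp add: M_def of_nat_diff)
  have Mn: "real n / 2 \<le> M" "0 < real M" using n_ge by (auto simp: M)
  have n0: "0 < real n" using n_ge by linarith
  have "\<bar>pp J (sg v) j - 1 / (2 * sqrt (pi * pq * M))\<bar> \<le> (real (\<Delta> + 4) + \<bar>of_int j\<bar> + 12) / (pq * M)"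
  proof (rule pp_near_general[OF assms(1,2)])
    show "n \<le> 2 * M" using n_ge by (simp add: M_def)
    show "card (J \<inter> R) + card (J \<inter> B) \<le> 2 * M + (\<Delta> + 4)"
      using card_mono[OF finite_R, of "J \<inter> R"] card_mono[OF finite_B, of "J \<inter> B"] card_R card_B n2 by (simp add: M_def)
  qed (use assms in \<open>auto simp: M_def\<close>)
  also have "\<dots> \<le> u / (pq * M)"
    using assms(5) u_Delta pq_pos Mn by (intro divide_right_mono) (auto simp: M)
  also have "\<dots> \<le> u * (u / M)"
  proof -
    have "1 / pq \<le> u" using u_pq pq_pos by (simp add: field_simps)
    then have "u / M * (1 / pq) \<le> u / M * u" using u_ge Mn by (intro mult_left_mono) auto
    then show ?thesis by (simp add: mult_ac)
  qed
  also have "\<dots> \<le> u * (u / (n / 2))"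
    using u_ge Mn n0 by (intro mult_left_mono divide_left_mono) auto
  finally have 1: "\<bar>pp J (sg v) j - 1 / (2 * sqrt (pi * pq * M))\<bar> \<le> 2 * u\<^sup>2 / n" by (simp add: power2_eq_square)
  have 2: "\<bar>1 / (2 * sqrt (pi * pq * M)) - kap\<bar> \<le> u\<^sup>2 / n"
  proof -
    define x where "x = sqrt M"
    define y where "y = sqrt n"
    have x: "1 \<le> x" "x \<le> y" using n_ge by (auto simp: x_def y_def M)
    have xy: "y\<^sup>2 - x\<^sup>2 = 2" "y\<^sup>2 = n" using n_ge by (auto simp: x_def y_def M)
    have d: "1 / x - 1 / y = 2 / (x * y * (x + y))"
    proof -
      have "(y - x) * (x + y) = 2" using xy by (simp add: power2_eq_square algebra_simps)
      then have "y - x = 2 / (x + y)" using x by (simp add: eq_divide_eq)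
      moreover have "1 / x - 1 / y = (y - x) / (x * y)" using x by (simp add: diff_divide_distrib)
      ultimately show ?thesis by (simp add: mult.commute)
    qed
    have "2 / (x * y * (x + y)) \<le> 2 / (1 * y * y)"
      using x by (intro divide_left_mono mult_mono mult_pos_pos) auto
    then have d2: "0 \<le> 1 / x - 1 / y" "1 / x - 1 / y \<le> 2 / n"
      using d x xy by (auto simp: power2_eq_square intro!: divide_nonneg_nonneg)
    define a where "a = sqrt (pi * pq)"
    have a0: "0 < a" using pq_pos by (simp add: a_def)
    have au: "1 / a \<le> u"
    proof -
      have "1 \<le> u * a" unfolding a_def by (rule one_le_u_pi_pq)
      then show ?thesis using a0 by (simp add: field_simps)
    qed
    have "1 / (2 * sqrt (pi * pq * M)) - kap = (1 / a) * ((1 / x - 1 / y) / 2)"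
      by (simp add: kap_def real_sqrt_mult x_def y_def a_def algebra_simps)
    moreover have "0 \<le> (1 / a) * ((1 / x - 1 / y) / 2)" using a0 d2 by simp
    moreover have "(1 / a) * ((1 / x - 1 / y) / 2) \<le> u * ((2 / n) / 2)"
      using au d2 a0 u_ge by (intro mult_mono divide_right_mono) auto
    moreover have "u * ((2 / n) / 2) \<le> u\<^sup>2 / n"
      using u_ge n0 by (simp add: power2_eq_square divide_right_mono)
    ultimately show ?thesis by linarith
  qed
  have "0 \<le> u\<^sup>2 / n" by simp
  with 1 2 show ?thesis by linarith
qed

lemma card_Int_Diff_ge:
  "card X \<le> 2 \<Longrightarrow> finite X \<Longrightarrow> n - 2 \<le> card ((VV - X) \<inter> R)" "card X \<le> 2 \<Longrightarrow> finite X \<Longrightarrow> n - 2 \<le> card ((VV - X) \<inter> B)"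
proof -
  assume X: "card X \<le> 2" "finite X"
  have "(VV - X) \<inter> R = R - X" "(VV - X) \<inter> B = B - X" by (auto simp: VV_def)
  then show "n - 2 \<le> card ((VV - X) \<inter> R)" "n - 2 \<le> card ((VV - X) \<inter> B)"
    using diff_card_le_card_Diff[of X R] diff_card_le_card_Diff[of X B] X card_R card_B by auto
qed

lemma influence_near:
  assumes "v \<in> VV" shows "\<bar>influence VV v w - kap\<bar> \<le> 6 * u\<^sup>2 / n"
  unfolding influence_def
  by (intro pp_near assms card_Int_Diff_ge) (auto simp: card_insert_if crit_def)

text \<open>The size of the own side without \<open>v\<close>, minus the size of the other
  side.\<close>

definition excess :: "'a \<Rightarrow> real" where
  "excess v = (if v \<in> R then real \<Delta> - 1 else - real \<Delta> - 1)"

text \<open>1/2 by symmetry, half a point probability for the ties, and \<open>p * kap\<close> for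
  each surplus vertex on the own side.\<close>

definition limit_prob :: "'a \<Rightarrow> real" where
  "limit_prob v = 1/2 + kap * (p * excess v + 1/2)"

text \<open>Set aside a set \<open>F\<close> of \<bar>excess v\<bar> vertices of the side that is
  larger as seen from \<open>v\<close>. The rest is balanced and covered by
  \<open>mean_nonneg_balanced\<close>; then \<open>F\<close> is put back bit by bit. Every bit costs
  one error \<open>\<epsilon>\<close>, and there are fewer than \<open>u\<close> of them.\<close>

lemma stay_prob_near:
  assumes v: "v \<in> VV"
  shows "\<bar>stay_prob VV v - limit_prob v\<bar> \<le> 6 * u ^ 3 / n"
proof -
  define \<epsilon> where "\<epsilon> = 6 * u\<^sup>2 / n"
  have \<epsilon>0: "0 \<le> \<epsilon>" by (simp add: \<epsilon>_def)
  have n2: "2 \<le> n" using n_ge by linarith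
  have gen: "\<bar>stay_prob VV v - (1/2 + kap * (p * (of_int c * card F) + 1/2))\<bar> \<le> (1 + card F) * \<epsilon>"
    if J: "J \<union> F = VV - {v}" "J \<inter> F = {}" and c: "c = 1 \<or> c = - 1" and F: "\<And>w. w \<in> F \<Longrightarrow> sg v w = c"
      and bal: "card (J \<inter> R) = card (J \<inter> B)" and ge: "n - 2 \<le> card (J \<inter> R)" for J F :: "'a set" and c :: int
  proof -
    have fin: "finite J" "finite F" using J(1) finite_V by (metis finite_Diff finite_Un)+
    have sub: "J \<subseteq> VV" using J(1) by auto
    have bal': "card {w \<in> J. sg v w = 1} = card {w \<in> J. sg v w = - 1}"
    proof (cases "v \<in> R")
      case True then show ?thesis using sg_plus(1,2)[OF True sub] bal by simp
    next
      case False then have "v \<in> B" using v by (auto simp: VV_def)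
      then show ?thesis using sg_plus(3,4)[OF _ sub] bal by simp
    qed
    have near: "\<bar>pp J' (sg v) j - kap\<bar> \<le> \<epsilon>" if "J \<subseteq> J'" "J' \<subseteq> J \<union> F" "\<bar>j\<bar> \<le> 1" for J' j
    proof -
      have J'V: "J' \<subseteq> VV" using that J(1) by auto
      have "card (J \<inter> R) \<le> card (J' \<inter> R)" "card (J \<inter> B) \<le> card (J' \<inter> B)"
        using that finite_R finite_B by (auto intro!: card_mono)
      then show ?thesis unfolding \<epsilon>_def using ge bal that by (intro pp_near v J'V) auto
    qed
    have "\<bar>mean (J \<union> F) (\<lambda>T. of_bool (0 \<le> sum (sg v) T)) - mean J (\<lambda>T. of_bool (0 \<le> sum (sg v) T)) - p * of_int c * card F * kap\<bar> \<le> card F * \<epsilon>"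
      using c by (intro mean_nonneg_add_bits fin near F) (use J(2) in \<open>auto simp: crit_def\<close>)
    moreover have "mean J (\<lambda>T. of_bool (0 \<le> sum (sg v) T)) = 1/2 + pp J (sg v) 0 / 2"
      by (rule mean_nonneg_balanced[OF fin(1) sg bal'])
    moreover have "stay_prob VV v = mean (J \<union> F) (\<lambda>T. of_bool (0 \<le> sum (sg v) T))" unfolding stay_prob_def J(1) ..
    moreover have "\<bar>pp J (sg v) 0 - kap\<bar> \<le> \<epsilon>" by (intro near) auto
    ultimately show ?thesis using \<epsilon>0 by (simp add: algebra_simps abs_le_iff)
  qed
  have fin: "finite R" "finite B" by (fact finite_R finite_B)+
  have "\<exists>(c::int) (F::'a set). (c = 1 \<or> c = - 1) \<and> of_int c * real (card F) = excess v \<and> card F \<le> \<Delta> + 1 \<and>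
     \<bar>stay_prob VV v - (1/2 + kap * (p * (of_int c * card F) + 1/2))\<bar> \<le> (1 + card F) * \<epsilon>"
  proof (cases "v \<in> R")
    case True
    have cRv: "card (R - {v}) = n + \<Delta> - 1" using True fin card_R by simp
    have sgR: "sg v w = 1" if "w \<in> R" for w using True that by (simp add: sg_def side_def)
    have sgB: "sg v w = - 1" if "w \<in> B" for w using True that disjoint by (auto simp: sg_def side_def)
    show ?thesis
    proof (cases "\<Delta> = 0")
      case False
      have "\<Delta> - 1 \<le> card (R - {v})" using cRv n2 by linarith
      then obtain F where F: "F \<subseteq> R - {v}" "card F = \<Delta> - 1" by (meson obtain_subset_with_card_n)
      define J where "J = (R - {v} - F) \<union> B"
      have JR: "J \<inter> R = R - {v} - F" "J \<inter> B = B" using disjoint by (auto simp: J_def)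
      have fF: "finite F" using F(1) fin by (meson finite_Diff finite_subset)
      have cJ: "card (J \<inter> R) = n" unfolding JR(1) using F fF cRv False by (subst card_Diff_subset) auto
      have "\<bar>stay_prob VV v - (1/2 + kap * (p * (of_int 1 * card F) + 1/2))\<bar> \<le> (1 + card F) * \<epsilon>"
      proof (rule gen[of J F 1])
        show "J \<union> F = VV - {v}" using F True disjoint by (auto simp: J_def VV_def)
        show "J \<inter> F = {}" using F disjoint by (auto simp: J_def)
      qed (use F sgR cJ JR card_B in auto)
      then show ?thesis using F(2) False True by (intro exI[of _ "1::int"] exI[of _ F]) (auto simp: excess_def of_nat_diff)
    next
      case True': True
      \<comment> \<open>For \<open>\<Delta> = 0\<close> a red vertex sees one red vertex fewer than
        blue ones, as it does not see itself, so the surplus vertex is blue.\<close>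
      have "1 \<le> card B" using card_B n2 by linarith
      then obtain F where F: "F \<subseteq> B" "card F = 1" by (meson obtain_subset_with_card_n)
      define J where "J = (R - {v}) \<union> (B - F)"
      have JR: "J \<inter> R = R - {v}" "J \<inter> B = B - F" using disjoint F by (auto simp: J_def)
      have fF: "finite F" using F(1) fin by (meson finite_subset)
      have cB: "card (B - F) = n - 1" using F fF card_B by (subst card_Diff_subset) auto
      have "\<bar>stay_prob VV v - (1/2 + kap * (p * (of_int (- 1) * card F) + 1/2))\<bar> \<le> (1 + card F) * \<epsilon>"
      proof (rule gen[of J F "- 1"])
        show "J \<union> F = VV - {v}" using F True disjoint by (auto simp: J_def VV_def)
        show "J \<inter> F = {}" using F disjoint by (auto simp: J_def)
      qed (use F sgB cRv cB JR True' in auto)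
      moreover have "excess v = - 1" unfolding excess_def using True True' by simp
      ultimately show ?thesis using F(2) by (intro exI[of _ "- 1::int"] exI[of _ F]) simp_all
    qed
  next
    case False
    then have vB: "v \<in> B" using v by (auto simp: VV_def)
    have sgR: "sg v w = - 1" if "w \<in> R" for w using False that by (simp add: sg_def side_def)
    have "\<Delta> + 1 \<le> card R" using card_R n2 by linarith
    then obtain F where F: "F \<subseteq> R" "card F = \<Delta> + 1" by (meson obtain_subset_with_card_n)
    define J where "J = (R - F) \<union> (B - {v})"
    have JR: "J \<inter> R = R - F" "J \<inter> B = B - {v}" using disjoint F vB by (auto simp: J_def)
    have fF: "finite F" using F(1) fin by (meson finite_subset)
    have cR: "card (R - F) = n - 1" using F fF card_R by (subst card_Diff_subset) auto
    have cB: "card (B - {v}) = n - 1" using vB fin card_B by simp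
    have "\<bar>stay_prob VV v - (1/2 + kap * (p * (of_int (- 1) * card F) + 1/2))\<bar> \<le> (1 + card F) * \<epsilon>"
    proof (rule gen[of J F "- 1"])
      show "J \<union> F = VV - {v}" using F False vB disjoint by (auto simp: J_def VV_def)
      show "J \<inter> F = {}" using F disjoint by (auto simp: J_def)
    qed (use F sgR cR cB JR in auto)
    then show ?thesis using F(2) False by (intro exI[of _ "- 1::int"] exI[of _ F]) (auto simp: excess_def)
  qed
  then obtain c :: int and F :: "'a set" where cF: "of_int c * real (card F) = excess v" "card F \<le> \<Delta> + 1"
    "\<bar>stay_prob VV v - (1/2 + kap * (p * (of_int c * card F) + 1/2))\<bar> \<le> (1 + card F) * \<epsilon>" by blast
  have "\<bar>stay_prob VV v - limit_prob v\<bar> \<le> (1 + card F) * \<epsilon>" using cF(1,3) by (simp add: limit_prob_def)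
  also have "\<dots> \<le> u * \<epsilon>" using cF(2) u_Delta \<epsilon>0 by (intro mult_right_mono) auto
  also have "\<dots> = 6 * u ^ 3 / n" by (simp add: \<epsilon>_def power2_eq_square power3_eq_cube)
  finally show ?thesis .
qed

text \<open>\<open>limit_prob\<close> is constant on each side. The centres of the statement are
  multiples of \<open>n\<close> on the red side too; the remaining \<open>\<Delta>\<close> red
  vertices contribute at most \<open>u ^ 3\<close>.\<close>

lemma sum_stay_prob_near:
  "\<bar>(\<Sum>v\<in>R. stay_prob VV v) - (1/2 + kap * (p * (real \<Delta> - 1) + 1/2)) * n\<bar> \<le> 7 * u ^ 3"
  "\<bar>(\<Sum>v\<in>B. stay_prob VV v) - (1/2 + kap * (p * (- real \<Delta> - 1) + 1/2)) * n\<bar> \<le> 7 * u ^ 3"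
proof -
  have n0: "0 < real n" using n_ge by linarith
  have gen: "\<bar>(\<Sum>v\<in>X. stay_prob VV v) - m * n\<bar> \<le> 7 * u ^ 3"
    if X: "X \<subseteq> VV" "card X = n + k" "k \<le> \<Delta>" and m: "\<And>v. v \<in> X \<Longrightarrow> limit_prob v = m" for X and k :: nat and m :: real
  proof -
    have "card X \<noteq> 0" using X(2) n0 by auto
    then have Xf: "finite X" by (simp add: card_ge_0_finite)
    obtain Y where Y: "Y \<subseteq> X" "card Y = n" using X(2) obtain_subset_with_card_n[of n X] by auto
    have fY: "finite Y" using Y(1) Xf by (rule finite_subset)
    have cXY: "card (X - Y) = k" using X Y fY by (simp add: card_Diff_subset)
    have "(\<Sum>v\<in>X. stay_prob VV v) = (\<Sum>v\<in>Y. stay_prob VV v) + (\<Sum>v\<in>X-Y. stay_prob VV v)"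
      using sum.subset_diff[OF Y(1) Xf, of "stay_prob VV"] by (simp add: add.commute)
    moreover have "\<bar>(\<Sum>v\<in>Y. stay_prob VV v) - m * n\<bar> \<le> 6 * u ^ 3"
    proof -
      have "(\<Sum>v\<in>Y. stay_prob VV v) - m * n = (\<Sum>v\<in>Y. stay_prob VV v - limit_prob v)"
      proof -
        have "(\<Sum>v\<in>Y. limit_prob v) = (\<Sum>v\<in>Y. m)" using m Y(1) by (intro sum.cong) auto
        then show ?thesis using Y(2) by (simp add: sum_subtractf)
      qed
      also have "\<bar>\<dots>\<bar> \<le> (\<Sum>v\<in>Y. 6 * u ^ 3 / n)"
        using X(1) Y(1) by (intro order_trans[OF sum_abs sum_mono] stay_prob_near) auto
      also have "\<dots> = 6 * u ^ 3" using Y(2) n0 by simp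
      finally show ?thesis .
    qed
    moreover have "0 \<le> (\<Sum>v\<in>X-Y. stay_prob VV v)" "(\<Sum>v\<in>X-Y. stay_prob VV v) \<le> u ^ 3"
    proof -
      have sp: "0 \<le> stay_prob VV v" "stay_prob VV v \<le> 1" for v
        unfolding stay_prob_def using finite_V by (auto intro!: mean_nonneg mean_le_const)
      show "0 \<le> (\<Sum>v\<in>X-Y. stay_prob VV v)" by (intro sum_nonneg sp)
      have "(\<Sum>v\<in>X-Y. stay_prob VV v) \<le> (\<Sum>v\<in>X-Y. 1)" by (intro sum_mono sp)
      also have "\<dots> = k" using cXY by simp
      also have "\<dots> \<le> u" using X(3) Delta_le by linarith
      also have "\<dots> \<le> u ^ 3" using u_ge by (intro self_le_power) auto
      finally show "(\<Sum>v\<in>X-Y. stay_prob VV v) \<le> u ^ 3" .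
    qed
    ultimately show ?thesis by linarith
  qed
  show "\<bar>(\<Sum>v\<in>R. stay_prob VV v) - (1/2 + kap * (p * (real \<Delta> - 1) + 1/2)) * n\<bar> \<le> 7 * u ^ 3"
    by (rule gen[of R \<Delta>]) (auto simp: VV_def card_R limit_prob_def excess_def)
  show "\<bar>(\<Sum>v\<in>B. stay_prob VV v) - (1/2 + kap * (p * (- real \<Delta> - 1) + 1/2)) * n\<bar> \<le> 7 * u ^ 3"
    by (rule gen[of B 0]) (use disjoint in \<open>auto simp: VV_def card_B limit_prob_def excess_def\<close>)
qed

definition freq :: "real \<Rightarrow> real \<Rightarrow> 'a \<Rightarrow> real" where
  "freq s t v = (if v \<in> R then s else t)"

text \<open>The limiting variance of the weighted count. Each indicator has variance near 1/4, and
  each of the pairs of vertices contributes its two frequencies times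
  \<open>pq * kap\<^sup>2\<close>, which is 1 / (4 pi n).\<close>

definition limit_form :: "real \<Rightarrow> real \<Rightarrow> real" where
  "limit_form s t = n / 4 * (s\<^sup>2 + t\<^sup>2) + n / (4 * pi) * (s + t)\<^sup>2"

lemma sum_VV: "(\<Sum>v\<in>VV. f v) = (\<Sum>v\<in>R. f v) + (\<Sum>v\<in>B. f v)" for f :: "'a \<Rightarrow> real"
  unfolding VV_def using finite_R finite_B disjoint by (rule sum.union_disjoint)

lemma sum_freq: "(\<Sum>v\<in>VV. f (freq s t v)) = (n + \<Delta>) * f s + n * f t" for f :: "real \<Rightarrow> real"
proof -
  have "(\<Sum>v\<in>B. f (freq s t v)) = (\<Sum>v\<in>B. f t)" using disjoint by (intro sum.cong) (auto simp: freq_def)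
  then show ?thesis by (simp add: sum_VV freq_def card_R card_B)
qed

text \<open>The deviation from 1/4 is the square of the deviation of the probability from
  1/2.\<close>

lemma stay_prob_variance:
  assumes "v \<in> VV" shows "\<bar>stay_prob VV v * (1 - stay_prob VV v) - 1/4\<bar> \<le> 9 * u ^ 4 / n"
proof -
  have n0: "0 < real n" using n_ge by linarith
  have sn: "0 < sqrt n" using n0 by simp
  have ex: "\<bar>p * excess v + 1/2\<bar> \<le> u"
  proof -
    have "\<bar>excess v\<bar> \<le> real \<Delta> + 1" by (auto simp: excess_def)
    then have "\<bar>p * excess v\<bar> \<le> 1 * (real \<Delta> + 1)" unfolding abs_mult using p_pos p_less_1 by (intro mult_mono) auto
    then show ?thesis using u_Delta by (simp add: abs_le_iff)
  qed
  have "\<bar>kap * (p * excess v + 1/2)\<bar> \<le> (u / sqrt n) * u"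
    unfolding abs_mult using ex kap_pos kap_le by (intro mult_mono) auto
  then have 1: "\<bar>limit_prob v - 1/2\<bar> \<le> u\<^sup>2 / sqrt n" by (simp add: limit_prob_def power2_eq_square)
  have 2: "6 * u ^ 3 / n \<le> u\<^sup>2 / sqrt n"
  proof -
    have "6 * u \<le> u ^ 2" using u_ge by (simp add: power2_eq_square)
    also have "u ^ 2 \<le> u ^ 50" using u_ge by (intro power_increasing) auto
    finally have "6 * u \<le> sqrt n" by (simp add: sqrt_n)
    then have "u\<^sup>2 * (6 * u) \<le> u\<^sup>2 * sqrt n" by (intro mult_left_mono) auto
    then have "6 * u ^ 3 * sqrt n \<le> u\<^sup>2 * (sqrt n * sqrt n)"
      using mult_right_mono[of "u\<^sup>2 * (6 * u)" "u\<^sup>2 * sqrt n" "sqrt n"] sn by (simp add: power2_eq_square power3_eq_cube mult_ac)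
    then have "6 * u ^ 3 * sqrt n \<le> u\<^sup>2 * n" using n0 by simp
    then show ?thesis using n0 sn by (simp add: divide_le_eq pos_le_divide_eq mult.commute)
  qed
  have "\<bar>stay_prob VV v - 1/2\<bar> \<le> 3 * (u\<^sup>2 / sqrt n)"
    using stay_prob_near[OF assms] 1 2 by linarith
  then have "(stay_prob VV v - 1/2)\<^sup>2 \<le> (3 * (u\<^sup>2 / sqrt n))\<^sup>2"
    using u_ge by (simp add: abs_le_square_iff[symmetric])
  also have "\<dots> = 9 * u ^ 4 / n" using n0 by (simp add: power_mult_distrib power_divide flip: power_mult)
  finally have "(stay_prob VV v - 1/2)\<^sup>2 \<le> 9 * u ^ 4 / n" .
  moreover have "stay_prob VV v * (1 - stay_prob VV v) - 1/4 = - (stay_prob VV v - 1/2)\<^sup>2"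
    by (simp add: power2_eq_square algebra_simps)
  ultimately show ?thesis by simp
qed

lemma influence_product_near:
  assumes "v \<in> VV" "w \<in> VV"
  shows "\<bar>influence VV v w * influence VV w v - kap\<^sup>2\<bar> \<le> 18 * u ^ 3 / (n * sqrt n)"
proof -
  have n0: "0 < real n" using n_ge by linarith
  define \<epsilon> where "\<epsilon> = 6 * u\<^sup>2 / n"
  have e: "\<bar>influence VV v w - kap\<bar> \<le> \<epsilon>" "\<bar>influence VV w v - kap\<bar> \<le> \<epsilon>"
    unfolding \<epsilon>_def using assms by (auto intro: influence_near)
  have \<epsilon>k: "\<epsilon> \<le> u / sqrt n"
  proof -
    have "6 * u \<le> u ^ 2" using u_ge by (simp add: power2_eq_square)
    also have "u ^ 2 \<le> u ^ 50" using u_ge by (intro power_increasing) auto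
    finally have "6 * u \<le> sqrt n" by (simp add: sqrt_n)
    then have "u * (6 * u) * sqrt n \<le> u * sqrt n * sqrt n" using u_ge by (intro mult_right_mono mult_left_mono) auto
    then have "6 * u\<^sup>2 * sqrt n \<le> u * n" using n0 by (simp add: power2_eq_square mult_ac)
    then show ?thesis using n0 by (simp add: \<epsilon>_def divide_le_eq pos_le_divide_eq mult.commute)
  qed
  have "influence VV v w * influence VV w v - kap\<^sup>2 = (influence VV v w - kap) * influence VV w v + kap * (influence VV w v - kap)"
    by (simp add: power2_eq_square algebra_simps)
  also have "\<bar>\<dots>\<bar> \<le> \<bar>influence VV v w - kap\<bar> * \<bar>influence VV w v\<bar> + \<bar>kap\<bar> * \<bar>influence VV w v - kap\<bar>"
    unfolding abs_mult[symmetric] by (rule abs_triangle_ineq)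
  also have "\<dots> \<le> \<epsilon> * (2 * (u / sqrt n)) + (u / sqrt n) * \<epsilon>"
  proof (intro add_mono mult_mono)
    show "\<bar>influence VV w v\<bar> \<le> 2 * (u / sqrt n)" using e(2) \<epsilon>k kap_le kap_pos by linarith
    show "\<bar>kap\<bar> \<le> u / sqrt n" using kap_le kap_pos by simp
  qed (use e u_ge in \<open>auto simp: \<epsilon>_def\<close>)
  also have "\<dots> = 18 * u ^ 3 / (n * sqrt n)" by (simp add: \<epsilon>_def power2_eq_square power3_eq_cube)
  finally show ?thesis .
qed

text \<open>The sum splits into a diagonal part with variance 1/4, an off-diagonal part with
  \<open>kap\<^sup>2\<close> for every product of influences, and the errors \<open>A\<close> and
  \<open>D\<close> of these two replacements. The double sum over distinct vertices is
  \<open>S1\<^sup>2 - S2\<close>, and replacing n + \<Delta> by n is of lower order.\<close>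

lemma drift_near:
  fixes s t z :: real
  assumes z: "\<bar>s\<bar> \<le> z" "\<bar>t\<bar> \<le> z"
  shows "\<bar>(\<Sum>v\<in>VV. freq s t v * drift (freq s t) v) - limit_form s t\<bar> \<le> 80 * u ^ 4 * sqrt n * z\<^sup>2"
proof -
  let ?f = "freq s t"
  have n0: "0 < real n" using n_ge by linarith
  have z0: "0 \<le> z" using z by linarith
  have fz: "\<bar>?f v\<bar> \<le> z" for v using z by (simp add: freq_def)
  have fz2: "\<bar>?f v * ?f w\<bar> \<le> z\<^sup>2" for v w
    unfolding abs_mult power2_eq_square using fz z0 by (intro mult_mono) auto
  have N: "real (card VV) \<le> 3 * n" using Delta_le by (simp add: card_VV)
  define A where "A = (\<Sum>v\<in>VV. (?f v)\<^sup>2 * (stay_prob VV v * (1 - stay_prob VV v) - 1/4))"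
  define D where "D = (\<Sum>v\<in>VV. \<Sum>w\<in>VV-{v}. ?f v * ?f w * (influence VV v w * influence VV w v - kap\<^sup>2))"
  have A: "\<bar>A\<bar> \<le> 27 * u ^ 4 * z\<^sup>2"
  proof -
    have "\<bar>A\<bar> \<le> (\<Sum>v\<in>VV. z\<^sup>2 * (9 * u ^ 4 / n))"
      unfolding A_def
    proof (rule order_trans[OF sum_abs sum_mono])
      fix v assume "v \<in> VV"
      then show "\<bar>(?f v)\<^sup>2 * (stay_prob VV v * (1 - stay_prob VV v) - 1/4)\<bar> \<le> z\<^sup>2 * (9 * u ^ 4 / n)"
        unfolding abs_mult using fz2[of v v] stay_prob_variance[of v] by (intro mult_mono) (auto simp: power2_eq_square)
    qed
    also have "\<dots> = card VV * (z\<^sup>2 * (9 * u ^ 4 / n))" by simp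
    also have "\<dots> \<le> (3 * n) * (z\<^sup>2 * (9 * u ^ 4 / n))" using N by (intro mult_right_mono) auto
    also have "\<dots> = 27 * u ^ 4 * z\<^sup>2" using n0 by simp
    finally show ?thesis .
  qed
  have D: "pq * \<bar>D\<bar> \<le> 41 * u ^ 3 * sqrt n * z\<^sup>2"
  proof -
    have "\<bar>D\<bar> \<le> (\<Sum>v\<in>VV. \<Sum>w\<in>VV-{v}. z\<^sup>2 * (18 * u ^ 3 / (n * sqrt n)))"
      unfolding D_def
    proof (rule order_trans[OF sum_abs sum_mono], rule order_trans[OF sum_abs sum_mono])
      fix v w assume "v \<in> VV" "w \<in> VV - {v}"
      then show "\<bar>?f v * ?f w * (influence VV v w * influence VV w v - kap\<^sup>2)\<bar> \<le> z\<^sup>2 * (18 * u ^ 3 / (n * sqrt n))"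
        unfolding abs_mult[of "_ * _" "_ - _"] using fz2[of v w] influence_product_near[of v w] by (intro mult_mono) auto
    qed
    also have "\<dots> \<le> (\<Sum>v\<in>VV. card VV * (z\<^sup>2 * (18 * u ^ 3 / (n * sqrt n))))"
    proof (intro sum_mono)
      fix v
      have "(\<Sum>w\<in>VV-{v}. z\<^sup>2 * (18 * u ^ 3 / (n * sqrt n))) = card (VV - {v}) * (z\<^sup>2 * (18 * u ^ 3 / (n * sqrt n)))" by simp
      also have "\<dots> \<le> card VV * (z\<^sup>2 * (18 * u ^ 3 / (n * sqrt n)))"
        using finite_V u_ge by (intro mult_right_mono) (auto intro: card_mono)
      finally show "(\<Sum>w\<in>VV-{v}. z\<^sup>2 * (18 * u ^ 3 / (n * sqrt n))) \<le> card VV * (z\<^sup>2 * (18 * u ^ 3 / (n * sqrt n)))" .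
    qed
    also have "\<dots> = real (card VV) * real (card VV) * (z\<^sup>2 * (18 * u ^ 3 / (n * sqrt n)))" by simp
    also have "\<dots> \<le> (3 * n) * (3 * n) * (z\<^sup>2 * (18 * u ^ 3 / (n * sqrt n)))"
      using mult_mono[OF N N] u_ge by (intro mult_right_mono) auto
    also have "\<dots> = 162 * u ^ 3 * sqrt n * z\<^sup>2" using n0 by (simp add: field_simps)
    finally have "pq * \<bar>D\<bar> \<le> 1/4 * (162 * u ^ 3 * sqrt n * z\<^sup>2)" using pq_pos pq_le by (intro mult_mono) auto
    moreover have "0 \<le> u ^ 3 * sqrt n * z\<^sup>2" using u_ge by simp
    ultimately show ?thesis by linarith
  qed
  \<comment> \<open>The dependence on \<open>p\<close> cancels; this is how \<open>pi\<close> enters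
    the covariance.\<close>
  have kp: "pq * kap\<^sup>2 = 1 / (4 * pi * n)"
    using pq_pos n0 by (simp add: kap_def power_divide power_mult_distrib)
  define S1 where "S1 = (\<Sum>v\<in>VV. ?f v)"
  define S2 where "S2 = (\<Sum>v\<in>VV. (?f v)\<^sup>2)"
  have S1: "S1 = (n + \<Delta>) * s + n * t" unfolding S1_def by (rule sum_freq)
  have S2: "S2 = (n + \<Delta>) * s\<^sup>2 + n * t\<^sup>2" unfolding S2_def by (rule sum_freq)
  have off: "(\<Sum>v\<in>VV. \<Sum>w\<in>VV-{v}. ?f v * ?f w) = S1\<^sup>2 - S2"
  proof -
    have "(\<Sum>w\<in>VV-{v}. ?f v * ?f w) = ?f v * S1 - (?f v)\<^sup>2" if "v \<in> VV" for v
      using that finite_V by (simp add: S1_def sum_diff1 power2_eq_square right_diff_distrib flip: sum_distrib_left)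
    then have "(\<Sum>v\<in>VV. \<Sum>w\<in>VV-{v}. ?f v * ?f w) = (\<Sum>v\<in>VV. ?f v * S1 - (?f v)\<^sup>2)" by (intro sum.cong) auto
    also have "\<dots> = S1\<^sup>2 - S2" unfolding sum_subtractf sum_distrib_right[symmetric] S2_def
      by (simp add: power2_eq_square flip: S1_def)
    finally show ?thesis .
  qed
  have eq: "(\<Sum>v\<in>VV. ?f v * drift ?f v) = A + S2 / 4 + pq * D + (pq * kap\<^sup>2) * (S1\<^sup>2 - S2)"
  proof -
    have "(\<Sum>v\<in>VV. ?f v * drift ?f v) = (\<Sum>v\<in>VV. (?f v)\<^sup>2 * (stay_prob VV v * (1 - stay_prob VV v) - 1/4) + (?f v)\<^sup>2 / 4
        + pq * (\<Sum>w\<in>VV-{v}. ?f v * ?f w * (influence VV v w * influence VV w v - kap\<^sup>2)) + (pq * kap\<^sup>2) * (\<Sum>w\<in>VV-{v}. ?f v * ?f w))"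
    proof (intro sum.cong refl)
      fix v
      have "?f v * (\<Sum>w\<in>VV-{v}. ?f w * (influence VV v w * influence VV w v))
         = (\<Sum>w\<in>VV-{v}. ?f v * ?f w * (influence VV v w * influence VV w v - kap\<^sup>2)) + kap\<^sup>2 * (\<Sum>w\<in>VV-{v}. ?f v * ?f w)"
        by (simp add: sum_distrib_left sum.distrib[symmetric] algebra_simps)
      then have "pq * (?f v * (\<Sum>w\<in>VV-{v}. ?f w * (influence VV v w * influence VV w v)))
         = pq * (\<Sum>w\<in>VV-{v}. ?f v * ?f w * (influence VV v w * influence VV w v - kap\<^sup>2)) + (pq * kap\<^sup>2) * (\<Sum>w\<in>VV-{v}. ?f v * ?f w)"
        by (simp only: distrib_left mult.assoc)
      moreover have "?f v * drift ?f v = (?f v)\<^sup>2 * (stay_prob VV v * (1 - stay_prob VV v) - 1/4) + (?f v)\<^sup>2 / 4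
        + pq * (?f v * (\<Sum>w\<in>VV-{v}. ?f w * (influence VV v w * influence VV w v)))"
        unfolding drift_def by (simp add: power2_eq_square algebra_simps)
      ultimately show "?f v * drift ?f v = (?f v)\<^sup>2 * (stay_prob VV v * (1 - stay_prob VV v) - 1/4) + (?f v)\<^sup>2 / 4
        + pq * (\<Sum>w\<in>VV-{v}. ?f v * ?f w * (influence VV v w * influence VV w v - kap\<^sup>2)) + (pq * kap\<^sup>2) * (\<Sum>w\<in>VV-{v}. ?f v * ?f w)"
        by linarith
    qed
    also have "\<dots> = A + S2 / 4 + pq * D + (pq * kap\<^sup>2) * (S1\<^sup>2 - S2)"
    proof -
      have gen: "(\<Sum>v\<in>VV. a v + b v / 4 + x * c v + y * e v) = sum a VV + sum b VV / 4 + x * sum c VV + y * sum e VV"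
        for a b c e :: "'a \<Rightarrow> real" and x y by (simp add: sum.distrib sum_distrib_left sum_divide_distrib)
      show ?thesis unfolding gen off A_def D_def S2_def ..
    qed
    finally show ?thesis .
  qed
  have st2: "s\<^sup>2 \<le> z\<^sup>2" "t\<^sup>2 \<le> z\<^sup>2" using z z0 by (simp_all add: abs_le_square_iff[symmetric])
  have "\<bar>S2 / 4 - n / 4 * (s\<^sup>2 + t\<^sup>2)\<bar> \<le> u * z\<^sup>2"
  proof -
    have "S2 / 4 - n / 4 * (s\<^sup>2 + t\<^sup>2) = \<Delta> / 4 * s\<^sup>2" unfolding S2 by (simp add: field_simps)
    moreover have "\<Delta> / 4 * s\<^sup>2 \<le> u * z\<^sup>2" using Delta_le st2 by (intro mult_mono) auto
    moreover have "0 \<le> \<Delta> / 4 * s\<^sup>2" by simp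
    ultimately show ?thesis by linarith
  qed
  moreover have "\<bar>(pq * kap\<^sup>2) * (S1\<^sup>2 - S2) - n / (4 * pi) * (s + t)\<^sup>2\<bar> \<le> 2 * u * z\<^sup>2"
  proof -
    have "(pq * kap\<^sup>2) * (S1\<^sup>2 - S2) - n / (4 * pi) * (s + t)\<^sup>2 = (S1\<^sup>2 - S2 - (n * (s + t))\<^sup>2) / (4 * pi * n)"
      unfolding kp using n0 by (simp add: field_simps power2_eq_square)
    also have "S1\<^sup>2 - S2 - (n * (s + t))\<^sup>2 = 2 * real n * (\<Delta> * (s * (s + t))) + \<Delta> * (\<Delta> * s\<^sup>2) - S2"
      unfolding S1 by (simp add: power2_eq_square algebra_simps)
    also have "\<bar>(2 * real n * (\<Delta> * (s * (s + t))) + \<Delta> * (\<Delta> * s\<^sup>2) - S2) / (4 * pi * n)\<bar> \<le> (8 * n * u * z\<^sup>2) / (4 * 1 * n)"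
      unfolding abs_divide
    proof (intro frac_le)
      have "\<bar>s * (s + t)\<bar> \<le> z * (2 * z)" unfolding abs_mult using z z0 by (intro mult_mono) auto
      then have "\<bar>\<Delta> * (s * (s + t))\<bar> \<le> u * (z * (2 * z))" unfolding abs_mult[of "real \<Delta>"] using Delta_le by (intro mult_mono) auto
      then have a: "\<bar>2 * real n * (\<Delta> * (s * (s + t)))\<bar> \<le> 2 * real n * (u * (z * (2 * z)))" unfolding abs_mult[of "2 * real n"] by (intro mult_mono) auto
      have b: "\<bar>\<Delta> * (\<Delta> * s\<^sup>2)\<bar> \<le> n * (u * z\<^sup>2)" using Delta_le st2 u_ge by (simp add: abs_mult) (intro mult_mono, auto)
      have "\<bar>S2\<bar> \<le> 3 * n * z\<^sup>2"
      proof -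
        have "S2 \<le> 2 * n * z\<^sup>2 + n * z\<^sup>2" unfolding S2 using Delta_le st2 by (intro add_mono mult_mono) auto
        moreover have "0 \<le> S2" unfolding S2_def by (intro sum_nonneg) auto
        ultimately show ?thesis by simp
      qed
      also have "3 * n * z\<^sup>2 \<le> 3 * n * (u * z\<^sup>2)" using u_ge by (intro mult_left_mono) (auto simp: mult_le_cancel_right1)
      finally have c: "\<bar>S2\<bar> \<le> 3 * n * (u * z\<^sup>2)" .
      show "\<bar>2 * real n * (\<Delta> * (s * (s + t))) + \<Delta> * (\<Delta> * s\<^sup>2) - S2\<bar> \<le> 8 * n * u * z\<^sup>2"
        using a b c by (simp add: power2_eq_square mult_ac abs_le_iff)
    qed (use n0 pi_gt3 u_ge in \<open>auto\<close>)
    also have "(8 * n * u * z\<^sup>2) / (4 * 1 * n) = 2 * u * z\<^sup>2" using n0 by simp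
    finally show ?thesis .
  qed
  ultimately have "\<bar>(\<Sum>v\<in>VV. ?f v * drift ?f v) - limit_form s t\<bar> \<le> 27 * u ^ 4 * z\<^sup>2 + 41 * u ^ 3 * sqrt n * z\<^sup>2 + u * z\<^sup>2 + 2 * u * z\<^sup>2"
  proof -
    assume h: "\<bar>S2 / 4 - n / 4 * (s\<^sup>2 + t\<^sup>2)\<bar> \<le> u * z\<^sup>2"
      "\<bar>(pq * kap\<^sup>2) * (S1\<^sup>2 - S2) - n / (4 * pi) * (s + t)\<^sup>2\<bar> \<le> 2 * u * z\<^sup>2"
    have "\<bar>pq * D\<bar> \<le> 41 * u ^ 3 * sqrt n * z\<^sup>2" using D pq_pos by (simp add: abs_mult)
    moreover have tri: "\<bar>a + b + c + d - (b' + d')\<bar> \<le> x + y + z + w"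
      if "\<bar>a\<bar> \<le> x" "\<bar>c\<bar> \<le> y" "\<bar>b - b'\<bar> \<le> z" "\<bar>d - d'\<bar> \<le> w" for a b c d b' d' x y z w :: real
      using that by linarith
    ultimately show ?thesis unfolding eq limit_form_def by (intro tri A h)
  qed
  also have "\<dots> \<le> 80 * u ^ 4 * sqrt n * z\<^sup>2"
  proof -
    have s1: "1 \<le> sqrt n" using n_ge by simp
    have "27 * u ^ 4 * 1 + 41 * u ^ 3 * sqrt n + u + 2 * u \<le> 80 * u ^ 4 * sqrt n"
    proof -
      have "u ^ 3 \<le> u ^ 4" "u \<le> u ^ 4" using u_ge by (intro power_increasing self_le_power; simp)+
      moreover have "u ^ 4 * 1 \<le> u ^ 4 * sqrt n" using s1 u_ge by (intro mult_left_mono) auto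
      moreover have "u ^ 3 * sqrt n \<le> u ^ 4 * sqrt n" using s1 calculation(1) by (intro mult_right_mono) auto
      moreover have "0 \<le> u ^ 4 * sqrt n" using u_ge by simp
      ultimately show ?thesis by linarith
    qed
    from mult_right_mono[OF this, of "z\<^sup>2"] show ?thesis by (simp add: algebra_simps)
  qed
  finally show ?thesis .
qed

end

section \<open>Fourier inversion and the local limit\<close>

lemma std_normal_fourier:
  "has_bochner_integral lborel (\<lambda>x. std_normal_density x *\<^sub>R cis (c * x)) (complex_of_real (exp (- (c\<^sup>2 / 2))))"
proof -
  have i: "integrable lborel (\<lambda>x. std_normal_density x *\<^sub>R cis (c * x))"
  proof (rule Bochner_Integration.integrable_bound[of lborel std_normal_density])
    have "cis \<in> borel_measurable borel" by (intro borel_measurable_continuous_onI continuous_intros)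
    then show "(\<lambda>x. std_normal_density x *\<^sub>R cis (c * x)) \<in> borel_measurable lborel"
      by measurable
  qed auto
  have m: "cis \<in> borel_measurable borel" by (intro borel_measurable_continuous_onI continuous_intros)
  have "complex_of_real (exp (- (c\<^sup>2 / 2))) = char std_normal_distribution c"
    by (simp add: char_std_normal_distribution)
  also have "\<dots> = integral\<^sup>L (density lborel std_normal_density) (\<lambda>x. cis (c * x))"
    by (simp add: char_def cis_conv_exp)
  also have "\<dots> = (\<integral>x. std_normal_density x *\<^sub>R cis (c * x) \<partial>lborel)"
    using m by (intro integral_density) auto
  finally show ?thesis using i by (simp add: has_bochner_integral_iff)
qed

lemma gauss_fourier:
  fixes a y :: real
  assumes "a > 0"
  shows "has_bochner_integral lborel (\<lambda>t. of_real (exp (- (a * t\<^sup>2 / 2))) * cis (- (t * y)))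
    (complex_of_real (sqrt (2 * pi / a) * exp (- (y\<^sup>2 / (2 * a)))))"
proof -
  define c where "c = - y / sqrt a"
  have sa: "sqrt a > 0" using assms by simp
  have "has_bochner_integral lborel (\<lambda>t. std_normal_density (0 + sqrt a * t) *\<^sub>R cis (c * (0 + sqrt a * t)))
     (complex_of_real (exp (- (c\<^sup>2 / 2))) /\<^sub>R \<bar>sqrt a\<bar>)"
    using lborel_has_bochner_integral_real_affine_iff[of "sqrt a" "\<lambda>x. std_normal_density x *\<^sub>R cis (c * x)" "complex_of_real (exp (- (c\<^sup>2 / 2)))" 0]
      sa std_normal_fourier[of c] by simp
  then have "has_bochner_integral lborel (\<lambda>t. complex_of_real (sqrt (2 * pi)) * (std_normal_density (0 + sqrt a * t) *\<^sub>R cis (c * (0 + sqrt a * t))))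
     (complex_of_real (sqrt (2 * pi)) * (complex_of_real (exp (- (c\<^sup>2 / 2))) /\<^sub>R \<bar>sqrt a\<bar>))"
    by (rule has_bochner_integral_mult_right)
  moreover have "complex_of_real (sqrt (2 * pi)) * (std_normal_density (0 + sqrt a * t) *\<^sub>R cis (c * (0 + sqrt a * t)))
     = of_real (exp (- (a * t\<^sup>2 / 2))) * cis (- (t * y))" for t
  proof -
    have "c * (0 + sqrt a * t) = - (t * y)" using sa by (simp add: c_def)
    moreover have "sqrt (2 * pi) * std_normal_density (0 + sqrt a * t) = exp (- (a * t\<^sup>2 / 2))"
      using assms by (simp add: std_normal_density_def power_mult_distrib)
    ultimately show ?thesis
      by (simp only: scaleR_conv_of_real mult.assoc[symmetric] of_real_mult[symmetric])
  qed
  moreover have "complex_of_real (sqrt (2 * pi)) * (complex_of_real (exp (- (c\<^sup>2 / 2))) /\<^sub>R \<bar>sqrt a\<bar>)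
     = complex_of_real (sqrt (2 * pi / a) * exp (- (y\<^sup>2 / (2 * a))))"
  proof -
    have 1: "c\<^sup>2 / 2 = y\<^sup>2 / (2 * a)" using assms by (simp add: c_def power_divide)
    have 2: "complex_of_real r /\<^sub>R \<bar>sqrt a\<bar> = of_real (r / sqrt a)" for r
      using assms by (simp add: scaleR_conv_of_real divide_inverse mult.commute)
    show ?thesis unfolding 1 2 by (simp only: of_real_mult[symmetric] real_sqrt_divide times_divide_eq_right times_divide_eq_left)
  qed
  ultimately show ?thesis by (simp only:)
qed

text \<open>Completing the square translates \<open>t\<close> by b / a. The linear term is real, so
  the translation stays on the real line.\<close>

lemma gauss_fourier_shift:
  fixes a b y :: real
  assumes "a > 0"
  shows "has_bochner_integral lborel (\<lambda>t. of_real (exp (- (a * t\<^sup>2 / 2) - b * t)) * cis (- (t * y)))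
    (of_real (sqrt (2 * pi / a) * exp (b\<^sup>2 / (2 * a) - y\<^sup>2 / (2 * a))) * cis (b * y / a))"
proof -
  let ?f = "\<lambda>t. complex_of_real (exp (- (a * t\<^sup>2 / 2))) * cis (- (t * y))"
  let ?K = "complex_of_real (exp (b\<^sup>2 / (2 * a))) * cis (b * y / a)"
  have "has_bochner_integral lborel (\<lambda>t. ?f (b / a + 1 * t)) (complex_of_real (sqrt (2 * pi / a) * exp (- (y\<^sup>2 / (2 * a)))))"
    using lborel_has_bochner_integral_real_affine_iff[of 1 ?f "complex_of_real (sqrt (2 * pi / a) * exp (- (y\<^sup>2 / (2 * a))))" "b / a"]
      gauss_fourier[OF assms, of y] by simp
  then have "has_bochner_integral lborel (\<lambda>t. ?K * ?f (b / a + 1 * t)) (?K * complex_of_real (sqrt (2 * pi / a) * exp (- (y\<^sup>2 / (2 * a)))))"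
    by (rule has_bochner_integral_mult_right)
  moreover have "?K * ?f (b / a + 1 * t) = of_real (exp (- (a * t\<^sup>2 / 2) - b * t)) * cis (- (t * y))" for t
  proof -
    have "?K * ?f (b / a + 1 * t) = complex_of_real (exp (b\<^sup>2 / (2 * a)) * exp (- (a * (b / a + 1 * t)\<^sup>2 / 2))) * (cis (b * y / a) * cis (- ((b / a + 1 * t) * y)))"
      by (simp only: of_real_mult mult_ac)
    also have "exp (b\<^sup>2 / (2 * a)) * exp (- (a * (b / a + 1 * t)\<^sup>2 / 2)) = exp (- (a * t\<^sup>2 / 2) - b * t)"
      unfolding exp_add[symmetric] using assms by (intro arg_cong[where f = exp]) (simp add: power2_eq_square field_simps)
    also have "cis (b * y / a) * cis (- ((b / a + 1 * t) * y)) = cis (- (t * y))"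
      unfolding cis_mult by (intro arg_cong[where f = cis]) (simp add: algebra_simps)
    finally show ?thesis .
  qed
  moreover have "?K * complex_of_real (sqrt (2 * pi / a) * exp (- (y\<^sup>2 / (2 * a)))) = of_real (sqrt (2 * pi / a) * exp (b\<^sup>2 / (2 * a) - y\<^sup>2 / (2 * a))) * cis (b * y / a)"
  proof -
    have "exp (b\<^sup>2 / (2 * a) - y\<^sup>2 / (2 * a)) = exp (b\<^sup>2 / (2 * a)) * exp (- (y\<^sup>2 / (2 * a)))"
      unfolding exp_add[symmetric] by simp
    then show ?thesis by (simp only: of_real_mult mult_ac)
  qed
  ultimately show ?thesis by (simp only:)
qed

lemma pair_lborel_mult:
  fixes f g :: "real \<Rightarrow> 'b::{real_normed_field, banach, second_countable_topology}"
  assumes f: "integrable lborel f" and g: "integrable lborel g"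
  shows "has_bochner_integral (lborel \<Otimes>\<^sub>M lborel) (\<lambda>(x, y). f x * g y) (integral\<^sup>L lborel f * integral\<^sup>L lborel g)"
proof -
  have [measurable]: "f \<in> borel_measurable lborel" "g \<in> borel_measurable lborel" using f g by auto
  have i: "integrable (lborel \<Otimes>\<^sub>M lborel) (\<lambda>(x, y). f x * g y)"
  proof (rule lborel_pair.Fubini_integrable)
    show "(\<lambda>(x, y). f x * g y) \<in> borel_measurable (lborel \<Otimes>\<^sub>M lborel)" by measurable
    have "(\<lambda>x. \<integral>y. norm (case (x, y) of (x, y) \<Rightarrow> f x * g y) \<partial>lborel) = (\<lambda>x. norm (f x) * (\<integral>y. norm (g y) \<partial>lborel))"
      by (simp add: norm_mult)
    then show "integrable lborel (\<lambda>x. \<integral>y. norm (case (x, y) of (x, y) \<Rightarrow> f x * g y) \<partial>lborel)"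
      using f by simp
    show "AE x in lborel. integrable lborel (\<lambda>y. case (x, y) of (x, y) \<Rightarrow> f x * g y)" using g by simp
  qed
  have "integral\<^sup>L (lborel \<Otimes>\<^sub>M lborel) (\<lambda>(x, y). f x * g y) = (\<integral>x. (\<integral>y. f x * g y \<partial>lborel) \<partial>lborel)"
    using lborel_pair.integral_fst[of "\<lambda>x y. f x * g y"] i by simp
  also have "\<dots> = integral\<^sup>L lborel f * integral\<^sup>L lborel g" using f g by simp
  finally show ?thesis using i by (simp add: has_bochner_integral_iff)
qed

text \<open>For fixed \<open>s\<close> the mixed term is linear in \<open>t\<close>. Integrating
  over \<open>t\<close> leaves a Gaussian in \<open>s\<close> whose coefficient is the Schur
  complement \<open>a'\<close>.\<close>

lemma gauss_fourier_2d:
  fixes a b X Y :: real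
  assumes ab: "0 \<le> b" "b < a"
  defines "a' \<equiv> a - b\<^sup>2 / a"
  shows "has_bochner_integral (lborel \<Otimes>\<^sub>M lborel)
     (\<lambda>(s, t). of_real (exp (- ((a * s\<^sup>2 + a * t\<^sup>2 + 2 * b * s * t) / 2))) * cis (- (s * X + t * Y)))
     (of_real (2 * pi / sqrt (a\<^sup>2 - b\<^sup>2) * exp (- (Y\<^sup>2 / (2 * a) + (X - b * Y / a)\<^sup>2 / (2 * a')))))"
proof -
  have a0: "a > 0" using ab by linarith
  have b2: "b\<^sup>2 < a\<^sup>2" using ab by (intro power_strict_mono) auto
  have a'a: "a * a' = a\<^sup>2 - b\<^sup>2" using a0 by (simp add: a'_def power2_eq_square field_simps)
  have a'0: "a' > 0"
  proof -
    have "0 < a * a'" using b2 a'a by simp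
    then show ?thesis using a0 by (simp add: zero_less_mult_iff)
  qed
  let ?F = "\<lambda>s t. complex_of_real (exp (- ((a * s\<^sup>2 + a * t\<^sup>2 + 2 * b * s * t) / 2))) * cis (- (s * X + t * Y))"
  have mF: "case_prod ?F \<in> borel_measurable (lborel \<Otimes>\<^sub>M lborel)"
  proof -
    have "continuous_on UNIV (\<lambda>z. ?F (fst z) (snd z))" by (intro continuous_intros) simp_all
    then have "(\<lambda>z. ?F (fst z) (snd z)) \<in> borel_measurable borel" by (rule borel_measurable_continuous_onI)
    then show ?thesis by (simp add: lborel_prod case_prod_unfold)
  qed
  \<comment> \<open>As \<open>b\<close> is nonnegative, the quadratic form is at least (a - b) (s^2
    + t^2), so a product of two Gaussians is an integrable majorant.\<close>
  define g where "g s = exp (- ((a - b) * s\<^sup>2 / 2))" for s :: real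
  have ig: "integrable lborel g"
    using has_bochner_integral_gauss_even[of "(a - b) / 2" 0] ab unfolding g_def[abs_def] by (simp add: has_bochner_integral_iff)
  have i: "integrable (lborel \<Otimes>\<^sub>M lborel) (case_prod ?F)"
  proof (rule Bochner_Integration.integrable_bound[OF _ mF])
    show "integrable (lborel \<Otimes>\<^sub>M lborel) (\<lambda>(s, t). g s * g t)"
      using pair_lborel_mult[OF ig ig] by (simp add: has_bochner_integral_iff)
    have "norm (?F s t) \<le> norm (g s * g t)" for s t
    proof -
      have "norm (?F s t) = exp (- ((a * s\<^sup>2 + a * t\<^sup>2 + 2 * b * s * t) / 2))" by (simp add: norm_mult)
      also have "\<dots> \<le> exp (- ((a - b) * s\<^sup>2 / 2) + - ((a - b) * t\<^sup>2 / 2))"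
      proof -
        have "0 \<le> b * (s + t)\<^sup>2" using ab by simp
        then show ?thesis by (simp add: power2_eq_square field_simps)
      qed
      also have "\<dots> = g s * g t" by (simp only: g_def exp_add)
      finally show ?thesis by (simp add: g_def)
    qed
    then show "AE x in lborel \<Otimes>\<^sub>M lborel. norm (case_prod ?F x) \<le> norm (case x of (s, t) \<Rightarrow> g s * g t)" by auto
  qed
  have inner: "(\<integral>t. ?F s t \<partial>lborel) = of_real (sqrt (2 * pi / a) * exp (- (Y\<^sup>2 / (2 * a)))) * (of_real (exp (- (a' * s\<^sup>2 / 2))) * cis (- (s * (X - b * Y / a))))" for s
  proof -
    have "?F s t = (of_real (exp (- (a * s\<^sup>2 / 2))) * cis (- (s * X))) * (of_real (exp (- (a * t\<^sup>2 / 2) - (b * s) * t)) * cis (- (t * Y)))" for t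
    proof -
      have "exp (- ((a * s\<^sup>2 + a * t\<^sup>2 + 2 * b * s * t) / 2)) = exp (- (a * s\<^sup>2 / 2)) * exp (- (a * t\<^sup>2 / 2) - (b * s) * t)"
        unfolding exp_add[symmetric] by (intro arg_cong[where f = exp]) (simp add: field_simps)
      moreover have "cis (- (s * X + t * Y)) = cis (- (s * X)) * cis (- (t * Y))" unfolding cis_mult by simp
      ultimately show ?thesis by (simp only: of_real_mult mult_ac)
    qed
    then have "(\<integral>t. ?F s t \<partial>lborel) = (of_real (exp (- (a * s\<^sup>2 / 2))) * cis (- (s * X))) * (of_real (sqrt (2 * pi / a) * exp ((b * s)\<^sup>2 / (2 * a) - Y\<^sup>2 / (2 * a))) * cis (b * s * Y / a))"
      using has_bochner_integral_integral_eq[OF has_bochner_integral_mult_right[OF gauss_fourier_shift[OF a0, of "b * s" Y]]]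
      by (simp only:)
    also have "\<dots> = of_real (exp (- (a * s\<^sup>2 / 2)) * (sqrt (2 * pi / a) * exp ((b * s)\<^sup>2 / (2 * a) - Y\<^sup>2 / (2 * a)))) * (cis (- (s * X)) * cis (b * s * Y / a))"
      by (simp only: of_real_mult mult_ac)
    also have "exp (- (a * s\<^sup>2 / 2)) * (sqrt (2 * pi / a) * exp ((b * s)\<^sup>2 / (2 * a) - Y\<^sup>2 / (2 * a))) = sqrt (2 * pi / a) * exp (- (Y\<^sup>2 / (2 * a))) * exp (- (a' * s\<^sup>2 / 2))"
    proof -
      have "exp (- (a * s\<^sup>2 / 2)) * exp ((b * s)\<^sup>2 / (2 * a) - Y\<^sup>2 / (2 * a)) = exp (- (Y\<^sup>2 / (2 * a))) * exp (- (a' * s\<^sup>2 / 2))"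
        unfolding exp_add[symmetric] using a0 by (intro arg_cong[where f = exp]) (simp add: a'_def power2_eq_square field_simps)
      then show ?thesis by (simp only: mult_ac)
    qed
    also have "cis (- (s * X)) * cis (b * s * Y / a) = cis (- (s * (X - b * Y / a)))"
      unfolding cis_mult by (intro arg_cong[where f = cis]) (simp add: algebra_simps)
    finally show ?thesis by (simp only: of_real_mult mult_ac)
  qed
  have "integral\<^sup>L (lborel \<Otimes>\<^sub>M lborel) (case_prod ?F) = (\<integral>s. (\<integral>t. ?F s t \<partial>lborel) \<partial>lborel)"
    using lborel_pair.integral_fst[OF i] by simp
  also have "\<dots> = of_real (sqrt (2 * pi / a) * exp (- (Y\<^sup>2 / (2 * a)))) * complex_of_real (sqrt (2 * pi / a') * exp (- ((X - b * Y / a)\<^sup>2 / (2 * a'))))"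
    unfolding inner by (rule has_bochner_integral_integral_eq[OF has_bochner_integral_mult_right[OF gauss_fourier[OF a'0]]])
  also have "\<dots> = of_real (2 * pi / sqrt (a\<^sup>2 - b\<^sup>2) * exp (- (Y\<^sup>2 / (2 * a) + (X - b * Y / a)\<^sup>2 / (2 * a'))))"
  proof -
    have "sqrt (2 * pi / a) * sqrt (2 * pi / a') = sqrt ((2 * pi)\<^sup>2 / (a * a'))"
      unfolding real_sqrt_mult[symmetric] by (simp add: power2_eq_square)
    also have "\<dots> = 2 * pi / sqrt (a\<^sup>2 - b\<^sup>2)" unfolding a'a real_sqrt_divide by (simp only: real_sqrt_abs) simp
    finally have "sqrt (2 * pi / a) * exp (- (Y\<^sup>2 / (2 * a))) * (sqrt (2 * pi / a') * exp (- ((X - b * Y / a)\<^sup>2 / (2 * a'))))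
      = 2 * pi / sqrt (a\<^sup>2 - b\<^sup>2) * exp (- (Y\<^sup>2 / (2 * a) + (X - b * Y / a)\<^sup>2 / (2 * a')))"
      by (simp add: exp_add[symmetric] mult_ac flip: mult.assoc[of "sqrt _" "sqrt _"])
    then show ?thesis by (simp only: of_real_mult[symmetric])
  qed
  finally show ?thesis using i by (simp add: has_bochner_integral_iff)
qed

context bernoulli_bits
begin

text \<open>The counts are integers, so their characters are orthogonal on the square.\<close>

lemma fourier_inversion_2d:
  fixes X Y :: "'e set \<Rightarrow> int" and x y :: int
  assumes "finite I"
  shows "has_bochner_integral (lborel \<Otimes>\<^sub>M lborel)
     (\<lambda>(s, t). (indicator {-pi..pi} s * indicator {-pi..pi} t) *\<^sub>R
        (mean I (\<lambda>A. cis (s * of_int (X A) + t * of_int (Y A))) * cis (- (s * of_int x + t * of_int y))))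
     (complex_of_real (4 * pi\<^sup>2 * mean I (\<lambda>A. of_bool (X A = x \<and> Y A = y))))"
proof -
  let ?c = "\<lambda>k s. indicator {-pi..pi} s *\<^sub>R cis (s * of_int k)"
  have i1: "integrable lborel (?c k)" for k :: int
    by (intro borel_integrable_compact continuous_intros) auto
  have v1: "integral\<^sup>L lborel (?c k) = (if k = 0 then of_real (2 * pi) else 0)" for k :: int
    using set_integral_cis[of k] by (simp add: set_lebesgue_integral_def)
  let ?w = "\<lambda>A. p ^ card A * (1 - p) ^ card (I - A)"
  have "has_bochner_integral (lborel \<Otimes>\<^sub>M lborel)
     (\<lambda>z. \<Sum>A\<in>Pow I. ?w A *\<^sub>R (case z of (s, t) \<Rightarrow> ?c (X A - x) s * ?c (Y A - y) t))
     (\<Sum>A\<in>Pow I. ?w A *\<^sub>R (integral\<^sup>L lborel (?c (X A - x)) * integral\<^sup>L lborel (?c (Y A - y))))"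
    by (intro has_bochner_integral_sum has_bochner_integral_scaleR_right pair_lborel_mult i1)
  moreover have "(\<Sum>A\<in>Pow I. ?w A *\<^sub>R (case z of (s, t) \<Rightarrow> ?c (X A - x) s * ?c (Y A - y) t))
    = (case z of (s, t) \<Rightarrow> (indicator {-pi..pi} s * indicator {-pi..pi} t) *\<^sub>R
        (mean I (\<lambda>A. cis (s * of_int (X A) + t * of_int (Y A))) * cis (- (s * of_int x + t * of_int y))))" for z
  proof (cases z)
    case (Pair s t)
    have "?c (X A - x) s * ?c (Y A - y) t = (indicator {-pi..pi} s * indicator {-pi..pi} t) *\<^sub>R (cis (s * of_int (X A) + t * of_int (Y A)) * cis (- (s * of_int x + t * of_int y)))" for A
    proof -
      have "cis (s * of_int (X A - x)) * cis (t * of_int (Y A - y)) = cis (s * of_int (X A) + t * of_int (Y A)) * cis (- (s * of_int x + t * of_int y))"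
        unfolding cis_mult by (intro arg_cong[where f = cis]) (simp add: algebra_simps)
      then show ?thesis by (simp only: mult_scaleR_left mult_scaleR_right scaleR_scaleR mult.commute[of "indicat_real _ t"])
    qed
    then show ?thesis
      unfolding Pair mean_def by (simp only: prod.case sum_distrib_right scaleR_sum_right mult_scaleR_left scaleR_left_commute[of "?w _"])
  qed
  moreover have "(\<Sum>A\<in>Pow I. ?w A *\<^sub>R (integral\<^sup>L lborel (?c (X A - x)) * integral\<^sup>L lborel (?c (Y A - y))))
     = complex_of_real (4 * pi\<^sup>2 * mean I (\<lambda>A. of_bool (X A = x \<and> Y A = y)))"
  proof -
    have "(\<Sum>A\<in>Pow I. ?w A *\<^sub>R (integral\<^sup>L lborel (?c (X A - x)) * integral\<^sup>L lborel (?c (Y A - y))))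
      = mean I (\<lambda>A. complex_of_real (4 * pi\<^sup>2 * of_bool (X A = x \<and> Y A = y)))"
      unfolding mean_def v1 by (intro sum.cong refl arg_cong2[where f = scaleR]) (simp add: power2_eq_square)
    then show ?thesis by (simp only: mean_of_real mean_mult_left)
  qed
  ultimately show ?thesis by (simp only:)
qed

end

section \<open>The characteristic function of the two counts and the local limit\<close>

context two_sides
begin

definition red_stay :: "'a set set \<Rightarrow> int" where "red_stay A = int (card {v \<in> R. 0 \<le> disc VV A v})"
definition blue_stay :: "'a set set \<Rightarrow> int" where "blue_stay A = int (card {v \<in> B. 0 \<le> disc VV A v})"

abbreviation "edges \<equiv> possible_edges VV"

definition cfun :: "real \<Rightarrow> real \<Rightarrow> complex" where
  "cfun s t = mean edges (\<lambda>A. cis (s * of_int (red_stay A) + t * of_int (blue_stay A)))"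

text \<open>The centre of the statement, with \<open>kap\<close> in place of the reciprocal square
  root.\<close>

definition red_center :: real where "red_center = (1/2 + kap * (p * (real \<Delta> - 1) + 1/2)) * n"
definition blue_center :: real where "blue_center = (1/2 + kap * (p * (- real \<Delta> - 1) + 1/2)) * n"

definition cutoff :: real where "cutoff = u ^ 3 / sqrt n"

lemma finite_edges: "finite edges"
  using finite_V by (rule finite_possible_edges)

lemma n_pos: "0 < real n"
  using n_ge by linarith

lemma sum_stays: "(\<Sum>v\<in>R. stays VV A v) = of_int (red_stay A)" "(\<Sum>v\<in>B. stays VV A v) = of_int (blue_stay A)"
proof -
  have "(\<Sum>v\<in>X. stays VV A v) = card {v \<in> X. 0 \<le> disc VV A v}" if "finite X" for X
  proof -
    have "(\<Sum>v\<in>X. stays VV A v) = (\<Sum>v\<in>{v \<in> X. 0 \<le> disc VV A v}. 1)"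
      unfolding stays_def using that by (intro sum.mono_neutral_cong_right) auto
    then show ?thesis by simp
  qed
  then show "(\<Sum>v\<in>R. stays VV A v) = of_int (red_stay A)" "(\<Sum>v\<in>B. stays VV A v) = of_int (blue_stay A)"
    using finite_R finite_B by (simp_all add: red_stay_def blue_stay_def)
qed

lemma sum_freq_mult: "(\<Sum>v\<in>VV. freq s t v * f v) = s * (\<Sum>v\<in>R. f v) + t * (\<Sum>v\<in>B. f v)"
proof -
  have "(\<Sum>v\<in>B. freq s t v * f v) = (\<Sum>v\<in>B. t * f v)" using disjoint by (intro sum.cong) (auto simp: freq_def)
  then show ?thesis by (simp add: sum_VV freq_def sum_distrib_left)
qed

lemma cutoff_pos: "0 < cutoff" and cutoff_square: "cutoff\<^sup>2 = u ^ 6 / n" and cutoff_le: "cutoff \<le> 1"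
  and cutoff_eq: "cutoff = 1 / u ^ 47"
proof -
  show "0 < cutoff" using u_ge n_pos by (simp add: cutoff_def)
  show "cutoff\<^sup>2 = u ^ 6 / n" using n_pos by (simp add: cutoff_def power_divide flip: power_mult)
  have "u ^ 50 = u ^ 3 * u ^ 47" by (simp flip: power_add)
  moreover have "u ^ 3 / (u ^ 3 * u ^ 47) = 1 / u ^ 47" using u_ge by (intro nonzero_divide_mult_cancel_left) auto
  ultimately show e: "cutoff = 1 / u ^ 47" unfolding cutoff_def sqrt_n by (simp only:)
  have "1 \<le> u ^ 47" using u_ge by (intro one_le_power) auto
  then show "cutoff \<le> 1" unfolding e by (subst divide_le_eq_1_pos) linarith+
qed

text \<open>Powers of \<open>u\<close>: the error of \<open>fourier_clt\<close> has exponent 100 - 3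
  * 47 + 25 = - 16, that of the variance 4 + 50 - 94 = - 40, and that of the centres 3 - 47 = -
  44.\<close>

lemma cfun_low:
  fixes s t x y :: real
  assumes st: "\<bar>s\<bar> \<le> cutoff" "\<bar>t\<bar> \<le> cutoff"
  shows "norm (cfun s t * cis (- (s * x + t * y))
     - of_real (exp (- limit_form s t / 2)) * cis (- (s * (x - red_center) + t * (y - blue_center)))) \<le> 1000 / u ^ 16"
proof -
  define m where "m = s * (\<Sum>v\<in>R. stay_prob VV v) + t * (\<Sum>v\<in>B. stay_prob VV v)"
  define \<phi> where "\<phi> = mean edges (\<lambda>A. cis (fluct (freq s t) A))"
  define G where "G = complex_of_real (exp (- limit_form s t / 2))"
  define \<alpha> where "\<alpha> = m - (s * x + t * y)"
  define \<beta> where "\<beta> = - (s * (x - red_center) + t * (y - blue_center))"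
  have fl: "s * of_int (red_stay A) + t * of_int (blue_stay A) = fluct (freq s t) A + m" for A
    unfolding fluct_def sum_freq_mult m_def by (simp add: sum_subtractf sum_stays algebra_simps)
  have "cfun s t = \<phi> * cis m" unfolding cfun_def fl \<phi>_def cis_mult[symmetric] by (rule mean_mult_right)
  then have c: "cfun s t * cis (- (s * x + t * y)) = \<phi> * cis \<alpha>"
  proof -
    have "m + - (s * x + t * y) = \<alpha>" by (simp add: \<alpha>_def)
    then show "cfun s t * cis (- (s * x + t * y)) = \<phi> * cis \<alpha>" if "cfun s t = \<phi> * cis m"
      unfolding that mult.assoc cis_mult by (simp only:)
  qed
  have z1: "1 / sqrt (card VV) \<le> cutoff"
  proof -
    have "sqrt n \<le> sqrt (card VV)" by (simp add: card_VV)
    then have "1 / sqrt (card VV) \<le> 1 / sqrt n" using n_pos by (intro divide_left_mono mult_pos_pos) (auto simp: card_VV)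
    also have "\<dots> \<le> cutoff" unfolding cutoff_def using u_ge by (intro divide_right_mono) (auto intro!: one_le_power)
    finally show ?thesis .
  qed
  have Q0: "0 \<le> limit_form s t" by (simp add: limit_form_def)
  have \<phi>G: "norm (\<phi> - G) \<le> 150 * card VV * cutoff ^ 3 * root4 + 80 * u ^ 4 * sqrt n * cutoff\<^sup>2"
  proof -
    have "norm (\<phi> - G) \<le> 150 * card VV * cutoff ^ 3 * root4 + \<bar>(\<Sum>v\<in>VV. freq s t v * drift (freq s t) v) - limit_form s t\<bar>"
      unfolding \<phi>_def G_def using st by (intro fourier_clt z1 Q0) (auto simp: freq_def)
    then show ?thesis using drift_near[OF st] by linarith
  qed
  have t1: "150 * card VV * cutoff ^ 3 * root4 \<le> 900 / u ^ 16"
  proof -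
    have N3: "real (card VV) \<le> 3 * n" using Delta_le by (simp add: card_VV)
    have r4: "root4 \<le> 2 * u ^ 25"
    proof -
      have "real (card VV) \<le> (2 * u ^ 25) ^ 4"
      proof -
        have "(2 * u ^ 25) ^ 4 = 16 * real n" by (simp add: power_mult_distrib n_eq flip: power_mult)
        then show ?thesis using N3 n_pos by simp
      qed
      then have "sqrt (sqrt (card VV)) \<le> sqrt (sqrt ((2 * u ^ 25) ^ 4))" by (intro real_sqrt_le_mono)
      also have "sqrt ((2 * u ^ 25) ^ 4) = (2 * u ^ 25)\<^sup>2"
        by (rule real_sqrt_unique) (simp_all flip: power_mult)
      finally show ?thesis unfolding root4_def using u_ge by (simp only: real_sqrt_abs) simp
    qed
    have "150 * card VV * cutoff ^ 3 * root4 \<le> 150 * (3 * n) * cutoff ^ 3 * (2 * u ^ 25)"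
      using N3 r4 cutoff_pos root4 by (intro mult_mono) auto
    also have "\<dots> = 900 * (u ^ 125 * cutoff ^ 3)" by (simp add: n_eq flip: power_add)
    also have "u ^ 125 * cutoff ^ 3 = 1 / u ^ 16"
    proof -
      have "u ^ 125 * u ^ 16 = (u ^ 47) ^ 3" by (simp flip: power_add power_mult)
      then show ?thesis using u_ge by (simp add: cutoff_eq power_divide field_simps)
    qed
    finally show ?thesis by simp
  qed
  have t2: "80 * u ^ 4 * sqrt n * cutoff\<^sup>2 \<le> 80 / u ^ 16"
  proof -
    have "u ^ 4 * sqrt n * cutoff\<^sup>2 = u ^ 54 / u ^ 94" by (simp add: sqrt_n cutoff_eq power_divide flip: power_add power_mult)
    also have "\<dots> \<le> 1 / u ^ 16"
    proof -
      have "u ^ 54 * u ^ 16 \<le> u ^ 94" unfolding power_add[symmetric] using u_ge by (intro power_increasing) auto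
      then show ?thesis using u_ge by (simp add: field_simps)
    qed
    finally show ?thesis by simp
  qed
  have t3: "\<bar>\<alpha> - \<beta>\<bar> \<le> 14 / u ^ 16"
  proof -
    have "\<alpha> - \<beta> = s * ((\<Sum>v\<in>R. stay_prob VV v) - red_center) + t * ((\<Sum>v\<in>B. stay_prob VV v) - blue_center)"
      by (simp add: \<alpha>_def \<beta>_def m_def algebra_simps)
    also have "\<bar>\<dots>\<bar> \<le> \<bar>s\<bar> * \<bar>(\<Sum>v\<in>R. stay_prob VV v) - red_center\<bar> + \<bar>t\<bar> * \<bar>(\<Sum>v\<in>B. stay_prob VV v) - blue_center\<bar>"
      unfolding abs_mult[symmetric] by (rule abs_triangle_ineq)
    also have "\<dots> \<le> cutoff * (7 * u ^ 3) + cutoff * (7 * u ^ 3)"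
      unfolding red_center_def blue_center_def using sum_stay_prob_near st cutoff_pos by (intro add_mono mult_mono) auto
    also have "\<dots> = 14 * (u ^ 3 / u ^ 47)" by (simp add: cutoff_eq)
    also have "u ^ 3 / u ^ 47 \<le> 1 / u ^ 16"
    proof -
      have "u ^ 3 * u ^ 16 \<le> u ^ 47" unfolding power_add[symmetric] using u_ge by (intro power_increasing) auto
      then show ?thesis using u_ge by (simp add: field_simps)
    qed
    finally show ?thesis by simp
  qed
  have cc: "norm (cis \<alpha> - cis \<beta>) \<le> \<bar>\<alpha> - \<beta>\<bar>"
  proof -
    have "cis \<alpha> - cis \<beta> = cis \<beta> * (cis (\<alpha> - \<beta>) - 1)" by (simp add: right_diff_distrib cis_mult)
    then show ?thesis using norm_cis_minus_1_le[of "\<alpha> - \<beta>"] by (simp only: norm_mult norm_cis mult_1)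
  qed
  have "\<phi> * cis \<alpha> - G * cis \<beta> = (\<phi> - G) * cis \<alpha> + G * (cis \<alpha> - cis \<beta>)" by (simp add: algebra_simps)
  also have "norm \<dots> \<le> norm ((\<phi> - G) * cis \<alpha>) + norm (G * (cis \<alpha> - cis \<beta>))" by (rule norm_triangle_ineq)
  also have "\<dots> \<le> norm (\<phi> - G) + 1 * norm (cis \<alpha> - cis \<beta>)"
    unfolding norm_mult using Q0 by (intro add_mono mult_right_mono) (auto simp: G_def)
  also have "\<dots> \<le> 900 / u ^ 16 + 80 / u ^ 16 + 14 / u ^ 16" using \<phi>G t1 t2 cc t3 by linarith
  also have "\<dots> \<le> 1000 / u ^ 16" unfolding add_divide_distrib[symmetric] using u_ge by (intro divide_right_mono) auto
  finally show ?thesis unfolding c G_def \<beta>_def .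
qed

lemma cfun_high:
  fixes s t :: real
  assumes st: "\<bar>s\<bar> \<le> pi" "\<bar>t\<bar> \<le> pi" "cutoff < \<bar>s\<bar> \<or> cutoff < \<bar>t\<bar>"
  shows "norm (cfun s t) \<le> 60 * n * exp (- u / 500)"
proof -
  \<comment> \<open>\<open>S\<close> takes \<open>m\<close> vertices from each side. These are
    enough to make \<open>m * cutoff\<^sup>2\<close> of order \<open>u\<close>, and few enough that
    \<open>\<theta>\<close>, chosen as u^48, satisfies
    \<open>\<theta>\<^sup>2 / card S \<ge> u / 2\<close>.\<close>
  define m where "m = nat \<lfloor>u ^ 95\<rfloor>"
  have u95: "1000000 \<le> u ^ 95"
  proof -
    have "1000 ^ 2 \<le> u ^ 2" using u_ge by (intro power_mono) auto
    also have "\<dots> \<le> u ^ 95" using u_ge by (intro power_increasing) auto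
    finally show ?thesis by simp
  qed
  have m: "u ^ 95 - 1 \<le> m" "m \<le> u ^ 95"
  proof -
    have "0 \<le> u ^ 95" using u95 by linarith
    then have "0 \<le> \<lfloor>u ^ 95\<rfloor>" by (simp only: zero_le_floor)
    then have "real m = of_int \<lfloor>u ^ 95\<rfloor>" by (simp add: m_def)
    then show "u ^ 95 - 1 \<le> m" "m \<le> u ^ 95" by linarith+
  qed
  have mh: "u ^ 95 / 2 \<le> m" using m u95 by linarith
  have mn: "8 * real m \<le> n"
  proof -
    have "8 * real m \<le> u * u ^ 95" using m u_ge by (intro mult_mono) auto
    also have "\<dots> = u ^ 96" by (simp flip: power_Suc)
    also have "\<dots> \<le> u ^ 100" using u_ge by (intro power_increasing) auto
    finally show ?thesis by (simp only: n_eq)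
  qed
  have mn': "8 * m \<le> n" using mn by linarith
  obtain SR where SR: "SR \<subseteq> R" "card SR = m" using obtain_subset_with_card_n[of m R] mn' card_R by auto
  obtain SB where SB: "SB \<subseteq> B" "card SB = m" using obtain_subset_with_card_n[of m B] mn' card_B by auto
  have fS: "finite SR" "finite SB" using SR SB finite_R finite_B by (auto dest: finite_subset)
  define S where "S = SR \<union> SB"
  define W1 where "W1 = R - SR"
  define W2 where "W2 = B - SB"
  define W where "W = W1 \<union> W2"
  have m0: "0 < m" using mh u95 by linarith
  have cS: "card S = 2 * m" unfolding S_def using fS SR SB disjoint by (subst card_Un_disjoint) auto
  have cW1: "card W1 = n + \<Delta> - m" and cW2: "card W2 = n - m"
    unfolding W1_def W2_def using SR SB fS card_R card_B by (simp_all add: card_Diff_subset)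
  have fW: "finite W1" "finite W2" "finite W" using finite_R finite_B by (auto simp: W1_def W2_def W_def)
  have dW: "W1 \<inter> W2 = {}" using disjoint by (auto simp: W1_def W2_def)
  have SW: "S \<inter> W = {}" "S \<union> W = VV" using SR SB disjoint by (auto simp: S_def W_def W1_def W2_def VV_def)
  have fSS: "finite S" using fS by (simp add: S_def)
  have cW: "card W = card W1 + card W2" unfolding W_def using fW dW by (intro card_Un_disjoint) auto
  \<comment> \<open>The part of \<open>S\<close> on a side whose frequency exceeds the
    cutoff.\<close>
  define S' where "S' = (if cutoff < \<bar>s\<bar> then SR else SB)"
  have S': "S' \<subseteq> S" "card S' = m" using SR SB by (auto simp: S'_def S_def)
  define \<theta> where "\<theta> = u ^ 48"
  have th0: "1 \<le> \<theta>" unfolding \<theta>_def using u_ge by (intro one_le_power) auto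
  \<comment> \<open>One factor \<open>u\<close> compensates \<open>pq\<close>, and 22^2 = 484 is
    below u / 2 because u \<ge> 1000.\<close>
  have big: "22 * u ^ 49 \<le> sqrt (pq * k)" if k: "real n / 2 \<le> k" for k :: real
  proof (rule real_le_rsqrt)
    have "(22 * u ^ 49)\<^sup>2 = 484 * u ^ 98" by (simp add: power_mult_distrib flip: power_mult)
    also have "\<dots> \<le> (u / 2) * u ^ 98" using u_ge by (intro mult_right_mono) auto
    also have "\<dots> = u ^ 99 / 2" by (simp flip: power_Suc)
    also have "\<dots> \<le> (u * pq) * (u ^ 99 / 2)" using u_pq u_ge by (simp add: mult_le_cancel_right1)
    also have "\<dots> = pq * (n / 2)" by (simp add: n_eq flip: power_Suc)
    also have "\<dots> \<le> pq * k" using k pq_pos by (intro mult_left_mono) auto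
    finally show "(22 * u ^ 49)\<^sup>2 \<le> pq * k" .
  qed
  have uu: "u * u ^ 48 = u ^ 49" by (simp flip: power_Suc)
  have u48: "u \<le> u ^ 48" using u_ge by (intro self_le_power) auto
  \<comment> \<open>The window is much narrower than the standard deviation, so the point
    probabilities in it keep at least half of their central value.\<close>
  have kappa: "kap / 2 \<le> pp (W - {w}) (sg v) j" if v: "v \<in> S'" and w: "w \<in> W" and j: "\<bar>real_of_int j\<bar> \<le> \<theta> + 1" for v w j
  proof -
    define M where "M = n - m - 1"
    have M: "real M = real n - m - 1" using mn' m0 by (simp add: M_def of_nat_diff)
    have M2: "n \<le> 2 * M" using mn' m0 by (simp add: M_def)
    have M0: "0 < real M" "real n / 2 \<le> M" using M2 n_pos by linarith+
    let ?J = "W - {w}"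
    have JR: "?J \<inter> R = W1 - {w}" "?J \<inter> B = W2 - {w}" using disjoint by (auto simp: W_def W1_def W2_def)
    have c1: "card W1 - 1 \<le> card (W1 - {w})" "card (W1 - {w}) \<le> card W1" "card W2 - 1 \<le> card (W2 - {w})" "card (W2 - {w}) \<le> card W2"
      using fW by (auto simp: card_Diff_singleton_if card_Diff1_le)
    have "\<bar>pp ?J (sg v) j - 1 / (2 * sqrt (pi * pq * M))\<bar> \<le> (real (\<Delta> + 2) + \<bar>real_of_int j\<bar> + 12) / (pq * M)"
    proof (rule pp_near_general)
      show "v \<in> VV" using v S' SW by auto
      show "?J \<subseteq> VV" using SW by auto
      show "n \<le> 2 * M" by (rule M2)
      show "M \<le> card (?J \<inter> R)" "M \<le> card (?J \<inter> B)" "card (?J \<inter> R) + card (?J \<inter> B) \<le> 2 * M + (\<Delta> + 2)"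
        unfolding JR using c1 cW1 cW2 mn' m0 by (simp_all add: M_def)
    qed
    also have "\<dots> \<le> 2 * u ^ 48 / (pq * M)"
    proof (intro divide_right_mono)
      show "real (\<Delta> + 2) + \<bar>real_of_int j\<bar> + 12 \<le> 2 * u ^ 48" using j u_Delta u48 by (simp add: \<theta>_def)
    qed (use pq_pos in auto)
    also have "\<dots> \<le> 1 / (4 * sqrt (pi * pq * M))"
    proof -
      define r where "r = sqrt (pq * M)"
      have r: "22 * u ^ 49 \<le> r" unfolding r_def by (rule big[OF M0(2)])
      have r0: "0 < r" using r u_ge by (smt (verit) zero_less_power)
      have rr: "pq * M = r * r" using pq_pos by (simp add: r_def)
      have sp: "sqrt pi \<le> 2" using pi_less_4 by (intro real_le_lsqrt) auto
      have "2 * u ^ 48 * (4 * sqrt pi) \<le> 2 * u ^ 48 * (4 * 2)" using sp u_ge by (intro mult_left_mono) auto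
      also have "\<dots> \<le> 22 * u ^ 49" unfolding uu[symmetric] using u_ge by (simp add: mult_le_cancel_right)
      also have "\<dots> \<le> r" by (rule r)
      finally have "2 * u ^ 48 * (4 * sqrt pi) \<le> r" .
      then have "2 * u ^ 48 / (r * r) \<le> 1 / (4 * (sqrt pi * r))" using r0 by (simp add: field_simps)
      moreover have "sqrt (pi * pq * M) = sqrt pi * r" by (simp add: r_def real_sqrt_mult mult.assoc)
      ultimately show ?thesis by (simp only: rr)
    qed
    finally have "1 / (2 * sqrt (pi * pq * M)) - 1 / (4 * sqrt (pi * pq * M)) \<le> pp ?J (sg v) j" by linarith
    moreover have "1 / (2 * sqrt (pi * pq * M)) - 1 / (4 * sqrt (pi * pq * M)) = 1 / (2 * sqrt (pi * pq * M)) / 2" by simp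
    moreover have "kap \<le> 1 / (2 * sqrt (pi * pq * M))"
      unfolding kap_def using M M0 pq_pos n_pos by (intro divide_left_mono mult_left_mono real_sqrt_le_mono mult_pos_pos) auto
    ultimately show ?thesis by linarith
  qed
  \<comment> \<open>\<open>bad_count_tail\<close> uses the edges to a second set, so the two sides
    of \<open>W\<close> are treated in turn. If each has fewer than n / 8 vertices of small
    discrepancy, more than \<open>n\<close> others remain, since \<open>W\<close> has at least 7 n /
    4 vertices.\<close>
  have bad: "mean (possible_edges W) (\<lambda>Q. of_bool (card {w \<in> W. \<theta> < \<bar>real_of_int (disc W Q w)\<bar>} < real n)) \<le> 2 * exp (- (n / 16))"
  proof -
    define N1 where "N1 Q = (\<Sum>v\<in>W1. of_bool (\<bar>real_of_int (disc W Q v)\<bar> \<le> \<theta>) :: real)" for Q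
    define N2 where "N2 Q = (\<Sum>v\<in>W2. of_bool (\<bar>real_of_int (disc W Q v)\<bar> \<le> \<theta>) :: real)" for Q
    have cnt: "real (card {w \<in> W. \<theta> < \<bar>real_of_int (disc W Q w)\<bar>}) = card W - (N1 Q + N2 Q)" for Q
    proof -
      have "N1 Q + N2 Q = (\<Sum>v\<in>W. of_bool (\<bar>real_of_int (disc W Q v)\<bar> \<le> \<theta>))"
        unfolding N1_def N2_def W_def using fW dW by (intro sum.union_disjoint[symmetric]) auto
      also have "\<dots> = (\<Sum>v\<in>W. 1 - of_bool (\<theta> < \<bar>real_of_int (disc W Q v)\<bar>))" by (intro sum.cong) auto
      also have "\<dots> = real (card W) - (\<Sum>v\<in>W. of_bool (\<theta> < \<bar>real_of_int (disc W Q v)\<bar>) :: real)" by (simp add: sum_subtractf)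
      also have "(\<Sum>v\<in>W. of_bool (\<theta> < \<bar>real_of_int (disc W Q v)\<bar>) :: real) = (\<Sum>v\<in>{w \<in> W. \<theta> < \<bar>real_of_int (disc W Q w)\<bar>}. (1::real))"
        using fW by (intro sum.mono_neutral_cong_right) auto
      finally show ?thesis by simp
    qed
    have est: "exp (2 * k1 * ((2 * \<theta> + 1) / sqrt (pq * k2)) - n / 8) \<le> exp (- (n / 16))"
      if k: "real n / 2 \<le> k2" "k1 \<le> 2 * real n" "0 \<le> k1" for k1 k2 :: real
    proof -
      have "(2 * \<theta> + 1) / sqrt (pq * k2) \<le> 3 * u ^ 48 / (22 * u ^ 49)"
        using th0 big[OF k(1)] u_ge by (intro frac_le) (auto simp: \<theta>_def)
      also have "\<dots> = 3 / (22 * u)" using u_ge unfolding uu[symmetric] by simp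
      also have "\<dots> \<le> 1 / 64" using u_ge by (simp add: field_simps)
      finally have "2 * k1 * ((2 * \<theta> + 1) / sqrt (pq * k2)) \<le> 2 * (2 * n) * (1 / 64)"
        using k th0 n_pos pq_pos
        by (intro mult_mono divide_nonneg_nonneg real_sqrt_ge_zero mult_nonneg_nonneg) auto
      then show ?thesis by simp
    qed
    have W2k: "real n / 2 \<le> card W2" "real n / 2 \<le> card W1" using cW1 cW2 mn' by auto
    have W2l: "card W1 \<le> 2 * real n" "card W2 \<le> 2 * real n" using cW1 cW2 Delta_le by auto
    have ne: "W1 \<noteq> {}" "W2 \<noteq> {}" using W2k n_pos by auto
    have b1: "mean (possible_edges W) (\<lambda>Q. of_bool (n / 8 \<le> N1 Q)) \<le> exp (- (n / 16))"
      unfolding N1_def W_def using th0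
      by (intro order_trans[OF bad_count_tail[OF fW(1,2) dW ne(2), unfolded of_nat_mult of_nat_numeral] est[OF W2k(1) W2l(1)]]) auto
    have b2: "mean (possible_edges W) (\<lambda>Q. of_bool (n / 8 \<le> N2 Q)) \<le> exp (- (n / 16))"
    proof -
      have c: "W1 \<union> W2 = W2 \<union> W1" "W2 \<inter> W1 = {}" using dW by auto
      show ?thesis
        unfolding N2_def W_def c(1) using th0
        by (intro order_trans[OF bad_count_tail[OF fW(2,1) c(2) ne(1), unfolded of_nat_mult of_nat_numeral] est[OF W2k(2) W2l(2)]]) auto
    qed
    have "mean (possible_edges W) (\<lambda>Q. of_bool (card {w \<in> W. \<theta> < \<bar>real_of_int (disc W Q w)\<bar>} < real n))
      \<le> mean (possible_edges W) (\<lambda>Q. of_bool (n / 8 \<le> N1 Q) + of_bool (n / 8 \<le> N2 Q) :: real)"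
    proof (intro mean_mono)
      fix Q
      have "n / 8 \<le> N1 Q \<or> n / 8 \<le> N2 Q" if "real (card {w \<in> W. \<theta> < \<bar>real_of_int (disc W Q w)\<bar>}) < n"
      proof -
        have "real (card W) = 2 * real n + \<Delta> - 2 * m" using cW cW1 cW2 mn' by (simp add: of_nat_diff)
        then show ?thesis using that mn n_pos unfolding cnt by linarith
      qed
      then show "(of_bool (card {w \<in> W. \<theta> < \<bar>real_of_int (disc W Q w)\<bar>} < real n) :: real) \<le> of_bool (n / 8 \<le> N1 Q) + of_bool (n / 8 \<le> N2 Q)"
        by auto
    qed
    then show ?thesis using b1 b2 by (simp add: mean_add)
  qed
  have eqc: "cfun s t = mean (possible_edges (S \<union> W)) (\<lambda>A. cis (\<Sum>v\<in>S \<union> W. freq s t v * stays (S \<union> W) A v))"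
    unfolding SW(2) cfun_def sum_freq_mult sum_stays ..
  have "norm (cfun s t) \<le> (12 * card W + 6 * card S) * exp (- (3/4) * \<theta>\<^sup>2 / card S) + 2 * exp (- (n / 16))
       + exp (- (card S' * (2 / pi\<^sup>2 * cutoff\<^sup>2 * pq * real n * (kap / 2)\<^sup>2)))"
    unfolding eqc
  proof (rule fourier_high_frequency[OF fSS fW(3) SW(1) S'(1)])
    show "S' \<noteq> {}" using S'(2) m0 by auto
    show "0 \<le> cutoff" using cutoff_pos by simp
    show "cutoff \<le> \<bar>freq s t v\<bar>" if "v \<in> S'" for v
      using that st(3) SR SB disjoint by (auto simp: S'_def freq_def split: if_splits)
    show "\<bar>freq s t v\<bar> \<le> pi" if "v \<in> S'" for v using st by (simp add: freq_def)
    show "0 \<le> \<theta>" using th0 by simp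
    have "u ^ 48 \<le> u ^ 95" using u_ge by (intro power_increasing) auto
    then show "\<theta> \<le> card S" using mh unfolding cS \<theta>_def by simp
    have "sum side S = sum side SR + sum side SB" unfolding S_def using fS SR SB disjoint by (intro sum.union_disjoint) auto
    also have "sum side SR = (\<Sum>v\<in>SR. 1)" using SR by (intro sum.cong) (auto simp: side_def)
    also have "sum side SB = (\<Sum>v\<in>SB. - 1)" using SB disjoint by (intro sum.cong) (auto simp: side_def)
    finally show "sum side S = 0" using SR SB by simp
    show "0 \<le> kap / 2" using kap_pos by simp
    show "0 < real n" by (rule n_pos)
  qed (use kappa bad in auto)
  also have "(12 * card W + 6 * card S) * exp (- (3/4) * \<theta>\<^sup>2 / card S) \<le> (36 * n) * exp (- u / 500)"
  proof (intro mult_mono)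
    show "real (12 * card W + 6 * card S) \<le> 36 * n" using cW cW1 cW2 cS mn' Delta_le by (simp add: of_nat_diff)
    have "u / 500 \<le> (3/4) * (u / 2)" using u_ge by simp
    also have "u / 2 \<le> \<theta>\<^sup>2 / card S"
    proof -
      have "u / 2 * (2 * m) \<le> u * u ^ 95" using m u_ge by simp
      also have "\<dots> = \<theta>\<^sup>2" by (simp add: \<theta>_def flip: power_mult power_Suc)
      finally show ?thesis unfolding cS using m0 by (simp add: field_simps)
    qed
    finally show "exp (- (3/4) * \<theta>\<^sup>2 / card S) \<le> exp (- u / 500)" by simp
  qed auto
  also have "2 * exp (- (n / 16)) \<le> (2 * n) * exp (- u / 500)"
  proof (intro mult_mono)
    have "u \<le> u ^ 2" using u_ge by (intro self_le_power) auto
    then show "exp (- (n / 16)) \<le> exp (- u / 500)" using n_ge u_ge by simp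
  qed (use n_ge in auto)
  also have "exp (- (card S' * (2 / pi\<^sup>2 * cutoff\<^sup>2 * pq * real n * (kap / 2)\<^sup>2))) \<le> (1 * n) * exp (- u / 500)"
  proof -
    have kp: "pq * real n * (kap / 2)\<^sup>2 = 1 / (16 * pi)"
      using pq_pos n_pos by (simp add: kap_def power_divide power_mult_distrib)
    \<comment> \<open>The 500 is 16 * 31.25, where 31.25 bounds pi^3.\<close>
    have "u / 500 \<le> u / (16 * pi ^ 3)"
    proof -
      have "pi ^ 3 \<le> 3.142 ^ 3" using pi_approx by (intro power_mono) auto
      also have "\<dots> \<le> (31.25 :: real)" by (simp add: power3_eq_cube)
      finally show ?thesis using u_ge by (intro divide_left_mono) auto
    qed
    also have "\<dots> = (u ^ 95 / 2) * (2 / pi\<^sup>2 * (u ^ 6 / n) * (1 / (16 * pi)))"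
    proof -
      have "u ^ 95 * u ^ 6 = u * n" by (simp add: n_eq flip: power_add power_Suc)
      then show ?thesis using n_pos by (simp add: power2_eq_square power3_eq_cube field_simps)
    qed
    also have "\<dots> \<le> m * (2 / pi\<^sup>2 * (u ^ 6 / n) * (1 / (16 * pi)))" using mh n_pos u_ge by (intro mult_right_mono) auto
    also have "\<dots> = card S' * (2 / pi\<^sup>2 * cutoff\<^sup>2 * pq * real n * (kap / 2)\<^sup>2)"
      unfolding S'(2) cutoff_square using kp by (simp only: mult.assoc)
    finally have "exp (- (card S' * (2 / pi\<^sup>2 * cutoff\<^sup>2 * pq * real n * (kap / 2)\<^sup>2))) \<le> 1 * exp (- u / 500)" by simp
    also have "\<dots> \<le> (1 * n) * exp (- u / 500)" using n_ge by (intro mult_right_mono) auto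
    finally show ?thesis .
  qed
  finally have "norm (cfun s t) \<le> (36 * n) * exp (- u / 500) + (2 * n) * exp (- u / 500) + (1 * n) * exp (- u / 500)" by simp
  also have "\<dots> \<le> 60 * n * exp (- u / 500)" unfolding distrib_right[symmetric] by (intro mult_right_mono) auto
  finally show ?thesis .
qed

end

text \<open>Rewrites the exponent of \<open>gauss_fourier_2d\<close> in the normalised variables. It
  is applied with k = n / (4 pi) and c = 1 + pi, for which c^2 - 1 = pi (2 + pi).\<close>

lemma gauss_exponent:
  fixes k c x y :: real
  assumes k: "0 < k" and c: "1 < c"
  shows "(sqrt k * y)\<^sup>2 / (2 * (k * c)) + (sqrt k * x - k * (sqrt k * y) / (k * c))\<^sup>2 / (2 * (k * c - k\<^sup>2 / (k * c)))
    = (c * x\<^sup>2 - 2 * x * y + c * y\<^sup>2) / (2 * (c\<^sup>2 - 1))"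
proof -
  have c2: "0 < c\<^sup>2 - 1" using c by (simp add: power2_eq_square less_1_mult)
  have 1: "(sqrt k * y)\<^sup>2 / (2 * (k * c)) = y\<^sup>2 / (2 * c)" using k c by (simp add: power_mult_distrib)
  have "sqrt k * x - k * (sqrt k * y) / (k * c) = sqrt k * (x - y / c)" using k c by (simp add: right_diff_distrib)
  then have 2: "(sqrt k * x - k * (sqrt k * y) / (k * c))\<^sup>2 = k * (x - y / c)\<^sup>2" using k by (simp add: power_mult_distrib)
  have 3: "k * c - k\<^sup>2 / (k * c) = k * ((c\<^sup>2 - 1) / c)" using k c by (simp add: power2_eq_square field_simps)
  have 4: "k * (x - y / c)\<^sup>2 / (2 * (k * ((c\<^sup>2 - 1) / c))) = (c * (x - y / c)\<^sup>2) / (2 * (c\<^sup>2 - 1))"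
    using k c c2 by (simp add: field_simps)
  have "y\<^sup>2 / (2 * c) = (y\<^sup>2 * (c\<^sup>2 - 1) / c) / (2 * (c\<^sup>2 - 1))"
  proof -
    define d where "d = c\<^sup>2 - 1"
    have "d \<noteq> 0" using c2 by (simp add: d_def)
    then show ?thesis unfolding d_def[symmetric] by simp
  qed
  then have "y\<^sup>2 / (2 * c) + (c * (x - y / c)\<^sup>2) / (2 * (c\<^sup>2 - 1)) = (y\<^sup>2 * (c\<^sup>2 - 1) / c + c * (x - y / c)\<^sup>2) / (2 * (c\<^sup>2 - 1))"
    by (simp only: add_divide_distrib)
  also have "y\<^sup>2 * (c\<^sup>2 - 1) / c + c * (x - y / c)\<^sup>2 = c * x\<^sup>2 - 2 * x * y + c * y\<^sup>2"
    using c by (simp add: power2_eq_square field_simps)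
  finally show ?thesis unfolding 1 2 3 4 .
qed

context two_sides
begin

lemma limit_form_eq: "limit_form s t = (n / (4 * pi) * (1 + pi)) * s\<^sup>2 + (n / (4 * pi) * (1 + pi)) * t\<^sup>2 + 2 * (n / (4 * pi)) * s * t"
proof -
  define k where "k = n / (4 * pi)"
  have k: "n / 4 = k * pi" by (simp add: k_def)
  show ?thesis unfolding limit_form_def k k_def[symmetric] by (simp add: power2_eq_square algebra_simps)
qed

text \<open>The probability is a Fourier integral over the square, the Gaussian density one over the
  plane, so it remains to integrate the difference of the integrands. Condition \<open>H\<close>
  makes \<open>exp (- u / 500)\<close> smaller than every power of \<open>n\<close> that is
  needed.\<close>

lemma local_limit:
  fixes x y :: int and x' y' :: real
  assumes H: "u ^ 210 * exp (- u / 500) \<le> 1"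
    and x': "sqrt (n / (4 * pi)) * x' = x - red_center" and y': "sqrt (n / (4 * pi)) * y' = y - blue_center"
  shows "\<bar>mean edges (\<lambda>A. of_bool (red_stay A = x \<and> blue_stay A = y))
     - 2 / (n * sqrt (pi * (2 + pi))) * exp (- (((1 + pi) * x'\<^sup>2 - 2 * x' * y' + (1 + pi) * y'\<^sup>2) / (2 * pi * (2 + pi))))\<bar>
    \<le> 300 / (u ^ 10 * n)"
proof -
  let ?M = "lborel \<Otimes>\<^sub>M lborel :: (real \<times> real) measure"
  define k where "k = n / (4 * pi)"
  have k0: "0 < k" using n_pos by (simp add: k_def)
  define a where "a = k * (1 + pi)"
  have ka: "0 \<le> k" "k < a" using k0 pi_gt_zero by (auto simp: a_def algebra_simps)
  define P where "P = mean edges (\<lambda>A. of_bool (red_stay A = x \<and> blue_stay A = y) :: real)"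
  define G where "G = 2 / (n * sqrt (pi * (2 + pi))) * exp (- (((1 + pi) * x'\<^sup>2 - 2 * x' * y' + (1 + pi) * y'\<^sup>2) / (2 * pi * (2 + pi))))"
  define F1 where "F1 = (\<lambda>(s, t). (indicator {-pi..pi} s * indicator {-pi..pi} t) *\<^sub>R (cfun s t * cis (- (s * of_int x + t * of_int y))))"
  define F2 where "F2 = (\<lambda>(s, t). complex_of_real (exp (- (limit_form s t / 2))) * cis (- (s * (x - red_center) + t * (y - blue_center))))"
  have F1: "has_bochner_integral ?M F1 (complex_of_real (4 * pi\<^sup>2 * P))"
    unfolding F1_def cfun_def P_def by (rule fourier_inversion_2d[OF finite_edges])
  have F2: "has_bochner_integral ?M F2 (complex_of_real (4 * pi\<^sup>2 * G))"
  proof -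
    have lf: "limit_form s t = a * s\<^sup>2 + a * t\<^sup>2 + 2 * k * s * t" for s t
      unfolding limit_form_eq a_def k_def ..
    have "has_bochner_integral ?M F2 (of_real (2 * pi / sqrt (a\<^sup>2 - k\<^sup>2) *
        exp (- ((y - blue_center)\<^sup>2 / (2 * a) + ((x - red_center) - k * (y - blue_center) / a)\<^sup>2 / (2 * (a - k\<^sup>2 / a))))))"
      unfolding F2_def lf by (rule gauss_fourier_2d[OF ka])
    moreover have "2 * pi / sqrt (a\<^sup>2 - k\<^sup>2) *
        exp (- ((y - blue_center)\<^sup>2 / (2 * a) + ((x - red_center) - k * (y - blue_center) / a)\<^sup>2 / (2 * (a - k\<^sup>2 / a)))) = 4 * pi\<^sup>2 * G"
    proof -
      have c1: "(1 + pi)\<^sup>2 - 1 = pi * (2 + pi)" by (simp add: power2_eq_square algebra_simps)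
      have "(y - blue_center)\<^sup>2 / (2 * a) + ((x - red_center) - k * (y - blue_center) / a)\<^sup>2 / (2 * (a - k\<^sup>2 / a))
        = ((1 + pi) * x'\<^sup>2 - 2 * x' * y' + (1 + pi) * y'\<^sup>2) / (2 * ((1 + pi)\<^sup>2 - 1))"
        unfolding x'[symmetric] y'[symmetric] k_def[symmetric] a_def using k0 pi_gt_zero by (intro gauss_exponent) auto
      then have e: "(y - blue_center)\<^sup>2 / (2 * a) + ((x - red_center) - k * (y - blue_center) / a)\<^sup>2 / (2 * (a - k\<^sup>2 / a))
        = ((1 + pi) * x'\<^sup>2 - 2 * x' * y' + (1 + pi) * y'\<^sup>2) / (2 * pi * (2 + pi))"
        by (simp only: c1 mult.assoc)
      have "a\<^sup>2 - k\<^sup>2 = k\<^sup>2 * (pi * (2 + pi))" unfolding a_def c1[symmetric] by (simp add: power2_eq_square algebra_simps)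
      then have "sqrt (a\<^sup>2 - k\<^sup>2) = k * sqrt (pi * (2 + pi))" using k0 by (simp only: real_sqrt_mult real_sqrt_abs)
      moreover have "2 * pi / (k * S) = 4 * pi\<^sup>2 * (2 / (n * S))" for S :: real
        by (simp add: k_def power2_eq_square)
      ultimately have "2 * pi / sqrt (a\<^sup>2 - k\<^sup>2) = 4 * pi\<^sup>2 * (2 / (n * sqrt (pi * (2 + pi))))"
        by (simp only:)
      then show ?thesis unfolding e G_def by (simp only: mult.assoc)
    qed
    ultimately show ?thesis by (simp only:)
  qed
  \<comment> \<open>The majorant of the difference: \<open>c1\<close> on the small square,
    \<open>c2\<close> for the characteristic function on the rest of the large square, and
    \<open>c3\<close> for the Gaussian outside the small square.\<close>
  define c1 where "c1 = 1000 / u ^ 16"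
  define c2 where "c2 = 60 * n * exp (- u / 500)"
  define c3 where "c3 = exp (- (u ^ 6 / 16))"
  define i1 where "i1 = (\<lambda>s::real. indicator {-cutoff..cutoff} s :: real)"
  define i2 where "i2 = (\<lambda>s::real. indicator {-pi..pi} s :: real)"
  define g where "g = (\<lambda>s::real. exp (- (n / 16) * s\<^sup>2))"
  have ii1: "integrable lborel i1" "integral\<^sup>L lborel i1 = 2 * cutoff" using cutoff_pos by (simp_all add: i1_def)
  have ii2: "integrable lborel i2" "integral\<^sup>L lborel i2 = 2 * pi" by (simp_all add: i2_def)
  have ig: "integrable lborel g" "integral\<^sup>L lborel g = sqrt (pi / (n / 16))"
    using has_bochner_integral_gauss_even[of "n / 16" 0] n_pos unfolding g_def by (simp_all add: has_bochner_integral_iff)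
  let ?b = "\<lambda>w. c1 * (case w of (s, t) \<Rightarrow> i1 s * i1 t) + c2 * (case w of (s, t) \<Rightarrow> i2 s * i2 t) + c3 * (case w of (s, t) \<Rightarrow> g s * g t)"
  have b: "has_bochner_integral ?M ?b (c1 * (2 * cutoff * (2 * cutoff)) + c2 * (2 * pi * (2 * pi)) + c3 * (sqrt (pi / (n / 16)) * sqrt (pi / (n / 16))))"
    using pair_lborel_mult[OF ii1(1) ii1(1)] pair_lborel_mult[OF ii2(1) ii2(1)] pair_lborel_mult[OF ig(1) ig(1)]
    unfolding ii1(2) ii2(2) ig(2)
    by (intro has_bochner_integral_add has_bochner_integral_mult_right)
  have cpi: "cutoff \<le> pi" using cutoff_le pi_gt3 by linarith
  have c0: "0 \<le> c1" "0 \<le> c2" "0 \<le> c3" using u_ge by (auto simp: c1_def c2_def c3_def)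
  have pt: "norm (F1 w - F2 w) \<le> ?b w" for w
  proof (cases w)
    case (Pair s t)
    have nn: "0 \<le> c1 * (i1 s * i1 t)" "0 \<le> c2 * (i2 s * i2 t)" "0 \<le> c3 * (g s * g t)"
      using c0 by (simp_all add: i1_def i2_def g_def)
    show ?thesis
    proof (cases "\<bar>s\<bar> \<le> cutoff \<and> \<bar>t\<bar> \<le> cutoff")
      case True
      then have "s \<in> {-pi..pi}" "t \<in> {-pi..pi}" using cpi by auto
      then have "F1 w = cfun s t * cis (- (s * of_int x + t * of_int y))" by (simp add: F1_def Pair)
      then have "norm (F1 w - F2 w) \<le> c1"
        using cfun_low[of s t "of_int x" "of_int y"] True by (simp add: F2_def Pair c1_def)
      also have "c1 = c1 * (i1 s * i1 t)"
      proof -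
        have "s \<in> {-cutoff..cutoff}" "t \<in> {-cutoff..cutoff}" using True by auto
        then show ?thesis by (simp add: i1_def)
      qed
      finally show ?thesis using nn by (simp add: Pair)
    next
      case False
      have "norm (F1 w) \<le> c2 * (i2 s * i2 t)"
      proof (cases "\<bar>s\<bar> \<le> pi \<and> \<bar>t\<bar> \<le> pi")
        case True
        then have "norm (cfun s t) \<le> c2" unfolding c2_def using False by (intro cfun_high) auto
        then show ?thesis using True by (auto simp: F1_def Pair i2_def norm_mult indicator_def)
      next
        case False
        then show ?thesis by (auto simp: F1_def Pair i2_def indicator_def)
      qed
      moreover have "norm (F2 w) \<le> c3 * (g s * g t)"
      proof -
        have "cutoff\<^sup>2 \<le> s\<^sup>2 + t\<^sup>2"
        proof (cases "\<bar>s\<bar> \<le> cutoff")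
          case True
          then have "cutoff\<^sup>2 \<le> \<bar>t\<bar>\<^sup>2" using False cutoff_pos by (intro power_mono) auto
          then have "cutoff\<^sup>2 \<le> t\<^sup>2" by simp
          then show ?thesis using zero_le_power2[of s] by linarith
        next
          case False
          then have "cutoff\<^sup>2 \<le> \<bar>s\<bar>\<^sup>2" using cutoff_pos by (intro power_mono) auto
          then have "cutoff\<^sup>2 \<le> s\<^sup>2" by simp
          then show ?thesis using zero_le_power2[of t] by linarith
        qed
        then have st: "u ^ 6 \<le> n * (s\<^sup>2 + t\<^sup>2)" unfolding cutoff_square using n_pos by (simp add: field_simps)
        have "n / 4 * (s\<^sup>2 + t\<^sup>2) \<le> limit_form s t" by (simp add: limit_form_def)
        \<comment> \<open>Half of the exponent yields the constant \<open>c3\<close>, the other half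
          keeps the majorant integrable.\<close>
        then have "u ^ 6 / 16 + n / 16 * s\<^sup>2 + n / 16 * t\<^sup>2 \<le> limit_form s t / 2" using st by (simp add: field_simps)
        then have "exp (- (limit_form s t / 2)) \<le> exp (- (u ^ 6 / 16) + - (n / 16) * s\<^sup>2 + - (n / 16) * t\<^sup>2)" by simp
        also have "\<dots> = c3 * (g s * g t)" by (simp only: exp_add c3_def g_def mult.assoc)
        finally show ?thesis by (simp add: F2_def Pair norm_mult)
      qed
      ultimately show ?thesis using nn norm_triangle_ineq4[of "F1 w" "F2 w"] by (simp add: Pair)
    qed
  qed
  have iF: "integrable ?M F1" "integrable ?M F2" "integral\<^sup>L ?M F1 = complex_of_real (4 * pi\<^sup>2 * P)" "integral\<^sup>L ?M F2 = complex_of_real (4 * pi\<^sup>2 * G)"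
    using F1 F2 by (simp_all add: has_bochner_integral_iff)
  have ib: "integrable ?M ?b" "integral\<^sup>L ?M ?b = c1 * (2 * cutoff * (2 * cutoff)) + c2 * (2 * pi * (2 * pi)) + c3 * (sqrt (pi / (n / 16)) * sqrt (pi / (n / 16)))"
    using b unfolding has_bochner_integral_iff by blast+
  have "norm (integral\<^sup>L ?M (\<lambda>w. F1 w - F2 w)) \<le> integral\<^sup>L ?M ?b"
    by (intro Bochner_Integration.integral_norm_bound_integral Bochner_Integration.integrable_diff iF ib pt)
  also have "integral\<^sup>L ?M (\<lambda>w. F1 w - F2 w) = complex_of_real (4 * pi\<^sup>2 * (P - G))"
    using Bochner_Integration.integral_diff[OF iF(1,2)] by (simp only: iF(3,4) of_real_diff[symmetric] right_diff_distrib)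
  finally have main: "4 * pi\<^sup>2 * \<bar>P - G\<bar> \<le> c1 * (4 * cutoff\<^sup>2) + c2 * (4 * pi\<^sup>2) + c3 * (16 * pi / n)"
    unfolding ib(2) norm_of_real abs_mult using n_pos by (simp add: power2_eq_square mult_ac)
  \<comment> \<open>The unit of error: \<open>cutoff\<^sup>2\<close> times u^(-16).\<close>
  define e where "e = 1 / (u ^ 10 * n)"
  have upos: "0 < u" using u_ge by linarith
  have pi2: "9 < pi\<^sup>2" using power_strict_mono[OF pi_gt3, of 2] by simp
  have E: "exp (- u / 500) \<le> 1 / u ^ 210" using H upos by (simp add: field_simps)
  have t1: "c1 * (4 * cutoff\<^sup>2) = 4000 * e"
  proof -
    have "u ^ 6 * u ^ 10 = u ^ 16" by (simp flip: power_add)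
    then show ?thesis unfolding c1_def cutoff_square e_def using upos n_pos by (simp add: field_simps)
  qed
  have t2: "c2 \<le> 60 * e"
  proof -
    have "c2 \<le> 60 * n * (1 / u ^ 210)" unfolding c2_def using E by (intro mult_left_mono) auto
    also have "\<dots> = 60 * e"
    proof -
      have "real n * (u ^ 10 * n) = u ^ 210" by (simp add: n_eq flip: power_add)
      then show ?thesis using upos n_pos unfolding e_def by (simp add: field_simps)
    qed
    finally show ?thesis .
  qed
  have t3: "c3 * (16 * pi / n) \<le> 64 * e"
  proof -
    have "c3 \<le> exp (- u / 500)"
    proof -
      have "u \<le> u ^ 6" using u_ge by (intro self_le_power) auto
      then show ?thesis using u_ge by (simp add: c3_def)
    qed
    also have "\<dots> \<le> 1 / u ^ 210" by (rule E)
    also have "\<dots> \<le> 1 / u ^ 10" using u_ge by (intro divide_left_mono power_increasing) auto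
    finally have "c3 * (16 * pi / n) \<le> 1 / u ^ 10 * (16 * 4 / n)"
      using pi_less_4 n_pos c0 upos by (intro mult_mono divide_right_mono) auto
    then show ?thesis by (simp add: e_def)
  qed
  have e0: "0 \<le> e" using upos by (simp add: e_def)
  have "4 * pi\<^sup>2 * \<bar>P - G\<bar> \<le> 4000 * e + (60 * e) * (4 * pi\<^sup>2) + 64 * e"
  proof -
    have "c2 * (4 * pi\<^sup>2) \<le> 60 * e * (4 * pi\<^sup>2)" by (intro mult_right_mono t2) simp
    then show ?thesis using main t1 t3 by linarith
  qed
  also have "\<dots> \<le> 4 * pi\<^sup>2 * (300 * e)"
  proof -
    have "9 * e \<le> pi\<^sup>2 * e" using pi2 e0 by (intro mult_right_mono) auto
    then show ?thesis using e0 by (simp add: algebra_simps)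
  qed
  finally have "\<bar>P - G\<bar> \<le> 300 * e" by (rule mult_left_le_imp_le) simp
  then show ?thesis by (simp add: P_def G_def e_def)
qed

section \<open>Tails of the counts\<close>

lemma ln_n_ge: "1 \<le> ln n"
proof -
  have "exp 1 \<le> real n" using exp_le n_ge by linarith
  then show ?thesis using n_pos by (simp add: ln_ge_iff)
qed

text \<open>A Chernoff bound with parameter \<plusminus> sqrt (ln n / n). By the assumed sizes, the
  exponent in \<open>mgf_stays\<close> is at most (2 + 16) ln n, and the deviation contributes - 24
  ln n, so the total is below - 5 ln n.\<close>

lemma side_tail:
  fixes x :: real
  assumes SW: "S \<union> W = VV" "S \<inter> W = {}" "card S \<le> 2 * n" "n \<le> card W"
    and x: "24 * sqrt (n * ln n) \<le> \<bar>x - (\<Sum>v\<in>S. stay_prob VV v)\<bar>"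
  shows "mean edges (\<lambda>A. of_bool ((\<Sum>v\<in>S. stays VV A v) = x)) \<le> n powr (-5)"
proof -
  have fin: "finite S" "finite W" using SW(1) finite_V by (metis finite_Un)+
  have Wne: "W \<noteq> {}" using SW(4) n_pos by auto
  have L1: "1 \<le> ln n" by (rule ln_n_ge)
  define l0 where "l0 = sqrt (ln n / n)"
  have Ln: "ln n / n \<le> 1" using n_pos ln_bound[of "real n"] by simp
  have l0: "0 \<le> l0" "l0 \<le> 1" "l0\<^sup>2 = ln n / n" using Ln n_pos L1 by (auto simp: l0_def real_sqrt_le_1_iff)
  define E where "E = (\<Sum>v\<in>S. stay_prob VV v)"
  define l where "l = (if x - E \<ge> 0 then l0 else - l0)"
  have l: "\<bar>l\<bar> \<le> 1" "l\<^sup>2 = ln n / n" using l0 by (auto simp: l_def)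
  have lx: "24 * ln n \<le> l * (x - E)"
  proof -
    have "l * (x - E) = l0 * \<bar>x - E\<bar>" by (simp add: l_def abs_if algebra_simps)
    moreover have "l0 * (24 * sqrt (n * ln n)) \<le> l0 * \<bar>x - E\<bar>" using x l0 by (intro mult_left_mono) (auto simp: E_def)
    moreover have "l0 * sqrt (n * ln n) = ln n"
    proof -
      have "l0 * sqrt (n * ln n) = sqrt ((ln n)\<^sup>2)" unfolding l0_def real_sqrt_mult[symmetric] using n_pos by (simp add: power2_eq_square)
      then show ?thesis using L1 by simp
    qed
    ultimately show ?thesis by (simp add: mult.left_commute)
  qed
  have pW: "4 \<le> pq * card W"
  proof -
    have "4 \<le> pq * n" using pq_n u_ge by linarith
    also have "\<dots> \<le> pq * card W" using SW(4) pq_pos by (intro mult_left_mono) auto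
    finally show ?thesis .
  qed
  have "mean edges (\<lambda>A. of_bool ((\<Sum>v\<in>S. stays VV A v) = x)) \<le> mean edges (\<lambda>A. exp (- (l * (x - E))) * exp (l * (\<Sum>v\<in>S. stays VV A v - stay_prob VV v)))"
  proof (intro mean_mono)
    fix A
    show "(of_bool ((\<Sum>v\<in>S. stays VV A v) = x) :: real) \<le> exp (- (l * (x - E))) * exp (l * (\<Sum>v\<in>S. stays VV A v - stay_prob VV v))"
      by (auto simp: sum_subtractf E_def simp flip: exp_add)
  qed
  also have "\<dots> \<le> exp (- (l * (x - E))) * exp (l\<^sup>2 * (card S + 4 * (card S)\<^sup>2 / card W))"
    unfolding mean_mult_left using mgf_stays[OF fin SW(2) Wne l(1) pW] unfolding SW(1) by (intro mult_left_mono) auto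
  also have "\<dots> \<le> exp (- (24 * ln n)) * exp (18 * ln n)"
  proof (intro mult_mono)
    have "4 * (real (card S))\<^sup>2 / card W \<le> 4 * (2 * real n)\<^sup>2 / n"
      using SW n_pos by (intro frac_le mult_left_mono power_mono) auto
    also have "\<dots> = 16 * n" using n_pos by (simp add: power2_eq_square)
    finally have "real (card S) + 4 * (real (card S))\<^sup>2 / card W \<le> 18 * n" using SW(3) by simp
    then have "l\<^sup>2 * (card S + 4 * (card S)\<^sup>2 / card W) \<le> ln n / n * (18 * n)"
      unfolding l(2) using L1 n_pos by (intro mult_left_mono) auto
    also have "\<dots> = 18 * ln n" using n_pos by simp
    finally show "exp (l\<^sup>2 * (card S + 4 * (card S)\<^sup>2 / card W)) \<le> exp (18 * ln n)" by simp
  qed (use lx in auto)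
  also have "\<dots> \<le> exp (- 5 * ln n)" unfolding exp_add[symmetric] using L1 by simp
  also have "\<dots> = n powr (-5)" using n_pos by (simp add: powr_def)
  finally show ?thesis .
qed

text \<open>The step from 24 to 25 absorbs the distance \<open>7 * u ^ 3\<close> between a centre
  and the expected count.\<close>

lemma joint_tail:
  fixes x y :: int
  assumes "25 * sqrt (n * ln n) \<le> \<bar>x - red_center\<bar> \<or> 25 * sqrt (n * ln n) \<le> \<bar>y - blue_center\<bar>"
  shows "mean edges (\<lambda>A. of_bool (red_stay A = x \<and> blue_stay A = y)) \<le> n powr (-5)"
proof -
  have sm: "7 * u ^ 3 \<le> sqrt (n * ln n)"
  proof -
    have "7 * u ^ 3 \<le> u * u ^ 3" using u_ge by (intro mult_right_mono) auto
    also have "\<dots> = u ^ 4" by (simp flip: power_Suc)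
    also have "\<dots> \<le> u ^ 50" using u_ge by (intro power_increasing) auto
    also have "\<dots> = sqrt n" by (simp add: sqrt_n)
    also have "\<dots> \<le> sqrt (n * ln n)" using ln_n_ge n_pos by (intro real_sqrt_le_mono) (simp add: mult_le_cancel_left1)
    finally show ?thesis .
  qed
  have un: "R \<union> B = VV" "B \<union> R = VV" "B \<inter> R = {}" using disjoint by (auto simp: VV_def)
  have cc: "card R \<le> 2 * n" "card B \<le> 2 * n" "n \<le> card B" "n \<le> card R"
    using card_R card_B Delta_le(2) by auto
  from assms show ?thesis
  proof
    assume h: "25 * sqrt (n * ln n) \<le> \<bar>x - red_center\<bar>"
    have "mean edges (\<lambda>A. of_bool (red_stay A = x \<and> blue_stay A = y)) \<le> mean edges (\<lambda>A. of_bool ((\<Sum>v\<in>R. stays VV A v) = of_int x) :: real)"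
      by (intro mean_mono) (auto simp: sum_stays)
    also have "\<dots> \<le> n powr (-5)"
      by (rule side_tail[OF un(1) disjoint cc(1,3)]) (use h sm sum_stay_prob_near(1) in \<open>unfold red_center_def, linarith\<close>)
    finally show ?thesis .
  next
    assume h: "25 * sqrt (n * ln n) \<le> \<bar>y - blue_center\<bar>"
    have "mean edges (\<lambda>A. of_bool (red_stay A = x \<and> blue_stay A = y)) \<le> mean edges (\<lambda>A. of_bool ((\<Sum>v\<in>B. stays VV A v) = of_int y) :: real)"
      by (intro mean_mono) (auto simp: sum_stays)
    also have "\<dots> \<le> n powr (-5)"
      by (rule side_tail[OF un(2,3) cc(2,4)]) (use h sm sum_stay_prob_near(2) in \<open>unfold blue_center_def, linarith\<close>)
    finally show ?thesis .
  qed
qed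

section \<open>From discrepancies to one step of majority dynamics\<close>

lemma disc_eq_card:
  assumes v: "v \<in> VV"
  shows "v \<in> R \<Longrightarrow> disc VV A v = int (card (neighbors A v \<inter> R)) - int (card (neighbors A v \<inter> B))"
    and "v \<in> B \<Longrightarrow> disc VV A v = int (card (neighbors A v \<inter> B)) - int (card (neighbors A v \<inter> R))"
proof -
  have nb: "{v, w} \<in> A \<longleftrightarrow> w \<in> neighbors A v" for w by (simp add: neighbors_def insert_commute)
  have s: "(\<Sum>w\<in>X. of_bool ({v, w} \<in> A) * c) = int (card (neighbors A v \<inter> X)) * c" if "finite X" for X and c :: int
  proof -
    have "(\<Sum>w\<in>X. of_bool ({v, w} \<in> A) * c) = (\<Sum>w\<in>neighbors A v \<inter> X. c)"
      using that by (intro sum.mono_neutral_cong_right) (auto simp: nb)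
    then show ?thesis by simp
  qed
  have d: "disc VV A v = (\<Sum>w\<in>R. of_bool ({v, w} \<in> A) * side v) + (\<Sum>w\<in>B. of_bool ({v, w} \<in> A) * (- side v))"
  proof -
    have "disc VV A v = (\<Sum>w\<in>R. of_bool ({v, w} \<in> A) * sg v w) + (\<Sum>w\<in>B. of_bool ({v, w} \<in> A) * sg v w)"
      unfolding disc_def VV_def using finite_R finite_B disjoint by (rule sum.union_disjoint)
    also have "(\<Sum>w\<in>R. of_bool ({v, w} \<in> A) * sg v w) = (\<Sum>w\<in>R. of_bool ({v, w} \<in> A) * side v)"
      by (intro sum.cong) (auto simp: sg_def side_def[of "_ :: 'a"])
    also have "(\<Sum>w\<in>B. of_bool ({v, w} \<in> A) * sg v w) = (\<Sum>w\<in>B. of_bool ({v, w} \<in> A) * (- side v))"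
      using disjoint by (intro sum.cong) (auto simp: sg_def side_def)
    finally show ?thesis .
  qed
  show "disc VV A v = int (card (neighbors A v \<inter> R)) - int (card (neighbors A v \<inter> B))" if "v \<in> R"
    unfolding d s[OF finite_R] s[OF finite_B] using that by (simp add: side_def)
  show "disc VV A v = int (card (neighbors A v \<inter> B)) - int (card (neighbors A v \<inter> R))" if "v \<in> B"
    unfolding d s[OF finite_R] s[OF finite_B] using that disjoint by (auto simp: side_def)
qed

text \<open>A tie is no reason to move, so staying means a nonnegative discrepancy. Vertices
  arriving from the other side are removed by the intersection.\<close>

lemma stay_counts:
  "int (card (R \<inter> red_at A R B 1)) = red_stay A" "int (card (B \<inter> blue_at A R B 1)) = blue_stay A"
proof -
  have dR: "disc VV A v = int (card (neighbors A v \<inter> R)) - int (card (neighbors A v \<inter> B))" if "v \<in> R" for v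
    using that by (intro disc_eq_card(1)) (auto simp: VV_def)
  have dB: "disc VV A v = int (card (neighbors A v \<inter> B)) - int (card (neighbors A v \<inter> R))" if "v \<in> B" for v
    using that by (intro disc_eq_card(2)) (auto simp: VV_def)
  have 1: "R \<inter> red_at A R B 1 = {v \<in> R. 0 \<le> disc VV A v}"
    using disjoint by (auto simp: red_at_def majority_dynamics_def wants_to_move_def dR dB)
  have 2: "B \<inter> blue_at A R B 1 = {v \<in> B. 0 \<le> disc VV A v}"
    using disjoint by (auto simp: blue_at_def majority_dynamics_def wants_to_move_def dR dB)
  show "int (card (R \<inter> red_at A R B 1)) = red_stay A" "int (card (B \<inter> blue_at A R B 1)) = blue_stay A"
    unfolding 1 2 red_stay_def blue_stay_def by simp_all
qed

lemma prob_counts: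
  "measure_pmf.prob (erdos_renyi VV p) {E. int (card (R \<inter> red_at E R B 1)) = x \<and> int (card (B \<inter> blue_at E R B 1)) = y}
    = mean edges (\<lambda>A. of_bool (red_stay A = x \<and> blue_stay A = y))"
  unfolding erdos_renyi_def stay_counts by (rule prob_Pi_bernoulli[OF finite_edges])

end

section \<open>Choice of the scale, bounded \<open>n\<close>, and the final statement\<close>

lemma eventually_scale:
  "\<exists>n0. \<forall>n\<ge>n0. 1000 \<le> real n powr (1/100) \<and> 2 * ln (real n) powr (1/4) \<le> real n powr (1/100) \<and>
    ln (real n) powr (1/4) + 20 \<le> real n powr (1/100) \<and>
    (real n powr (1/100)) ^ 210 * exp (- (real n powr (1/100)) / 500) \<le> 1"
proof -
  have lim: "filterlim (\<lambda>n. real n powr (1/100)) at_top sequentially" by real_asymp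
  have "eventually (\<lambda>u::real. u ^ 210 * exp (- u / 500) \<le> 1) at_top" by real_asymp
  then have "eventually (\<lambda>n. (real n powr (1/100)) ^ 210 * exp (- (real n powr (1/100)) / 500) \<le> 1) sequentially"
    by (rule eventually_compose_filterlim[OF _ lim])
  moreover have "eventually (\<lambda>n. 1000 \<le> real n powr (1/100)) sequentially" by real_asymp
  moreover have "eventually (\<lambda>n. 2 * ln (real n) powr (1/4) \<le> real n powr (1/100)) sequentially" by real_asymp
  moreover have "eventually (\<lambda>n. ln (real n) powr (1/4) + 20 \<le> real n powr (1/100)) sequentially" by real_asymp
  ultimately have "eventually (\<lambda>n. 1000 \<le> real n powr (1/100) \<and> 2 * ln (real n) powr (1/4) \<le> real n powr (1/100) \<and>
    ln (real n) powr (1/4) + 20 \<le> real n powr (1/100) \<and>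
    (real n powr (1/100)) ^ 210 * exp (- (real n powr (1/100)) / 500) \<le> 1) sequentially"
    by eventually_elim blast
  then show ?thesis unfolding eventually_sequentially .
qed

text \<open>The variance is smallest at the ends of the range of \<open>p\<close>, where it is (1 -
  1 / r) / r, and the range is nonempty only for r \<ge> 2.\<close>

lemma bernoulli_variance_ge:
  fixes p r :: real
  assumes r: "0 < r" and p: "1 / r \<le> p" "p \<le> 1 - 1 / r"
  shows "2 \<le> r" "1 / (2 * r) \<le> p * (1 - p)"
proof -
  have "1 / r \<le> 1 / 2" using p by linarith
  then show "2 \<le> r" using r by (simp add: field_simps)
  have "0 \<le> (p - 1 / r) * (1 - 1 / r - p)" using p by simp
  moreover have "(1 / r) * (1 / r) \<le> (1 / r) * (1 / 2)" using \<open>1 / r \<le> 1 / 2\<close> r by (intro mult_left_mono) auto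
  ultimately have "(1 / r) / 2 \<le> p * (1 - p)" by (simp add: algebra_simps)
  then show "1 / (2 * r) \<le> p * (1 - p)" by simp
qed

text \<open>For bounded \<open>n\<close>: the centres are at most of order m^2, so a sufficiently
  large \<open>x'\<close> is out of reach of the counts.\<close>

lemma abs_center_le:
  fixes d p w m :: real
  assumes m: "2 \<le> m" and d: "\<bar>d\<bar> \<le> m" and p: "0 \<le> p" "p \<le> 1" and w: "1 \<le> w"
  shows "\<bar>(1/2 + (p * (d - 1) + 1/2) / (2 * sqrt w)) * m\<bar> \<le> 2 * m\<^sup>2"
proof -
  define a where "a = p * (d - 1) + 1/2"
  define b where "b = a / (2 * sqrt w)"
  have "\<bar>p * (d - 1)\<bar> \<le> 1 * (m + 1)" unfolding abs_mult using p d by (intro mult_mono) auto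
  then have a: "\<bar>a\<bar> \<le> 2 * m" using m abs_triangle_ineq[of "p * (d - 1)" "1/2"] unfolding a_def[symmetric] by simp
  then have "\<bar>b\<bar> \<le> 2 * m / 2"
    using w m unfolding b_def abs_divide by (intro frac_le) auto
  then have "\<bar>1/2 + b\<bar> \<le> 2 * m" using m by linarith
  then have "\<bar>1/2 + b\<bar> * \<bar>m\<bar> \<le> 2 * m * m" using m by (intro mult_mono) auto
  then show ?thesis by (simp add: abs_mult power2_eq_square a_def b_def)
qed

lemma gauss_density_bounds:
  fixes x y m :: real
  assumes m: "2 \<le> m"
  shows "0 \<le> 2 / (m * sqrt (pi * (2 + pi))) * exp (- (((1 + pi) * x\<^sup>2 - 2 * x * y + (1 + pi) * y\<^sup>2) / (2 * pi * (2 + pi))))"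
    and "2 / (m * sqrt (pi * (2 + pi))) * exp (- (((1 + pi) * x\<^sup>2 - 2 * x * y + (1 + pi) * y\<^sup>2) / (2 * pi * (2 + pi)))) \<le> 1"
proof -
  have q: "(1 + pi) * x\<^sup>2 - 2 * x * y + (1 + pi) * y\<^sup>2 = (x - y)\<^sup>2 + pi * x\<^sup>2 + pi * y\<^sup>2"
    by (simp add: power2_eq_square algebra_simps)
  have e: "exp (- (((1 + pi) * x\<^sup>2 - 2 * x * y + (1 + pi) * y\<^sup>2) / (2 * pi * (2 + pi)))) \<le> 1"
    unfolding q using pi_gt_zero by (auto intro!: divide_nonneg_nonneg add_nonneg_nonneg)
  have "1 * 1 \<le> pi * (2 + pi)" using pi_gt3 by (intro mult_mono) auto
  then have "1 \<le> sqrt (pi * (2 + pi))" by simp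
  then have "2 * 1 \<le> m * sqrt (pi * (2 + pi))" using m by (intro mult_mono) auto
  then have d: "0 \<le> 2 / (m * sqrt (pi * (2 + pi)))" "2 / (m * sqrt (pi * (2 + pi))) \<le> 1" by simp_all
  show "0 \<le> 2 / (m * sqrt (pi * (2 + pi))) * exp (- (((1 + pi) * x\<^sup>2 - 2 * x * y + (1 + pi) * y\<^sup>2) / (2 * pi * (2 + pi))))"
    using d(1) by (intro mult_nonneg_nonneg) auto
  show "2 / (m * sqrt (pi * (2 + pi))) * exp (- (((1 + pi) * x\<^sup>2 - 2 * x * y + (1 + pi) * y\<^sup>2) / (2 * pi * (2 + pi)))) \<le> 1"
    using mult_mono[OF d(2) e] by simp
qed

theorem theorem2p1:
  "\<exists>C c :: real. C > 0 \<and> c > 0 \<and>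
    (\<exists>K :: real. \<forall>(n :: nat) (\<Delta> :: nat) (p :: real) (R0 :: nat set) (B0 :: nat set)
        (x :: int) (y :: int) (x' :: real) (y' :: real).
      n \<ge> 2 \<longrightarrow>
      real \<Delta> \<le> ln (real n) powr (1/4) \<longrightarrow>
      ln (real n) powr (-1/4) \<le> p \<longrightarrow> p \<le> 1 - ln (real n) powr (-1/4) \<longrightarrow>
      R0 \<union> B0 = {..<2 * n + \<Delta>} \<longrightarrow> R0 \<inter> B0 = {} \<longrightarrow>
      card R0 = n + \<Delta> \<longrightarrow> card B0 = n \<longrightarrow>
      sqrt (real n / (4 * pi)) * x' =
        real_of_int x
          - (1/2 + (p * (real \<Delta> - 1) + 1/2) / (2 * sqrt (pi * p * (1 - p) * real n))) * real n \<longrightarrow>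
      sqrt (real n / (4 * pi)) * y' =
        real_of_int y
          - (1/2 + (p * (- real \<Delta> - 1) + 1/2) / (2 * sqrt (pi * p * (1 - p) * real n))) * real n \<longrightarrow>
      (let P = measure_pmf.prob (erdos_renyi {..<2 * n + \<Delta>} p)
                 {E. int (card (R0 \<inter> red_at E R0 B0 1)) = x \<and>
                     int (card (B0 \<inter> blue_at E R0 B0 1)) = y}
       in \<bar>P - 2 / (real n * sqrt (pi * (2 + pi))) *
               exp (- (((1 + pi) * x'\<^sup>2 - 2 * x' * y' + (1 + pi) * y'\<^sup>2) / (2 * pi * (2 + pi))))\<bar>
            \<le> K * real n powr (-1 - c) \<and>
          (\<bar>x'\<bar> \<ge> C * sqrt (ln (real n)) \<or> \<bar>y'\<bar> \<ge> C * sqrt (ln (real n)) \<longrightarrow>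
             P \<le> real n powr (-5))))"
proof -
  obtain n0 where n0: "\<And>n. n0 \<le> n \<Longrightarrow> 1000 \<le> real n powr (1/100) \<and> 2 * ln (real n) powr (1/4) \<le> real n powr (1/100) \<and>
    ln (real n) powr (1/4) + 20 \<le> real n powr (1/100) \<and>
    (real n powr (1/100)) ^ 210 * exp (- (real n powr (1/100)) / 500) \<le> 1"
    using eventually_scale by metis
  \<comment> \<open>100 = 4 * 25, because sqrt (n / (4 pi)) is at least sqrt n / 4. The terms with
    \<open>n0\<close> take care of the finitely many smaller \<open>n\<close>.\<close>
  define C where "C = 100 + 3 * (real n0)\<^sup>2"
  define K where "K = 300 + 2 * (real n0)\<^sup>2"
  show ?thesis
  \<comment> \<open>The exponent 1/10 is that of \<open>u ^ 10\<close> in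
    \<open>local_limit\<close>, as \<open>u\<close> is the hundredth root of
    \<open>n\<close>.\<close>
  proof (rule exI[of _ C], rule exI[of _ "1/10"], intro conjI)
    show "0 < C" "(0::real) < 1 / 10" by (simp_all add: C_def add_pos_nonneg)
    show "\<exists>K :: real. \<forall>(n :: nat) (\<Delta> :: nat) (p :: real) (R0 :: nat set) (B0 :: nat set)
        (x :: int) (y :: int) (x' :: real) (y' :: real).
      n \<ge> 2 \<longrightarrow>
      real \<Delta> \<le> ln (real n) powr (1/4) \<longrightarrow>
      ln (real n) powr (-1/4) \<le> p \<longrightarrow> p \<le> 1 - ln (real n) powr (-1/4) \<longrightarrow>
      R0 \<union> B0 = {..<2 * n + \<Delta>} \<longrightarrow> R0 \<inter> B0 = {} \<longrightarrow>
      card R0 = n + \<Delta> \<longrightarrow> card B0 = n \<longrightarrow>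
      sqrt (real n / (4 * pi)) * x' =
        real_of_int x
          - (1/2 + (p * (real \<Delta> - 1) + 1/2) / (2 * sqrt (pi * p * (1 - p) * real n))) * real n \<longrightarrow>
      sqrt (real n / (4 * pi)) * y' =
        real_of_int y
          - (1/2 + (p * (- real \<Delta> - 1) + 1/2) / (2 * sqrt (pi * p * (1 - p) * real n))) * real n \<longrightarrow>
      (let P = measure_pmf.prob (erdos_renyi {..<2 * n + \<Delta>} p)
                 {E. int (card (R0 \<inter> red_at E R0 B0 1)) = x \<and>
                     int (card (B0 \<inter> blue_at E R0 B0 1)) = y}
       in \<bar>P - 2 / (real n * sqrt (pi * (2 + pi))) *
               exp (- (((1 + pi) * x'\<^sup>2 - 2 * x' * y' + (1 + pi) * y'\<^sup>2) / (2 * pi * (2 + pi))))\<bar>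
            \<le> K * real n powr (-1 - 1/10) \<and>
          (\<bar>x'\<bar> \<ge> C * sqrt (ln (real n)) \<or> \<bar>y'\<bar> \<ge> C * sqrt (ln (real n)) \<longrightarrow>
             P \<le> real n powr (-5)))"
    proof (rule exI[of _ K], intro allI impI)
      fix n \<Delta> :: nat and p :: real and R0 B0 :: "nat set" and x y :: int and x' y' :: real
      assume n2: "2 \<le> n" and D: "real \<Delta> \<le> ln (real n) powr (1/4)"
        and p: "ln (real n) powr (-1/4) \<le> p" "p \<le> 1 - ln (real n) powr (-1/4)"
        and RB: "R0 \<union> B0 = {..<2 * n + \<Delta>}" "R0 \<inter> B0 = {}" "card R0 = n + \<Delta>" "card B0 = n"
        and x': "sqrt (real n / (4 * pi)) * x' =
          real_of_int x - (1/2 + (p * (real \<Delta> - 1) + 1/2) / (2 * sqrt (pi * p * (1 - p) * real n))) * real n"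
        and y': "sqrt (real n / (4 * pi)) * y' =
          real_of_int y - (1/2 + (p * (- real \<Delta> - 1) + 1/2) / (2 * sqrt (pi * p * (1 - p) * real n))) * real n"
      define P where "P = measure_pmf.prob (erdos_renyi {..<2 * n + \<Delta>} p)
                 {E. int (card (R0 \<inter> red_at E R0 B0 1)) = x \<and>
                     int (card (B0 \<inter> blue_at E R0 B0 1)) = y}"
      define G where "G = 2 / (real n * sqrt (pi * (2 + pi))) *
               exp (- (((1 + pi) * x'\<^sup>2 - 2 * x' * y' + (1 + pi) * y'\<^sup>2) / (2 * pi * (2 + pi))))"
      define r where "r = ln (real n) powr (1/4)"
      have L0: "0 < ln (real n)" using n2 by simp
      have r0: "0 < r" using L0 by (simp add: r_def)
      have r4: "r ^ 4 = ln (real n)" using L0 unfolding r_def by (simp flip: powr_realpow add: powr_powr)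
      have er: "ln (real n) powr (-1/4) = 1 / r" using powr_minus_divide[of "ln (real n)" "1/4"] by (simp add: r_def)
      have p': "1 / r \<le> p" "p \<le> 1 - 1 / r" using p unfolding er .
      have r2: "2 \<le> r" and pq: "1 / (2 * r) \<le> p * (1 - p)" using bernoulli_variance_ge[OF r0 p'] by auto
      have "0 < 1 / r" using r0 by simp
      then have p01: "0 < p" "p < 1" using p' by linarith+
      have Dr: "real \<Delta> \<le> r" using D by (simp add: r_def)
      have rn: "r \<le> real n"
      proof -
        have "r \<le> r ^ 4" using r2 by (intro self_le_power) auto
        also have "\<dots> \<le> real n" unfolding r4 using n2 by (intro ln_bound) auto
        finally show ?thesis .
      qed
      have scale: "1 / 4 * sqrt (real n) \<le> sqrt (real n / (4 * pi))"
      proof -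
        have "real n / 16 \<le> real n / (4 * pi)" using pi_less_4 n2 by (intro frac_le) auto
        then have "sqrt (real n / 16) \<le> sqrt (real n / (4 * pi))" by simp
        then show ?thesis by (simp add: real_sqrt_divide)
      qed
      have "\<bar>P - G\<bar> \<le> K * real n powr (-1 - 1/10) \<and>
          (\<bar>x'\<bar> \<ge> C * sqrt (ln (real n)) \<or> \<bar>y'\<bar> \<ge> C * sqrt (ln (real n)) \<longrightarrow> P \<le> real n powr (-5))"
      proof (cases "n0 \<le> n")
        case True
        define u where "u = real n powr (1/100)"
        have u: "1000 \<le> u" "2 * r \<le> u" "r + 20 \<le> u" "u ^ 210 * exp (- u / 500) \<le> 1"
          using n0[OF True] by (simp_all add: u_def r_def)
        have "u * p * (1 - p) \<ge> 1"
        proof -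
          have "(2 * r) * (1 / (2 * r)) \<le> u * (p * (1 - p))" using u pq r0 by (intro mult_mono) auto
          then show ?thesis using r0 by (simp add: mult.assoc)
        qed
        moreover have "real n = u ^ 100" using n2 unfolding u_def by (simp flip: powr_realpow add: powr_powr)
        moreover have "finite (R0 \<union> B0)" unfolding RB by simp
        ultimately interpret two_sides p R0 B0 n \<Delta> u
          using p01 RB u Dr
          by (unfold_locales) (auto simp: bernoulli_bits.pq_def bernoulli_bits_def mult.assoc)
        have VV: "{..<2 * n + \<Delta>} = VV" using RB by (simp add: VV_def)
        have sq: "pi * p * (1 - p) * real n = pi * pq * n" by (simp add: pq_def)
        have rc: "real_of_int x - red_center = sqrt (real n / (4 * pi)) * x'"
          and bc: "real_of_int y - blue_center = sqrt (real n / (4 * pi)) * y'"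
          unfolding x' y' sq red_center_def blue_center_def kap_def by simp_all
        have P: "P = mean edges (\<lambda>A. of_bool (red_stay A = x \<and> blue_stay A = y))"
          unfolding P_def VV by (rule prob_counts)
        have "\<bar>P - G\<bar> \<le> K * real n powr (-1 - 1/10)"
        proof -
          have "\<bar>P - G\<bar> \<le> 300 / (u ^ 10 * n)" unfolding P G_def by (rule local_limit[OF u(4) rc[symmetric] bc[symmetric]])
          also have "u ^ 10 * n = n powr (1 + 1/10)"
            using n2 powr_add[of "real n" 1 "1/10"] unfolding u_def by (simp flip: powr_realpow add: powr_powr)
          also have "300 / n powr (1 + 1/10) = 300 * n powr (-1 - 1/10)"
            using powr_minus_divide[of "real n" "1 + 1/10"] by simp
          also have "\<dots> \<le> K * n powr (-1 - 1/10)" by (intro mult_right_mono) (auto simp: K_def)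
          finally show ?thesis .
        qed
        moreover have "P \<le> real n powr (-5)" if "\<bar>x'\<bar> \<ge> C * sqrt (ln (real n)) \<or> \<bar>y'\<bar> \<ge> C * sqrt (ln (real n))"
        proof -
          have big: "25 * sqrt (n * ln n) \<le> \<bar>sqrt (real n / (4 * pi)) * z\<bar>" if "\<bar>z\<bar> \<ge> C * sqrt (ln (real n))" for z
          proof -
            have "100 * sqrt (ln (real n)) \<le> C * sqrt (ln (real n))" using L0 by (intro mult_right_mono) (auto simp: C_def)
            then have "(1 / 4 * sqrt (real n)) * (100 * sqrt (ln (real n))) \<le> sqrt (real n / (4 * pi)) * \<bar>z\<bar>"
              using scale L0 order_trans[OF _ that] by (intro mult_mono) auto
            then show ?thesis by (simp add: abs_mult real_sqrt_mult)
          qed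
          have "25 * sqrt (n * ln n) \<le> \<bar>x - red_center\<bar> \<or> 25 * sqrt (n * ln n) \<le> \<bar>y - blue_center\<bar>"
            unfolding rc bc using that big by blast
          then show ?thesis unfolding P by (rule joint_tail)
        qed
        ultimately show ?thesis by blast
      next
        \<comment> \<open>Here \<open>n\<close> is bounded, and \<open>C\<close> is so large that \<open>x'\<close> or \<open>y'\<close> is out of the range of the counts.\<close>
        case False
        have nn0: "(real n)\<^sup>2 \<le> (real n0)\<^sup>2" using False by (intro power_mono) auto
        have P01: "0 \<le> P" "P \<le> 1" by (simp_all add: P_def)
        have "\<bar>P - G\<bar> \<le> K * real n powr (-1 - 1/10)"
        proof -
          have "0 \<le> G" "G \<le> 1" using gauss_density_bounds[of "real n" x' y'] n2 by (simp_all add: G_def)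
          then have "\<bar>P - G\<bar> \<le> 1" using P01 by linarith
          also have "1 = (real n)\<^sup>2 * real n powr (-2)" using n2 powr_minus_divide[of "real n" 2] by simp
          also have "\<dots> \<le> K * real n powr (-1 - 1/10)"
          proof (intro mult_mono powr_mono)
            show "(real n)\<^sup>2 \<le> K" using nn0 zero_le_power2[of "real n0"] unfolding K_def by linarith
          qed (use n2 in \<open>auto simp: K_def\<close>)
          finally show ?thesis .
        qed
        moreover have "P \<le> real n powr (-5)" if far: "\<bar>x'\<bar> \<ge> C * sqrt (ln (real n)) \<or> \<bar>y'\<bar> \<ge> C * sqrt (ln (real n))"
        proof -
          have w: "1 \<le> pi * p * (1 - p) * real n"
          proof -
            have "1 / 2 = 1 / (2 * r) * r" using r0 by simp
            also have "\<dots> \<le> (p * (1 - p)) * real n" using pq rn r0 p01 by (intro mult_mono) auto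
            finally have "2 * (1 / 2) \<le> pi * ((p * (1 - p)) * real n)" using pi_gt3 by (intro mult_mono) auto
            then show ?thesis by (simp add: mult.assoc)
          qed
          \<comment> \<open>A nonempty range for \<open>p\<close> forces r \<ge> 2, that is ln n
            \<ge> 16.\<close>
          have sL: "4 \<le> sqrt (ln (real n))"
          proof -
            have "2 ^ 4 \<le> r ^ 4" using r2 by (intro power_mono) auto
            then have "sqrt 16 \<le> sqrt (ln (real n))" unfolding r4 by (intro real_sqrt_le_mono) simp
            then show ?thesis by simp
          qed
          \<comment> \<open>\<open>C\<close> contains \<open>3 * (real n0)\<^sup>2\<close>. The
            factor 4 from the logarithm and the factor 1/4 from the scale cancel, and 3 n^2 bounds
            the count (n^2) and the centre (2 n^2) together.\<close>
          have far': "(real n)\<^sup>2 + 2 * (real n)\<^sup>2 < \<bar>sqrt (real n / (4 * pi)) * z\<bar>" if "\<bar>z\<bar> \<ge> C * sqrt (ln (real n))" for z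
          proof -
            have "C * 4 \<le> C * sqrt (ln (real n))" using sL by (intro mult_left_mono) (auto simp: C_def)
            then have "C * 4 \<le> \<bar>z\<bar>" using that by linarith
            then have z: "12 * (real n)\<^sup>2 < \<bar>z\<bar>" using nn0 unfolding C_def by argo
            have "1 \<le> sqrt (real n)" using n2 by simp
            then have "1 / 4 \<le> sqrt (real n / (4 * pi))" using scale by linarith
            then have "1 / 4 * \<bar>z\<bar> \<le> sqrt (real n / (4 * pi)) * \<bar>z\<bar>" by (intro mult_right_mono) auto
            then show ?thesis using z by (simp add: abs_mult)
          qed
          have DD: "real \<Delta> \<le> real n" using Dr rn by linarith
          have nsq: "2 * real n \<le> (real n)\<^sup>2" using n2 by (simp add: power2_eq_square)
          have "{E. int (card (R0 \<inter> red_at E R0 B0 1)) = x \<and> int (card (B0 \<inter> blue_at E R0 B0 1)) = y} = {}"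
          proof (rule ccontr)
            assume "\<not> ?thesis"
            then obtain E where E: "x = int (card (R0 \<inter> red_at E R0 B0 1))" "y = int (card (B0 \<inter> blue_at E R0 B0 1))" by blast
            have "finite (R0 \<union> B0)" unfolding RB by simp
            then have "finite R0" "finite B0" by simp_all
            then have "card (R0 \<inter> red_at E R0 B0 1) \<le> n + \<Delta>" "card (B0 \<inter> blue_at E R0 B0 1) \<le> n"
              using card_mono[of R0 "R0 \<inter> red_at E R0 B0 1"] card_mono[of B0 "B0 \<inter> blue_at E R0 B0 1"] RB by auto
            then have "0 \<le> x" "x \<le> int (n + \<Delta>)" "0 \<le> y" "y \<le> int (n + \<Delta>)" using E by auto
            then have xy: "\<bar>real_of_int x\<bar> \<le> (real n)\<^sup>2" "\<bar>real_of_int y\<bar> \<le> (real n)\<^sup>2" using DD nsq by auto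
            have "\<bar>sqrt (real n / (4 * pi)) * x'\<bar> \<le> (real n)\<^sup>2 + 2 * (real n)\<^sup>2"
              unfolding x' using n2 DD p01 xy
              by (intro order_trans[OF abs_triangle_ineq4 add_mono] abs_center_le w) auto
            moreover have "\<bar>sqrt (real n / (4 * pi)) * y'\<bar> \<le> (real n)\<^sup>2 + 2 * (real n)\<^sup>2"
              unfolding y' using n2 DD p01 xy
              by (intro order_trans[OF abs_triangle_ineq4 add_mono] abs_center_le w) auto
            ultimately show False using far far' by fastforce
          qed
          then have "P = 0" unfolding P_def by (simp only: measure_empty)
          then show ?thesis by simp
        qed
        ultimately show ?thesis by blast
      qed
      then show "let P = measure_pmf.prob (erdos_renyi {..<2 * n + \<Delta>} p)
                 {E. int (card (R0 \<inter> red_at E R0 B0 1)) = x \<and>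
                     int (card (B0 \<inter> blue_at E R0 B0 1)) = y}
       in \<bar>P - 2 / (real n * sqrt (pi * (2 + pi))) *
               exp (- (((1 + pi) * x'\<^sup>2 - 2 * x' * y' + (1 + pi) * y'\<^sup>2) / (2 * pi * (2 + pi))))\<bar>
            \<le> K * real n powr (-1 - 1/10) \<and>
          (\<bar>x'\<bar> \<ge> C * sqrt (ln (real n)) \<or> \<bar>y'\<bar> \<ge> C * sqrt (ln (real n)) \<longrightarrow>
             P \<le> real n powr (-5))"
        unfolding Let_def P_def G_def .
    qed
  qed
qed

end
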